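(* Let $\phi,\psi\in H^5_\sigma$ with $0<\sigma<1$. Let $U:\mathbb{R}^2\times\mathbb{R}\to\mathbb{R}$ solve $$\bar m\,\partial_{\tau\tau}U=\Delta_{\mathbf X}U,\qquad U(\mathbf X,0)=\phi(\mathbf X),\qquad \partial_\tau U(\mathbf X,0)=\psi(\mathbf X),$$ and for each $\epsilon>0$ let $u$ (depending on $\epsilon$) solve $$m(\mathbf j)\,\ddot u(\mathbf j,t)=\Delta u(\mathbf j,t),\qquad u(\mathbf j,0)=\epsilon^{-1}\phi(\epsilon\mathbf j),\qquad \dot u(\mathbf j,0)=\psi(\epsilon\mathbf j).$$ Put $$U_\epsilon(\mathbf X,\tau)=\epsilon\,\mathcal{L}\big(u(\cdot,\tau/\epsilon)\big)(\mathbf X/\epsilon),\qquad\text{so that}\qquad \partial_\tau U_\epsilon(\mathbf X,\tau)=\mathcal{L}\big(\dot u(\cdot,\tau/\epsilon)\big)(\mathbf X/\epsilon).$$ Then, almost surely, $$\lim_{\epsilon\to0^+}\ \sup_{|\tau|\le T}\big\|U_\epsilon(\cdot,\tau)-U(\cdot,\tau),\ \partial_\tau U_\epsilon(\cdot,\tau)-\partial_\tau U(\cdot,\tau)\big\|_{L^2}=0 .$$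
   Context: The masses $m(\mathbf j)$, $\mathbf j\in\mathbb{Z}^2$, are i.i.d. random variables contained almost surely in an interval $[a,b]\subset(0,\infty)$, $\bar m=\mathbb{E}[m(\mathbf j)]$, and the same realization is used for all $\epsilon$. $T>0$ is fixed. The discrete Laplacian is $\Delta u(\mathbf j)=-4u(\mathbf j)+\sum_{i=1}^2\big(u(\mathbf j+\mathbf e_i)+u(\mathbf j-\mathbf e_i)\big)$, $\mathbf e_1=(1,0)$, $\mathbf e_2=(0,1)$; $\Delta_{\mathbf X}=\partial_{X_1X_1}+\partial_{X_2X_2}$. Solutions of the lattice and wave equations are the usual finite-energy ($\ell^2$-, respectively $L^2$-based) solutions. The weighted norm is $\|f\|_{H^k_\sigma}=\sum_{j=0}^k\|(1+|\cdot|)^{1/\sigma}|D^jf|\|_{L^2(\mathbb{R}^2)}$, with $D^jf$ the tensor of all $j$-th order derivatives. For $f\in\ell^2(\mathbb{Z}^2)$ the lattice Fourier transform is $F[f](\mathbf y)=\frac1{(2\pi)^2}\sum_{\mathbf j\in\mathbb{Z}^2}e^{-i\mathbf j\cdot\mathbf y}f(\mathbf j)$, with inverse $F^{-1}[g](\mathbf j)=\int_{[-\pi,\pi]^2}e^{i\mathbf y\cdot\mathbf j}g(\mathbf y)\,d\mathbf y$. The low-pass interpolator is $\mathcal{L}[f](\mathbf x)=\mathcal{F}^{-1}[\theta_\pi F[f]](\mathbf x)=\int_{[-\pi,\pi]^2}e^{i\mathbf y\cdot\mathbf x}F[f](\mathbf y)\,d\mathbf y$ for $\mathbf x\in\mathbb{R}^2$,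 where $\theta_\pi$ is the indicator function of $[-\pi,\pi]^2$ and $\mathcal{F}^{-1}$ is the inverse Fourier transform on $\mathbb{R}^2$ normalized as shown (so that $\mathcal{L}[f](\mathbf j)=f(\mathbf j)$ for $\mathbf j\in\mathbb{Z}^2$). The $L^2(\mathbb{R}^2)$ norm of a pair is the sum (equivalently the Euclidean combination) of the norms of its components. *)

theory Defs
  imports "HOL-Probability.Probability"
begin

section \<open>Square-integrable functions on the plane\<close>

text \<open>
  Functions on the plane are representatives of their classes modulo Lebesgue-null sets. Norms take
  values in \<^typ>\<open>ennreal\<close>, so that a divergent integral yields \<open>\<infinity>\<close> and not \<open>0\<close>.
\<close>

definition L2_norm :: "(real^2 \<Rightarrow> 'a::real_normed_vector) \<Rightarrow> ennreal" where
  "L2_norm f =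
    (let I = (\<integral>\<^sup>+ x. ennreal ((norm (f x))\<^sup>2) \<partial>lebesgue)
     in if I = \<infinity> then \<infinity> else ennreal (sqrt (enn2real I)))"

definition L2_fun :: "(real^2 \<Rightarrow> real) \<Rightarrow> bool" where
  "L2_fun f \<longleftrightarrow> f \<in> borel_measurable lebesgue \<and> L2_norm f < \<infinity>"


section \<open>Weak derivatives and weighted Sobolev spaces\<close>

definition partial_deriv :: "2 \<Rightarrow> (real^2 \<Rightarrow> real) \<Rightarrow> real^2 \<Rightarrow> real" where
  "partial_deriv i f x = deriv (\<lambda>t. f (x + t *\<^sub>R axis i 1)) 0"

text \<open>A list of directions of length \<open>j\<close> indexes one component of the tensor \<open>D\<^sup>j f\<close>.\<close>

primrec iter_partial :: "2 list \<Rightarrow> (real^2 \<Rightarrow> real) \<Rightarrow> real^2 \<Rightarrow> real" where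
  "iter_partial [] f = f"
| "iter_partial (i # \<alpha>) f = partial_deriv i (iter_partial \<alpha> f)"

definition smooth_fun :: "(real^2 \<Rightarrow> real) \<Rightarrow> bool" where
  "smooth_fun f \<longleftrightarrow>
    (\<forall>\<alpha>. continuous_on UNIV (iter_partial \<alpha> f) \<and>
         (\<forall>i x. (\<lambda>t. iter_partial \<alpha> f (x + t *\<^sub>R axis i 1)) differentiable (at (0::real))))"

definition test_fun :: "(real^2 \<Rightarrow> real) \<Rightarrow> bool" where
  "test_fun w \<longleftrightarrow> smooth_fun w \<and> compact (closure {x. w x \<noteq> 0})"

definition loc_integrable :: "(real^2 \<Rightarrow> real) \<Rightarrow> bool" where
  "loc_integrable f \<longleftrightarrow> (\<forall>K. compact K \<longrightarrow> set_integrable lebesgue K f)"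

definition has_weak_deriv :: "2 list \<Rightarrow> (real^2 \<Rightarrow> real) \<Rightarrow> (real^2 \<Rightarrow> real) \<Rightarrow> bool" where
  "has_weak_deriv \<alpha> f g \<longleftrightarrow>
    loc_integrable f \<and> loc_integrable g \<and>
    (\<forall>w. test_fun w \<longrightarrow>
      (LINT x|lebesgue. f x * iter_partial \<alpha> w x)
        = (- 1) ^ length \<alpha> * (LINT x|lebesgue. g x * w x))"

text \<open>
  Weak derivatives are unique almost everywhere, so the norms below do not depend on the chosen
  representative; \<open>wderiv\<close> is only meaningful where a weak derivative exists.
\<close>

definition wderiv :: "2 list \<Rightarrow> (real^2 \<Rightarrow> real) \<Rightarrow> real^2 \<Rightarrow> real" where
  "wderiv \<alpha> f = (SOME g. has_weak_deriv \<alpha> f g)"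

definition tensor_norm :: "nat \<Rightarrow> (real^2 \<Rightarrow> real) \<Rightarrow> real^2 \<Rightarrow> real" where
  "tensor_norm j f x = sqrt (\<Sum>\<alpha> | length \<alpha> = j. (wderiv \<alpha> f x)\<^sup>2)"

definition Sobolev_norm :: "(real^2 \<Rightarrow> real) \<Rightarrow> nat \<Rightarrow> (real^2 \<Rightarrow> real) \<Rightarrow> ennreal" where
  "Sobolev_norm \<rho> k f = (\<Sum>j\<le>k. L2_norm (\<lambda>x. \<rho> x * tensor_norm j f x))"

definition Sobolev_fun :: "(real^2 \<Rightarrow> real) \<Rightarrow> nat \<Rightarrow> (real^2 \<Rightarrow> real) \<Rightarrow> bool" where
  "Sobolev_fun \<rho> k f \<longleftrightarrow>
    (\<forall>\<alpha>. length \<alpha> \<le> k \<longrightarrow> (\<exists>g. has_weak_deriv \<alpha> f g)) \<and> Sobolev_norm \<rho> k f < \<infinity>"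

definition poly_weight :: "real \<Rightarrow> real^2 \<Rightarrow> real" where
  "poly_weight \<sigma> x = (1 + norm x) powr (1 / \<sigma>)"

text \<open>
  Membership does not depend on the representative; where lattice samples of such a function are
  taken, its continuous representative (which exists for \<open>k \<ge> 2\<close>) has to be chosen.
\<close>

abbreviation H_weighted :: "nat \<Rightarrow> real \<Rightarrow> (real^2 \<Rightarrow> real) set" where
  "H_weighted k \<sigma> \<equiv> {f. Sobolev_fun (poly_weight \<sigma>) k f}"


section \<open>The wave equation\<close>

text \<open>
  Finite-energy solutions of \<open>c \<partial>\<^sub>\<tau>\<^sub>\<tau> U = \<Delta> U\<close>, \<open>U(0) = \<phi>\<close>, \<open>\<partial>\<^sub>\<tau> U(0) = \<psi>\<close>: \<open>U\<close> is continuous in time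
  with values in \<open>H\<^sup>1\<close> and continuously differentiable with values in \<open>L\<^sup>2\<close>, where \<open>V = \<partial>\<^sub>\<tau> U\<close>; the
  equation holds in the sense of distributions in space. The time is the first argument.
\<close>

definition wave_solution ::
  "real \<Rightarrow> (real^2 \<Rightarrow> real) \<Rightarrow> (real^2 \<Rightarrow> real) \<Rightarrow>
    (real \<Rightarrow> real^2 \<Rightarrow> real) \<Rightarrow> (real \<Rightarrow> real^2 \<Rightarrow> real) \<Rightarrow> bool" where
  "wave_solution c \<phi> \<psi> U V \<longleftrightarrow>
    (\<forall>\<tau>. Sobolev_fun (\<lambda>_. 1) 1 (U \<tau>) \<and> L2_fun (V \<tau>)) \<and>
    (\<forall>\<tau>. ((\<lambda>s. Sobolev_norm (\<lambda>_. 1) 1 (\<lambda>X. U s X - U \<tau> X)) \<longlongrightarrow> 0) (at \<tau>)) \<and>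
    (\<forall>\<tau>. ((\<lambda>s. L2_norm (\<lambda>X. V s X - V \<tau> X)) \<longlongrightarrow> 0) (at \<tau>)) \<and>
    (\<forall>\<tau>. ((\<lambda>s. L2_norm (\<lambda>X. (U s X - U \<tau> X) / (s - \<tau>) - V \<tau> X)) \<longlongrightarrow> 0) (at \<tau>)) \<and>
    (\<forall>w. test_fun w \<longrightarrow> (\<forall>\<tau>.
      ((\<lambda>s. c * (LINT X|lebesgue. V s X * w X)) has_real_derivative
        (LINT X|lebesgue. U \<tau> X * (\<Sum>i\<in>UNIV. iter_partial [i, i] w X))) (at \<tau>))) \<and>
    (AE X in lebesgue. U 0 X = \<phi> X) \<and> (AE X in lebesgue. V 0 X = \<psi> X)"


section \<open>The lattice equation\<close>

definition lattice_pt :: "int^2 \<Rightarrow> real^2" where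
  "lattice_pt j = (\<chi> i. of_int (j $ i))"

definition lattice_laplacian :: "(int^2 \<Rightarrow> real) \<Rightarrow> int^2 \<Rightarrow> real" where
  "lattice_laplacian f j = - 4 * f j + (\<Sum>i\<in>UNIV. f (j + axis i 1) + f (j - axis i 1))"

definition l2_seq :: "(int^2 \<Rightarrow> real) \<Rightarrow> bool" where
  "l2_seq f \<longleftrightarrow> (\<lambda>j. (f j)\<^sup>2) summable_on UNIV"

definition l2_norm :: "(int^2 \<Rightarrow> real) \<Rightarrow> real" where
  "l2_norm f = sqrt (\<Sum>\<^sub>\<infinity>j. (f j)\<^sup>2)"

text \<open>
  Solutions of \<open>\<mu>(j) u''(j,t) = \<Delta> u(j,t)\<close> that are continuously differentiable in time with values in
  \<open>\<ell>\<^sup>2\<close>; \<open>v\<close> is the time derivative of \<open>u\<close>. The time is the first argument.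
\<close>

definition lattice_solution ::
  "(int^2 \<Rightarrow> real) \<Rightarrow> (int^2 \<Rightarrow> real) \<Rightarrow> (int^2 \<Rightarrow> real) \<Rightarrow>
    (real \<Rightarrow> int^2 \<Rightarrow> real) \<Rightarrow> (real \<Rightarrow> int^2 \<Rightarrow> real) \<Rightarrow> bool" where
  "lattice_solution \<mu> f g u v \<longleftrightarrow>
    (\<forall>t. l2_seq (u t) \<and> l2_seq (v t)) \<and>
    (\<forall>t. ((\<lambda>s. l2_norm (\<lambda>j. (u s j - u t j) / (s - t) - v t j)) \<longlongrightarrow> 0) (at t)) \<and>
    (\<forall>t. ((\<lambda>s. l2_norm (\<lambda>j. v s j - v t j)) \<longlongrightarrow> 0) (at t)) \<and>
    (\<forall>t j. \<exists>a. ((\<lambda>s. v s j) has_real_derivative a) (at t) \<and>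
               \<mu> j * a = lattice_laplacian (u t) j) \<and>
    u 0 = f \<and> v 0 = g"


section \<open>Lattice Fourier transform and low-pass interpolation\<close>

definition torus_cell :: "(real^2) set" where
  "torus_cell = cbox (vec (- pi)) (vec pi)"

text \<open>
  For \<open>f \<in> \<ell>\<^sup>2\<close> the Fourier series converges in \<open>L\<^sup>2\<close> of the cell but in general not pointwise; its sum
  is determined up to null sets within the cell, and only its values there are used.
\<close>

definition lattice_FT :: "(int^2 \<Rightarrow> complex) \<Rightarrow> real^2 \<Rightarrow> complex" where
  "lattice_FT f = (SOME g. g \<in> borel_measurable lebesgue \<and>
    ((\<lambda>A. L2_norm (\<lambda>y. indicator torus_cell y *\<^sub>R
        (g y - (1 / (2 * pi)\<^sup>2) *\<^sub>R (\<Sum>j\<in>A. cis (- (lattice_pt j \<bullet> y)) * f j))))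
      \<longlongrightarrow> 0) (finite_subsets_at_top UNIV))"

definition low_pass :: "(int^2 \<Rightarrow> complex) \<Rightarrow> real^2 \<Rightarrow> complex" where
  "low_pass f x = (LINT y:torus_cell|lebesgue. cis (y \<bullet> x) * lattice_FT f y)"

definition rescaled_interp :: "real \<Rightarrow> (real \<Rightarrow> int^2 \<Rightarrow> real) \<Rightarrow> real \<Rightarrow> real^2 \<Rightarrow> complex" where
  "rescaled_interp \<epsilon> u \<tau> X = low_pass (\<lambda>j. complex_of_real (u (\<tau> / \<epsilon>) j)) ((1 / \<epsilon>) *\<^sub>R X)"

end

theory Submission
  imports Defs
begin

text \<open>
  The lattice solution is compared with samples of the macroscopic one by an energy estimate. As
  \<open>U\<close> has only finite energy, it is first mollified at a scale \<open>\<eta>\<close>; the limit \<open>\<epsilon> \<rightarrow> 0\<close> is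
  taken for fixed \<open>\<eta>\<close>, and \<open>\<eta> \<rightarrow> 0\<close> at the very end.

  Write \<open>U\<^sup>\<eta>\<close> for the mollification and \<open>e\<close> for the lattice function
  \<open>e(k) = \<epsilon> u(k, \<tau>/\<epsilon>) - U\<^sup>\<eta>(\<epsilon> k, \<tau>)\<close>. The weak wave equation, tested with mollifiers centred at the
  lattice points, gives
  \<open>m \<partial>\<^sub>\<tau>\<^sub>\<tau> e = \<epsilon>\<^bsup>-2\<^esup> \<Delta> e - (m - mbar) A - r\<close>, where \<open>A = \<partial>\<^sub>\<tau>\<^sub>\<tau> U\<^sup>\<eta>\<close> at the lattice points and \<open>r\<close>
  is the error of replacing the Laplacian by differences, of order \<open>\<epsilon>\<close> (\<open>consistency\<close>). The forcing
  \<open>(m - mbar) A\<close> is as large as \<open>A\<close>, but it oscillates. An integration by parts in time makes it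
  enter the energy balance only through its pairing with \<open>e\<close>, whose gradient the energy controls
  (\<open>energy_estimate\<close>). Averaging such a pairing over blocks of \<open>N \<times> N\<close> sites costs the gradients
  times \<open>N\<close> and leaves block averages of \<open>m - mbar\<close> (\<open>oscillating_pairing_bound\<close>). With
  \<open>N \<approx> 1 / sqrt \<epsilon>\<close> the cost is \<open>N \<epsilon> \<rightarrow> 0\<close>. By Hoeffding's inequality and the Borel-Cantelli lemma the
  averages are almost surely small, eventually for all blocks within distance \<open>N\<^sup>3\<close> of the origin
  (\<open>block_average_AE\<close>); since \<open>\<epsilon> N\<^sup>3 \<rightarrow> \<infinity>\<close>, that region exhausts the plane, and what lies outside is
  negligible because the solution is square-integrable (\<open>samp_tail_small\<close>).

  At time \<open>0\<close> the error is the difference between samples of the data and of their mollifications.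
  First and mixed second derivatives in \<open>L\<^sup>2\<close> bound point values in the plane, which shows that
  the sampled difference and its difference quotients are small with \<open>\<eta>\<close>
  (\<open>data_sampling_value\<close>, \<open>data_sampling_gradient\<close>). Together, the lattice error is at most \<open>\<Theta> \<eta>\<close> for
  small \<open>\<epsilon>\<close>, with \<open>\<Theta> \<eta> \<rightarrow> 0\<close> (\<open>lattice_error\<close>).

  The \<open>L\<^sup>2\<close> norm over the plane is an average, over the position \<open>x\<close> within a lattice cell, of
  \<open>\<ell>\<^sup>2\<close> norms along the shifted lattices \<open>\<epsilon> (k + x)\<close> (\<open>L2_norm_tile_le\<close>). Along each of them the
  low-pass interpolation is a contraction, by Bessel's inequality, and its difference from the lattice
  function itself is controlled by the gradient (\<open>interpolation_error\<close>), which is of order \<open>\<epsilon>\<close> for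
  samples of \<open>U\<^sup>\<eta>\<close>. Finally \<open>U\<^sup>\<eta> \<rightarrow> U\<close> uniformly on compact time intervals (\<open>mollification_uniform\<close>).
\<close>

section \<open>Square-summable families\<close>

lemma square_summable_mult:
  fixes f g :: "'i \<Rightarrow> real"
  assumes "(\<lambda>i. (f i)\<^sup>2) summable_on UNIV" "(\<lambda>i. (g i)\<^sup>2) summable_on UNIV"
  shows "(\<lambda>i. f i * g i) summable_on UNIV"
proof -
  have "(\<lambda>i. (f i)\<^sup>2 + (g i)\<^sup>2) summable_on UNIV"
    using assms by (rule summable_on_add)
  then have "(\<lambda>i. norm (f i * g i)) summable_on UNIV"
  proof (rule summable_on_comparison_test)
    fix i
    have "0 \<le> (\<bar>f i\<bar> - \<bar>g i\<bar>)\<^sup>2" by simp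
    then have "2 * (\<bar>f i\<bar> * \<bar>g i\<bar>) \<le> (f i)\<^sup>2 + (g i)\<^sup>2" by (simp add: power2_diff)
    moreover have "0 \<le> \<bar>f i\<bar> * \<bar>g i\<bar>" by simp
    ultimately show "norm (f i * g i) \<le> (f i)\<^sup>2 + (g i)\<^sup>2"
      unfolding real_norm_def abs_mult by linarith
  qed auto
  then show ?thesis by (rule abs_summable_summable)
qed

lemma square_summable_add:
  fixes f g :: "'i \<Rightarrow> real"
  assumes "(\<lambda>i. (f i)\<^sup>2) summable_on UNIV" "(\<lambda>i. (g i)\<^sup>2) summable_on UNIV"
  shows "(\<lambda>i. (f i + g i)\<^sup>2) summable_on UNIV"
proof -
  have "(\<lambda>i. (f i)\<^sup>2 + 2 * (f i * g i) + (g i)\<^sup>2) summable_on UNIV"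
    by (intro summable_on_add summable_on_cmult_right square_summable_mult assms)
  then show ?thesis by (simp add: power2_sum algebra_simps)
qed

lemma square_summable_bound:
  fixes f g :: "'i \<Rightarrow> real"
  assumes "(\<lambda>i. (f i)\<^sup>2) summable_on UNIV" "\<And>i. \<bar>g i\<bar> \<le> c * \<bar>f i\<bar>"
  shows "(\<lambda>i. (g i)\<^sup>2) summable_on UNIV"
proof (rule summable_on_comparison_test)
  show "(\<lambda>i. c\<^sup>2 * (f i)\<^sup>2) summable_on UNIV"
    by (intro summable_on_cmult_right assms)
  show "(g i)\<^sup>2 \<le> c\<^sup>2 * (f i)\<^sup>2" for i
    using power_mono[OF assms(2)[of i], of 2] by (simp add: power_mult_distrib)
qed auto

text \<open>
  As a type, the square-summable families are an inner product space, so that the notions of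
  continuity and derivative for curves apply to lattice functions depending on time.
\<close>

typedef 'i ell2 = "{f :: 'i \<Rightarrow> real. (\<lambda>i. (f i)\<^sup>2) summable_on UNIV}"
  morphisms coord Abs_ell2
  by (rule exI[of _ "\<lambda>_. 0"]) simp

setup_lifting type_definition_ell2

instantiation ell2 :: (type) real_vector
begin

lift_definition zero_ell2 :: "'a ell2" is "\<lambda>_. 0" by simp
lift_definition plus_ell2 :: "'a ell2 \<Rightarrow> 'a ell2 \<Rightarrow> 'a ell2" is "\<lambda>f g i. f i + g i"
  by (rule square_summable_add)
lift_definition uminus_ell2 :: "'a ell2 \<Rightarrow> 'a ell2" is "\<lambda>f i. - f i" by simp
lift_definition minus_ell2 :: "'a ell2 \<Rightarrow> 'a ell2 \<Rightarrow> 'a ell2" is "\<lambda>f g i. f i - g i"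
  subgoal for f g using square_summable_add[of f "\<lambda>i. - g i"] by simp
  done
lift_definition scaleR_ell2 :: "real \<Rightarrow> 'a ell2 \<Rightarrow> 'a ell2" is "\<lambda>r f i. r * f i"
  by (simp add: power_mult_distrib summable_on_cmult_right)

instance
  by standard (transfer; simp add: algebra_simps fun_eq_iff)+

end

lemma coord_simps [simp]:
  "coord 0 i = 0" "coord (x + y) i = coord x i + coord y i" "coord (x - y) i = coord x i - coord y i"
  "coord (- x) i = - coord x i" "coord (r *\<^sub>R x) i = r * coord x i"
  by (transfer; simp)+

lemma ell2_eqI: "(\<And>i. coord x i = coord y i) \<Longrightarrow> x = y"
  by (transfer) auto

lemma coord_summable: "(\<lambda>i. (coord x i)\<^sup>2) summable_on UNIV"
  by transfer simp

lemma coord_summable_mult: "(\<lambda>i. coord x i * coord y i) summable_on UNIV"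
  by (intro square_summable_mult coord_summable)

instantiation ell2 :: (type) real_inner
begin

definition inner_ell2 :: "'a ell2 \<Rightarrow> 'a ell2 \<Rightarrow> real" where
  "inner_ell2 x y = (\<Sum>\<^sub>\<infinity>i. coord x i * coord y i)"
definition norm_ell2 :: "'a ell2 \<Rightarrow> real" where "norm_ell2 x = sqrt (inner x x)"
definition sgn_ell2 :: "'a ell2 \<Rightarrow> 'a ell2" where "sgn_ell2 x = x /\<^sub>R norm x"
definition dist_ell2 :: "'a ell2 \<Rightarrow> 'a ell2 \<Rightarrow> real" where "dist_ell2 x y = norm (x - y)"
definition uniformity_ell2 :: "('a ell2 \<times> 'a ell2) filter" where
  "uniformity_ell2 = (INF e\<in>{0 <..}. principal {(x, y). dist x y < e})"
definition open_ell2 :: "'a ell2 set \<Rightarrow> bool" where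
  "open_ell2 S = (\<forall>x\<in>S. \<forall>\<^sub>F (x', y) in uniformity. x' = x \<longrightarrow> y \<in> S)"

instance
proof
  fix x y z :: "'a ell2" and r :: real
  show "x \<bullet> y = y \<bullet> x" by (simp add: inner_ell2_def mult.commute)
  show "(x + y) \<bullet> z = x \<bullet> z + y \<bullet> z"
    by (simp add: inner_ell2_def distrib_right infsum_add coord_summable_mult)
  show "(r *\<^sub>R x) \<bullet> y = r * (x \<bullet> y)"
    by (simp add: inner_ell2_def mult.assoc infsum_cmult_right')
  show "0 \<le> x \<bullet> x" by (auto simp: inner_ell2_def intro!: infsum_nonneg)
  show "(x \<bullet> x = 0) = (x = 0)"
  proof
    assume "x \<bullet> x = 0"
    then have "coord x i * coord x i = 0" for i
      using nonneg_infsum_le_0D[of "\<lambda>i. coord x i * coord x i" UNIV i] coord_summable_mult[of x x]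
      by (simp add: inner_ell2_def)
    then show "x = 0" by (intro ell2_eqI) simp
  qed (simp add: inner_ell2_def)
qed (auto simp: norm_ell2_def sgn_ell2_def dist_ell2_def uniformity_ell2_def open_ell2_def)

end

lemma norm_ell2_sq: "(norm x)\<^sup>2 = (\<Sum>\<^sub>\<infinity>i. (coord x i)\<^sup>2)" for x :: "'i ell2"
proof -
  have "(norm x)\<^sup>2 = inner x x" by (rule power2_norm_eq_inner)
  also have "\<dots> = (\<Sum>\<^sub>\<infinity>i. (coord x i)\<^sup>2)"
    unfolding inner_ell2_def power2_eq_square by (rule refl)
  finally show ?thesis .
qed

lemma sum_coord_sq_le: "finite A \<Longrightarrow> (\<Sum>i\<in>A. (coord x i)\<^sup>2) \<le> (norm x)\<^sup>2"
  by (auto simp: norm_ell2_sq intro!: finite_sum_le_infsum coord_summable)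

lemma abs_coord_le_norm: "\<bar>coord x i\<bar> \<le> norm x"
  using sum_coord_sq_le[of "{i}" x] by (simp add: abs_le_square_iff[symmetric])

lemma norm_ell2_le:
  assumes "0 \<le> c" "\<And>A. finite A \<Longrightarrow> (\<Sum>i\<in>A. (coord x i)\<^sup>2) \<le> c\<^sup>2"
  shows "norm x \<le> c"
proof -
  have "(norm x)\<^sup>2 \<le> c\<^sup>2"
    unfolding norm_ell2_sq using assms(2) by (intro infsum_le_finite_sums coord_summable) auto
  then show ?thesis using assms(1) by (rule power2_le_imp_le)
qed

text \<open>Partial sums of squares decide both membership and the size of the norm.\<close>

lemma square_summableI:
  fixes f :: "'i \<Rightarrow> real"
  assumes "\<And>A. finite A \<Longrightarrow> (\<Sum>i\<in>A. (f i)\<^sup>2) \<le> c"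
  shows "(\<lambda>i. (f i)\<^sup>2) summable_on UNIV"
  by (rule nonneg_bdd_above_summable_on) (use assms in \<open>auto intro!: bdd_aboveI2\<close>)

lemma coord_Abs_ell2: "(\<lambda>i. (f i)\<^sup>2) summable_on UNIV \<Longrightarrow> coord (Abs_ell2 f) = f"
  by (simp add: Abs_ell2_inverse)

lemma coord_Abs_ell2I:
  assumes "\<And>A. finite A \<Longrightarrow> (\<Sum>i\<in>A. (f i)\<^sup>2) \<le> c"
  shows "coord (Abs_ell2 f) = f"
  using square_summableI[OF assms] by (rule coord_Abs_ell2)

lemma norm_ell2_mono:
  assumes "\<And>i. \<bar>coord x i\<bar> \<le> \<bar>coord y i\<bar>"
  shows "norm x \<le> norm y"
proof (rule norm_ell2_le)
  fix A :: "'a set" assume "finite A"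
  have "(\<Sum>i\<in>A. (coord x i)\<^sup>2) \<le> (\<Sum>i\<in>A. (coord y i)\<^sup>2)"
    by (intro sum_mono) (use assms in \<open>simp add: abs_le_square_iff\<close>)
  also have "\<dots> \<le> (norm y)\<^sup>2" using \<open>finite A\<close> by (rule sum_coord_sq_le)
  finally show "(\<Sum>i\<in>A. (coord x i)\<^sup>2) \<le> (norm y)\<^sup>2" .
qed simp

lemma inner_cong:
  fixes x y x' y' :: "'i ell2"
  shows "(\<And>i. coord x i * coord y i = coord x' i * coord y' i) \<Longrightarrow> inner x y = inner x' y'"
  by (simp add: inner_ell2_def)

subsection \<open>Multiplication and translation operators\<close>

text \<open>Meaningful for bounded multipliers, where the product is again square-summable.\<close>

definition mult_op :: "('i \<Rightarrow> real) \<Rightarrow> 'i ell2 \<Rightarrow> 'i ell2" where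
  "mult_op \<mu> x = Abs_ell2 (\<lambda>i. \<mu> i * coord x i)"

lemma coord_mult_op:
  assumes "\<And>i. \<bar>\<mu> i\<bar> \<le> c"
  shows "coord (mult_op \<mu> x) i = \<mu> i * coord x i"
proof -
  have "\<bar>\<mu> i * coord x i\<bar> \<le> c * \<bar>coord x i\<bar>" for i
    using assms[of i] by (simp add: abs_mult mult_right_mono)
  from square_summable_bound[OF coord_summable this] show ?thesis
    by (simp add: mult_op_def coord_Abs_ell2)
qed

lemma norm_mult_op_le:
  assumes "\<And>i. \<bar>\<mu> i\<bar> \<le> c"
  shows "norm (mult_op \<mu> x) \<le> c * norm x"
proof -
  have "0 \<le> c" using assms[of undefined] by linarith
  have "norm (mult_op \<mu> x) \<le> norm (c *\<^sub>R x)"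
    by (rule norm_ell2_mono) (use assms \<open>0 \<le> c\<close> in \<open>simp add: coord_mult_op[OF assms] abs_mult mult_right_mono\<close>)
  then show ?thesis using \<open>0 \<le> c\<close> by simp
qed

lemma bounded_linear_mult_op:
  assumes "\<And>i. \<bar>\<mu> i\<bar> \<le> c"
  shows "bounded_linear (mult_op \<mu>)"
  by (rule bounded_linear_intro[where K=c])
     (auto intro!: ell2_eqI simp: coord_mult_op[OF assms] algebra_simps mult.commute[of _ c] norm_mult_op_le[OF assms])

lemma inner_mult_op:
  assumes "\<And>i. \<bar>\<mu> i\<bar> \<le> c"
  shows "inner (mult_op \<mu> x) y = inner x (mult_op \<mu> y)"
  by (rule inner_cong) (simp add: coord_mult_op[OF assms])

lift_definition shift_op :: "'i::ab_group_add \<Rightarrow> 'i ell2 \<Rightarrow> 'i ell2" is "\<lambda>k f i. f (i + k)"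
  subgoal for k f
    using summable_on_reindex_bij_betw[of "\<lambda>i. i + k" UNIV UNIV "\<lambda>i. (f i)\<^sup>2"]
    by (simp add: bij_plus_right)
  done

lemma coord_shift_op [simp]: "coord (shift_op k x) i = coord x (i + k)"
  by transfer simp

lemma inner_shift_op: "inner (shift_op k x) (shift_op k y) = inner x y"
  using infsum_reindex_bij_betw[of "\<lambda>i. i + k" UNIV UNIV "\<lambda>i. coord x i * coord y i"]
  by (simp add: inner_ell2_def bij_plus_right)

lemma norm_shift_op [simp]: "norm (shift_op k x) = norm x"
  by (simp add: norm_eq_sqrt_inner inner_shift_op)

lemma shift_op_shift_op: "shift_op k (shift_op l x) = shift_op (k + l) x"
  by (rule ell2_eqI) (simp add: add_ac)

lemma bounded_linear_shift_op: "bounded_linear (shift_op k)"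
  by (rule bounded_linear_intro[where K=1]) (auto intro!: ell2_eqI)

lemmas shift_op_linear = 
  linear_add[OF bounded_linear.linear[OF bounded_linear_shift_op]]
  linear_diff[OF bounded_linear.linear[OF bounded_linear_shift_op]]
  linear_scale[OF bounded_linear.linear[OF bounded_linear_shift_op]]

lemma inner_shift_op_left: "inner (shift_op k x) y = inner x (shift_op (- k) y)"
  using inner_shift_op[of "k" x "shift_op (- k) y"] 
  by (simp add: shift_op_shift_op ell2_eqI[of "shift_op 0 y" y])

subsection \<open>Differentiation in \<open>\<ell>\<^sup>2\<close>\<close>

text \<open>
  A pointwise derivative that is continuous with values in \<open>\<ell>\<^sup>2\<close> is a derivative in the norm. On a
  finite set of sites this is the mean value theorem for the pairing of the remainder with a fixed
  vector; that vector is then taken to be the remainder itself.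
\<close>

lemma ell2_has_vector_derivativeI:
  fixes f f' :: "real \<Rightarrow> 'i ell2"
  assumes der: "\<And>t i. ((\<lambda>s. coord (f s) i) has_real_derivative coord (f' t) i) (at t)"
    and cont: "isCont f' t"
  shows "(f has_vector_derivative f' t) (at t)"
  unfolding has_vector_derivative_def has_derivative_at_within
proof safe
  show "bounded_linear (\<lambda>x. x *\<^sub>R f' t)" by (rule bounded_linear_scaleR_left)
  have key: "norm (f s - f t - (s - t) *\<^sub>R f' t) \<le> \<bar>s - t\<bar> * e"
    if e: "0 < e" "\<And>r. \<bar>r - t\<bar> \<le> \<bar>s - t\<bar> \<Longrightarrow> norm (f' r - f' t) \<le> e" for s e
  proof (rule norm_ell2_le)
    show "0 \<le> \<bar>s - t\<bar> * e" using e(1) by simp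
    fix A :: "'i set" assume A: "finite A"
    define x where "x i = coord (f s) i - coord (f t) i - (s - t) * coord (f' t) i" for i
    define G where "G r = (\<Sum>i\<in>A. x i * (coord (f r) i - coord (f t) i - (r - t) * coord (f' t) i))" for r
    have G': "(G has_real_derivative (\<Sum>i\<in>A. x i * (coord (f' r) i - coord (f' t) i))) (at r)" for r
      unfolding G_def by (auto intro!: derivative_eq_intros der sum.cong)
    have bd: "\<bar>\<Sum>i\<in>A. x i * (coord (f' r) i - coord (f' t) i)\<bar> \<le> sqrt (\<Sum>i\<in>A. (x i)\<^sup>2) * e"
      if r: "\<bar>r - t\<bar> \<le> \<bar>s - t\<bar>" for r
    proof -
      have "\<bar>\<Sum>i\<in>A. x i * (coord (f' r) i - coord (f' t) i)\<bar> \<le> (\<Sum>i\<in>A. \<bar>x i\<bar> * \<bar>coord (f' r - f' t) i\<bar>)"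
        by (rule order_trans[OF sum_abs]) (simp add: abs_mult)
      also have "\<dots> \<le> L2_set x A * L2_set (coord (f' r - f' t)) A"
        by (rule L2_set_mult_ineq)
      also have "L2_set (coord (f' r - f' t)) A \<le> norm (f' r - f' t)"
        unfolding L2_set_def by (rule real_le_lsqrt[OF _ sum_coord_sq_le[OF A]]) simp
      also have "\<dots> \<le> e" using e(2)[OF r] .
      finally show ?thesis by (simp add: L2_set_def mult_left_mono sum_nonneg)
    qed
    have "norm (G s - G t) \<le> sqrt (\<Sum>i\<in>A. (x i)\<^sup>2) * e * norm (s - t)"
    proof (rule field_differentiable_bound)
      show "convex {r. \<bar>r - t\<bar> \<le> \<bar>s - t\<bar>}"
        using convex_cball[of t "\<bar>s - t\<bar>"] by (simp add: cball_def dist_real_def abs_minus_commute)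
      show "(G has_field_derivative (\<Sum>i\<in>A. x i * (coord (f' r) i - coord (f' t) i))) (at r within {r. \<bar>r - t\<bar> \<le> \<bar>s - t\<bar>})" for r
        using G' by (rule has_field_derivative_at_within)
    qed (use bd in auto)
    moreover have "G s = (\<Sum>i\<in>A. (x i)\<^sup>2)" "G t = 0"
      by (simp_all add: G_def x_def power2_eq_square)
    ultimately have le: "(sqrt (\<Sum>i\<in>A. (x i)\<^sup>2))\<^sup>2 \<le> sqrt (\<Sum>i\<in>A. (x i)\<^sup>2) * (\<bar>s - t\<bar> * e)"
      by (simp add: sum_nonneg mult_ac)
    have "sqrt (\<Sum>i\<in>A. (x i)\<^sup>2) \<le> \<bar>s - t\<bar> * e"
    proof (cases "sqrt (\<Sum>i\<in>A. (x i)\<^sup>2) > 0")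
      case True
      have "y \<le> z" if "0 < y" "y\<^sup>2 \<le> y * z" for y z :: real
        using that by (simp add: power2_eq_square)
      from this[OF True le] show ?thesis .
    next
      case False then show ?thesis using e(1) by (smt (verit) abs_ge_zero mult_nonneg_nonneg)
    qed
    then have "(sqrt (\<Sum>i\<in>A. (x i)\<^sup>2))\<^sup>2 \<le> (\<bar>s - t\<bar> * e)\<^sup>2"
      by (intro power_mono) (auto simp: sum_nonneg)
    then show "(\<Sum>i\<in>A. (coord (f s - f t - (s - t) *\<^sub>R f' t) i)\<^sup>2) \<le> (\<bar>s - t\<bar> * e)\<^sup>2"
      by (simp add: x_def sum_nonneg)
  qed
  show "((\<lambda>y. ((f y - f t) - (y - t) *\<^sub>R f' t) /\<^sub>R norm (y - t)) \<longlongrightarrow> 0) (at t)"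
  proof (rule tendstoI)
    fix e :: real assume "0 < e"
    then obtain d where d: "d > 0" "\<And>r. dist r t < d \<Longrightarrow> dist (f' r) (f' t) < e / 2"
      using cont unfolding continuous_at_eps_delta by (metis half_gt_zero)
    have "dist (((f s - f t) - (s - t) *\<^sub>R f' t) /\<^sub>R norm (s - t)) 0 < e" if s: "s \<noteq> t" "dist s t < d" for s
    proof -
      have "norm (f s - f t - (s - t) *\<^sub>R f' t) \<le> \<bar>s - t\<bar> * (e / 2)"
        by (rule key) (use \<open>0 < e\<close> d s in \<open>auto simp: dist_norm less_imp_le\<close>)
      then have "norm (f s - f t - (s - t) *\<^sub>R f' t) / \<bar>s - t\<bar> \<le> e / 2"
        using s by (simp add: divide_le_eq mult.commute)
      moreover have "dist (z /\<^sub>R \<bar>s - t\<bar>) 0 = norm z / \<bar>s - t\<bar>" for z :: "'i ell2"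
        by (simp add: divide_inverse)
      ultimately show ?thesis using \<open>0 < e\<close> by (simp only: real_norm_def)
    qed
    then show "\<forall>\<^sub>F s in at t. dist (((f s - f t) - (s - t) *\<^sub>R f' t) /\<^sub>R norm (s - t)) 0 < e"
      unfolding eventually_at using d(1) by auto
  qed
qed

section \<open>Square-integrable functions on the plane\<close>

lemma ennreal_power2_le_imp_le:
  fixes x y :: ennreal
  assumes "x\<^sup>2 \<le> y\<^sup>2" shows "x \<le> y"
proof (cases "y = \<infinity>")
  case False
  then have "x \<noteq> \<infinity>"
    using assms by (auto simp: power2_eq_square ennreal_mult_eq_top_iff top_unique)
  with False obtain a b where "x = ennreal a" "y = ennreal b" "0 \<le> a" "0 \<le> b"
    by (metis ennreal_cases infinity_ennreal_def)
  with assms show ?thesis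
    by (auto simp: ennreal_power intro: power2_le_imp_le ennreal_leI)
qed simp

lemma L2_norm_power2: "(L2_norm f)\<^sup>2 = (\<integral>\<^sup>+ x. ennreal ((norm (f x))\<^sup>2) \<partial>lebesgue)"
  by (cases "\<integral>\<^sup>+ x. ennreal ((norm (f x))\<^sup>2) \<partial>lebesgue" rule: ennreal_cases)
     (simp_all add: L2_norm_def Let_def ennreal_power)

lemma L2_norm_le_iff:
  "L2_norm f \<le> ennreal c \<longleftrightarrow> (\<integral>\<^sup>+ x. ennreal ((norm (f x))\<^sup>2) \<partial>lebesgue) \<le> ennreal (c\<^sup>2)" if "0 \<le> c"
proof -
  have "ennreal (c\<^sup>2) = (ennreal c)\<^sup>2" using that by (simp add: ennreal_power)
  then show ?thesis
    unfolding L2_norm_power2[symmetric]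
    by (metis ennreal_power2_le_imp_le power_mono zero_le)
qed

lemma L2_norm_triangle:
  fixes f g :: "real^2 \<Rightarrow> 'a::real_normed_vector"
  assumes [measurable]: "(\<lambda>x. norm (f x)) \<in> borel_measurable lebesgue"
    "(\<lambda>x. norm (g x)) \<in> borel_measurable lebesgue"
  shows "L2_norm (\<lambda>x. f x + g x) \<le> L2_norm f + L2_norm g"
proof (rule ennreal_power2_le_imp_le)
  let ?f = "\<lambda>x. ennreal (norm (f x))" and ?g = "\<lambda>x. ennreal (norm (g x))"
  have F: "(L2_norm f)\<^sup>2 = (\<integral>\<^sup>+x. (?f x)\<^sup>2 \<partial>lebesgue)" and G: "(L2_norm g)\<^sup>2 = (\<integral>\<^sup>+x. (?g x)\<^sup>2 \<partial>lebesgue)"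
    by (simp_all add: L2_norm_power2 ennreal_power)
  have CS: "(\<integral>\<^sup>+x. ?f x * ?g x \<partial>lebesgue) \<le> L2_norm f * L2_norm g"
    by (rule ennreal_power2_le_imp_le) (use Cauchy_Schwarz_nn_integral[of ?f lebesgue ?g] in \<open>simp add: F G power_mult_distrib\<close>)
  have "(L2_norm (\<lambda>x. f x + g x))\<^sup>2 = (\<integral>\<^sup>+x. (ennreal (norm (f x + g x)))\<^sup>2 \<partial>lebesgue)"
    by (simp add: L2_norm_power2 ennreal_power)
  also have "\<dots> \<le> (\<integral>\<^sup>+x. (?f x + ?g x)\<^sup>2 \<partial>lebesgue)"
    by (intro nn_integral_mono power_mono) (auto simp flip: ennreal_plus intro: norm_triangle_ineq)
  also have "\<dots> = (\<integral>\<^sup>+x. ((?f x)\<^sup>2 + 2 * (?f x * ?g x)) + (?g x)\<^sup>2 \<partial>lebesgue)"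
    by (intro nn_integral_cong) (simp add: power2_sum algebra_simps)
  also have "\<dots> = (L2_norm f)\<^sup>2 + 2 * (\<integral>\<^sup>+x. ?f x * ?g x \<partial>lebesgue) + (L2_norm g)\<^sup>2"
    by (simp add: nn_integral_add nn_integral_cmult F G)
  also have "\<dots> \<le> (L2_norm f)\<^sup>2 + 2 * (L2_norm f * L2_norm g) + (L2_norm g)\<^sup>2"
    by (intro add_mono mult_left_mono CS) auto
  also have "\<dots> = (L2_norm f + L2_norm g)\<^sup>2"
    by (simp add: power2_sum algebra_simps)
  finally show "(L2_norm (\<lambda>x. f x + g x))\<^sup>2 \<le> (L2_norm f + L2_norm g)\<^sup>2" .
qed

text \<open>
  A real number, so that it can be used in limits and algebra; it is the norm on square-integrable
  functions and takes the default value \<open>0\<close> where the norm is infinite.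
\<close>

definition L2n :: "(real^2 \<Rightarrow> real) \<Rightarrow> real" where
  "L2n f = enn2real (L2_norm f)"

lemma L2n_nonneg [simp]: "0 \<le> L2n f" by (simp add: L2n_def)

lemma L2_norm_eq: "L2_fun f \<Longrightarrow> L2_norm f = ennreal (L2n f)"
  by (simp add: L2n_def L2_fun_def)

lemma L2_fun_iff: "L2_fun f \<longleftrightarrow> f \<in> borel_measurable lebesgue \<and> integrable lebesgue (\<lambda>x. (f x)\<^sup>2)"
proof -
  have "L2_norm f < \<infinity> \<longleftrightarrow> (L2_norm f)\<^sup>2 < \<infinity>"
    by (cases "L2_norm f") (auto simp: ennreal_power power2_eq_square ennreal_mult_eq_top_iff ennreal_mult_less_top)
  also have "\<dots> \<longleftrightarrow> (\<integral>\<^sup>+ x. ennreal (norm ((f x)\<^sup>2)) \<partial>lebesgue) < \<infinity>"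
    by (simp add: L2_norm_power2)
  finally show ?thesis
    unfolding L2_fun_def integrable_iff_bounded by auto
qed

lemma L2_fun_measurable: "L2_fun f \<Longrightarrow> f \<in> borel_measurable lebesgue"
  by (simp add: L2_fun_def)

lemma L2_fun_integrable_sq: "L2_fun f \<Longrightarrow> integrable lebesgue (\<lambda>x. (f x)\<^sup>2)"
  by (simp add: L2_fun_iff)

lemma L2n_sq: "L2_fun f \<Longrightarrow> (L2n f)\<^sup>2 = (LINT x|lebesgue. (f x)\<^sup>2)"
proof -
  assume f: "L2_fun f"
  then have "ennreal ((L2n f)\<^sup>2) = (\<integral>\<^sup>+ x. ennreal ((f x)\<^sup>2) \<partial>lebesgue)"
    using L2_norm_power2[of f] by (simp add: L2_norm_eq ennreal_power)
  also have "\<dots> = ennreal (LINT x|lebesgue. (f x)\<^sup>2)"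
    using f by (intro nn_integral_eq_integral) (auto simp: L2_fun_iff)
  finally show ?thesis by (simp add: ennreal_inj)
qed

lemma L2_fun_bound:
  assumes "L2_fun g" "f \<in> borel_measurable lebesgue" "AE x in lebesgue. \<bar>f x\<bar> \<le> \<bar>g x\<bar>"
  shows "L2_fun f" "L2n f \<le> L2n g"
proof -
  have "L2_norm f \<le> L2_norm g"
    by (rule ennreal_power2_le_imp_le, unfold L2_norm_power2, rule nn_integral_mono_AE)
       (use assms(3) in eventually_elim, auto simp: abs_le_square_iff[symmetric] intro!: ennreal_leI)
  then show "L2_fun f" using assms by (auto simp: L2_fun_def)
  with \<open>L2_norm f \<le> L2_norm g\<close> show "L2n f \<le> L2n g"
    using assms by (simp add: L2_norm_eq)
qed

lemma L2_fun_cong_AE: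
  assumes "L2_fun g" "f \<in> borel_measurable lebesgue" "AE x in lebesgue. f x = g x"
  shows "L2_fun f" "L2n f = L2n g"
proof -
  have 1: "AE x in lebesgue. \<bar>f x\<bar> \<le> \<bar>g x\<bar>" "AE x in lebesgue. \<bar>g x\<bar> \<le> \<bar>f x\<bar>"
    using assms(3) by (auto elim!: eventually_mono)
  show "L2_fun f" by (rule L2_fun_bound(1)[OF assms(1,2) 1(1)])
  then show "L2n f = L2n g"
    using L2_fun_bound(2)[OF assms(1,2) 1(1)] L2_fun_bound(2)[of f g] 1(2) assms(1)
    by (auto simp: L2_fun_def)
qed

lemma L2_fun_add:
  assumes "L2_fun f" "L2_fun g"
  shows "L2_fun (\<lambda>x. f x + g x)" "L2n (\<lambda>x. f x + g x) \<le> L2n f + L2n g"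
proof -
  have m [measurable]: "f \<in> borel_measurable lebesgue" "g \<in> borel_measurable lebesgue"
    using assms by (auto simp: L2_fun_def)
  have *: "L2_norm (\<lambda>x. f x + g x) \<le> ennreal (L2n f + L2n g)"
    using L2_norm_triangle[of f g] assms by (simp add: L2_norm_eq)
  then show "L2_fun (\<lambda>x. f x + g x)"
    using le_less_trans[OF * ennreal_less_top] by (auto simp: L2_fun_def)
  then show "L2n (\<lambda>x. f x + g x) \<le> L2n f + L2n g"
    using * by (simp add: L2_norm_eq flip: ennreal_plus)
qed

lemma L2_fun_cmult:
  assumes "L2_fun f"
  shows "L2_fun (\<lambda>x. c * f x)" "L2n (\<lambda>x. c * f x) = \<bar>c\<bar> * L2n f"
proof -
  show *: "L2_fun (\<lambda>x. c * f x)"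
    using assms by (auto simp: L2_fun_iff power_mult_distrib)
  have "(L2n (\<lambda>x. c * f x))\<^sup>2 = (\<bar>c\<bar> * L2n f)\<^sup>2"
    using assms * by (simp add: L2n_sq power_mult_distrib)
  then show "L2n (\<lambda>x. c * f x) = \<bar>c\<bar> * L2n f"
    by (simp add: power2_eq_iff_nonneg)
qed

lemma L2_fun_diff:
  assumes "L2_fun f" "L2_fun g"
  shows "L2_fun (\<lambda>x. f x - g x)" "L2n (\<lambda>x. f x - g x) \<le> L2n f + L2n g"
  using L2_fun_add[OF assms(1) L2_fun_cmult(1)[OF assms(2), of "-1"]] L2_fun_cmult(2)[OF assms(2), of "-1"]
  by simp_all

lemma L2n_diff_commute: "L2n (\<lambda>x. f x - g x) = L2n (\<lambda>x. g x - f x)"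
  by (simp add: L2n_def L2_norm_def power2_commute)

lemma L2n_triangle_diff:
  assumes "L2_fun f" "L2_fun g"
  shows "\<bar>L2n f - L2n g\<bar> \<le> L2n (\<lambda>x. f x - g x)"
  using L2_fun_add(2)[OF L2_fun_diff(1)[OF assms] assms(2)]
    L2_fun_add(2)[OF L2_fun_diff(1)[OF assms(2,1)] assms(1)] L2n_diff_commute[of f g] by simp

lemma L2n_dominated_convergence:
  assumes w: "L2_fun w" and m: "\<And>n. F n \<in> borel_measurable lebesgue" "f \<in> borel_measurable lebesgue"
    and lim: "AE x in lebesgue. (\<lambda>n. F n x) \<longlonglongrightarrow> f x"
    and dom: "\<And>n. AE x in lebesgue. \<bar>F n x\<bar> \<le> w x"
  shows "L2_fun f" "\<And>n. L2_fun (F n)" "(\<lambda>n. L2n (\<lambda>x. F n x - f x)) \<longlonglongrightarrow> 0"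
proof -
  have domf: "AE x in lebesgue. \<bar>f x\<bar> \<le> w x"
  proof -
    have "AE x in lebesgue. \<forall>n. \<bar>F n x\<bar> \<le> w x" using dom by (simp add: AE_all_countable)
    with lim show ?thesis
    proof eventually_elim
      case (elim x)
      then show ?case by (intro LIMSEQ_le_const2[OF tendsto_rabs[OF elim(1)]]) auto
    qed
  qed
  show f: "L2_fun f" by (rule L2_fun_bound(1)[OF w m(2)]) (use domf in \<open>auto elim!: eventually_mono\<close>)
  show F: "L2_fun (F n)" for n by (rule L2_fun_bound(1)[OF w m(1)]) (use dom[of n] in \<open>auto elim!: eventually_mono\<close>)
  have "(\<lambda>n. LINT x|lebesgue. (F n x - f x)\<^sup>2) \<longlonglongrightarrow> integral\<^sup>L lebesgue (\<lambda>_::real^2. 0::real)"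
  proof (rule integral_dominated_convergence[where w="\<lambda>x. 4 * (w x)\<^sup>2"])
    show "integrable lebesgue (\<lambda>x. 4 * (w x)\<^sup>2)" using w by (simp add: L2_fun_iff)
    show "AE x in lebesgue. (\<lambda>n. (F n x - f x)\<^sup>2) \<longlonglongrightarrow> 0"
      using lim by eventually_elim (auto intro!: tendsto_eq_intros)
    show "AE x in lebesgue. norm ((F n x - f x)\<^sup>2) \<le> 4 * (w x)\<^sup>2" for n
      using dom[of n] domf
    proof eventually_elim
      case (elim x)
      then have "\<bar>F n x - f x\<bar> \<le> 2 * w x" by linarith
      then have "\<bar>F n x - f x\<bar>\<^sup>2 \<le> (2 * w x)\<^sup>2" by (intro power_mono) auto
      then show ?case by (simp add: power_mult_distrib)
    qed
  qed (use m in measurable)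
  then have "(\<lambda>n. (L2n (\<lambda>x. F n x - f x))\<^sup>2) \<longlonglongrightarrow> 0"
    using L2n_sq[OF L2_fun_diff(1)[OF F f]] by simp
  then have "(\<lambda>n. sqrt ((L2n (\<lambda>x. F n x - f x))\<^sup>2)) \<longlonglongrightarrow> sqrt 0"
    by (rule tendsto_real_sqrt)
  then show "(\<lambda>n. L2n (\<lambda>x. F n x - f x)) \<longlonglongrightarrow> 0" by simp
qed

subsection \<open>Square boxes\<close>

definition sqbox :: "real^2 \<Rightarrow> real \<Rightarrow> (real^2) set" where
  "sqbox X R = {Y. \<forall>i. \<bar>Y $ i - X $ i\<bar> \<le> R}"

lemma sqbox_eq_cbox: "sqbox X R = cbox (X - vec R) (X + vec R)"
proof -
  have "\<bar>y - x\<bar> \<le> R \<longleftrightarrow> x - R \<le> y \<and> y \<le> x + R" for x y :: real by linarith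
  then show ?thesis by (auto simp: sqbox_def mem_box_cart)
qed

lemma compact_sqbox [simp, intro]: "compact (sqbox X R)"
  by (simp add: sqbox_eq_cbox)

lemma sqbox_sets [measurable, simp]: "sqbox X R \<in> sets lebesgue" "sqbox X R \<in> sets borel"
  by (simp_all add: sqbox_eq_cbox)

lemma sqbox_mono: "R \<le> R' \<Longrightarrow> sqbox X R \<subseteq> sqbox X R'"
  unfolding sqbox_def using order_trans by blast

lemma measure_sqbox: "0 \<le> R \<Longrightarrow> measure lebesgue (sqbox X R) = (2 * R)\<^sup>2"
proof -
  assume R: "0 \<le> R"
  have "measure lborel (cbox (X - vec R) (X + vec R)) = (\<Prod>i\<in>UNIV. (X + vec R) $ i - (X - vec R) $ i)"
    by (rule content_cbox_cart) (use R in \<open>auto simp: interval_ne_empty_cart(1)\<close>)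
  then show ?thesis by (simp add: sqbox_eq_cbox UNIV_2 power2_eq_square)
qed

lemma lmeasurable_sqbox [simp]: "sqbox X R \<in> lmeasurable"
  by (simp add: sqbox_eq_cbox)

lemma bounded_subset_sqbox: "bounded S \<Longrightarrow> \<exists>R>0. S \<subseteq> sqbox 0 R"
proof -
  assume "bounded S"
  then obtain R where R: "R > 0" "\<And>x. x \<in> S \<Longrightarrow> norm x \<le> R"
    unfolding bounded_pos by blast
  then show ?thesis
    by (intro exI[of _ R]) (auto simp: sqbox_def intro: order_trans[OF component_le_norm_cart])
qed

subsection \<open>Square-integrable functions are locally integrable\<close>

lemma L2_fun_set_integrable:
  assumes h: "L2_fun h" and S: "S \<in> lmeasurable"
  shows "set_integrable lebesgue S h"
  unfolding set_integrable_def
proof (rule Bochner_Integration.integrable_bound)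
  have S': "S \<in> sets lebesgue" using S by (simp add: fmeasurableD)
  show "integrable lebesgue (\<lambda>x. indicator S x + (h x)\<^sup>2)"
    by (intro Bochner_Integration.integrable_add)
       (use h S in \<open>auto simp: L2_fun_iff fmeasurable_def less_top[symmetric]\<close>)
  show "(\<lambda>x. indicat_real S x *\<^sub>R h x) \<in> borel_measurable lebesgue"
    using S' L2_fun_measurable[OF h] by measurable
  show "AE x in lebesgue. norm (indicat_real S x *\<^sub>R h x) \<le> norm (indicator S x + (h x)\<^sup>2)"
  proof (intro always_eventually allI)
    fix x
    have "0 \<le> (\<bar>h x\<bar> - 1)\<^sup>2" by simp
    then have "2 * \<bar>h x\<bar> \<le> 1 + (h x)\<^sup>2" by (simp add: power2_diff)
    then have "\<bar>h x\<bar> \<le> 1 + (h x)\<^sup>2" using abs_ge_zero[of "h x"] by linarith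
    then show "norm (indicat_real S x *\<^sub>R h x) \<le> norm (indicator S x + (h x)\<^sup>2)"
      by (auto split: split_indicator simp: abs_of_nonneg)
  qed
qed

lemma L2_fun_loc_integrable: "L2_fun h \<Longrightarrow> loc_integrable h"
  by (auto simp: loc_integrable_def intro!: L2_fun_set_integrable lmeasurable_compact)

lemma loc_integrable_measurable:
  assumes "loc_integrable f" shows "f \<in> borel_measurable lebesgue"
proof (rule borel_measurable_LIMSEQ_real)
  show "(\<lambda>x. indicat_real (sqbox 0 (real n)) x *\<^sub>R f x) \<in> borel_measurable lebesgue" for n
    using assms unfolding loc_integrable_def set_integrable_def by (auto dest!: spec[of _ "sqbox 0 (real n)"])
  fix x :: "real^2"
  obtain R where R: "x \<in> sqbox 0 R" using bounded_subset_sqbox[of "{x}"] by auto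
  obtain N :: nat where N: "R \<le> real N" using real_arch_simple by blast
  have "x \<in> sqbox 0 (real n)" if "n \<ge> N" for n
    using R N that sqbox_mono[of R "real n" 0] by auto
  then have "\<forall>\<^sub>F n in sequentially. indicat_real (sqbox 0 (real n)) x *\<^sub>R f x = f x"
    by (intro eventually_sequentiallyI[of N]) auto
  then show "(\<lambda>n. indicat_real (sqbox 0 (real n)) x *\<^sub>R f x) \<longlonglongrightarrow> f x"
    by (rule tendsto_eventually)
qed

text \<open>The inequality of Cauchy and Schwarz against the indicator of a set of finite measure.\<close>

lemma set_integral_abs_sq_le:
  assumes h: "L2_fun h" and S: "S \<in> lmeasurable"
  shows "(LINT Y:S|lebesgue. \<bar>h Y\<bar>)\<^sup>2 \<le> measure lebesgue S * (LINT Y:S|lebesgue. (h Y)\<^sup>2)"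
proof -
  have S' [measurable]: "S \<in> sets lebesgue" using S by (simp add: fmeasurableD)
  have hm [measurable]: "h \<in> borel_measurable lebesgue" using h by (rule L2_fun_measurable)
  have i2: "set_integrable lebesgue S (\<lambda>x. (h x)\<^sup>2)"
    unfolding set_integrable_def using L2_fun_integrable_sq[OF h] S'
    using integrable_mult_indicator by blast
  have "L2_fun (\<lambda>x. \<bar>h x\<bar>)" by (rule L2_fun_bound(1)[OF h]) auto
  note i1 = L2_fun_set_integrable[OF this S]
  let ?f = "\<lambda>x. ennreal (indicator S x * \<bar>h x\<bar>)" and ?g = "\<lambda>x. ennreal (indicator S x)"
  have "(\<integral>\<^sup>+x. ?f x * ?g x \<partial>lebesgue)\<^sup>2 \<le> (\<integral>\<^sup>+x. (?f x)\<^sup>2 \<partial>lebesgue) * (\<integral>\<^sup>+x. (?g x)\<^sup>2 \<partial>lebesgue)"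
    by (rule Cauchy_Schwarz_nn_integral) measurable
  also have "(\<integral>\<^sup>+x. ?f x * ?g x \<partial>lebesgue) = (\<integral>\<^sup>+x. ennreal (indicator S x *\<^sub>R \<bar>h x\<bar>) \<partial>lebesgue)"
    by (intro nn_integral_cong) (auto split: split_indicator)
  also have "\<dots> = ennreal (LINT Y:S|lebesgue. \<bar>h Y\<bar>)"
    unfolding set_lebesgue_integral_def
    by (intro nn_integral_eq_integral) (use i1 in \<open>auto simp: set_integrable_def\<close>)
  also have "(\<integral>\<^sup>+x. (?f x)\<^sup>2 \<partial>lebesgue) = (\<integral>\<^sup>+x. ennreal (indicator S x *\<^sub>R (h x)\<^sup>2) \<partial>lebesgue)"
    by (intro nn_integral_cong) (auto split: split_indicator simp: ennreal_power)
  also have "\<dots> = ennreal (LINT Y:S|lebesgue. (h Y)\<^sup>2)"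
    unfolding set_lebesgue_integral_def
    by (intro nn_integral_eq_integral) (use i2 in \<open>auto simp: set_integrable_def\<close>)
  also have "(\<integral>\<^sup>+x. (?g x)\<^sup>2 \<partial>lebesgue) = (\<integral>\<^sup>+x. indicator S x \<partial>lebesgue)"
    by (intro nn_integral_cong) (auto split: split_indicator)
  also have "\<dots> = ennreal (measure lebesgue S)"
    unfolding nn_integral_indicator[OF S'] by (rule emeasure_eq_ennreal_measure[OF fmeasurableD2[OF S]])
  finally have le: "(ennreal (LINT Y:S|lebesgue. \<bar>h Y\<bar>))\<^sup>2
      \<le> ennreal (LINT Y:S|lebesgue. (h Y)\<^sup>2) * ennreal (measure lebesgue S)" .
  have nn: "0 \<le> (LINT Y:S|lebesgue. \<bar>h Y\<bar>)" "0 \<le> (LINT Y:S|lebesgue. (h Y)\<^sup>2)"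
    unfolding set_lebesgue_integral_def by (intro Bochner_Integration.integral_nonneg; simp)+
  have "ennreal ((LINT Y:S|lebesgue. \<bar>h Y\<bar>)\<^sup>2) \<le> ennreal ((LINT Y:S|lebesgue. (h Y)\<^sup>2) * measure lebesgue S)"
    using le by (simp only: ennreal_power[OF nn(1)] ennreal_mult[OF nn(2) measure_nonneg])
  then have "(LINT Y:S|lebesgue. \<bar>h Y\<bar>)\<^sup>2 \<le> (LINT Y:S|lebesgue. (h Y)\<^sup>2) * measure lebesgue S"
    by (rule ennreal_le_iff[THEN iffD1, rotated]) (intro mult_nonneg_nonneg nn(2) measure_nonneg)
  then show ?thesis by (simp only: mult.commute)
qed

subsection \<open>Approximation by continuous functions with compact support\<close>

lemma L2_fun_sqbox_bounded:
  assumes "f \<in> borel_measurable lebesgue" "\<And>x. \<bar>f x\<bar> \<le> c * indicator (sqbox X R) x" "0 \<le> R"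
  shows "L2_fun f" "L2n f \<le> \<bar>c\<bar> * (2 * R)"
proof -
  let ?w = "\<lambda>x. indicator (sqbox X R) x :: real"
  have sq: "(\<lambda>x. (?w x)\<^sup>2) = ?w" by (auto split: split_indicator)
  have w: "L2_fun ?w"
    unfolding L2_fun_iff sq
    using lmeasurable_sqbox[of X R] by (intro conjI integrable_real_indicator) (simp_all add: fmeasurable_def)
  have "(L2n ?w)\<^sup>2 = (2 * R)\<^sup>2" using L2n_sq[OF w] measure_sqbox[OF assms(3), of X] by (simp add: sq)
  then have nw: "L2n ?w = 2 * R"
    using assms(3) by (simp only: power2_eq_iff_nonneg[OF L2n_nonneg] mult_nonneg_nonneg zero_le_numeral)
  have 1: "AE x in lebesgue. \<bar>f x\<bar> \<le> \<bar>c * ?w x\<bar>"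
    using assms(2) by (intro always_eventually) (metis abs_ge_self order_trans)
  show "L2_fun f" by (rule L2_fun_bound(1)[OF L2_fun_cmult(1)[OF w, of c] assms(1) 1])
  show "L2n f \<le> \<bar>c\<bar> * (2 * R)"
    using L2_fun_bound(2)[OF L2_fun_cmult(1)[OF w, of c] assms(1) 1] by (simp add: L2_fun_cmult(2)[OF w] nw)
qed

text \<open>
  Truncating in space and in size makes the function bounded with bounded support; it is then an
  almost-everywhere limit of continuous functions, to which the same truncations are applied.
\<close>

lemma L2_approx_continuous:
  assumes h: "L2_fun h" and e: "0 < e"
  obtains f R where "continuous_on UNIV f" "0 < R" "\<And>x. x \<notin> sqbox 0 R \<Longrightarrow> f x = 0"
    "L2_fun f" "L2n (\<lambda>x. h x - f x) < e"
proof -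
  note [measurable] = L2_fun_measurable[OF h]
  define H where "H n x = indicat_real (sqbox 0 (real n)) x * (if \<bar>h x\<bar> \<le> real n then h x else 0)" for n :: nat and x
  have Hm [measurable]: "H n \<in> borel_measurable lebesgue" for n
    unfolding H_def by measurable
  have habs: "L2_fun (\<lambda>x. \<bar>h x\<bar>)" by (rule L2_fun_bound(1)[OF h]) auto
  have H1: "\<And>n. L2_fun (H n)" "(\<lambda>n. L2n (\<lambda>x. H n x - h x)) \<longlonglongrightarrow> 0"
  proof -
    have dom: "AE x in lebesgue. \<bar>H n x\<bar> \<le> \<bar>h x\<bar>" for n
      by (auto simp: H_def split: split_indicator)
    have lim: "AE x in lebesgue. (\<lambda>n. H n x) \<longlonglongrightarrow> h x"
    proof (intro always_eventually allI)
      fix x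
      obtain R where R: "x \<in> sqbox 0 R" using bounded_subset_sqbox[of "{x}"] by auto
      obtain N :: nat where N: "max R \<bar>h x\<bar> \<le> real N" using real_arch_simple by blast
      have "H n x = h x" if "n \<ge> N" for n
      proof -
        have "max R \<bar>h x\<bar> \<le> real n" using N that by linarith
        then show ?thesis using R sqbox_mono[of R "real n" 0] by (auto simp: H_def)
      qed
      then have "\<forall>\<^sub>F n in sequentially. H n x = h x" by (intro eventually_sequentiallyI[of N]) auto
      then show "(\<lambda>n. H n x) \<longlonglongrightarrow> h x" by (rule tendsto_eventually)
    qed
    show "\<And>n. L2_fun (H n)" "(\<lambda>n. L2n (\<lambda>x. H n x - h x)) \<longlonglongrightarrow> 0"
      using L2n_dominated_convergence(2,3)[OF habs Hm _ lim dom] by auto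
  qed
  have "\<forall>\<^sub>F n in sequentially. L2n (\<lambda>x. H n x - h x) < e / 2"
    using H1(2) e by (intro order_tendstoD) auto
  then obtain n where n: "L2n (\<lambda>x. H n x - h x) < e / 2"
    by (meson eventually_sequentially order_refl)
  have "H n measurable_on UNIV"
    by (simp add: measurable_on_iff_borel_measurable lebesgue_on_UNIV_eq Hm)
  then obtain N G where N: "negligible N" and G: "\<And>k. continuous_on UNIV (G k)"
    and lim: "\<And>x. x \<notin> N \<Longrightarrow> (\<lambda>k::nat. G k x) \<longlonglongrightarrow> H n x"
    unfolding measurable_on_def by auto
  define cut where "cut x = (\<Prod>i\<in>UNIV. max 0 (min 1 (real n + 1 - \<bar>x $ i\<bar>)))" for x :: "real^2"
  define F where "F k x = cut x * max (- real n) (min (real n) (G k x))" for k x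
  have cut01: "0 \<le> cut x" "cut x \<le> 1" for x
    unfolding cut_def by (auto intro!: prod_nonneg prod_le_1)
  have cut0: "cut x = 0" if out: "x \<notin> sqbox 0 (real n + 1)" for x
  proof -
    obtain i where "\<not> \<bar>x $ i - 0 $ i\<bar> \<le> real n + 1" using out unfolding sqbox_def by blast
    then show ?thesis unfolding cut_def by (intro prod_zero bexI[of _ i]) auto
  qed
  have cut1: "cut x = 1" if "x \<in> sqbox 0 (real n)" for x
  proof -
    have "max 0 (min 1 (real n + 1 - \<bar>x $ i\<bar>)) = 1" for i
      using that[unfolded sqbox_def] by (auto dest!: spec[of _ i])
    then show ?thesis by (simp add: cut_def)
  qed
  have Fc: "continuous_on UNIV (F k)" for k
    unfolding F_def cut_def by (intro continuous_intros G)
  have Fm: "F k \<in> borel_measurable lebesgue" for k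
    using borel_measurable_continuous_onI[OF Fc] by (simp add: measurable_completion)
  have Fb: "\<bar>F k x\<bar> \<le> real n * indicator (sqbox 0 (real n + 1)) x" for k x
  proof (cases "x \<in> sqbox 0 (real n + 1)")
    case True
    have "\<bar>F k x\<bar> \<le> 1 * real n" unfolding F_def abs_mult
      by (intro mult_mono) (use cut01 in auto)
    with True show ?thesis by simp
  qed (simp add: F_def cut0)
  have Hb: "\<bar>H n x\<bar> \<le> real n" for x by (auto simp: H_def split: split_indicator)
  let ?w = "\<lambda>x. real n * indicator (sqbox 0 (real n + 1)) x"
  have w: "L2_fun ?w" by (rule L2_fun_sqbox_bounded(1)[of _ "real n" 0 "real n + 1"]) auto
  have limF: "AE x in lebesgue. (\<lambda>k. F k x) \<longlonglongrightarrow> H n x"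
  proof -
    have "AE x in lebesgue. x \<notin> N"
      using N by (auto simp: negligible_iff_null_sets intro: AE_not_in)
    then show ?thesis
    proof eventually_elim
      case (elim x)
      have "(\<lambda>k. F k x) \<longlonglongrightarrow> cut x * max (- real n) (min (real n) (H n x))"
        unfolding F_def by (intro tendsto_intros lim elim)
      moreover have "max (- real n) (min (real n) (H n x)) = H n x"
        using Hb[of x] by (auto simp: abs_le_iff)
      moreover have "cut x * H n x = H n x"
        by (cases "x \<in> sqbox 0 (real n)") (auto simp: cut1 H_def)
      ultimately show ?case by simp
    qed
  qed
  have F2: "\<And>k. L2_fun (F k)" and F3: "(\<lambda>k. L2n (\<lambda>x. F k x - H n x)) \<longlonglongrightarrow> 0"
    using L2n_dominated_convergence(2,3)[OF w Fm Hm limF always_eventually[OF allI, OF Fb]] by auto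
  have "\<forall>\<^sub>F k in sequentially. L2n (\<lambda>x. F k x - H n x) < e / 2"
    using F3 e by (intro order_tendstoD) auto
  then obtain k where k: "L2n (\<lambda>x. F k x - H n x) < e / 2"
    by (meson eventually_sequentially order_refl)
  have "L2n (\<lambda>x. h x - F k x) \<le> L2n (\<lambda>x. h x - H n x) + L2n (\<lambda>x. H n x - F k x)"
    using L2_fun_add(2)[OF L2_fun_diff(1)[OF h H1(1)[of n]] L2_fun_diff(1)[OF H1(1)[of n] F2[of k]]] by simp
  also have "\<dots> < e" using n k L2n_diff_commute[of h "H n"] L2n_diff_commute[of "H n" "F k"] by simp
  finally have "L2n (\<lambda>x. h x - F k x) < e" .
  moreover have "F k x = 0" if "x \<notin> sqbox 0 (real n + 1)" for x
    using that by (simp add: F_def cut0)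
  ultimately show thesis using that[OF Fc[of k], of "real n + 1"] F2[of k] by simp
qed

text \<open>Far away, an approximating function with compact support vanishes.\<close>

lemma L2_tail_small:
  assumes h: "L2_fun h" and e: "0 < e"
  obtains R where "0 < R" "L2n (\<lambda>x. indicator (- sqbox 0 R) x * h x) < e"
proof -
  obtain f R where f: "continuous_on UNIV f" "0 < R" "\<And>x. x \<notin> sqbox 0 R \<Longrightarrow> f x = 0"
    "L2_fun f" "L2n (\<lambda>x. h x - f x) < e"
    by (rule L2_approx_continuous[OF h e]) auto
  have "L2n (\<lambda>x. indicator (- sqbox 0 R) x * h x) \<le> L2n (\<lambda>x. h x - f x)"
    by (rule L2_fun_bound(2)[OF L2_fun_diff(1)[OF h f(4)]])
       (use f(3) L2_fun_measurable[OF h] in \<open>auto split: split_indicator intro!: borel_measurable_times\<close>)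
  then show thesis using that f(2,5) by force
qed

section \<open>Functions on the plane and their lattice samples\<close>

subsection \<open>Tiling the plane\<close>

definition unit_cell :: "(real^2) set" where
  "unit_cell = {x. \<forall>i. 0 \<le> x $ i \<and> x $ i < 1}"

lemma unit_cell_sets [measurable, simp]: "unit_cell \<in> sets borel" "unit_cell \<in> sets lebesgue"
proof -
  have *: "unit_cell = (\<Inter>i. {x. 0 \<le> x $ i} \<inter> {x. x $ i < 1})" by (auto simp: unit_cell_def)
  have "{x::real^2. 0 \<le> x $ i} \<in> sets borel" "{x::real^2. x $ i < 1} \<in> sets borel" for i
    by (auto intro!: borel_closed borel_open closed_Collect_le open_Collect_less continuous_intros)
  then show "unit_cell \<in> sets borel" unfolding * by (intro sets.finite_INT sets.Int) auto
  then show "unit_cell \<in> sets lebesgue" by auto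
qed

lemma emeasure_unit_cell: "emeasure lebesgue unit_cell \<le> 1"
proof -
  have "unit_cell \<subseteq> sqbox (vec (1/2)) (1/2)"
  proof
    fix x assume x: "x \<in> unit_cell"
    have "\<bar>x $ i - 1/2\<bar> \<le> 1/2" for i
    proof -
      have "0 \<le> x $ i" "x $ i < 1" using x by (auto simp: unit_cell_def)
      then show ?thesis by linarith
    qed
    then show "x \<in> sqbox (vec (1/2)) (1/2)" by (simp add: sqbox_def)
  qed
  then have "emeasure lebesgue unit_cell \<le> emeasure lebesgue (sqbox (vec (1/2)) (1/2))"
    by (intro emeasure_mono) auto
  also have "\<dots> = ennreal (measure lebesgue (sqbox (vec (1/2)) (1/2)))"
    by (intro emeasure_eq_ennreal_measure fmeasurableD2) simp
  also have "\<dots> = 1" by (subst measure_sqbox) auto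
  finally show ?thesis .
qed

lemma affine_R2_measurable: "(\<lambda>x::real^2. t + \<epsilon> *\<^sub>R x) \<in> lebesgue \<rightarrow>\<^sub>M lebesgue" if "0 < \<epsilon>"
  using lebesgue_affine_measurable[of "\<lambda>_. \<epsilon>" t] that
  by (simp add: scaleR_scaleR[symmetric] scaleR_sum_right[symmetric] euclidean_representation del: scaleR_scaleR)

lemma nn_integral_affine_R2:
  fixes F :: "real^2 \<Rightarrow> ennreal"
  assumes [measurable]: "F \<in> borel_measurable lebesgue" and \<epsilon>: "0 < \<epsilon>"
  shows "(\<integral>\<^sup>+x. F x \<partial>lebesgue) = ennreal (\<epsilon>\<^sup>2) * (\<integral>\<^sup>+x. F (t + \<epsilon> *\<^sub>R x) \<partial>lebesgue)"
proof -
  have T [measurable]: "(\<lambda>x::real^2. t + \<epsilon> *\<^sub>R x) \<in> lebesgue \<rightarrow>\<^sub>M lebesgue"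
    using \<epsilon> by (rule affine_R2_measurable)
  have "lebesgue = density (distr lebesgue lebesgue (\<lambda>x::real^2. t + \<epsilon> *\<^sub>R x)) (\<lambda>_. ennreal (\<epsilon>\<^sup>2))"
    using lebesgue_affine_euclidean[of "\<lambda>_. \<epsilon>" t] \<epsilon>
    by (simp add: scaleR_scaleR[symmetric] scaleR_sum_right[symmetric] euclidean_representation del: scaleR_scaleR)
  then have "(\<integral>\<^sup>+x. F x \<partial>lebesgue) = (\<integral>\<^sup>+x. F x \<partial>density (distr lebesgue lebesgue (\<lambda>x. t + \<epsilon> *\<^sub>R x)) (\<lambda>_. ennreal (\<epsilon>\<^sup>2)))"
    by simp
  also have "\<dots> = (\<integral>\<^sup>+x. ennreal (\<epsilon>\<^sup>2) * F (t + \<epsilon> *\<^sub>R x) \<partial>lebesgue)"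
    by (subst nn_integral_density) (simp_all add: nn_integral_distr)
  also have "\<dots> = ennreal (\<epsilon>\<^sup>2) * (\<integral>\<^sup>+x. F (t + \<epsilon> *\<^sub>R x) \<partial>lebesgue)"
    by (rule nn_integral_cmult) measurable
  finally show ?thesis .
qed

lemma lattice_pt_nth [simp]: "lattice_pt j $ i = of_int (j $ i)"
  by (simp add: lattice_pt_def)

lemma tiles_unique:
  "x \<in> unit_cell \<Longrightarrow> y \<in> unit_cell \<Longrightarrow> lattice_pt j + x = lattice_pt k + y \<Longrightarrow> j = k"
proof -
  assume xy: "x \<in> unit_cell" "y \<in> unit_cell" and eq: "lattice_pt j + x = lattice_pt k + y"
  show "j = k"
    unfolding vec_eq_iff
  proof
    fix i
    have "of_int (j $ i) + x $ i = of_int (k $ i) + y $ i"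
      using arg_cong[OF eq, of "\<lambda>v. v $ i"] by simp
    moreover have "0 \<le> x $ i" "x $ i < 1" "0 \<le> y $ i" "y $ i < 1"
      using xy by (auto simp: unit_cell_def)
    ultimately show "j $ i = k $ i" by linarith
  qed
qed

lemma tiles_cover: "\<exists>k. \<exists>x\<in>unit_cell. X = lattice_pt k + x"
proof (intro exI bexI)
  show "X = lattice_pt (\<chi> i. \<lfloor>X $ i\<rfloor>) + (\<chi> i. frac (X $ i))"
    by (simp add: vec_eq_iff frac_def)
  show "(\<chi> i. frac (X $ i)) \<in> unit_cell"
    by (simp add: unit_cell_def frac_lt_1)
qed

text \<open>
  The plane is the disjoint union of the cells \<open>\<epsilon> (k + unit_cell)\<close>; an integral over the plane is
  therefore the average, over the position \<open>x\<close> within a cell, of the lattice sums along \<open>\<epsilon> (k + x)\<close>.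
\<close>

lemma nn_integral_tile_le:
  fixes F :: "real^2 \<Rightarrow> ennreal"
  assumes F [measurable]: "F \<in> borel_measurable lebesgue" and \<epsilon>: "0 < \<epsilon>"
    and le: "\<And>x A. x \<in> unit_cell \<Longrightarrow> finite A \<Longrightarrow>
      ennreal (\<epsilon>\<^sup>2) * (\<Sum>k\<in>A. F (\<epsilon> *\<^sub>R (lattice_pt k + x))) \<le> c"
  shows "(\<integral>\<^sup>+x. F x \<partial>lebesgue) \<le> c"
proof -
  have inf: "infinite (UNIV :: (int^2) set)"
  proof
    assume "finite (UNIV :: (int^2) set)"
    then have "finite (range (\<lambda>n::int. (\<chi> i. n) :: int^2))" by (rule rev_finite_subset) auto
    moreover have "inj (\<lambda>n::int. (\<chi> i. n) :: int^2)" by (auto simp: inj_def vec_eq_iff)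
    ultimately show False using finite_imageD infinite_UNIV_int by blast
  qed
  obtain b :: "nat \<Rightarrow> int^2" where b: "bij b"
    using bij_betw_from_nat_into[OF _ inf] by auto
  define T where "T n x = \<epsilon> *\<^sub>R lattice_pt (b n) + \<epsilon> *\<^sub>R x" for n and x :: "real^2"
  define C where "C n = (\<lambda>X. (1 / \<epsilon>) *\<^sub>R X - lattice_pt (b n)) -` unit_cell" for n
  have Cb: "C n \<in> sets borel" for n
  proof -
    have "(\<lambda>X::real^2. (1 / \<epsilon>) *\<^sub>R X - lattice_pt (b n)) \<in> borel \<rightarrow>\<^sub>M borel" by measurable
    from measurable_sets[OF this unit_cell_sets(1)] show ?thesis by (simp add: C_def)
  qed
  then have [measurable]: "C n \<in> sets lebesgue" for n by auto
  have TC: "T n x \<in> C m \<longleftrightarrow> lattice_pt (b n) + x - lattice_pt (b m) \<in> unit_cell" for n m x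
    using \<epsilon> by (simp add: T_def C_def scaleR_add_right)
  have disj: "disjoint_family C"
    unfolding disjoint_family_on_def
  proof (intro ballI impI, rule ccontr)
    fix m n :: nat assume "m \<noteq> n" "C m \<inter> C n \<noteq> {}"
    then obtain X where X: "(1 / \<epsilon>) *\<^sub>R X - lattice_pt (b m) \<in> unit_cell" "(1 / \<epsilon>) *\<^sub>R X - lattice_pt (b n) \<in> unit_cell"
      by (auto simp: C_def)
    have "b m = b n" by (rule tiles_unique[OF X]) simp
    with \<open>m \<noteq> n\<close> b show False by (auto simp: bij_def inj_def)
  qed
  have cover: "\<exists>n. X \<in> C n" for X
  proof -
    obtain k x where kx: "x \<in> unit_cell" "(1 / \<epsilon>) *\<^sub>R X = lattice_pt k + x" using tiles_cover by blast
    obtain n where "k = b n" using b by (metis bij_def surjD)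
    with kx have "X \<in> C n" by (simp add: C_def)
    then show ?thesis ..
  qed
  have "(\<integral>\<^sup>+x. F x \<partial>lebesgue) = (\<integral>\<^sup>+X. (\<Sum>n. F X * indicator (C n) X) \<partial>lebesgue)"
  proof (rule nn_integral_cong)
    fix X obtain n where "X \<in> C n" using cover by blast
    from suminf_cmult_indicator[OF disj this, of "\<lambda>_. F X"]
    show "F X = (\<Sum>n. F X * indicator (C n) X)" by (rule sym)
  qed
  also have "\<dots> = (\<Sum>n. \<integral>\<^sup>+X. F X * indicator (C n) X \<partial>lebesgue)"
    by (rule nn_integral_suminf) measurable
  also have "\<dots> = (\<Sum>n. \<integral>\<^sup>+x. ennreal (\<epsilon>\<^sup>2) * (F (T n x) * indicator unit_cell x) \<partial>lebesgue)"
  proof (rule suminf_cong)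
    fix n
    have Tm [measurable]: "T n \<in> lebesgue \<rightarrow>\<^sub>M lebesgue"
      unfolding T_def using \<epsilon> by (rule affine_R2_measurable)
    have "(\<integral>\<^sup>+X. F X * indicator (C n) X \<partial>lebesgue) = ennreal (\<epsilon>\<^sup>2) * (\<integral>\<^sup>+x. F (T n x) * indicator (C n) (T n x) \<partial>lebesgue)"
      unfolding T_def by (rule nn_integral_affine_R2) (use \<epsilon> in \<open>auto intro!: borel_measurable_times_ennreal\<close>)
    also have "\<dots> = ennreal (\<epsilon>\<^sup>2) * (\<integral>\<^sup>+x. F (T n x) * indicator unit_cell x \<partial>lebesgue)"
      by (simp add: indicator_def TC)
    also have "\<dots> = (\<integral>\<^sup>+x. ennreal (\<epsilon>\<^sup>2) * (F (T n x) * indicator unit_cell x) \<partial>lebesgue)"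
      by (rule nn_integral_cmult[symmetric]) measurable
    finally show "(\<integral>\<^sup>+X. F X * indicator (C n) X \<partial>lebesgue) = (\<integral>\<^sup>+x. ennreal (\<epsilon>\<^sup>2) * (F (T n x) * indicator unit_cell x) \<partial>lebesgue)" .
  qed
  also have "\<dots> \<le> c"
    unfolding suminf_eq_SUP
  proof (rule SUP_least)
    fix N :: nat
    have Tm [measurable]: "T n \<in> lebesgue \<rightarrow>\<^sub>M lebesgue" for n
      unfolding T_def using \<epsilon> by (rule affine_R2_measurable)
    have "(\<Sum>n<N. \<integral>\<^sup>+x. ennreal (\<epsilon>\<^sup>2) * (F (T n x) * indicator unit_cell x) \<partial>lebesgue)
        = (\<integral>\<^sup>+x. (\<Sum>n<N. ennreal (\<epsilon>\<^sup>2) * (F (T n x) * indicator unit_cell x)) \<partial>lebesgue)"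
      by (rule nn_integral_sum[symmetric]) measurable
    also have "\<dots> \<le> (\<integral>\<^sup>+x. c * indicator unit_cell x \<partial>lebesgue)"
    proof (rule nn_integral_mono)
      fix x :: "real^2"
      show "(\<Sum>n<N. ennreal (\<epsilon>\<^sup>2) * (F (T n x) * indicator unit_cell x)) \<le> c * indicator unit_cell x"
      proof (cases "x \<in> unit_cell")
        case True
        have "(\<Sum>k\<in>b ` {..<N}. F (\<epsilon> *\<^sub>R (lattice_pt k + x))) = (\<Sum>n<N. F (T n x))"
          using b by (subst sum.reindex) (auto simp: T_def scaleR_add_right bij_def intro: inj_on_subset)
        with le[OF True, of "b ` {..<N}"] True show ?thesis
          by (simp add: sum_distrib_left)
      qed simp
    qed
    also have "\<dots> = c * emeasure lebesgue unit_cell" by (rule nn_integral_cmult_indicator) simp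
    also have "\<dots> \<le> c * 1" by (rule mult_left_mono[OF emeasure_unit_cell]) simp
    finally show "(\<Sum>n<N. \<integral>\<^sup>+x. ennreal (\<epsilon>\<^sup>2) * (F (T n x) * indicator unit_cell x) \<partial>lebesgue) \<le> c"
      by simp
  qed
  finally show ?thesis .
qed

lemma L2_norm_tile_le:
  fixes F :: "real^2 \<Rightarrow> 'a::real_normed_vector"
  assumes F [measurable]: "(\<lambda>x. norm (F x)) \<in> borel_measurable lebesgue" and \<epsilon>: "0 < \<epsilon>" and c: "0 \<le> c"
    and le: "\<And>x A. x \<in> unit_cell \<Longrightarrow> finite A \<Longrightarrow>
      \<epsilon>\<^sup>2 * (\<Sum>k\<in>A. (norm (F (\<epsilon> *\<^sub>R (lattice_pt k + x))))\<^sup>2) \<le> c\<^sup>2"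
  shows "L2_norm F \<le> ennreal c"
  unfolding L2_norm_le_iff[OF c]
proof (rule nn_integral_tile_le[OF _ \<epsilon>])
  show "(\<lambda>x. ennreal ((norm (F x))\<^sup>2)) \<in> borel_measurable lebesgue" by measurable
  fix x A assume "x \<in> unit_cell" "finite (A :: (int^2) set)"
  then show "ennreal (\<epsilon>\<^sup>2) * (\<Sum>k\<in>A. ennreal ((norm (F (\<epsilon> *\<^sub>R (lattice_pt k + x))))\<^sup>2)) \<le> ennreal (c\<^sup>2)"
    using ennreal_leI[OF le] by (simp add: ennreal_mult' sum_nonneg)
qed

subsection \<open>Sampling\<close>

lemma card_int_interval_le:
  fixes u v :: real assumes "u \<le> v + 1"
  shows "real (card {n::int. u \<le> of_int n \<and> of_int n \<le> v}) \<le> v - u + 1"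
proof -
  have "{n::int. u \<le> of_int n \<and> of_int n \<le> v} = {\<lceil>u\<rceil>..\<lfloor>v\<rfloor>}"
    by (auto simp: ceiling_le_iff le_floor_iff)
  then have "card {n::int. u \<le> of_int n \<and> of_int n \<le> v} = nat (\<lfloor>v\<rfloor> - \<lceil>u\<rceil> + 1)" by simp
  then show ?thesis using assms by linarith
qed

text \<open>In each coordinate at most \<open>2 R / \<epsilon> + 1\<close> lattice points are within distance \<open>R\<close> of a given number.\<close>

lemma lattice_overlap:
  assumes \<epsilon>: "0 < \<epsilon>" and R: "0 \<le> R" and A: "finite A"
  shows "\<epsilon>\<^sup>2 * (\<Sum>k\<in>A. indicator (sqbox (\<epsilon> *\<^sub>R (lattice_pt k + x)) R) Y) \<le> (2 * R + \<epsilon>)\<^sup>2"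
proof -
  define I where "I i = {n::int. (Y $ i - R) / \<epsilon> - x $ i \<le> of_int n \<and> of_int n \<le> (Y $ i + R) / \<epsilon> - x $ i}" for i
  have fin: "finite (I i)" for i
  proof -
    have "I i \<subseteq> {\<lceil>(Y $ i - R) / \<epsilon> - x $ i\<rceil>..\<lfloor>(Y $ i + R) / \<epsilon> - x $ i\<rfloor>}"
      unfolding I_def by (auto simp: ceiling_le_iff le_floor_iff)
    then show ?thesis by (rule finite_subset) simp
  qed
  have card: "real (card (I i)) \<le> 2 * R / \<epsilon> + 1" for i
    unfolding I_def by (rule order_trans[OF card_int_interval_le]) (use \<epsilon> R in \<open>auto simp: field_simps\<close>)
  have mem: "Y \<in> sqbox (\<epsilon> *\<^sub>R (lattice_pt k + x)) R \<longleftrightarrow> (\<forall>i. k $ i \<in> I i)" for k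
  proof -
    have "\<bar>Y $ i - \<epsilon> * (of_int (k $ i) + x $ i)\<bar> \<le> R \<longleftrightarrow> k $ i \<in> I i" for i
      unfolding I_def using \<epsilon> by (auto simp: field_simps abs_le_iff)
    then show ?thesis by (simp add: sqbox_def)
  qed
  let ?B = "{k\<in>A. \<forall>i. k $ i \<in> I i}"
  have "(\<Sum>k\<in>A. indicator (sqbox (\<epsilon> *\<^sub>R (lattice_pt k + x)) R) Y) = real (card ?B)"
    using A by (simp add: indicator_def mem sum.If_cases Int_def)
  also have "card ?B \<le> card (I 1 \<times> I 2)"
    by (rule card_inj_on_le[where f="\<lambda>k. (k $ 1, k $ 2)"]) (auto simp: inj_on_def vec_eq_iff forall_2 fin)
  also have "real (card (I 1 \<times> I 2)) \<le> (2 * R / \<epsilon> + 1)\<^sup>2"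
    unfolding card_cartesian_product power2_eq_square of_nat_mult
    by (intro mult_mono card) (use \<epsilon> R in auto)
  finally have "\<epsilon>\<^sup>2 * (\<Sum>k\<in>A. indicator (sqbox (\<epsilon> *\<^sub>R (lattice_pt k + x)) R) Y) \<le> \<epsilon>\<^sup>2 * (2 * R / \<epsilon> + 1)\<^sup>2"
    by (intro mult_left_mono) auto
  also have "\<dots> = (\<epsilon> * (2 * R / \<epsilon> + 1))\<^sup>2" by (simp add: power_mult_distrib)
  also have "\<epsilon> * (2 * R / \<epsilon> + 1) = 2 * R + \<epsilon>" using \<epsilon> by (simp add: field_simps)
  finally show ?thesis .
qed

text \<open>
  A lattice function controlled by local averages of a square-integrable function has a small
  \<open>\<ell>\<^sup>2\<close> norm, because every point of the plane lies in few of the averaging boxes.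
\<close>

lemma sampling_bound_sq:
  assumes h: "L2_fun h" and \<epsilon>: "0 < \<epsilon>" and R: "0 \<le> R" and c: "0 \<le> c" and A: "finite A"
    and g: "\<And>k. k \<in> A \<Longrightarrow> (g k)\<^sup>2 \<le> c * (LINT Y:sqbox (\<epsilon> *\<^sub>R (lattice_pt k + x)) R|lebesgue. (h Y)\<^sup>2)"
  shows "\<epsilon>\<^sup>2 * (\<Sum>k\<in>A. (g k)\<^sup>2) \<le> c * (2 * R + \<epsilon>)\<^sup>2 * (L2n h)\<^sup>2"
proof -
  let ?B = "\<lambda>k. sqbox (\<epsilon> *\<^sub>R (lattice_pt k + x)) R"
  have i2: "integrable lebesgue (\<lambda>Y. indicator (?B k) Y * (h Y)\<^sup>2)" for k
    using integrable_mult_indicator[OF sqbox_sets(1) L2_fun_integrable_sq[OF h]] by simp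
  have "(g k)\<^sup>2 \<le> c * (LINT Y|lebesgue. indicator (?B k) Y * (h Y)\<^sup>2)" if "k \<in> A" for k
    using g[OF that] by (simp add: set_lebesgue_integral_def)
  then have "\<epsilon>\<^sup>2 * (\<Sum>k\<in>A. (g k)\<^sup>2) \<le> \<epsilon>\<^sup>2 * (\<Sum>k\<in>A. c * (LINT Y|lebesgue. indicator (?B k) Y * (h Y)\<^sup>2))"
    by (intro mult_left_mono sum_mono) auto
  also have "\<dots> = c * (LINT Y|lebesgue. \<epsilon>\<^sup>2 * (\<Sum>k\<in>A. indicator (?B k) Y) * (h Y)\<^sup>2)"
  proof -
    have "(LINT Y|lebesgue. \<epsilon>\<^sup>2 * (\<Sum>k\<in>A. indicator (?B k) Y) * (h Y)\<^sup>2)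
        = (LINT Y|lebesgue. \<epsilon>\<^sup>2 * (\<Sum>k\<in>A. indicator (?B k) Y * (h Y)\<^sup>2))"
      by (simp add: sum_distrib_right mult.assoc)
    also have "\<dots> = \<epsilon>\<^sup>2 * (\<Sum>k\<in>A. LINT Y|lebesgue. indicator (?B k) Y * (h Y)\<^sup>2)"
      using i2 by simp
    finally show ?thesis by (simp add: sum_distrib_left mult_ac)
  qed
  also have "\<dots> \<le> c * (LINT Y|lebesgue. (2 * R + \<epsilon>)\<^sup>2 * (h Y)\<^sup>2)"
  proof (intro mult_left_mono integral_mono)
    have "integrable lebesgue (\<lambda>Y. \<epsilon>\<^sup>2 * (\<Sum>k\<in>A. indicator (?B k) Y * (h Y)\<^sup>2))" using i2 by simp
    then show "integrable lebesgue (\<lambda>Y. \<epsilon>\<^sup>2 * (\<Sum>k\<in>A. indicator (?B k) Y) * (h Y)\<^sup>2)"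
      by (simp add: sum_distrib_right mult.assoc)
    show "\<epsilon>\<^sup>2 * (\<Sum>k\<in>A. indicator (?B k) Y) * (h Y)\<^sup>2 \<le> (2 * R + \<epsilon>)\<^sup>2 * (h Y)\<^sup>2" for Y
      by (rule mult_right_mono[OF lattice_overlap[OF \<epsilon> R A]]) simp
  qed (use L2_fun_integrable_sq[OF h] c in auto)
  also have "\<dots> = c * (2 * R + \<epsilon>)\<^sup>2 * (L2n h)\<^sup>2"
    by (simp add: L2n_sq[OF h])
  finally show ?thesis .
qed

text \<open>The averages of \<open>\<bar>h\<bar>\<close> reduce to averages of \<open>h\<^sup>2\<close>; the factor \<open>2 R\<close> is the root of the measure of the box.\<close>

lemma sampling_bound:
  assumes h: "L2_fun h" and \<epsilon>: "0 < \<epsilon>" and R: "0 \<le> R" and c: "0 \<le> c" and A: "finite A"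
    and g: "\<And>k. k \<in> A \<Longrightarrow> \<bar>g k\<bar> \<le> c * (LINT Y:sqbox (\<epsilon> *\<^sub>R (lattice_pt k + x)) R|lebesgue. \<bar>h Y\<bar>)"
  shows "\<epsilon>\<^sup>2 * (\<Sum>k\<in>A. (g k)\<^sup>2) \<le> (c * (2 * R) * (2 * R + \<epsilon>) * L2n h)\<^sup>2"
proof -
  let ?B = "\<lambda>k. sqbox (\<epsilon> *\<^sub>R (lattice_pt k + x)) R"
  have "(g k)\<^sup>2 \<le> (c\<^sup>2 * (2 * R)\<^sup>2) * (LINT Y:?B k|lebesgue. (h Y)\<^sup>2)" if "k \<in> A" for k
  proof -
    have "(g k)\<^sup>2 \<le> (c * (LINT Y:?B k|lebesgue. \<bar>h Y\<bar>))\<^sup>2"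
      using power_mono[OF g[OF that] abs_ge_zero, of 2] by simp
    also have "\<dots> = c\<^sup>2 * (LINT Y:?B k|lebesgue. \<bar>h Y\<bar>)\<^sup>2" by (simp add: power_mult_distrib)
    also have "\<dots> \<le> c\<^sup>2 * ((2 * R)\<^sup>2 * (LINT Y:?B k|lebesgue. (h Y)\<^sup>2))"
      using set_integral_abs_sq_le[OF h lmeasurable_sqbox, of "\<epsilon> *\<^sub>R (lattice_pt k + x)" R] by (intro mult_left_mono) (auto simp: measure_sqbox[OF R])
    finally show ?thesis by (simp add: mult.assoc)
  qed
  then have "\<epsilon>\<^sup>2 * (\<Sum>k\<in>A. (g k)\<^sup>2) \<le> c\<^sup>2 * (2 * R)\<^sup>2 * (2 * R + \<epsilon>)\<^sup>2 * (L2n h)\<^sup>2"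
    by (intro sampling_bound_sq[OF h \<epsilon> R _ A]) auto
  then show ?thesis by (simp only: power_mult_distrib mult.assoc)
qed

subsection \<open>Correlation with compactly supported kernels\<close>

definition kern :: "real \<Rightarrow> real \<Rightarrow> (real^2 \<Rightarrow> real) \<Rightarrow> bool" where
  "kern R c K \<longleftrightarrow> K \<in> borel_measurable borel \<and> (\<forall>z. \<bar>K z\<bar> \<le> c * indicator (sqbox 0 R) z)"

text \<open>
  Correlation rather than convolution: \<open>K\<close> is translated without reflection, so the value at \<open>X\<close> is
  the pairing with a test function centred at \<open>X\<close>, as it occurs in weak formulations.
\<close>

definition corr :: "(real^2 \<Rightarrow> real) \<Rightarrow> (real^2 \<Rightarrow> real) \<Rightarrow> real^2 \<Rightarrow> real" where
  "corr K h X = (LINT Y|lebesgue. K (Y - X) * h Y)"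

lemma kern_nonneg: "kern R c K \<Longrightarrow> 0 \<le> R \<Longrightarrow> 0 \<le> c"
proof -
  assume K: "kern R c K" and "0 \<le> R"
  then have "(0::real^2) \<in> sqbox 0 R" by (simp add: sqbox_def)
  then have "\<bar>K 0\<bar> \<le> c" using K unfolding kern_def by (metis indicator_simps(1) mult.right_neutral)
  then show "0 \<le> c" by linarith
qed

lemma sqbox_shift: "Y - X \<in> sqbox 0 R \<longleftrightarrow> Y \<in> sqbox X R"
  by (simp add: sqbox_def)

lemma kern_mono: "kern R c K \<Longrightarrow> 0 \<le> R \<Longrightarrow> R \<le> R' \<Longrightarrow> c \<le> c' \<Longrightarrow> kern R' c' K"
  unfolding kern_def
proof safe
  fix z assume le: "R \<le> R'" "c \<le> c'" "0 \<le> R" and K: "K \<in> borel_measurable borel" "\<forall>z. \<bar>K z\<bar> \<le> c * indicat_real (sqbox 0 R) z"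
  have "0 \<le> c" using kern_nonneg[of R c K] K le by (simp add: kern_def)
  then have "c * indicat_real (sqbox 0 R) z \<le> c' * indicat_real (sqbox 0 R') z"
    using sqbox_mono[OF le(1)] le(2) by (intro mult_mono) (auto split: split_indicator)
  with K(2) show "\<bar>K z\<bar> \<le> c' * indicat_real (sqbox 0 R') z" by (meson order_trans)
qed

lemma kern_le: "kern R c K \<Longrightarrow> \<bar>K (Y - X)\<bar> \<le> c * indicator (sqbox X R) Y"
proof -
  assume "kern R c K"
  then have "\<bar>K (Y - X)\<bar> \<le> c * indicator (sqbox 0 R) (Y - X)" by (simp only: kern_def)
  also have "indicator (sqbox 0 R) (Y - X) = (indicator (sqbox X R) Y :: real)"
    by (simp add: indicator_def sqbox_shift)
  finally show ?thesis .
qed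

lemma kern_integrable:
  assumes K: "kern R c K" and h: "loc_integrable h"
  shows "integrable lebesgue (\<lambda>Y. K (Y - X) * h Y)"
proof (rule Bochner_Integration.integrable_bound)
  have [measurable]: "K \<in> borel_measurable borel" using K by (simp add: kern_def)
  have Km: "(\<lambda>Y. K (Y - X)) \<in> borel_measurable borel" by measurable
  show "(\<lambda>Y. K (Y - X) * h Y) \<in> borel_measurable lebesgue"
    by (intro borel_measurable_times loc_integrable_measurable[OF h]) (use Km in \<open>simp add: measurable_completion\<close>)
  have "set_integrable lebesgue (sqbox X R) h" using h by (simp add: loc_integrable_def)
  then show "integrable lebesgue (\<lambda>Y. c * (indicator (sqbox X R) Y *\<^sub>R h Y))"
    unfolding set_integrable_def by simp
  show "AE Y in lebesgue. norm (K (Y - X) * h Y) \<le> norm (c * (indicat_real (sqbox X R) Y *\<^sub>R h Y))"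
  proof (intro always_eventually allI)
    fix Y
    have "\<bar>K (Y - X)\<bar> \<le> \<bar>c * indicator (sqbox X R) Y\<bar>"
      by (rule order_trans[OF kern_le[OF K] abs_ge_self])
    then have "\<bar>K (Y - X)\<bar> * \<bar>h Y\<bar> \<le> \<bar>c * indicator (sqbox X R) Y\<bar> * \<bar>h Y\<bar>"
      by (rule mult_right_mono) simp
    then show "norm (K (Y - X) * h Y) \<le> norm (c * (indicat_real (sqbox X R) Y *\<^sub>R h Y))"
      by (simp only: real_norm_def abs_mult real_scaleR_def mult.assoc)
  qed
qed

lemma corr_bound:
  assumes K: "kern R c K" and h: "loc_integrable h"
  shows "\<bar>corr K h X\<bar> \<le> c * (LINT Y:sqbox X R|lebesgue. \<bar>h Y\<bar>)"
proof -
  have int: "set_integrable lebesgue (sqbox X R) (\<lambda>Y. \<bar>h Y\<bar>)"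
    using h by (intro set_integrable_abs) (simp add: loc_integrable_def)
  have "\<bar>corr K h X\<bar> \<le> (LINT Y|lebesgue. \<bar>K (Y - X) * h Y\<bar>)"
    unfolding corr_def by (rule integral_abs_bound)
  also have "\<dots> \<le> (LINT Y|lebesgue. c * (indicator (sqbox X R) Y *\<^sub>R \<bar>h Y\<bar>))"
  proof (rule integral_mono)
    show "integrable lebesgue (\<lambda>Y. \<bar>K (Y - X) * h Y\<bar>)" using kern_integrable[OF assms] by simp
    show "integrable lebesgue (\<lambda>Y. c * (indicator (sqbox X R) Y *\<^sub>R \<bar>h Y\<bar>))"
      using int unfolding set_integrable_def by simp
    fix Y
    have "\<bar>K (Y - X)\<bar> \<le> c * indicator (sqbox X R) Y"
      by (rule kern_le[OF K])
    then have "\<bar>K (Y - X)\<bar> * \<bar>h Y\<bar> \<le> (c * indicator (sqbox X R) Y) * \<bar>h Y\<bar>"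
      by (rule mult_right_mono) simp
    then show "\<bar>K (Y - X) * h Y\<bar> \<le> c * (indicator (sqbox X R) Y *\<^sub>R \<bar>h Y\<bar>)"
      by (simp only: abs_mult real_scaleR_def mult.assoc)
  qed
  finally show ?thesis by (simp add: set_lebesgue_integral_def)
qed

lemma corr_diff_fun:
  assumes "kern R c K" "loc_integrable h" "loc_integrable h'"
  shows "corr K (\<lambda>Y. h Y - h' Y) X = corr K h X - corr K h' X"
  using kern_integrable[OF assms(1,2)] kern_integrable[OF assms(1,3)]
  by (simp add: corr_def right_diff_distrib)

lemma corr_cmult_fun: "corr K (\<lambda>Y. a * h Y) X = a * corr K h X"
  by (simp add: corr_def mult.left_commute)

lemma corr_shift: "corr K h (X + v) = corr (\<lambda>z. K (z - v)) h X"
  by (simp add: corr_def algebra_simps)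

lemma corr_cong_AE: "AE x in lebesgue. h x = h' x \<Longrightarrow> h \<in> borel_measurable lebesgue \<Longrightarrow>
   h' \<in> borel_measurable lebesgue \<Longrightarrow> kern R c K \<Longrightarrow> corr K h X = corr K h' X"
proof -
  assume a: "AE x in lebesgue. h x = h' x" and [measurable]: "h \<in> borel_measurable lebesgue" "h' \<in> borel_measurable lebesgue"
    and K: "kern R c K"
  have [measurable]: "K \<in> borel_measurable borel" using K by (simp add: kern_def)
  have Km: "(\<lambda>Y. K (Y - X)) \<in> borel_measurable borel" by measurable
  have [measurable]: "(\<lambda>Y. K (Y - X)) \<in> borel_measurable lebesgue" using Km by (simp add: measurable_completion)
  show ?thesis unfolding corr_def
    by (rule integral_cong_AE) (use a in \<open>auto elim!: eventually_mono\<close>)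
qed

section \<open>Smooth functions and test functions\<close>

text \<open>The whole tower of derivatives is part of the notion, which makes it closed under differentiation.\<close>

definition smooth1 :: "(real \<Rightarrow> real) \<Rightarrow> bool" where
  "smooth1 f \<longleftrightarrow> (\<exists>F. F (0::nat) = f \<and> (\<forall>n t. (F n has_real_derivative F (Suc n) t) (at t)))"

lemma smooth1_coinduct:
  assumes "C f" and step: "\<And>g. C g \<Longrightarrow> \<exists>g'. C g' \<and> (\<forall>t. (g has_real_derivative g' t) (at t))"
  shows "smooth1 f"
proof -
  obtain D where D: "\<And>g. C g \<Longrightarrow> C (D g) \<and> (\<forall>t. (g has_real_derivative D g t) (at t))"
    using step by metis
  define F where "F n = (D ^^ n) f" for n
  have "C (F n)" for n by (induction n) (use assms(1) D in \<open>auto simp: F_def\<close>)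
  then have "(F n has_real_derivative F (Suc n) t) (at t)" for n t
    using D[of "F n"] by (simp add: F_def)
  then show ?thesis unfolding smooth1_def by (intro exI[of _ F]) (simp add: F_def)
qed

lemma smooth1_deriv: "smooth1 f \<Longrightarrow> smooth1 (deriv f) \<and> (\<forall>t. (f has_real_derivative deriv f t) (at t))"
proof -
  assume "smooth1 f"
  then obtain F where F: "F 0 = f" "\<And>n t. (F n has_real_derivative F (Suc n) t) (at t)"
    unfolding smooth1_def by blast
  have d: "deriv f = F (Suc 0)" using DERIV_imp_deriv[OF F(2)[of 0]] F(1) by auto
  have "smooth1 (F (Suc 0))"
    unfolding smooth1_def by (rule exI[of _ "\<lambda>n. F (Suc n)"]) (simp add: F(2))
  then show ?thesis using F(2)[of 0] by (simp add: d F(1))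
qed

lemmas smooth1_DERIV = smooth1_deriv[THEN conjunct2, rule_format]
lemmas smooth1_deriv_smooth = smooth1_deriv[THEN conjunct1]

lemma smooth1_continuous: "smooth1 f \<Longrightarrow> continuous_on S f"
  by (meson DERIV_isCont continuous_at_imp_continuous_on smooth1_DERIV)

lemma smooth1_antideriv:
  assumes "\<And>t. (f has_real_derivative g t) (at t)" "smooth1 g"
  shows "smooth1 f"
proof -
  obtain G where G: "G 0 = g" "\<And>n t. (G n has_real_derivative G (Suc n) t) (at t)"
    using assms(2) unfolding smooth1_def by blast
  show ?thesis unfolding smooth1_def
    by (rule exI[of _ "case_nat f G"]) (auto simp: assms(1) G split: nat.split)
qed

text \<open>
  Sums and products of smooth functions are closed under differentiation as a class, by the product
  rule; smoothness of each member follows by coinduction.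
\<close>

inductive smooth_alg :: "(real \<Rightarrow> real) \<Rightarrow> bool" where
  base: "smooth1 f \<Longrightarrow> smooth_alg f"
| mult: "smooth_alg f \<Longrightarrow> smooth_alg g \<Longrightarrow> smooth_alg (\<lambda>t. f t * g t)"
| add: "smooth_alg f \<Longrightarrow> smooth_alg g \<Longrightarrow> smooth_alg (\<lambda>t. f t + g t)"

lemma smooth_alg_smooth1: "smooth_alg f \<Longrightarrow> smooth1 f"
proof (erule smooth1_coinduct)
  fix g assume "smooth_alg g"
  then show "\<exists>g'. smooth_alg g' \<and> (\<forall>t. (g has_real_derivative g' t) (at t))"
  proof induction
    case (base f)
    then show ?case using smooth1_deriv[OF base] by (intro exI[of _ "deriv f"]) (auto intro: smooth_alg.intros)
  next
    case (mult f g)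
    then obtain f' g' where "smooth_alg f'" "\<And>t. (f has_real_derivative f' t) (at t)"
      "smooth_alg g'" "\<And>t. (g has_real_derivative g' t) (at t)" by blast
    with mult show ?case
      by (intro exI[of _ "\<lambda>t. f' t * g t + f t * g' t"] conjI allI smooth_alg.mult smooth_alg.add)
         (auto intro!: derivative_eq_intros)
  next
    case (add f g)
    then obtain f' g' where "smooth_alg f'" "\<And>t. (f has_real_derivative f' t) (at t)"
      "smooth_alg g'" "\<And>t. (g has_real_derivative g' t) (at t)" by blast
    with add show ?case
      by (intro exI[of _ "\<lambda>t. f' t + g' t"] conjI allI smooth_alg.mult smooth_alg.add)
         (auto intro!: derivative_eq_intros)
  qed
qed

lemma smooth1_const: "smooth1 (\<lambda>_. c)"
  unfolding smooth1_def by (rule exI[of _ "\<lambda>n _. if n = 0 then c else 0"]) auto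

lemma smooth1_mult: "smooth1 f \<Longrightarrow> smooth1 g \<Longrightarrow> smooth1 (\<lambda>t. f t * g t)"
  by (rule smooth_alg_smooth1[OF smooth_alg.mult[OF smooth_alg.base smooth_alg.base]])

lemma smooth1_add: "smooth1 f \<Longrightarrow> smooth1 g \<Longrightarrow> smooth1 (\<lambda>t. f t + g t)"
  by (rule smooth_alg_smooth1[OF smooth_alg.add[OF smooth_alg.base smooth_alg.base]])

lemma smooth1_cmult: "smooth1 f \<Longrightarrow> smooth1 (\<lambda>t. c * f t)"
  by (intro smooth1_mult smooth1_const)

lemma smooth1_diff: "smooth1 f \<Longrightarrow> smooth1 g \<Longrightarrow> smooth1 (\<lambda>t. f t - g t)"
  using smooth1_add[of f "\<lambda>t. (-1) * g t"] smooth1_cmult[of g "-1"] by simp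

lemma smooth1_affine:
  assumes "smooth1 f" shows "smooth1 (\<lambda>t. f (a * t + b))"
proof -
  obtain F where F: "F 0 = f" "\<And>n t. (F n has_real_derivative F (Suc n) t) (at t)"
    using assms unfolding smooth1_def by blast
  have "((\<lambda>t. a ^ n * F n (a * t + b)) has_real_derivative a ^ Suc n * F (Suc n) (a * t + b)) (at t)" for n t
    by (rule derivative_eq_intros DERIV_chain2[OF F(2)] | simp)+
  then show ?thesis unfolding smooth1_def
    by (intro exI[of _ "\<lambda>n t. a ^ n * F n (a * t + b)"]) (simp add: F(1))
qed

text \<open>
  The derivatives of \<open>exp (- 1 / t)\<close> on the positive half-line are polynomials in \<open>1 / t\<close> times that
  function, and all of these vanish to every order at the origin.
\<close>

definition flat_exp :: "real poly \<Rightarrow> real \<Rightarrow> real" where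
  "flat_exp p t = (if t > 0 then poly p (1 / t) * exp (- (1 / t)) else 0)"

lemma poly_exp_tendsto_0: "((\<lambda>x. poly p x * exp (- x)) \<longlongrightarrow> (0::real)) at_top"
proof -
  have "((\<lambda>x. \<Sum>i\<le>degree p. coeff p i * (x ^ i / exp x)) \<longlongrightarrow> (\<Sum>i\<le>degree p. coeff p i * 0)) at_top"
    by (intro tendsto_sum tendsto_mult tendsto_const tendsto_power_div_exp_0)
  then show ?thesis
    by (simp add: poly_altdef sum_distrib_right exp_minus divide_inverse mult.assoc)
qed

lemma flat_exp_DERIV:
  "(flat_exp p has_real_derivative flat_exp ([:0, 0, 1:] * (p - pderiv p)) t) (at t)"
proof -
  consider "t > 0" | "t < 0" | "t = 0" by linarith
  then show ?thesis
  proof cases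
    case 1
    have "((\<lambda>t. poly p (1 / t) * exp (- (1 / t))) has_real_derivative
        poly ([:0, 0, 1:] * (p - pderiv p)) (1 / t) * exp (- (1 / t))) (at t)"
      using 1 by (auto intro!: derivative_eq_intros DERIV_chain2[OF poly_DERIV]
          simp: field_simps power2_eq_square)
    then have "(flat_exp p has_real_derivative poly ([:0, 0, 1:] * (p - pderiv p)) (1 / t) * exp (- (1 / t))) (at t)"
      by (rule DERIV_cong_ev[THEN iffD1, rotated -1, OF _ refl _ refl])
         (use 1 in \<open>auto simp: flat_exp_def eventually_nhds intro!: exI[of _ "{0<..}"]\<close>)
    then show ?thesis using 1 by (simp add: flat_exp_def)
  next
    case 2
    have "((\<lambda>_. 0) has_real_derivative 0) (at t)" by simp
    then have "(flat_exp p has_real_derivative 0) (at t)"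
      by (rule DERIV_cong_ev[THEN iffD1, rotated -1, OF _ refl _ refl])
         (use 2 in \<open>auto simp: flat_exp_def eventually_nhds intro!: exI[of _ "{..<0}"]\<close>)
    then show ?thesis using 2 by (simp add: flat_exp_def)
  next
    case 3
    have "((\<lambda>h. poly ([:0, 1:] * p) (1 / h) * exp (- (1 / h))) \<longlongrightarrow> 0) (at_right (0::real))"
      using filterlim_compose[OF poly_exp_tendsto_0 filterlim_inverse_at_top_right, of "[:0, 1:] * p"]
      by (simp add: divide_inverse)
    moreover have "\<forall>\<^sub>F h in at_right (0::real). poly ([:0, 1:] * p) (1 / h) * exp (- (1 / h)) = (flat_exp p (0 + h) - flat_exp p 0) / h"
      by (rule eventually_at_right_less[THEN eventually_mono]) (simp add: flat_exp_def field_simps)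
    ultimately have r: "((\<lambda>h. (flat_exp p (0 + h) - flat_exp p 0) / h) \<longlongrightarrow> 0) (at_right 0)"
      by (rule Lim_transform_eventually)
    have l: "((\<lambda>h. (flat_exp p (0 + h) - flat_exp p 0) / h) \<longlongrightarrow> 0) (at_left 0)"
      by (rule tendsto_eventually) (auto simp: flat_exp_def eventually_at_filter)
    have "(flat_exp p has_real_derivative 0) (at 0)"
      unfolding DERIV_def using l r by (rule filterlim_split_at_real)
    then show ?thesis using 3 by (simp add: flat_exp_def)
  qed
qed

lemma smooth1_flat_exp: "smooth1 (flat_exp p)"
  by (rule smooth1_coinduct[where C="\<lambda>f. \<exists>p. f = flat_exp p"]) (use flat_exp_DERIV in blast)+

text \<open>A smooth transition from \<open>0\<close> to \<open>1\<close>: the normalised antiderivative of a bump.\<close>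

lemma smooth_step_exists:
  "\<exists>B. smooth1 B \<and> mono B \<and> (\<forall>t\<le>-1. B t = 0) \<and> (\<forall>t\<ge>1. B t = 1)"
proof -
  define b where "b t = flat_exp 1 (1 + t) * flat_exp 1 (1 - t)" for t
  have b: "smooth1 b"
    using smooth1_mult[OF smooth1_affine[OF smooth1_flat_exp, of 1 1 1] smooth1_affine[OF smooth1_flat_exp, of 1 "-1" 1]]
    by (simp add: b_def[abs_def] add.commute)
  have "isCont b t" for t
    using smooth1_continuous[OF b, of UNIV] by (simp add: continuous_on_eq_continuous_at)
  then obtain B where B: "\<And>t. (B has_real_derivative b t) (at t)"
    using einterval_antiderivative[of "-\<infinity>" "\<infinity>" b] by (auto simp: has_real_derivative_iff_has_vector_derivative)
  have bnn: "b t \<ge> 0" for t by (simp add: b_def flat_exp_def)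
  have b0: "b t = 0" if "t \<le> -1 \<or> t \<ge> 1" for t using that by (auto simp: b_def flat_exp_def)
  have Bmono: "B s \<le> B t" if "s \<le> t" for s t
    by (rule DERIV_nonneg_imp_nondecreasing[OF that]) (use B bnn in blast)
  have Bl: "B t = B (-1)" if "t \<le> -1" for t
  proof -
    have "B (-1) \<le> B t"
      by (rule DERIV_nonpos_imp_nonincreasing[OF that]) (use B b0 in force)
    with Bmono[OF that] show ?thesis by simp
  qed
  have Br: "B t = B 1" if "t \<ge> 1" for t
  proof -
    have "B t \<le> B 1"
      by (rule DERIV_nonpos_imp_nonincreasing[OF that]) (use B b0 in force)
    with Bmono[OF that] show ?thesis by simp
  qed
  have "B (-1) < B 1"
    by (rule DERIV_pos_imp_increasing_open)
       (use B in \<open>auto simp: b_def flat_exp_def intro!: exI DERIV_isCont continuous_at_imp_continuous_on\<close>)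
  define Z where "Z = B 1 - B (-1)"
  have Z: "Z > 0" using \<open>B (-1) < B 1\<close> by (simp add: Z_def)
  define S where "S t = (1 / Z) * B t + - B (-1) / Z" for t
  have "smooth1 S" unfolding S_def
    by (intro smooth1_add smooth1_cmult smooth1_const smooth1_antideriv[OF B b])
  moreover have "mono S"
    using Bmono Z by (auto simp: mono_def S_def divide_right_mono)
  moreover have "S t = 0" if "t \<le> -1" for t using Bl[OF that] by (simp add: S_def)
  moreover have "S t = 1" if "t \<ge> 1" for t
  proof -
    have "S t = (B 1 - B (-1)) / Z" unfolding S_def Br[OF that] by (simp add: diff_divide_distrib)
    then have "S t = Z / Z" by (simp only: Z_def)
    then show ?thesis using Z by simp
  qed
  ultimately show ?thesis by blast
qed

definition sstep :: "real \<Rightarrow> real" where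
  "sstep = (SOME B. smooth1 B \<and> mono B \<and> (\<forall>t\<le>-1. B t = 0) \<and> (\<forall>t\<ge>1. B t = 1))"

lemma sstep: "smooth1 sstep" "mono sstep" "t \<le> -1 \<Longrightarrow> sstep t = 0" "t \<ge> 1 \<Longrightarrow> sstep t = 1"
  using someI_ex[OF smooth_step_exists, folded sstep_def] by auto

lemma sstep_bounds: "0 \<le> sstep t" "sstep t \<le> 1"
proof -
  have m: "sstep (min t (-1)) \<le> sstep t" "sstep t \<le> sstep (max t 1)"
    using sstep(2) by (auto simp: mono_def)
  show "0 \<le> sstep t" using m(1) sstep(3)[of "min t (-1)"] by simp
  show "sstep t \<le> 1" using m(2) sstep(4)[of "max t 1"] by simp
qed

subsection \<open>Tensor products and test functions\<close>

definition tensor :: "(real \<Rightarrow> real) \<Rightarrow> (real \<Rightarrow> real) \<Rightarrow> real^2 \<Rightarrow> real" where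
  "tensor p q z = p (z $ 1) * q (z $ 2)"

lemma tensor_shift: "tensor p q (z - x) = tensor (\<lambda>t. p (t - x $ 1)) (\<lambda>t. q (t - x $ 2)) z"
  by (simp add: tensor_def)

lemma DERIV_shift0: "(p has_real_derivative d) (at x) \<Longrightarrow> ((\<lambda>t. p (x + t)) has_real_derivative d) (at 0)"
  using DERIV_shift[of p d 0 x] by (simp add: add.commute)

lemma tensor_partial:
  assumes "smooth1 p" "smooth1 q"
  shows "((\<lambda>t. tensor p q (x + t *\<^sub>R axis 1 1)) has_real_derivative tensor (deriv p) q x) (at 0)"
    "((\<lambda>t. tensor p q (x + t *\<^sub>R axis 2 1)) has_real_derivative tensor p (deriv q) x) (at 0)"
  unfolding tensor_def
  by (auto simp: axis_def intro!: derivative_eq_intros DERIV_shift0[OF smooth1_DERIV] assms)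

lemma partial_deriv_tensor:
  assumes "smooth1 p" "smooth1 q"
  shows "partial_deriv 1 (tensor p q) = tensor (deriv p) q"
    "partial_deriv 2 (tensor p q) = tensor p (deriv q)"
  using tensor_partial[OF assms] by (auto simp: partial_deriv_def fun_eq_iff intro: DERIV_imp_deriv)

lemma smooth1_shift: "smooth1 p \<Longrightarrow> smooth1 (\<lambda>t. p (t - c))"
  using smooth1_affine[of p 1 "-c"] by simp

lemma continuous_on_tensor:
  assumes p: "continuous_on UNIV p" and q: "continuous_on UNIV q"
  shows "continuous_on UNIV (tensor p q)"
proof -
  have n: "continuous_on UNIV (\<lambda>z::real^2. z $ i)" for i by (intro continuous_intros)
  have "continuous_on UNIV (\<lambda>z::real^2. p (z $ 1) * q (z $ 2))"
    by (rule continuous_on_mult[OF continuous_on_compose2[OF p n] continuous_on_compose2[OF q n]]) simp_all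
  then show ?thesis by (simp add: tensor_def[abs_def])
qed

lemma iter_partial_tensor:
  assumes "smooth1 p" "smooth1 q"
  shows "\<exists>p' q'. smooth1 p' \<and> smooth1 q' \<and> iter_partial \<alpha> (tensor p q) = tensor p' q'"
proof (induction \<alpha>)
  case Nil then show ?case using assms by auto
next
  case (Cons i \<alpha>)
  then obtain p' q' where *: "smooth1 p'" "smooth1 q'" "iter_partial \<alpha> (tensor p q) = tensor p' q'" by blast
  have "i = 1 \<or> i = 2" using exhaust_2[of i] by simp
  then show ?case
    using * partial_deriv_tensor[OF *(1,2)] smooth1_deriv_smooth by auto
qed

lemma smooth_fun_tensor:
  assumes "smooth1 p" "smooth1 q" shows "smooth_fun (tensor p q)"
  unfolding smooth_fun_def
proof (intro allI conjI)
  fix \<alpha>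
  obtain p' q' where *: "smooth1 p'" "smooth1 q'" "iter_partial \<alpha> (tensor p q) = tensor p' q'"
    using iter_partial_tensor[OF assms] by blast
  show "continuous_on UNIV (iter_partial \<alpha> (tensor p q))"
    unfolding * by (intro continuous_on_tensor smooth1_continuous *)
  fix i :: 2 and x
  have "i = 1 \<or> i = 2" using exhaust_2[of i] by simp
  then show "(\<lambda>t. iter_partial \<alpha> (tensor p q) (x + t *\<^sub>R axis i 1)) differentiable at 0"
    unfolding * using tensor_partial[OF *(1,2), of x] by (auto simp: real_differentiable_def)
qed

lemma test_fun_tensor:
  assumes "smooth1 p" "smooth1 q" "\<And>t. \<bar>t\<bar> > R \<Longrightarrow> p t = 0" "\<And>t. \<bar>t\<bar> > R \<Longrightarrow> q t = 0"
  shows "test_fun (tensor p q)"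
proof -
  have "{x. tensor p q x \<noteq> 0} \<subseteq> sqbox 0 R"
    using assms(3,4) unfolding tensor_def sqbox_def by (auto simp: forall_2) (meson not_le)+
  then have "bounded {x. tensor p q x \<noteq> 0}"
    by (rule bounded_subset[OF compact_imp_bounded[OF compact_sqbox]])
  then show ?thesis unfolding test_fun_def
    by (simp add: smooth_fun_tensor[OF assms(1,2)] compact_closure)
qed

lemma test_fun_tensor_shift:
  assumes "smooth1 p" "smooth1 q" "\<And>t. \<bar>t\<bar> > R \<Longrightarrow> p t = 0" "\<And>t. \<bar>t\<bar> > R \<Longrightarrow> q t = 0"
  shows "test_fun (\<lambda>Y. tensor p q (Y - x))"
  unfolding tensor_shift
proof (rule test_fun_tensor[where R="R + \<bar>x $ 1\<bar> + \<bar>x $ 2\<bar>"])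
  show "p (t - x $ 1) = 0" if "\<bar>t\<bar> > R + \<bar>x $ 1\<bar> + \<bar>x $ 2\<bar>" for t
    by (rule assms(3)) (use that in linarith)
  show "q (t - x $ 2) = 0" if "\<bar>t\<bar> > R + \<bar>x $ 1\<bar> + \<bar>x $ 2\<bar>" for t
    by (rule assms(4)) (use that in linarith)
qed (intro smooth1_shift assms)+

lemma deriv_shift: "smooth1 p \<Longrightarrow> deriv (\<lambda>t. p (t - c)) = (\<lambda>t. deriv p (t - c))"
proof
  fix t assume "smooth1 p"
  then have "((\<lambda>t. p (t - c)) has_real_derivative deriv p (t - c) * 1) (at t)"
    by (intro DERIV_chain2[OF smooth1_DERIV]) (auto intro!: derivative_eq_intros)
  then show "deriv (\<lambda>t. p (t - c)) t = deriv p (t - c)" by (intro DERIV_imp_deriv) simp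
qed

lemma partial_deriv_tensor_shift:
  assumes "smooth1 p" "smooth1 q"
  shows "partial_deriv 1 (\<lambda>Y. tensor p q (Y - x)) = (\<lambda>Y. tensor (deriv p) q (Y - x))"
    "partial_deriv 2 (\<lambda>Y. tensor p q (Y - x)) = (\<lambda>Y. tensor p (deriv q) (Y - x))"
  unfolding tensor_shift[abs_def]
  using partial_deriv_tensor[OF smooth1_shift[OF assms(1)] smooth1_shift[OF assms(2)]] assms
  by (simp_all add: deriv_shift)

subsection \<open>Integrals of tensor products\<close>

text \<open>Fubini's theorem, transported along the product structure of Lebesgue measure on \<open>\<real>\<^sup>2\<close>.\<close>

lemma lborel_tensor:
  fixes f g :: "real \<Rightarrow> 'a::{real_normed_field, banach, second_countable_topology}"
  assumes "integrable lborel f" "integrable lborel g"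
  shows "integrable lborel (\<lambda>z::real^2. f (z $ 1) * g (z $ 2))"
    and "(LINT z|lborel. f ((z::real^2) $ 1) * g (z $ 2)) = (LINT t|lborel. f t) * (LINT t|lborel. g t)"
proof -
  interpret product_sigma_finite "\<lambda>_::real^2. lborel :: real measure" ..
  let ?e1 = "axis 1 1 :: real^2" and ?e2 = "axis 2 1 :: real^2"
  have B: "(Basis :: (real^2) set) = {?e1, ?e2}"
    by (auto simp: Basis_vec_def UNIV_2)
  have ne: "?e1 \<noteq> ?e2" by (simp add: axis_eq_axis)
  define T where "T h = (\<Sum>b\<in>Basis. h b *\<^sub>R b)" for h :: "real^2 \<Rightarrow> real"
  have T12: "T h $ 1 = h ?e1" "T h $ 2 = h ?e2" for h
    using ne by (simp_all add: T_def B axis_def)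
  have Tm [measurable]: "T \<in> (\<Pi>\<^sub>M b\<in>Basis. lborel) \<rightarrow>\<^sub>M borel"
    unfolding T_def[abs_def] by measurable
  define F where "F b = (if b = ?e1 then f else g)" for b :: "real^2"
  have Fi: "integrable lborel (F b)" for b using assms by (simp add: F_def)
  have prod: "(\<Prod>b\<in>Basis. F b (h b)) = f (T h $ 1) * g (T h $ 2)" for h
    using ne by (simp add: B F_def T12)
  have fm: "(\<lambda>z::real^2. f (z $ 1) * g (z $ 2)) \<in> borel_measurable borel"
  proof -
    have [measurable]: "f \<in> borel_measurable borel" "g \<in> borel_measurable borel"
      using assms by (auto dest: borel_measurable_integrable)
    have [measurable]: "(\<lambda>z::real^2. z $ i) \<in> borel_measurable borel" for i
      by (intro borel_measurable_continuous_onI continuous_intros)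
    show ?thesis by measurable
  qed
  have leq: "(lborel :: (real^2) measure) = distr (\<Pi>\<^sub>M b\<in>Basis. lborel) borel T"
    unfolding T_def[abs_def] by (rule lborel_eq)
  show "integrable lborel (\<lambda>z::real^2. f (z $ 1) * g (z $ 2))"
    unfolding leq using product_integrable_prod[of Basis F] Fi
    by (subst integrable_distr_eq[OF Tm fm]) (simp add: prod)
  have "(LINT z|lborel. f ((z::real^2) $ 1) * g (z $ 2)) = (LINT h|(\<Pi>\<^sub>M b\<in>Basis. lborel). f (T h $ 1) * g (T h $ 2))"
    unfolding leq by (rule integral_distr[OF Tm fm])
  also have "\<dots> = (\<Prod>b\<in>Basis. LINT t|lborel. F b t)"
    using product_integral_prod[of Basis F] Fi by (simp add: prod)
  finally show "(LINT z|lborel. f ((z::real^2) $ 1) * g (z $ 2)) = (LINT t|lborel. f t) * (LINT t|lborel. g t)"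
    using ne by (simp add: B F_def)
qed

lemma lebesgue_tensor:
  fixes f g :: "real \<Rightarrow> 'a::{real_normed_field, banach, second_countable_topology}"
  assumes "integrable lborel f" "integrable lborel g"
  shows "integrable lebesgue (\<lambda>z::real^2. f (z $ 1) * g (z $ 2))"
    and "(LINT z|lebesgue. f ((z::real^2) $ 1) * g (z $ 2)) = (LINT t|lborel. f t) * (LINT t|lborel. g t)"
  using lborel_tensor[OF assms] by (simp_all add: integrable_completion integral_completion borel_measurable_integrable)

section \<open>Mollification\<close>

subsection \<open>Compactly supported smooth functions and Lipschitz kernels\<close>

definition smooth_cc :: "real \<Rightarrow> (real \<Rightarrow> real) \<Rightarrow> bool" where
  "smooth_cc R p \<longleftrightarrow> smooth1 p \<and> (\<forall>t. R < \<bar>t\<bar> \<longrightarrow> p t = 0)"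

lemma smooth_cc_deriv:
  assumes "smooth_cc R p" shows "smooth_cc R (deriv p)"
  unfolding smooth_cc_def
proof (intro conjI allI impI)
  show "smooth1 (deriv p)" using assms smooth1_deriv_smooth by (auto simp: smooth_cc_def)
  fix t :: real assume t: "R < \<bar>t\<bar>"
  have "open {s::real. R < \<bar>s\<bar>}" by (intro open_Collect_less continuous_intros)
  then have "\<forall>\<^sub>F s in nhds t. p s = 0"
    unfolding eventually_nhds using t assms by (intro exI[of _ "{s. R < \<bar>s\<bar>}"]) (auto simp: smooth_cc_def)
  then have "deriv p t = deriv (\<lambda>_. 0) t" by (rule deriv_cong_ev) simp
  then show "deriv p t = 0" by simp
qed

lemma smooth_cc_bounded:
  assumes "smooth_cc R p" shows "\<exists>P\<ge>0. \<forall>t. \<bar>p t\<bar> \<le> P"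
proof -
  have "compact (p ` {-\<bar>R\<bar>..\<bar>R\<bar>})"
    using assms by (intro compact_continuous_image smooth1_continuous) (auto simp: smooth_cc_def)
  then have "bounded (p ` {-\<bar>R\<bar>..\<bar>R\<bar>})" by (rule compact_imp_bounded)
  then obtain P where P: "P > 0" and P': "\<forall>y\<in>p ` {-\<bar>R\<bar>..\<bar>R\<bar>}. norm y \<le> P"
    unfolding bounded_pos by blast
  have "\<bar>p t\<bar> \<le> P" for t
  proof (cases "R < \<bar>t\<bar>")
    case True then show ?thesis using assms P by (simp add: smooth_cc_def)
  next
    case False
    then have "t \<in> {-\<bar>R\<bar>..\<bar>R\<bar>}" by auto
    then show ?thesis using P' by simp
  qed
  then show ?thesis using P by (intro exI[of _ P]) auto
qed

lemma DERIV_bound_diff: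
  assumes "\<And>t. (p has_real_derivative p' t) (at t)" "\<And>t. \<bar>p' t\<bar> \<le> P"
  shows "\<bar>p s - p t\<bar> \<le> P * \<bar>s - t\<bar>"
  using field_differentiable_bound[of UNIV p p' P s t] assms by (auto simp: convex_UNIV)

lemma smooth_cc_Lipschitz:
  assumes "smooth_cc R p" shows "\<exists>P\<ge>0. \<forall>s t. \<bar>p s - p t\<bar> \<le> P * \<bar>s - t\<bar>"
proof -
  obtain P where P: "P \<ge> 0" "\<And>t. \<bar>deriv p t\<bar> \<le> P"
    using smooth_cc_bounded[OF smooth_cc_deriv[OF assms]] by blast
  have "\<bar>p s - p t\<bar> \<le> P * \<bar>s - t\<bar>" for s t
    by (rule DERIV_bound_diff[OF smooth1_DERIV P(2)]) (use assms in \<open>simp add: smooth_cc_def\<close>)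
  with P(1) show ?thesis by blast
qed

lemma tensor_zero_outside:
  assumes "\<And>t. R < \<bar>t\<bar> \<Longrightarrow> p t = 0" "\<And>t. R < \<bar>t\<bar> \<Longrightarrow> q t = 0" "z \<notin> sqbox 0 R"
  shows "tensor p q z = 0"
proof -
  obtain i where "\<not> \<bar>z $ i - 0 $ i\<bar> \<le> R" using assms(3) unfolding sqbox_def by blast
  then have "R < \<bar>z $ i\<bar>" by simp
  then show ?thesis using exhaust_2[of i] assms(1,2) by (auto simp: tensor_def)
qed

text \<open>
  The second condition makes a difference of two nearby correlations with \<open>K\<close> a correlation with a
  kernel whose size is proportional to the shift. The bound \<open>s \<le> 1\<close> keeps one support for all shifts.
\<close>

definition lip_kern :: "real \<Rightarrow> real \<Rightarrow> (real^2 \<Rightarrow> real) \<Rightarrow> bool" where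
  "lip_kern R L K \<longleftrightarrow> 0 \<le> R \<and> 0 \<le> L \<and> kern R L K \<and>
    (\<forall>v s. 0 \<le> s \<longrightarrow> s \<le> 1 \<longrightarrow> v \<in> sqbox 0 s \<longrightarrow> kern (R + 1) (L * s) (\<lambda>z. K (z - v) - K z))"

lemma kern_tensorI:
  assumes "continuous_on UNIV p" "continuous_on UNIV q"
    "\<And>t. \<bar>p t\<bar> \<le> P" "\<And>t. \<bar>q t\<bar> \<le> Q" "\<And>t. R < \<bar>t\<bar> \<Longrightarrow> p t = 0" "\<And>t. R < \<bar>t\<bar> \<Longrightarrow> q t = 0"
  shows "kern R (P * Q) (tensor p q)"
  unfolding kern_def
proof (intro conjI allI)
  show "tensor p q \<in> borel_measurable borel"
    by (rule borel_measurable_continuous_onI[OF continuous_on_tensor[OF assms(1,2)]])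
  fix z
  show "\<bar>tensor p q z\<bar> \<le> P * Q * indicat_real (sqbox 0 R) z"
  proof (cases "z \<in> sqbox 0 R")
    case True
    have "0 \<le> P" using assms(3)[of 0] by linarith
    have "\<bar>tensor p q z\<bar> \<le> P * Q" unfolding tensor_def abs_mult
      by (intro mult_mono assms) (use \<open>0 \<le> P\<close> in auto)
    with True show ?thesis by simp
  qed (simp add: tensor_zero_outside[OF assms(5,6)])
qed

lemma lip_kern_tensor:
  assumes p: "smooth_cc R p" and q: "smooth_cc R q" and R: "0 \<le> R"
  shows "\<exists>L. lip_kern R L (tensor p q)"
proof -
  obtain P Q where P: "P \<ge> 0" "\<And>t. \<bar>p t\<bar> \<le> P" and Q: "Q \<ge> 0" "\<And>t. \<bar>q t\<bar> \<le> Q"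
    using smooth_cc_bounded[OF p] smooth_cc_bounded[OF q] by blast
  obtain P' Q' where P': "P' \<ge> 0" "\<And>s t. \<bar>p s - p t\<bar> \<le> P' * \<bar>s - t\<bar>"
    and Q': "Q' \<ge> 0" "\<And>s t. \<bar>q s - q t\<bar> \<le> Q' * \<bar>s - t\<bar>"
    using smooth_cc_Lipschitz[OF p] smooth_cc_Lipschitz[OF q] by blast
  define L where "L = P * Q + P' * Q + P * Q'"
  have cp: "continuous_on UNIV p" "continuous_on UNIV q"
    using p q smooth1_continuous by (auto simp: smooth_cc_def)
  have k: "kern R (P * Q) (tensor p q)"
    using p q by (intro kern_tensorI cp P(2) Q(2)) (auto simp: smooth_cc_def)
  have z0: "tensor p q z = 0" if "z \<notin> sqbox 0 R" for z
    using p q that by (intro tensor_zero_outside) (auto simp: smooth_cc_def)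
  have "lip_kern R L (tensor p q)"
    unfolding lip_kern_def
  proof (intro conjI allI impI)
    show "0 \<le> R" by fact
    show "0 \<le> L" unfolding L_def using P(1) Q(1) P'(1) Q'(1) by simp
    show "kern R L (tensor p q)"
      by (rule kern_mono[OF k R order_refl]) (use P(1) Q(1) P'(1) Q'(1) in \<open>simp add: L_def\<close>)
    fix v :: "real^2" and s :: real assume s: "0 \<le> s" "s \<le> 1" and v: "v \<in> sqbox 0 s"
    have v': "\<bar>v $ i\<bar> \<le> s" for i using v by (simp add: sqbox_def)
    show "kern (R + 1) (L * s) (\<lambda>z. tensor p q (z - v) - tensor p q z)"
      unfolding kern_def
    proof (intro conjI allI)
      have [measurable]: "tensor p q \<in> borel_measurable borel" using k by (simp add: kern_def)
      show "(\<lambda>z. tensor p q (z - v) - tensor p q z) \<in> borel_measurable borel" by measurable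
      fix z
      show "\<bar>tensor p q (z - v) - tensor p q z\<bar> \<le> L * s * indicat_real (sqbox 0 (R + 1)) z"
      proof (cases "z \<in> sqbox 0 (R + 1)")
        case True
        have "tensor p q (z - v) - tensor p q z
            = (p (z $ 1 - v $ 1) - p (z $ 1)) * q (z $ 2 - v $ 2) + p (z $ 1) * (q (z $ 2 - v $ 2) - q (z $ 2))"
          by (simp add: tensor_def algebra_simps)
        also have "\<bar>\<dots>\<bar> \<le> \<bar>p (z $ 1 - v $ 1) - p (z $ 1)\<bar> * \<bar>q (z $ 2 - v $ 2)\<bar> + \<bar>p (z $ 1)\<bar> * \<bar>q (z $ 2 - v $ 2) - q (z $ 2)\<bar>"
          by (rule order_trans[OF abs_triangle_ineq]) (simp add: abs_mult)
        also have "\<dots> \<le> (P' * s) * Q + P * (Q' * s)"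
        proof (intro add_mono mult_mono P Q)
          show "\<bar>p (z $ 1 - v $ 1) - p (z $ 1)\<bar> \<le> P' * s"
            by (rule order_trans[OF P'(2)]) (use v'[of 1] P'(1) in \<open>auto intro: mult_left_mono\<close>)
          show "\<bar>q (z $ 2 - v $ 2) - q (z $ 2)\<bar> \<le> Q' * s"
            by (rule order_trans[OF Q'(2)]) (use v'[of 2] Q'(1) in \<open>auto intro: mult_left_mono\<close>)
        qed (use s P'(1) in auto)
        also have "\<dots> \<le> L * s" unfolding L_def using P(1) Q(1) s by (simp add: algebra_simps)
        finally show ?thesis using True by simp
      next
        case False
        then obtain i where i: "\<not> \<bar>z $ i - 0 $ i\<bar> \<le> R + 1" unfolding sqbox_def by blast
        have "z \<notin> sqbox 0 R" using i unfolding sqbox_def by (auto intro!: exI[of _ i])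
        moreover have "\<not> \<bar>(z - v) $ i - 0 $ i\<bar> \<le> R" using i v'[of i] s by simp
        then have "z - v \<notin> sqbox 0 R" unfolding sqbox_def by blast
        ultimately show ?thesis using False by (simp add: z0)
      qed
    qed
  qed
  then show ?thesis by blast
qed

lemma lip_kernD:
  assumes "lip_kern R L K"
  shows "kern R L K" "0 \<le> R" "0 \<le> L"
    "0 \<le> s \<Longrightarrow> s \<le> 1 \<Longrightarrow> v \<in> sqbox 0 s \<Longrightarrow> kern (R + 1) (L * s) (\<lambda>z. K (z - v) - K z)"
  using assms unfolding lip_kern_def by blast+

lemma kern_add:
  assumes "kern R c K" "kern R c' K'" shows "kern R (c + c') (\<lambda>z. K z + K' z)"
  using assms unfolding kern_def
  by (auto intro!: borel_measurable_add order_trans[OF abs_triangle_ineq add_mono] simp: distrib_right)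

lemma lip_kern_add:
  assumes "lip_kern R L K" "lip_kern R L' K'" shows "lip_kern R (L + L') (\<lambda>z. K z + K' z)"
  unfolding lip_kern_def
proof (intro conjI allI impI)
  fix v :: "real^2" and s :: real assume "0 \<le> s" "s \<le> 1" "v \<in> sqbox 0 s"
  from kern_add[OF lip_kernD(4)[OF assms(1) this] lip_kernD(4)[OF assms(2) this]]
  show "kern (R + 1) ((L + L') * s) (\<lambda>z. K (z - v) + K' (z - v) - (K z + K' z))"
    by (simp add: distrib_right add_diff_add)
qed (use assms lip_kernD(1-3) kern_add in \<open>auto intro: add_nonneg_nonneg\<close>)

lemma corr_increment:
  assumes K: "lip_kern R L K" and h: "loc_integrable h" and s: "0 \<le> s" "s \<le> 1" "v \<in> sqbox 0 s"
  shows "\<bar>corr K h (X + v) - corr K h X\<bar> \<le> L * s * (LINT Y:sqbox X (R + 1)|lebesgue. \<bar>h Y\<bar>)"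
proof -
  have k: "kern R L (\<lambda>z. K z)" using lip_kernD(1)[OF K] by simp
  have eq: "corr (\<lambda>z. K (z - v) - K z) h X = corr K h (X + v) - corr K h X"
    unfolding corr_def
  proof -
    have 1: "integrable lebesgue (\<lambda>Y. K (Y - X) * h Y)" by (rule kern_integrable[OF k h])
    have 2: "integrable lebesgue (\<lambda>Y. K (Y - (X + v)) * h Y)" by (rule kern_integrable[OF k h])
    have "(LINT Y|lebesgue. (K (Y - X - v) - K (Y - X)) * h Y) = (LINT Y|lebesgue. K (Y - (X + v)) * h Y - K (Y - X) * h Y)"
      by (simp add: algebra_simps)
    also have "\<dots> = (LINT Y|lebesgue. K (Y - (X + v)) * h Y) - (LINT Y|lebesgue. K (Y - X) * h Y)"
      by (rule Bochner_Integration.integral_diff[OF 2 1])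
    finally show "(LINT Y|lebesgue. (K (Y - X - v) - K (Y - X)) * h Y) = \<dots>" .
  qed
  show ?thesis using corr_bound[OF lip_kernD(4)[OF K s] h, of X] by (simp only: eq)
qed

lemma mem_sqbox_norm: "v \<in> sqbox 0 (norm v)"
  by (simp add: sqbox_def component_le_norm_cart)

lemma corr_continuous:
  assumes K: "lip_kern R L K" and h: "loc_integrable h"
  shows "continuous_on UNIV (corr K h)"
  unfolding continuous_on_eq_continuous_at[OF open_UNIV]
proof
  fix X :: "real^2"
  let ?C = "L * (LINT Y:sqbox X (R + 1)|lebesgue. \<bar>h Y\<bar>)"
  have "((\<lambda>v. corr K h (X + v) - corr K h X) \<longlongrightarrow> 0) (at 0)"
  proof (rule Lim_null_comparison)
    show "\<forall>\<^sub>F v in at 0. norm (corr K h (X + v) - corr K h X) \<le> ?C * norm v"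
      unfolding eventually_at
    proof (intro exI[of _ "1::real"] conjI ballI impI)
      fix v :: "real^2" assume "v \<noteq> 0 \<and> dist v 0 < 1"
      then show "norm (corr K h (X + v) - corr K h X) \<le> ?C * norm v"
        using corr_increment[OF K h norm_ge_zero _ mem_sqbox_norm, of v X] by (simp add: mult_ac)
    qed simp
    show "((\<lambda>v. ?C * norm v) \<longlongrightarrow> 0) (at (0::real^2))"
      by (rule tendsto_mult_right_zero) (intro tendsto_norm_zero tendsto_ident_at)
  qed
  then have "((\<lambda>v. corr K h (X + v)) \<longlongrightarrow> corr K h X) (at 0)" by (simp add: LIM_zero_iff)
  then show "isCont (corr K h) X" unfolding isCont_iff .
qed

lemma corr_measurable: "lip_kern R L K \<Longrightarrow> loc_integrable h \<Longrightarrow> corr K h \<in> borel_measurable lebesgue"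
  using borel_measurable_continuous_onI[OF corr_continuous] by (simp add: measurable_completion)

text \<open>The sampling bound with spacing \<open>R\<close>, averaged over the offset of the lattice.\<close>

lemma corr_L2:
  assumes K: "lip_kern R L K" and k: "kern R c K" and h: "L2_fun h" and R: "0 < R"
  shows "L2_fun (corr K h)" "L2n (corr K h) \<le> c * (2 * R) * (3 * R) * L2n h"
proof -
  note hl = L2_fun_loc_integrable[OF h]
  have c: "0 \<le> c" using kern_nonneg[OF k] R by simp
  let ?c = "c * (2 * R) * (2 * R + R) * L2n h"
  have c0: "0 \<le> ?c" using c R by simp
  have "L2_norm (corr K h) \<le> ennreal ?c"
  proof (rule L2_norm_tile_le[OF _ R c0])
    show "(\<lambda>x. norm (corr K h x)) \<in> borel_measurable lebesgue"
      using corr_measurable[OF K hl] by simp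
    fix x :: "real^2" and A :: "(int^2) set" assume "finite A"
    then show "R\<^sup>2 * (\<Sum>k\<in>A. (norm (corr K h (R *\<^sub>R (lattice_pt k + x))))\<^sup>2) \<le> ?c\<^sup>2"
      unfolding real_norm_def power2_abs
      by (rule sampling_bound[OF h R less_imp_le[OF R] c _ corr_bound[OF k hl]])
  qed
  then show f: "L2_fun (corr K h)"
    using corr_measurable[OF K hl] le_less_trans[OF _ ennreal_less_top] by (auto simp: L2_fun_def)
  show "L2n (corr K h) \<le> c * (2 * R) * (3 * R) * L2n h"
    using \<open>L2_norm (corr K h) \<le> ennreal ?c\<close> c0 by (simp add: L2_norm_eq[OF f])
qed

subsection \<open>Sampled correlations as elements of \<open>\<ell>\<^sup>2\<close>\<close>

text \<open>
  Besides the lattice \<open>\<epsilon> k\<close> itself, the shifted lattices \<open>\<epsilon> (k + x)\<close> are needed to recover norms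
  over the plane.
\<close>

definition samp :: "real \<Rightarrow> real^2 \<Rightarrow> (real^2 \<Rightarrow> real) \<Rightarrow> (real^2 \<Rightarrow> real) \<Rightarrow> (int^2) ell2" where
  "samp \<epsilon> x K h = Abs_ell2 (\<lambda>k. corr K h (\<epsilon> *\<^sub>R (lattice_pt k + x)))"

lemma samp_props:
  assumes k: "kern R c K" and h: "L2_fun h" and \<epsilon>: "0 < \<epsilon>" "\<epsilon> \<le> 1" and R: "0 \<le> R"
  shows "coord (samp \<epsilon> x K h) j = corr K h (\<epsilon> *\<^sub>R (lattice_pt j + x))"
    and "\<epsilon> * norm (samp \<epsilon> x K h) \<le> c * (2 * R) * (2 * R + 1) * L2n h"
proof -
  note hl = L2_fun_loc_integrable[OF h]
  have c: "0 \<le> c" using kern_nonneg[OF k R] .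
  let ?g = "\<lambda>k. corr K h (\<epsilon> *\<^sub>R (lattice_pt k + x))"
  let ?C = "c * (2 * R) * (2 * R + \<epsilon>) * L2n h"
  have bd: "\<epsilon>\<^sup>2 * (\<Sum>k\<in>A. (?g k)\<^sup>2) \<le> ?C\<^sup>2" if "finite A" for A
    by (rule sampling_bound[OF h \<epsilon>(1) R c that corr_bound[OF k hl]])
  then have bd': "(\<Sum>k\<in>A. (?g k)\<^sup>2) \<le> (?C / \<epsilon>)\<^sup>2" if "finite A" for A
    using that \<epsilon>(1) by (simp add: power_divide le_divide_eq mult.commute)
  have co: "coord (samp \<epsilon> x K h) = ?g"
    unfolding samp_def by (rule coord_Abs_ell2I[OF bd'])
  then show "coord (samp \<epsilon> x K h) j = corr K h (\<epsilon> *\<^sub>R (lattice_pt j + x))" by simp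
  have "norm (samp \<epsilon> x K h) \<le> ?C / \<epsilon>"
    by (rule norm_ell2_le) (use c R \<epsilon> bd' in \<open>simp_all add: co\<close>)
  then have "\<epsilon> * norm (samp \<epsilon> x K h) \<le> ?C" using \<epsilon>(1) by (simp add: le_divide_eq mult.commute)
  also have "\<dots> \<le> c * (2 * R) * (2 * R + 1) * L2n h"
    using c R \<epsilon> by (intro mult_right_mono mult_left_mono) auto
  finally show "\<epsilon> * norm (samp \<epsilon> x K h) \<le> c * (2 * R) * (2 * R + 1) * L2n h" .
qed

lemma samp_diff:
  assumes k: "kern R c K" and h: "L2_fun h" "L2_fun h'" and \<epsilon>: "0 < \<epsilon>" "\<epsilon> \<le> 1" and R: "0 \<le> R"
  shows "samp \<epsilon> x K (\<lambda>Y. h Y - h' Y) = samp \<epsilon> x K h - samp \<epsilon> x K h'"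
  by (rule ell2_eqI)
     (simp add: samp_props(1)[OF k _ \<epsilon> R] h L2_fun_diff corr_diff_fun[OF k] L2_fun_loc_integrable)

lemma samp_cmult:
  assumes k: "kern R c K" and h: "L2_fun h" and \<epsilon>: "0 < \<epsilon>" "\<epsilon> \<le> 1" and R: "0 \<le> R"
  shows "samp \<epsilon> x K (\<lambda>Y. a * h Y) = a *\<^sub>R samp \<epsilon> x K h"
  by (rule ell2_eqI)
     (simp add: samp_props(1)[OF k _ \<epsilon> R] h L2_fun_cmult corr_cmult_fun)

subsection \<open>The mollifier\<close>

text \<open>
  The mollifier is a product of derivatives of one-dimensional steps: its factors have
  antiderivatives bounded by \<open>1\<close>, uniformly in the scale.
\<close>

definition stp :: "real \<Rightarrow> real \<Rightarrow> real" where "stp \<eta> t = sstep (t / \<eta>)"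
definition rho :: "real \<Rightarrow> real^2 \<Rightarrow> real" where "rho \<eta> = tensor (deriv (stp \<eta>)) (deriv (stp \<eta>))"

lemma stp:
  assumes "0 < \<eta>"
  shows "smooth1 (stp \<eta>)" "t \<le> -\<eta> \<Longrightarrow> stp \<eta> t = 0" "t \<ge> \<eta> \<Longrightarrow> stp \<eta> t = 1"
    "0 \<le> stp \<eta> t" "stp \<eta> t \<le> 1"
proof -
  show "smooth1 (stp \<eta>)" using smooth1_affine[OF sstep(1), of "1/\<eta>" 0] by (simp add: stp_def[abs_def])
  show "t \<le> -\<eta> \<Longrightarrow> stp \<eta> t = 0" unfolding stp_def using assms by (intro sstep(3)) (simp add: divide_le_eq)
  show "t \<ge> \<eta> \<Longrightarrow> stp \<eta> t = 1" unfolding stp_def using assms by (intro sstep(4)) (simp add: le_divide_eq)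
qed (simp_all add: stp_def sstep_bounds)

lemma deriv_stp: "0 < \<eta> \<Longrightarrow> deriv (stp \<eta>) t = deriv sstep (t / \<eta>) / \<eta>"
proof -
  assume "0 < \<eta>"
  then have "((\<lambda>t. t / \<eta>) has_real_derivative 1 / \<eta>) (at t)" by (auto intro!: derivative_eq_intros)
  from DERIV_chain2[OF smooth1_DERIV[OF sstep(1)] this]
  show ?thesis unfolding stp_def by (intro DERIV_imp_deriv) simp
qed

lemma deriv_zero_right_left:
  assumes "smooth1 f" "\<And>t. t \<ge> a \<Longrightarrow> f t = c" shows "t > a \<Longrightarrow> deriv f t = 0"
proof -
  assume "t > a"
  then have "\<forall>\<^sub>F s in nhds t. f s = c"
    unfolding eventually_nhds using assms(2) by (intro exI[of _ "{a<..}"]) auto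
  then have "deriv f t = deriv (\<lambda>_. c) t" by (rule deriv_cong_ev) simp
  then show ?thesis by simp
qed

lemma deriv_zero_left:
  assumes "smooth1 f" "\<And>t. t \<le> a \<Longrightarrow> f t = c" shows "t < a \<Longrightarrow> deriv f t = 0"
proof -
  assume "t < a"
  then have "\<forall>\<^sub>F s in nhds t. f s = c"
    unfolding eventually_nhds using assms(2) by (intro exI[of _ "{..<a}"]) auto
  then have "deriv f t = deriv (\<lambda>_. c) t" by (rule deriv_cong_ev) simp
  then show ?thesis by simp
qed

lemma smooth_cc_deriv_stp: "0 < \<eta> \<Longrightarrow> smooth_cc \<eta> (deriv (stp \<eta>))"
  unfolding smooth_cc_def
proof (intro conjI allI impI)
  assume \<eta>: "0 < \<eta>"
  show "smooth1 (deriv (stp \<eta>))" using stp(1)[OF \<eta>] smooth1_deriv_smooth by blast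
  fix t :: real assume "\<eta> < \<bar>t\<bar>"
  then consider "t > \<eta>" | "t < - \<eta>" by linarith
  then show "deriv (stp \<eta>) t = 0"
    using deriv_zero_right_left[OF stp(1)[OF \<eta>] stp(3)[OF \<eta>]] deriv_zero_left[OF stp(1)[OF \<eta>] stp(2)[OF \<eta>]]
    by cases auto
qed

lemma deriv_stp_nonneg: "0 < \<eta> \<Longrightarrow> 0 \<le> deriv (stp \<eta>) t"
proof -
  assume "0 < \<eta>"
  then have "mono (stp \<eta>)"
    using sstep(2) by (auto simp: mono_def stp_def divide_right_mono)
  then show ?thesis
    using smooth1_DERIV[OF stp(1)[OF \<open>0 < \<eta>\<close>], of t] by (intro mono_on_imp_deriv_nonneg[of UNIV "stp \<eta>"]) auto
qed

lemma integral_deriv_stp: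
  assumes "0 < \<eta>"
  shows "integrable lborel (\<lambda>t. deriv (stp \<eta>) (t - x))" "(LINT t|lborel. deriv (stp \<eta>) (t - x)) = 1"
proof -
  have sm: "smooth1 (\<lambda>t. stp \<eta> (t - x))" by (rule smooth1_shift[OF stp(1)[OF assms]])
  have d: "((\<lambda>t. stp \<eta> (t - x)) has_real_derivative deriv (stp \<eta>) (t - x)) (at t)" for t
    using smooth1_DERIV[OF sm, of t] by (simp add: deriv_shift[OF stp(1)[OF assms]])
  have c: "continuous_on S (\<lambda>t. deriv (stp \<eta>) (t - x))" for S
    using smooth1_continuous[OF smooth1_deriv_smooth[OF sm]] by (simp add: deriv_shift[OF stp(1)[OF assms]])
  have "has_bochner_integral lborel (\<lambda>t. deriv (stp \<eta>) (t - x) * indicator {x - \<eta>..x + \<eta>} t)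
     (stp \<eta> (x + \<eta> - x) - stp \<eta> (x - \<eta> - x))"
    by (rule has_bochner_integral_FTC_Icc_real) (use assms d c in \<open>auto simp: continuous_on_eq_continuous_within intro: DERIV_isCont\<close>)
  moreover have "(\<lambda>t. deriv (stp \<eta>) (t - x) * indicator {x - \<eta>..x + \<eta>} t) = (\<lambda>t. deriv (stp \<eta>) (t - x))"
  proof
    fix t
    show "deriv (stp \<eta>) (t - x) * indicator {x - \<eta>..x + \<eta>} t = deriv (stp \<eta>) (t - x)"
      using smooth_cc_deriv_stp[OF assms] by (cases "\<eta> < \<bar>t - x\<bar>") (auto simp: smooth_cc_def indicator_def)
  qed
  ultimately have "has_bochner_integral lborel (\<lambda>t. deriv (stp \<eta>) (t - x)) 1"
    using stp(2)[OF assms, of "-\<eta>"] stp(3)[OF assms, of \<eta>] by simp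
  then show "integrable lborel (\<lambda>t. deriv (stp \<eta>) (t - x))" "(LINT t|lborel. deriv (stp \<eta>) (t - x)) = 1"
    by (auto simp: has_bochner_integral_iff)
qed

lemma integral_rho:
  assumes "0 < \<eta>"
  shows "integrable lebesgue (\<lambda>Y. rho \<eta> (Y - X))" "(LINT Y|lebesgue. rho \<eta> (Y - X)) = 1"
  using lebesgue_tensor[OF integral_deriv_stp(1)[OF assms, of "X $ 1"] integral_deriv_stp(1)[OF assms, of "X $ 2"]]
  by (simp_all add: rho_def tensor_def integral_deriv_stp(2)[OF assms])

lemma rho_nonneg: "0 < \<eta> \<Longrightarrow> 0 \<le> rho \<eta> z"
  by (simp add: rho_def tensor_def deriv_stp_nonneg)

lemma rho_outside: "0 < \<eta> \<Longrightarrow> Y \<notin> sqbox X \<eta> \<Longrightarrow> rho \<eta> (Y - X) = 0"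
  unfolding rho_def using smooth_cc_deriv_stp[of \<eta>] sqbox_shift[of Y X \<eta>]
  by (intro tensor_zero_outside[where R=\<eta>]) (auto simp: smooth_cc_def)

lemma lip_kern_rho: "0 < \<eta> \<Longrightarrow> \<exists>L. lip_kern \<eta> L (rho \<eta>)"
  unfolding rho_def by (intro lip_kern_tensor smooth_cc_deriv_stp) auto

text \<open>A bound for the derivative of the step at scale \<open>1\<close>; at scale \<open>\<eta>\<close> it becomes \<open>M0 / \<eta>\<close>.\<close>

definition M0 :: real where "M0 = (SOME P. 0 \<le> P \<and> (\<forall>t. \<bar>deriv (stp 1) t\<bar> \<le> P))"

lemma M0: "0 \<le> M0" "\<bar>deriv (stp 1) t\<bar> \<le> M0"
proof -
  have "\<exists>P. 0 \<le> P \<and> (\<forall>t. \<bar>deriv (stp 1) t\<bar> \<le> P)"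
    using smooth_cc_bounded[OF smooth_cc_deriv_stp[of 1]] by auto
  from someI_ex[OF this] show "0 \<le> M0" "\<bar>deriv (stp 1) t\<bar> \<le> M0" by (auto simp: M0_def)
qed

lemma kern_rho: "0 < \<eta> \<Longrightarrow> kern \<eta> (M0 / \<eta> * (M0 / \<eta>)) (rho \<eta>)"
  unfolding rho_def
proof (rule kern_tensorI)
  assume \<eta>: "0 < \<eta>"
  show "continuous_on UNIV (deriv (stp \<eta>))" "continuous_on UNIV (deriv (stp \<eta>))"
    using smooth_cc_deriv_stp[OF \<eta>] smooth1_continuous by (auto simp: smooth_cc_def)
  show "\<bar>deriv (stp \<eta>) t\<bar> \<le> M0 / \<eta>" "\<bar>deriv (stp \<eta>) t\<bar> \<le> M0 / \<eta>" for t
    using M0(2)[of "t / \<eta>"] \<eta> by (simp_all add: deriv_stp divide_right_mono)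
  show "deriv (stp \<eta>) t = 0" "deriv (stp \<eta>) t = 0" if "\<eta> < \<bar>t\<bar>" for t
    using smooth_cc_deriv_stp[OF \<eta>] that by (auto simp: smooth_cc_def)
qed

text \<open>The size \<open>(M0 / \<eta>)\<^sup>2\<close> of the mollifier and the area of its support compensate each other.\<close>

lemma corr_rho_L2:
  assumes "0 < \<eta>" "L2_fun h"
  shows "L2_fun (corr (rho \<eta>) h)" "L2n (corr (rho \<eta>) h) \<le> 6 * M0\<^sup>2 * L2n h"
proof -
  obtain L where L: "lip_kern \<eta> L (rho \<eta>)" using lip_kern_rho[OF assms(1)] by blast
  from corr_L2[OF L kern_rho[OF assms(1)] assms(2,1)] assms(1)
  show "L2_fun (corr (rho \<eta>) h)" "L2n (corr (rho \<eta>) h) \<le> 6 * M0\<^sup>2 * L2n h"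
    by (auto simp: power2_eq_square)
qed

lemma corr_rho_close:
  assumes \<eta>: "0 < \<eta>" and f: "loc_integrable f" and w: "\<And>Y. Y \<in> sqbox X \<eta> \<Longrightarrow> \<bar>f Y - f X\<bar> \<le> w"
  shows "\<bar>corr (rho \<eta>) f X - f X\<bar> \<le> w"
proof -
  have i1: "integrable lebesgue (\<lambda>Y. rho \<eta> (Y - X) * f Y)" by (rule kern_integrable[OF kern_rho[OF \<eta>] f])
  have i2: "integrable lebesgue (\<lambda>Y. rho \<eta> (Y - X) * f X)" using integral_rho(1)[OF \<eta>] by simp
  have "corr (rho \<eta>) f X - f X = (LINT Y|lebesgue. rho \<eta> (Y - X) * f Y) - (LINT Y|lebesgue. rho \<eta> (Y - X) * f X)"
    by (simp add: corr_def integral_rho(2)[OF \<eta>])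
  also have "\<dots> = (LINT Y|lebesgue. rho \<eta> (Y - X) * f Y - rho \<eta> (Y - X) * f X)"
    by (rule Bochner_Integration.integral_diff[symmetric, OF i1 i2])
  also have "\<bar>\<dots>\<bar> \<le> (LINT Y|lebesgue. rho \<eta> (Y - X) * w)"
  proof (rule order_trans[OF integral_abs_bound integral_mono])
    show "integrable lebesgue (\<lambda>Y. \<bar>rho \<eta> (Y - X) * f Y - rho \<eta> (Y - X) * f X\<bar>)" using i1 i2 by simp
    show "integrable lebesgue (\<lambda>Y. rho \<eta> (Y - X) * w)" using integral_rho(1)[OF \<eta>] by simp
    fix Y
    show "\<bar>rho \<eta> (Y - X) * f Y - rho \<eta> (Y - X) * f X\<bar> \<le> rho \<eta> (Y - X) * w"
    proof (cases "Y \<in> sqbox X \<eta>")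
      case True
      have "\<bar>rho \<eta> (Y - X) * f Y - rho \<eta> (Y - X) * f X\<bar> = rho \<eta> (Y - X) * \<bar>f Y - f X\<bar>"
        using rho_nonneg[OF \<eta>, of "Y - X"] by (simp add: right_diff_distrib[symmetric] abs_mult)
      then show ?thesis using w[OF True] rho_nonneg[OF \<eta>, of "Y - X"] by (simp add: mult_left_mono)
    qed (simp add: rho_outside[OF \<eta>])
  qed
  also have "\<dots> = w" by (simp add: integral_rho(2)[OF \<eta>])
  finally show ?thesis .
qed

lemma sqbox_dist: "Y \<in> sqbox X s \<Longrightarrow> dist Y X \<le> 2 * s"
proof -
  assume Y: "Y \<in> sqbox X s"
  have "norm (Y - X) \<le> (\<Sum>i\<in>UNIV. \<bar>(Y - X) $ i\<bar>)" by (rule norm_le_l1_cart)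
  also have "\<dots> \<le> (\<Sum>i\<in>(UNIV::2 set). s)" by (rule sum_mono) (use Y in \<open>simp add: sqbox_def\<close>)
  finally show ?thesis by (simp add: dist_norm)
qed

lemma continuous_loc_integrable:
  assumes "continuous_on UNIV f" shows "loc_integrable f"
  unfolding loc_integrable_def
proof (intro allI impI)
  fix K :: "(real^2) set" assume K: "compact K"
  have "set_integrable lborel K f"
    by (rule borel_integrable_compact[OF K continuous_on_subset[OF assms subset_UNIV], folded set_integrable_def])
  moreover have "(\<lambda>x. indicat_real K x *\<^sub>R f x) \<in> borel_measurable borel"
  proof -
    have [measurable]: "K \<in> sets borel" "f \<in> borel_measurable borel"
      using borel_compact[OF K] borel_measurable_continuous_onI[OF assms] by auto
    show ?thesis by measurable
  qed
  ultimately show "set_integrable lebesgue K f" by (simp add: set_integrable_def integrable_completion)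
qed

lemma corr_rho_tendsto_continuous:
  assumes f: "continuous_on UNIV f"
  shows "((\<lambda>\<eta>. corr (rho \<eta>) f X) \<longlongrightarrow> f X) (at_right 0)"
proof (rule tendstoI)
  fix e :: real assume e: "0 < e"
  have "isCont f X" using f by (simp add: continuous_on_eq_continuous_at)
  then obtain d where d: "d > 0" "\<And>Y. dist Y X < d \<Longrightarrow> dist (f Y) (f X) < e / 2"
    using e unfolding continuous_at_eps_delta by (metis half_gt_zero)
  have "dist (corr (rho \<eta>) f X) (f X) < e" if \<eta>: "0 < \<eta>" "\<eta> < d / 2" for \<eta>
  proof -
    have "\<bar>corr (rho \<eta>) f X - f X\<bar> \<le> e / 2"
    proof (rule corr_rho_close[OF \<eta>(1) continuous_loc_integrable[OF f]])
      fix Y assume "Y \<in> sqbox X \<eta>"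
      then have "dist Y X < d" using sqbox_dist[of Y X \<eta>] \<eta> by simp
      then show "\<bar>f Y - f X\<bar> \<le> e / 2" using d(2)[of Y] by (simp add: dist_real_def)
    qed
    then show ?thesis using e by (simp add: dist_real_def)
  qed
  then show "\<forall>\<^sub>F \<eta> in at_right 0. dist (corr (rho \<eta>) f X) (f X) < e"
    unfolding eventually_at_right[OF zero_less_one] using d(1) by (intro exI[of _ "d/2"]) auto
qed

text \<open>
  Mollification converges in \<open>L\<^sup>2\<close>: it does so for continuous functions with compact support, and
  the operators are uniformly bounded.
\<close>

lemma corr_rho_tendsto_L2:
  assumes h: "L2_fun h"
  shows "((\<lambda>\<eta>. L2n (\<lambda>X. corr (rho \<eta>) h X - h X)) \<longlongrightarrow> 0) (at_right 0)"
proof (rule tendstoI)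
  fix e' :: real assume e': "0 < e'"
  define e where "e = e' / (6 * M0\<^sup>2 + 3)"
  have M: "6 * M0\<^sup>2 + 3 > 0" by (intro add_nonneg_pos) simp_all
  have e: "0 < e" using e' M by (simp add: e_def)
  obtain f R where f: "continuous_on UNIV f" "0 < R" "\<And>x. x \<notin> sqbox 0 R \<Longrightarrow> f x = 0"
    "L2_fun f" "L2n (\<lambda>x. h x - f x) < e"
    by (rule L2_approx_continuous[OF h e]) auto
  have "uniformly_continuous_on (sqbox 0 (R + 2)) f"
    by (intro compact_uniformly_continuous continuous_on_subset[OF f(1)]) auto
  moreover define w where "w = e / (2 * (R + 1))"
  moreover have w: "w > 0" using e f(2) by (simp add: w_def)
  ultimately obtain d where d: "d > 0" "\<And>X Y. X \<in> sqbox 0 (R + 2) \<Longrightarrow> Y \<in> sqbox 0 (R + 2) \<Longrightarrow> dist Y X < d \<Longrightarrow> dist (f Y) (f X) < w"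
    unfolding uniformly_continuous_on_def by metis
  have main: "L2n (\<lambda>X. corr (rho \<eta>) h X - h X) < e'" if \<eta>: "0 < \<eta>" "\<eta> < min 1 (d / 2)" for \<eta>
  proof -
    obtain L where L: "lip_kern \<eta> L (rho \<eta>)" using lip_kern_rho[OF \<eta>(1)] by blast
    have fl: "loc_integrable f" by (rule L2_fun_loc_integrable[OF f(4)])
    have cf: "\<bar>corr (rho \<eta>) f X - f X\<bar> \<le> w * indicator (sqbox 0 (R + 1)) X" for X
    proof (cases "X \<in> sqbox 0 (R + 1)")
      case True
      have "\<bar>corr (rho \<eta>) f X - f X\<bar> \<le> w"
      proof (rule corr_rho_close[OF \<eta>(1) fl])
        fix Y assume Y: "Y \<in> sqbox X \<eta>"
        have "\<bar>Y $ i\<bar> \<le> R + 2" "\<bar>X $ i\<bar> \<le> R + 2" for i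
        proof -
          have "\<bar>Y $ i - X $ i\<bar> \<le> \<eta>" "\<bar>X $ i\<bar> \<le> R + 1" using True Y by (auto simp: sqbox_def)
          then show "\<bar>Y $ i\<bar> \<le> R + 2" "\<bar>X $ i\<bar> \<le> R + 2" using \<eta> by linarith+
        qed
        then have "dist (f Y) (f X) < w"
          using sqbox_dist[OF Y] \<eta> by (intro d(2)) (auto simp: sqbox_def)
        then show "\<bar>f Y - f X\<bar> \<le> w" by (simp add: dist_real_def)
      qed
      then show ?thesis using True by simp
    next
      case False
      then obtain i where i: "\<not> \<bar>X $ i - 0 $ i\<bar> \<le> R + 1" unfolding sqbox_def by blast
      have "\<bar>corr (rho \<eta>) f X - f X\<bar> \<le> 0"
      proof (rule corr_rho_close[OF \<eta>(1) fl])
        fix Y assume Y: "Y \<in> sqbox X \<eta>"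
        then have "\<bar>Y $ i - X $ i\<bar> \<le> \<eta>" by (simp add: sqbox_def)
        then have "\<not> \<bar>Y $ i - 0 $ i\<bar> \<le> R" "\<not> \<bar>X $ i - 0 $ i\<bar> \<le> R"
            using i \<eta> unfolding zero_index by linarith+
        then have "Y \<notin> sqbox 0 R" "X \<notin> sqbox 0 R" unfolding sqbox_def by blast+
        then show "\<bar>f Y - f X\<bar> \<le> 0" by (simp add: f(3))
      qed
      then show ?thesis using False by simp
    qed
    have mf: "(\<lambda>X. corr (rho \<eta>) f X - f X) \<in> borel_measurable lebesgue"
      by (intro borel_measurable_diff corr_measurable[OF L fl] L2_fun_measurable f)
    have R1: "0 \<le> R + 1" using f(2) by simp
    note l1 = L2_fun_sqbox_bounded[OF mf cf R1]
    have hf: "L2_fun (\<lambda>X. h X - f X)" by (rule L2_fun_diff(1)[OF h f(4)])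
    note l2 = corr_rho_L2[OF \<eta>(1) hf]
    have fh: "L2_fun (\<lambda>X. f X - h X)" by (rule L2_fun_diff(1)[OF f(4) h])
    have eq: "(\<lambda>X. corr (rho \<eta>) h X - h X) = (\<lambda>X. corr (rho \<eta>) (\<lambda>X. h X - f X) X + ((corr (rho \<eta>) f X - f X) + (f X - h X)))"
      by (simp add: corr_diff_fun[OF lip_kernD(1)[OF L] L2_fun_loc_integrable[OF h] fl])
    have "L2n (\<lambda>X. corr (rho \<eta>) h X - h X) \<le> L2n (corr (rho \<eta>) (\<lambda>X. h X - f X)) + (L2n (\<lambda>X. corr (rho \<eta>) f X - f X) + L2n (\<lambda>X. f X - h X))"
      unfolding eq using L2_fun_add(2)[OF l2(1) L2_fun_add(1)[OF l1(1) fh]] L2_fun_add(2)[OF l1(1) fh] by simp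
    also have "\<dots> \<le> 6 * M0\<^sup>2 * e + (w * (2 * (R + 1)) + e)"
    proof (intro add_mono)
      show "L2n (corr (rho \<eta>) (\<lambda>X. h X - f X)) \<le> 6 * M0\<^sup>2 * e"
        by (rule order_trans[OF l2(2)]) (use f(5) in \<open>auto intro!: mult_left_mono\<close>)
      show "L2n (\<lambda>X. corr (rho \<eta>) f X - f X) \<le> w * (2 * (R + 1))" using l1(2) w by simp
      show "L2n (\<lambda>X. f X - h X) \<le> e" using f(5) L2n_diff_commute[of f h] by simp
    qed
    also have "w * (2 * (R + 1)) = e" using f(2) by (simp add: w_def)
    also have "6 * M0\<^sup>2 * e + (e + e) < (6 * M0\<^sup>2 + 3) * e" using e by (simp add: algebra_simps)
    also have "\<dots> = e'" using M by (simp add: e_def)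
    finally show ?thesis .
  qed
  show "\<forall>\<^sub>F \<eta> in at_right 0. dist (L2n (\<lambda>X. corr (rho \<eta>) h X - h X)) 0 < e'"
    unfolding eventually_at_right[OF zero_less_one]
    using d(1) main by (intro exI[of _ "min 1 (d / 2)"]) (auto simp: dist_real_def)
qed

subsection \<open>Families depending continuously on time\<close>

lemma L2n_bounded_on_compact:
  assumes W: "\<And>\<tau>. L2_fun (W \<tau>)" and c: "\<And>\<tau>. ((\<lambda>s. L2n (\<lambda>X. W s X - W \<tau> X)) \<longlongrightarrow> 0) (at \<tau>)"
  shows "\<exists>B\<ge>0. \<forall>\<tau>\<in>{-T..T::real}. L2n (W \<tau>) \<le> B"
proof -
  have "isCont (\<lambda>s. L2n (W s)) \<tau>" for \<tau>
  proof -
    have "((\<lambda>s. L2n (W s) - L2n (W \<tau>)) \<longlongrightarrow> 0) (at \<tau>)"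
      by (rule Lim_null_comparison[OF _ c[of \<tau>]]) (simp add: L2n_triangle_diff W)
    then show ?thesis by (simp add: isCont_def LIM_zero_iff)
  qed
  then have "continuous_on {-T..T} (\<lambda>s. L2n (W s))" by (simp add: continuous_at_imp_continuous_on)
  then have "bounded ((\<lambda>s. L2n (W s)) ` {-T..T})"
    by (intro compact_imp_bounded compact_continuous_image) auto
  then obtain B where B: "B > 0" "\<forall>y\<in>(\<lambda>s. L2n (W s)) ` {-T..T}. norm y \<le> B" unfolding bounded_pos by blast
  show ?thesis
  proof (intro exI[of _ B] conjI ballI)
    fix \<tau> assume "\<tau> \<in> {-T..T}"
    then have "norm (L2n (W \<tau>)) \<le> B" using B(2) by blast
    then show "L2n (W \<tau>) \<le> B" by simp
  qed (use B(1) in simp)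
qed

text \<open>
  Equi-Lipschitz functionals that tend to zero pointwise do so uniformly on the compact orbit of a
  continuous family.
\<close>

lemma L2_uniform_on_compact:
  assumes W: "\<And>\<tau>. L2_fun (W \<tau>)" and c: "\<And>\<tau>. ((\<lambda>s. L2n (\<lambda>X. W s X - W \<tau> X)) \<longlongrightarrow> 0) (at \<tau>)"
    and lip: "\<forall>\<^sub>F p in F. \<forall>h h'. L2_fun h \<longrightarrow> L2_fun h' \<longrightarrow> \<bar>\<Phi> p h - \<Phi> p h'\<bar> \<le> C * L2n (\<lambda>X. h X - h' X)"
    and lim: "\<And>h. L2_fun h \<Longrightarrow> ((\<lambda>p. \<Phi> p h) \<longlongrightarrow> 0) F" and e: "0 < e"
  shows "\<forall>\<^sub>F p in F. \<forall>\<tau>\<in>{-T..T::real}. \<bar>\<Phi> p (W \<tau>)\<bar> < e"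
proof -
  have "\<exists>d>0. \<forall>s. dist s \<tau> < d \<longrightarrow> \<bar>C\<bar> * L2n (\<lambda>X. W s X - W \<tau> X) < e / 2" for \<tau>
  proof -
    have "((\<lambda>s. \<bar>C\<bar> * L2n (\<lambda>X. W s X - W \<tau> X)) \<longlongrightarrow> 0) (at \<tau>)"
      using tendsto_mult_right_zero[OF c[of \<tau>], of "\<bar>C\<bar>"] by simp
    then have "\<forall>\<^sub>F s in at \<tau>. \<bar>C\<bar> * L2n (\<lambda>X. W s X - W \<tau> X) < e / 2"
      using e by (intro order_tendstoD) auto
    then obtain d where "d > 0" "\<And>s. s \<noteq> \<tau> \<Longrightarrow> dist s \<tau> < d \<Longrightarrow> \<bar>C\<bar> * L2n (\<lambda>X. W s X - W \<tau> X) < e / 2"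
      unfolding eventually_at by auto
    moreover have "L2n (\<lambda>X. W \<tau> X - W \<tau> X) = 0" by (simp add: L2n_def L2_norm_def)
    ultimately show ?thesis using e by (metis half_gt_zero mult_zero_right)
  qed
  then obtain d where d: "\<And>\<tau>. d \<tau> > 0" "\<And>\<tau> s. dist s \<tau> < d \<tau> \<Longrightarrow> \<bar>C\<bar> * L2n (\<lambda>X. W s X - W \<tau> X) < e / 2"
    by metis
  have sub: "{-T..T} \<subseteq> (\<Union>\<tau>\<in>{-T..T}. ball \<tau> (d \<tau>))" using d(1) by force
  obtain D where D: "D \<subseteq> {-T..T}" "finite D" "{-T..T} \<subseteq> (\<Union>\<tau>\<in>D. ball \<tau> (d \<tau>))"
    by (rule compactE_image[OF compact_Icc _ sub]) auto
  have "\<forall>\<^sub>F p in F. \<forall>\<tau>\<in>D. \<bar>\<Phi> p (W \<tau>)\<bar> < e / 2"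
  proof (rule eventually_ball_finite[OF D(2)], rule ballI)
    fix \<tau>
    show "\<forall>\<^sub>F p in F. \<bar>\<Phi> p (W \<tau>)\<bar> < e / 2"
      using lim[OF W[of \<tau>], THEN tendsto_rabs] e by (intro order_tendstoD(2)[of _ 0]) auto
  qed
  with lip show ?thesis
  proof eventually_elim
    case (elim p)
    show ?case
    proof
      fix s assume "s \<in> {-T..T}"
      then obtain \<tau> where \<tau>: "\<tau> \<in> D" "dist s \<tau> < d \<tau>" using D(3) by (auto simp: dist_commute)
      have "\<bar>\<Phi> p (W s) - \<Phi> p (W \<tau>)\<bar> \<le> C * L2n (\<lambda>X. W s X - W \<tau> X)" using elim(1) W by blast
      also have "\<dots> \<le> \<bar>C\<bar> * L2n (\<lambda>X. W s X - W \<tau> X)" by (intro mult_right_mono) auto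
      also have "\<dots> < e / 2" by (rule d(2)[OF \<tau>(2)])
      finally show "\<bar>\<Phi> p (W s)\<bar> < e" using bspec[OF elim(2) \<tau>(1)] by linarith
    qed
  qed
qed

section \<open>Weak derivatives and weak solutions\<close>

subsection \<open>The fundamental lemma of the calculus of variations\<close>

text \<open>The indicator of a box is a bounded pointwise limit of products of smooth steps.\<close>

lemma integral_box_zero_of_test:
  assumes h: "loc_integrable h" and z: "\<And>w. test_fun w \<Longrightarrow> (LINT x|lebesgue. h x * w x) = 0"
  shows "(LINT x:box a b|lebesgue. h x) = 0"
proof -
  define p where "p n i t = sstep (real n * (t - a $ i) - 1) * sstep (real n * (b $ i - t) - 1)" for n :: nat and i :: 2 and t
  define w where "w n = tensor (p n 1) (p n 2)" for n
  have psm: "smooth1 (p n i)" for n i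
  proof -
    have "smooth1 (\<lambda>t. sstep (real n * t + (- real n * a $ i - 1)) * sstep (- real n * t + (real n * b $ i - 1)))"
      by (intro smooth1_mult smooth1_affine sstep(1))
    then show ?thesis by (simp add: p_def[abs_def] algebra_simps)
  qed
  have p0: "p n i t = 0" if "t \<le> a $ i \<or> b $ i \<le> t" for n i t
    using that
  proof
    assume "t \<le> a $ i"
    then have "real n * (t - a $ i) \<le> 0" by (simp add: mult_nonneg_nonpos)
    then show ?thesis by (simp add: p_def sstep(3))
  next
    assume "b $ i \<le> t"
    then have "real n * (b $ i - t) \<le> 0" by (simp add: mult_nonneg_nonpos)
    then show ?thesis by (simp add: p_def sstep(3))
  qed
  have pb: "0 \<le> p n i t" "p n i t \<le> 1" for n i t
    using sstep_bounds by (auto simp: p_def intro!: mult_nonneg_nonneg mult_le_one)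
  have plim: "(\<lambda>n. p n i t) \<longlonglongrightarrow> 1" if t: "a $ i < t" "t < b $ i" for i t
  proof (rule tendsto_eventually)
    obtain N1 N2 :: nat where N: "2 / (t - a $ i) \<le> real N1" "2 / (b $ i - t) \<le> real N2"
      using real_arch_simple by metis
    show "\<forall>\<^sub>F n in sequentially. p n i t = 1"
    proof (rule eventually_sequentiallyI[of "max N1 N2"])
      fix n assume n: "max N1 N2 \<le> n"
      have "2 / (t - a $ i) \<le> real n" "2 / (b $ i - t) \<le> real n" using N n by linarith+
      then have "2 \<le> real n * (t - a $ i)" "2 \<le> real n * (b $ i - t)" using t by (simp_all add: divide_le_eq)
      then show "p n i t = 1" by (simp add: p_def sstep(4))
    qed
  qed
  define R where "R = (\<Sum>i\<in>UNIV. \<bar>a $ i\<bar> + \<bar>b $ i\<bar>)"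
  have pR: "p n i t = 0" if "R < \<bar>t\<bar>" for n i t
  proof (rule p0)
    have "\<bar>a $ i\<bar> + \<bar>b $ i\<bar> \<le> R" unfolding R_def by (rule member_le_sum) auto
    then show "t \<le> a $ i \<or> b $ i \<le> t" using that by linarith
  qed
  have "test_fun (w n)" for n unfolding w_def by (rule test_fun_tensor[OF psm psm pR pR])
  then have z': "(LINT x|lebesgue. h x * w n x) = 0" for n by (rule z)
  have wb: "\<bar>w n x\<bar> \<le> indicator (box a b) x" for n x
  proof (cases "x \<in> box a b")
    case True
    have "\<bar>w n x\<bar> = p n 1 (x $ 1) * p n 2 (x $ 2)"
      unfolding w_def tensor_def using pb by (simp add: abs_of_nonneg)
    also have "\<dots> \<le> 1" by (intro mult_le_one pb)
    finally show ?thesis using True by simp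
  next
    case False
    then obtain i where "\<not> (a $ i < x $ i \<and> x $ i < b $ i)" by (auto simp: mem_box_cart)
    then have "p n i (x $ i) = 0" by (intro p0) auto
    then show ?thesis using exhaust_2[of i] False by (auto simp: w_def tensor_def)
  qed
  have hm: "h \<in> borel_measurable lebesgue" by (rule loc_integrable_measurable[OF h])
  have "set_integrable lebesgue (cbox a b) h" using h by (simp add: loc_integrable_def)
  then have hi: "set_integrable lebesgue (box a b) h"
    by (rule set_integrable_subset) (auto simp: box_subset_cbox)
  have wm: "w n \<in> borel_measurable lebesgue" for n
  proof -
    have "w n \<in> borel_measurable borel"
      unfolding w_def by (intro borel_measurable_continuous_onI continuous_on_tensor smooth1_continuous psm)
    then show ?thesis by (simp add: measurable_completion)
  qed
  have "(\<lambda>n. LINT x|lebesgue. h x * w n x) \<longlonglongrightarrow> (LINT x|lebesgue. indicator (box a b) x *\<^sub>R h x)"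
  proof (rule integral_dominated_convergence[where w="\<lambda>x. \<bar>indicator (box a b) x *\<^sub>R h x\<bar>"])
    show "(\<lambda>x. indicat_real (box a b) x *\<^sub>R h x) \<in> borel_measurable lebesgue"
      using hi unfolding set_integrable_def by (rule borel_measurable_integrable)
    show "integrable lebesgue (\<lambda>x. \<bar>indicat_real (box a b) x *\<^sub>R h x\<bar>)"
      using hi unfolding set_integrable_def by simp
    show "AE x in lebesgue. (\<lambda>n. h x * w n x) \<longlonglongrightarrow> indicat_real (box a b) x *\<^sub>R h x"
    proof (intro always_eventually allI)
      fix x
      show "(\<lambda>n. h x * w n x) \<longlonglongrightarrow> indicat_real (box a b) x *\<^sub>R h x"
      proof (cases "x \<in> box a b")
        case True
        then have "(\<lambda>n. h x * (p n 1 (x $ 1) * p n 2 (x $ 2))) \<longlonglongrightarrow> h x * (1 * 1)"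
          by (intro tendsto_intros plim) (auto simp: mem_box_cart)
        then show ?thesis using True by (simp add: w_def tensor_def)
      next
        case False
        then have "w n x = 0" for n using wb[of n x] by simp
        then show ?thesis using False by simp
      qed
    qed
    show "AE x in lebesgue. norm (h x * w n x) \<le> \<bar>indicat_real (box a b) x *\<^sub>R h x\<bar>" for n
    proof (intro always_eventually allI)
      fix x
      have "\<bar>h x\<bar> * \<bar>w n x\<bar> \<le> \<bar>h x\<bar> * indicator (box a b) x" by (intro mult_left_mono wb) simp
      then show "norm (h x * w n x) \<le> \<bar>indicat_real (box a b) x *\<^sub>R h x\<bar>"
        by (simp add: abs_mult mult.commute)
    qed
  qed (intro borel_measurable_times hm wm)
  then have "(\<lambda>n. 0) \<longlonglongrightarrow> (LINT x|lebesgue. indicat_real (box a b) x *\<^sub>R h x)" using z' by simp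
  then show ?thesis unfolding set_lebesgue_integral_def using LIMSEQ_unique tendsto_const by blast
qed

text \<open>Boxes generate the Borel sets, so vanishing integrals over boxes propagate to all Borel sets.\<close>

lemma AE_zero_of_boxes:
  fixes g :: "real^2 \<Rightarrow> real"
  assumes g: "integrable lborel g" and g0: "(LINT x|lborel. g x) = 0"
    and z: "\<And>a b. (LINT x:box a b|lborel. g x) = 0"
  shows "AE x in lborel. g x = 0"
proof -
  have [measurable]: "g \<in> borel_measurable borel" using g by (auto dest: borel_measurable_integrable)
  have si: "set_integrable lborel A g" if "A \<in> sets borel" for A
    unfolding set_integrable_def using integrable_mult_indicator[of A lborel g] that g by simp
  have sg: "sigma_sets UNIV (range (\<lambda>(a, b). box a b)) = sets (borel :: (real^2) measure)"
    by (subst borel_eq_box) simp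
  have all: "(LINT x:A|lborel. g x) = 0" if A: "A \<in> sets borel" for A
  proof (rule sigma_sets_induct_disjoint[of "range (\<lambda>(a, b). box a b :: (real^2) set)" UNIV A
      "\<lambda>A. (LINT x:A|lborel. g x) = 0"])
    show "Int_stable (range (\<lambda>(a, b). box a b :: (real^2) set))"
      by (auto simp: Int_stable_def box_Int_box)
    show "A \<in> sigma_sets UNIV (range (\<lambda>(a, b). box a b))" using A by (simp add: sg)
    show "(LINT x:B|lborel. g x) = 0" if "B \<in> range (\<lambda>(a, b). box a b)" for B using that z by auto
    show "(LINT x:(UNIV - B)|lborel. g x) = 0" if B: "B \<in> sigma_sets UNIV (range (\<lambda>(a, b). box a b))" "(LINT x:B|lborel. g x) = 0" for B
    proof -
      have Bs: "B \<in> sets borel" using B(1) by (simp add: sg)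
      have "(LINT x:(UNIV - B)|lborel. g x) + (LINT x:B|lborel. g x) = (LINT x:(UNIV - B) \<union> B|lborel. g x)"
        by (rule set_integral_Un[symmetric]) (use si Bs in auto)
      then show ?thesis using B(2) g0 by (simp add: set_lebesgue_integral_def)
    qed
    show "(LINT x:(\<Union>i::nat. B i)|lborel. g x) = 0"
      if B: "disjoint_family B" "range B \<subseteq> sigma_sets UNIV (range (\<lambda>(a, b). box a b))" "\<And>i. (LINT x:B i|lborel. g x) = 0" for B
    proof -
      have Bs: "B i \<in> sets borel" for i using B(2) by (auto simp: sg)
      have "(LINT x:(\<Union>i. B i)|lborel. g x) = (\<Sum>i. LINT x:B i|lborel. g x)"
        by (rule lebesgue_integral_countable_add) (use Bs B(1) si in \<open>auto simp: disjoint_family_on_def\<close>)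
      then show ?thesis using B(3) by simp
    qed
  qed (auto simp: set_lebesgue_integral_def)
  have "AE x in lborel. indicator {x. 0 < g x} x * g x = 0"
  proof (subst integral_nonneg_eq_0_iff_AE[symmetric])
    show "integrable lborel (\<lambda>x. indicator {x. 0 < g x} x * g x)" using si[of "{x. 0 < g x}"] by (simp add: set_integrable_def)
    show "(LINT x|lborel. indicator {x. 0 < g x} x * g x) = 0" using all[of "{x. 0 < g x}"] by (simp add: set_lebesgue_integral_def)
  qed (auto split: split_indicator)
  moreover have "AE x in lborel. indicator {x. g x < 0} x * (- g x) = 0"
  proof (subst integral_nonneg_eq_0_iff_AE[symmetric])
    show "integrable lborel (\<lambda>x. indicator {x. g x < 0} x * (- g x))" using si[of "{x. g x < 0}"] by (simp add: set_integrable_def)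
    show "(LINT x|lborel. indicator {x. g x < 0} x * (- g x)) = 0" using all[of "{x. g x < 0}"] by (simp add: set_lebesgue_integral_def)
  qed (auto split: split_indicator)
  ultimately show ?thesis
    by eventually_elim (auto split: split_indicator_asm)
qed

text \<open>Localisation to large boxes reduces this to integrable functions with vanishing integrals over boxes.\<close>

lemma AE_zero_of_test:
  assumes h: "loc_integrable h" and z: "\<And>w. test_fun w \<Longrightarrow> (LINT x|lebesgue. h x * w x) = 0"
  shows "AE x in lebesgue. h x = 0"
proof -
  obtain h' where h': "h' \<in> borel_measurable lborel" "AE x in lborel. h x = h' x"
    using completion_ex_borel_measurable_real[OF loc_integrable_measurable[OF h]] by blast
  have ae: "AE x in lebesgue. h x = h' x" by (rule AE_completion[OF h'(2)])
  define Q where "Q n = box (- vec (real n)) (vec (real n) :: real^2)" for n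
  have Qm [measurable]: "Q n \<in> sets borel" for n by (simp add: Q_def)
  have [measurable]: "h' \<in> borel_measurable borel" using h'(1) by simp
  have h'm: "h' \<in> borel_measurable lebesgue" using h'(1) by (rule measurable_completion)
  have eqint: "(LINT x:box a b|lborel. h' x) = 0" for a b
  proof -
    have "(LINT x:box a b|lborel. h' x) = (LINT x:box a b|lebesgue. h' x)"
      unfolding set_lebesgue_integral_def by (rule integral_completion[symmetric]) measurable
    also have "\<dots> = (LINT x:box a b|lebesgue. h x)"
      by (rule set_lebesgue_integral_cong_AE) (use ae h'm loc_integrable_measurable[OF h] in \<open>auto elim!: eventually_mono\<close>)
    finally show ?thesis using integral_box_zero_of_test[OF h z] by simp
  qed
  have "AE x in lborel. indicator (Q n) x * h' x = 0" for n
  proof (rule AE_zero_of_boxes)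
    have "set_integrable lebesgue (cbox (- vec (real n)) (vec (real n))) h" using h by (simp add: loc_integrable_def)
    then have "set_integrable lebesgue (Q n) h"
      by (rule set_integrable_subset) (auto simp: Q_def box_subset_cbox)
    then have "integrable lebesgue (\<lambda>x. indicator (Q n) x * h x)" by (simp add: set_integrable_def)
    then have "integrable lebesgue (\<lambda>x. indicator (Q n) x * h' x)"
      by (rule integrable_cong_AE_imp) (use ae h'm in \<open>auto elim!: eventually_mono intro!: borel_measurable_times borel_measurable_indicator\<close>)
    then show "integrable lborel (\<lambda>x. indicator (Q n) x * h' x)"
      by (subst (asm) integrable_completion) auto
    show "(LINT x|lborel. indicator (Q n) x * h' x) = 0"
      using eqint[of "- vec (real n)" "vec (real n)"] by (simp add: set_lebesgue_integral_def Q_def)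
    fix a b :: "real^2"
    obtain c d where cd: "box a b \<inter> Q n = box c d" unfolding Q_def box_Int_box by blast
    have "(\<lambda>x. indicator (box a b) x *\<^sub>R (indicator (Q n) x * h' x)) = (\<lambda>x. indicator (box c d) x *\<^sub>R h' x)"
      unfolding cd[symmetric] by (auto split: split_indicator)
    then show "(LINT x:box a b|lborel. indicator (Q n) x * h' x) = 0"
      using eqint[of c d] by (simp add: set_lebesgue_integral_def)
  qed
  then have "AE x in lborel. \<forall>n. indicator (Q n) x * h' x = 0"
    unfolding AE_all_countable by (rule allI)
  then have "AE x in lebesgue. \<forall>n. indicator (Q n) x * h' x = 0" by (rule AE_completion)
  with ae show ?thesis
  proof eventually_elim
    case (elim x)
    obtain n :: nat where n: "norm x < real n" using reals_Archimedean2 by blast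
    have "x \<in> Q n"
      unfolding Q_def mem_box_cart
    proof
      fix i
      have "\<bar>x $ i\<bar> < real n" using component_le_norm_cart[of x i] n by linarith
      then show "(- vec (real n)) $ i < x $ i \<and> x $ i < vec (real n) $ i" by auto
    qed
    then show ?case using elim by (auto dest!: spec[of _ n])
  qed
qed

subsection \<open>Weak derivatives\<close>

lemma L2_norm_mono: "(\<And>x. norm (f x) \<le> norm (g x)) \<Longrightarrow> L2_norm f \<le> L2_norm g"
  by (rule ennreal_power2_le_imp_le, unfold L2_norm_power2, rule nn_integral_mono)
     (auto intro!: ennreal_leI power_mono)

lemma has_weak_deriv_Nil: "loc_integrable f \<Longrightarrow> has_weak_deriv [] f f"
  by (simp add: has_weak_deriv_def)

text \<open>A weak derivative of order zero pairs with test functions like the function itself.\<close>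

lemma wderiv_Nil_AE:
  assumes "loc_integrable f" shows "AE x in lebesgue. wderiv [] f x = f x" "loc_integrable (wderiv [] f)"
proof -
  have *: "has_weak_deriv [] f (wderiv [] f)"
    unfolding wderiv_def by (rule someI[of "has_weak_deriv [] f"]) (rule has_weak_deriv_Nil[OF assms])
  then show l: "loc_integrable (wderiv [] f)" by (simp add: has_weak_deriv_def)
  have "AE x in lebesgue. wderiv [] f x - f x = 0"
  proof (rule AE_zero_of_test)
    show "loc_integrable (\<lambda>x. wderiv [] f x - f x)"
      using l assms unfolding loc_integrable_def by (auto intro: set_integral_diff(1))
    fix w assume w: "test_fun w"
    have wc: "continuous_on UNIV w" using w unfolding test_fun_def smooth_fun_def by (auto dest: spec[of _ "[]"])
    have wb: "bounded {x. w x \<noteq> 0}" using w unfolding test_fun_def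
      by (meson bounded_subset closure_subset compact_imp_bounded)
    obtain R where R: "R > 0" "{x. w x \<noteq> 0} \<subseteq> sqbox 0 R" using bounded_subset_sqbox[OF wb] by blast
    have "compact (w ` sqbox 0 R)" by (intro compact_continuous_image continuous_on_subset[OF wc]) auto
    then have "bounded (w ` sqbox 0 R)" by (rule compact_imp_bounded)
    then obtain C where C: "C > 0" "\<forall>y\<in>w ` sqbox 0 R. norm y \<le> C" unfolding bounded_pos by blast
    have "kern R C w"
      unfolding kern_def
    proof (intro conjI allI)
      show "w \<in> borel_measurable borel" by (rule borel_measurable_continuous_onI[OF wc])
      show "\<bar>w z\<bar> \<le> C * indicat_real (sqbox 0 R) z" for z
        using C R(2) by (cases "z \<in> sqbox 0 R") auto
    qed
    note ki = kern_integrable[OF this, of _ 0]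
    have i1: "integrable lebesgue (\<lambda>x. wderiv [] f x * w x)" using ki[OF l] by (simp add: mult.commute)
    have i2: "integrable lebesgue (\<lambda>x. f x * w x)" using ki[OF assms] by (simp add: mult.commute)
    have "(LINT x|lebesgue. f x * w x) = (LINT x|lebesgue. wderiv [] f x * w x)"
      using * w unfolding has_weak_deriv_def by simp
    then show "(LINT x|lebesgue. (wderiv [] f x - f x) * w x) = 0"
      using i1 i2 by (simp add: left_diff_distrib)
  qed
  then show "AE x in lebesgue. wderiv [] f x = f x" by simp
qed

lemma abs_wderiv_le_tensor_norm: "\<bar>wderiv \<alpha> f x\<bar> \<le> tensor_norm (length \<alpha>) f x"
proof -
  have fin: "finite {\<beta> :: 2 list. length \<beta> = length \<alpha>}"
    using finite_lists_length_eq[of "UNIV :: 2 set" "length \<alpha>"] by simp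
  have "(wderiv \<alpha> f x)\<^sup>2 \<le> (\<Sum>\<beta> | length \<beta> = length \<alpha>. (wderiv \<beta> f x)\<^sup>2)"
    by (rule member_le_sum[where f="\<lambda>\<beta>. (wderiv \<beta> f x)\<^sup>2"]) (use fin in auto)
  then show ?thesis unfolding tensor_norm_def by (rule real_le_rsqrt[OF order_trans, rotated]) simp
qed

lemma Sobolev_norm_ge:
  assumes "length \<alpha> \<le> k" "\<And>x. 1 \<le> \<rho> x"
  shows "L2_norm (wderiv \<alpha> f) \<le> Sobolev_norm \<rho> k f"
proof -
  have "L2_norm (wderiv \<alpha> f) \<le> L2_norm (\<lambda>x. \<rho> x * tensor_norm (length \<alpha>) f x)"
  proof (rule L2_norm_mono)
    fix x
    have t: "0 \<le> tensor_norm (length \<alpha>) f x" by (simp add: tensor_norm_def sum_nonneg)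
    have "\<bar>wderiv \<alpha> f x\<bar> \<le> 1 * tensor_norm (length \<alpha>) f x" using abs_wderiv_le_tensor_norm[of \<alpha> f x] by simp
    also have "\<dots> \<le> \<rho> x * tensor_norm (length \<alpha>) f x" by (intro mult_right_mono assms t)
    finally show "norm (wderiv \<alpha> f x) \<le> norm (\<rho> x * tensor_norm (length \<alpha>) f x)" by simp
  qed
  also have "\<dots> \<le> Sobolev_norm \<rho> k f"
    unfolding Sobolev_norm_def using assms(1)
    by (intro member_le_sum[where f="\<lambda>j. L2_norm (\<lambda>x. \<rho> x * tensor_norm j f x)"]) auto
  finally show ?thesis .
qed

lemma Sobolev_fun_wderiv:
  assumes f: "Sobolev_fun \<rho> k f" and \<alpha>: "length \<alpha> \<le> k" and \<rho>: "\<And>x. 1 \<le> \<rho> x"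
  shows "has_weak_deriv \<alpha> f (wderiv \<alpha> f)" "L2_fun (wderiv \<alpha> f)"
proof -
  show *: "has_weak_deriv \<alpha> f (wderiv \<alpha> f)"
    unfolding wderiv_def using f \<alpha> unfolding Sobolev_fun_def by (metis someI_ex)
  then have "wderiv \<alpha> f \<in> borel_measurable lebesgue"
    by (intro loc_integrable_measurable) (simp add: has_weak_deriv_def)
  moreover have "L2_norm (wderiv \<alpha> f) < \<infinity>"
    using Sobolev_norm_ge[OF \<alpha> \<rho>, of f] f unfolding Sobolev_fun_def by (meson le_less_trans)
  ultimately show "L2_fun (wderiv \<alpha> f)" by (simp add: L2_fun_def)
qed

lemma Sobolev_fun_L2:
  assumes f: "Sobolev_fun \<rho> k f" and \<rho>: "\<And>x. 1 \<le> \<rho> x"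
  shows "L2_fun f" "ennreal (L2n f) \<le> Sobolev_norm \<rho> k f"
proof -
  have "has_weak_deriv [] f (wderiv [] f)" by (rule Sobolev_fun_wderiv(1)[OF f _ \<rho>]) simp
  then have l: "loc_integrable f" by (simp add: has_weak_deriv_def)
  have w: "L2_fun (wderiv [] f)" by (rule Sobolev_fun_wderiv(2)[OF f _ \<rho>]) simp
  have ae: "AE x in lebesgue. f x = wderiv [] f x" using wderiv_Nil_AE(1)[OF l] by (auto elim!: eventually_mono)
  note * = L2_fun_cong_AE[OF w loc_integrable_measurable[OF l] ae]
  show "L2_fun f" by (rule *(1))
  show "ennreal (L2n f) \<le> Sobolev_norm \<rho> k f"
    using Sobolev_norm_ge[of "[]" k \<rho> f] \<rho> by (simp add: *(2) L2_norm_eq[OF w, symmetric])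
qed

subsection \<open>Finite-energy solutions of the wave equation as curves in \<open>L\<^sup>2\<close>\<close>

lemma tendsto_L2n:
  assumes "((\<lambda>s. L2_norm (f s)) \<longlongrightarrow> 0) F" shows "((\<lambda>s. L2n (f s)) \<longlongrightarrow> 0) F"
  using tendsto_enn2real[of "\<lambda>s. L2_norm (f s)" 0 F] assms by (simp add: L2n_def)

lemma wave_solution_L2:
  assumes "wave_solution c \<phi> \<psi> U V"
  shows "L2_fun (U \<tau>)" "L2_fun (V \<tau>)"
    "((\<lambda>s. L2n (\<lambda>X. U s X - U \<tau> X)) \<longlongrightarrow> 0) (at \<tau>)"
    "((\<lambda>s. L2n (\<lambda>X. V s X - V \<tau> X)) \<longlongrightarrow> 0) (at \<tau>)"
    "((\<lambda>s. L2n (\<lambda>X. (U s X - U \<tau> X) / (s - \<tau>) - V \<tau> X)) \<longlongrightarrow> 0) (at \<tau>)"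
proof -
  have S: "Sobolev_fun (\<lambda>_. 1) 1 (U \<tau>)" "L2_fun (V \<tau>)" for \<tau>
    using assms unfolding wave_solution_def by blast+
  show U: "L2_fun (U \<tau>)" for \<tau> by (rule Sobolev_fun_L2(1)[OF S(1)]) simp
  show "L2_fun (V \<tau>)" by (rule S(2))
  have l1: "((\<lambda>s. Sobolev_norm (\<lambda>_. 1) 1 (\<lambda>X. U s X - U \<tau> X)) \<longlongrightarrow> 0) (at \<tau>)"
    and l2: "((\<lambda>s. L2_norm (\<lambda>X. V s X - V \<tau> X)) \<longlongrightarrow> 0) (at \<tau>)"
    and l3: "((\<lambda>s. L2_norm (\<lambda>X. (U s X - U \<tau> X) / (s - \<tau>) - V \<tau> X)) \<longlongrightarrow> 0) (at \<tau>)"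
    using assms unfolding wave_solution_def by blast+
  show "((\<lambda>s. L2n (\<lambda>X. V s X - V \<tau> X)) \<longlongrightarrow> 0) (at \<tau>)" using l2 by (rule tendsto_L2n)
  show "((\<lambda>s. L2n (\<lambda>X. (U s X - U \<tau> X) / (s - \<tau>) - V \<tau> X)) \<longlongrightarrow> 0) (at \<tau>)" using l3 by (rule tendsto_L2n)
  have le: "L2_norm (\<lambda>X. U s X - U \<tau> X) \<le> Sobolev_norm (\<lambda>_. 1) 1 (\<lambda>X. U s X - U \<tau> X)" for s
  proof -
    have d: "L2_fun (\<lambda>X. U s X - U \<tau> X)" by (rule L2_fun_diff(1)[OF U U])
    note l = L2_fun_loc_integrable[OF d]
    have m: "wderiv [] (\<lambda>X. U s X - U \<tau> X) \<in> borel_measurable lebesgue"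
      by (rule loc_integrable_measurable[OF wderiv_Nil_AE(2)[OF l]])
    note w = L2_fun_cong_AE[OF d m wderiv_Nil_AE(1)[OF l]]
    have "L2_norm (\<lambda>X. U s X - U \<tau> X) = L2_norm (wderiv [] (\<lambda>X. U s X - U \<tau> X))"
      by (simp add: L2_norm_eq[OF d] L2_norm_eq[OF w(1)] w(2))
    also have "\<dots> \<le> Sobolev_norm (\<lambda>_. 1) 1 (\<lambda>X. U s X - U \<tau> X)" by (rule Sobolev_norm_ge) auto
    finally show ?thesis .
  qed
  have "((\<lambda>s. L2_norm (\<lambda>X. U s X - U \<tau> X)) \<longlongrightarrow> 0) (at \<tau>)"
    by (rule tendsto_sandwich[OF _ always_eventually[OF allI[OF le]] tendsto_const l1]) simp
  then show "((\<lambda>s. L2n (\<lambda>X. U s X - U \<tau> X)) \<longlongrightarrow> 0) (at \<tau>)" by (rule tendsto_L2n)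
qed

text \<open>Tested against a shifted tensor product, the weak wave equation is an equation for correlations.\<close>

lemma wave_solution_corr:
  assumes w: "wave_solution c \<phi> \<psi> U V" and p: "smooth_cc R p" and q: "smooth_cc R q"
  shows "((\<lambda>s. c * corr (tensor p q) (V s) X) has_real_derivative
     corr (\<lambda>z. tensor (deriv (deriv p)) q z + tensor p (deriv (deriv q)) z) (U \<tau>) X) (at \<tau>)"
proof -
  let ?w = "\<lambda>Y. tensor p q (Y - X)"
  have s: "smooth1 p" "smooth1 q" "smooth1 (deriv p)" "smooth1 (deriv q)"
    using p q smooth1_deriv_smooth by (auto simp: smooth_cc_def)
  have t: "test_fun ?w"
    by (rule test_fun_tensor_shift[where R=R]) (use p q in \<open>auto simp: smooth_cc_def\<close>)
  have "(\<Sum>i\<in>UNIV. iter_partial [i, i] ?w Y) = tensor (deriv (deriv p)) q (Y - X) + tensor p (deriv (deriv q)) (Y - X)" for Y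
    by (simp add: UNIV_2 partial_deriv_tensor_shift s)
  moreover have "((\<lambda>s. c * (LINT Y|lebesgue. V s Y * ?w Y)) has_real_derivative
        (LINT Y|lebesgue. U \<tau> Y * (\<Sum>i\<in>UNIV. iter_partial [i, i] ?w Y))) (at \<tau>)"
    using w t unfolding wave_solution_def by blast
  ultimately show ?thesis by (simp add: corr_def mult.commute)
qed

section \<open>Sampling the initial data\<close>

subsection \<open>Integration by parts against tensor products\<close>

text \<open>The first factor acts in direction \<open>i\<close>, so that statements about both directions are the same.\<close>

definition tens :: "2 \<Rightarrow> (real \<Rightarrow> real) \<Rightarrow> (real \<Rightarrow> real) \<Rightarrow> real^2 \<Rightarrow> real" where
  "tens i p q = (if i = 1 then tensor p q else tensor q p)"

text \<open>
  Integration by parts against products of functions of one variable. In this form it holds between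
  consecutive weak derivatives of a Sobolev function.
\<close>

definition tensor_wd :: "2 \<Rightarrow> (real^2 \<Rightarrow> real) \<Rightarrow> (real^2 \<Rightarrow> real) \<Rightarrow> bool" where
  "tensor_wd i f g \<longleftrightarrow> (\<forall>R p q x. smooth_cc R p \<longrightarrow> smooth_cc R q \<longrightarrow>
     corr (tens i (deriv p) q) f x = - corr (tens i p q) g x)"

lemma two_neq_one [simp]: "(2::2) \<noteq> 1" "(1::2) \<noteq> 2"
  by simp_all

lemma iter_partial_append: "iter_partial (\<alpha> @ [i]) w = iter_partial \<alpha> (partial_deriv i w)"
  by (induction \<alpha>) simp_all

text \<open>Both sides are pairings of \<open>f\<close> with the same derivative of order \<open>length \<alpha> + 1\<close> of the test function.\<close>

lemma Sobolev_fun_tensor_wd: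
  assumes f: "Sobolev_fun \<rho> k f" and \<alpha>: "length \<alpha> < k" and \<rho>: "\<And>x. 1 \<le> \<rho> x"
  shows "tensor_wd i (wderiv \<alpha> f) (wderiv (\<alpha> @ [i]) f)"
  unfolding tensor_wd_def
proof (intro allI impI)
  fix R p q x assume p: "smooth_cc R p" and q: "smooth_cc R q"
  have w1: "has_weak_deriv \<alpha> f (wderiv \<alpha> f)" by (rule Sobolev_fun_wderiv(1)[OF f _ \<rho>]) (use \<alpha> in simp)
  have w2: "has_weak_deriv (\<alpha> @ [i]) f (wderiv (\<alpha> @ [i]) f)" by (rule Sobolev_fun_wderiv(1)[OF f _ \<rho>]) (use \<alpha> in simp)
  have sm: "smooth1 p" "smooth1 q" using p q by (auto simp: smooth_cc_def)
  have t1: "test_fun (\<lambda>Y. tens i p q (Y - x))"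
    unfolding tens_def using p q by (auto simp: smooth_cc_def intro!: test_fun_tensor_shift[where R=R])
  have t2: "test_fun (\<lambda>Y. tens i (deriv p) q (Y - x))"
    unfolding tens_def using smooth_cc_deriv[OF p] q by (auto simp: smooth_cc_def intro!: test_fun_tensor_shift[where R=R])
  have pd: "partial_deriv i (\<lambda>Y. tens i p q (Y - x)) = (\<lambda>Y. tens i (deriv p) q (Y - x))"
    using exhaust_2[of i] by (auto simp: tens_def partial_deriv_tensor_shift sm)
  have "(LINT Y|lebesgue. f Y * iter_partial (\<alpha> @ [i]) (\<lambda>Y. tens i p q (Y - x)) Y)
      = (- 1) ^ length (\<alpha> @ [i]) * (LINT Y|lebesgue. wderiv (\<alpha> @ [i]) f Y * tens i p q (Y - x))"
    using w2 t1 unfolding has_weak_deriv_def by blast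
  moreover have "(LINT Y|lebesgue. f Y * iter_partial \<alpha> (\<lambda>Y. tens i (deriv p) q (Y - x)) Y)
      = (- 1) ^ length \<alpha> * (LINT Y|lebesgue. wderiv \<alpha> f Y * tens i (deriv p) q (Y - x))"
    using w1 t2 unfolding has_weak_deriv_def by blast
  ultimately have "(- 1) ^ length \<alpha> * (LINT Y|lebesgue. wderiv \<alpha> f Y * tens i (deriv p) q (Y - x))
      = (- 1) ^ length (\<alpha> @ [i]) * (LINT Y|lebesgue. wderiv (\<alpha> @ [i]) f Y * tens i p q (Y - x))"
    unfolding iter_partial_append pd by simp
  then have "(- 1) ^ length \<alpha> * (LINT Y|lebesgue. wderiv \<alpha> f Y * tens i (deriv p) q (Y - x))
      = (- 1) ^ length \<alpha> * (- (LINT Y|lebesgue. wderiv (\<alpha> @ [i]) f Y * tens i p q (Y - x)))"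
    by simp
  then have "(LINT Y|lebesgue. wderiv \<alpha> f Y * tens i (deriv p) q (Y - x)) = - (LINT Y|lebesgue. wderiv (\<alpha> @ [i]) f Y * tens i p q (Y - x))"
    by (subst (asm) mult_left_cancel) simp_all
  then show "corr (tens i (deriv p) q) (wderiv \<alpha> f) x = - corr (tens i p q) (wderiv (\<alpha> @ [i]) f) x"
    by (simp add: corr_def mult.commute)
qed

subsection \<open>Comparison of mollifications at two scales\<close>

text \<open>All steps of width \<open>\<kappa>\<close> agree outside \<open>{-\<kappa>..\<kappa>}\<close> and are bounded by \<open>1\<close>, whatever their slopes.\<close>

definition is_step :: "real \<Rightarrow> (real \<Rightarrow> real) \<Rightarrow> bool" where
  "is_step \<kappa> s \<longleftrightarrow> smooth1 s \<and> (\<forall>t. 0 \<le> s t \<and> s t \<le> 1) \<and> (\<forall>t\<le>-\<kappa>. s t = 0) \<and> (\<forall>t\<ge>\<kappa>. s t = 1)"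

definition cutoff :: "real \<Rightarrow> real" where "cutoff t = sstep (t + 4) * sstep (4 - t)"

lemma cutoff: "smooth_cc 5 cutoff" "\<bar>t\<bar> \<le> 3 \<Longrightarrow> cutoff t = 1" "\<bar>cutoff t\<bar> \<le> 1"
proof -
  have "smooth1 (\<lambda>t. sstep (1 * t + 4) * sstep ((-1) * t + 4))" by (intro smooth1_mult smooth1_affine sstep)
  then have "smooth1 cutoff" by (simp add: cutoff_def[abs_def])
  moreover have "cutoff t = 0" if "5 < \<bar>t\<bar>" for t
  proof -
    have "t + 4 \<le> -1 \<or> 4 - t \<le> -1" using that by linarith
    then show ?thesis by (auto simp: cutoff_def sstep(3))
  qed
  ultimately show "smooth_cc 5 cutoff" by (simp add: smooth_cc_def)
  show "cutoff t = 1" if "\<bar>t\<bar> \<le> 3" using that by (auto simp: cutoff_def sstep(4) abs_le_iff)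
  show "\<bar>cutoff t\<bar> \<le> 1" using sstep_bounds[of "t + 4"] sstep_bounds[of "4 - t"]
    by (simp add: cutoff_def abs_mult mult_le_one)
qed

definition C0 :: real where "C0 = (SOME C. 1 \<le> C \<and> (\<forall>t. \<bar>deriv cutoff t\<bar> \<le> C))"

lemma C0: "1 \<le> C0" "\<bar>deriv cutoff t\<bar> \<le> C0" "\<bar>cutoff t\<bar> \<le> C0"
proof -
  obtain P where P: "P \<ge> 0" "\<And>t. \<bar>deriv cutoff t\<bar> \<le> P"
    using smooth_cc_bounded[OF smooth_cc_deriv[OF cutoff(1)]] by blast
  have "\<exists>C. 1 \<le> C \<and> (\<forall>t. \<bar>deriv cutoff t\<bar> \<le> C)"
    by (rule exI[of _ "max 1 P"]) (use P in \<open>auto simp: le_max_iff_disj\<close>)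
  from someI_ex[OF this] show "1 \<le> C0" "\<bar>deriv cutoff t\<bar> \<le> C0" by (auto simp: C0_def)
  then show "\<bar>cutoff t\<bar> \<le> C0" using cutoff(3)[of t] by linarith
qed

lemma is_step_deriv_cc: "is_step \<kappa> s \<Longrightarrow> smooth_cc \<kappa> (deriv s)"
  unfolding smooth_cc_def
proof (intro conjI allI impI)
  assume s: "is_step \<kappa> s"
  then have sm: "smooth1 s" by (simp add: is_step_def)
  show "smooth1 (deriv s)" by (rule smooth1_deriv_smooth[OF sm])
  fix t :: real assume "\<kappa> < \<bar>t\<bar>"
  then consider "t > \<kappa>" | "t < - \<kappa>" by linarith
  then show "deriv s t = 0"
    using deriv_zero_right_left[OF sm, of \<kappa> 1 t] deriv_zero_left[OF sm, of "-\<kappa>" 0 t] s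
    by cases (auto simp: is_step_def)
qed

lemma localized_step:
  assumes s: "is_step \<kappa> s" and \<kappa>: "\<kappa> \<le> 2"
  shows "smooth_cc 5 (\<lambda>t. cutoff t * s t)" "smooth_cc 5 (\<lambda>t. deriv cutoff t * s t)"
    "deriv s t = deriv (\<lambda>t. cutoff t * s t) t - deriv cutoff t * s t"
proof -
  have sm: "smooth1 s" "smooth1 cutoff" "smooth1 (deriv cutoff)"
    using s cutoff(1) smooth_cc_deriv[OF cutoff(1)] by (auto simp: is_step_def smooth_cc_def)
  show "smooth_cc 5 (\<lambda>t. cutoff t * s t)" "smooth_cc 5 (\<lambda>t. deriv cutoff t * s t)"
    using cutoff(1) smooth_cc_deriv[OF cutoff(1)] sm by (auto simp: smooth_cc_def intro: smooth1_mult)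
  have "((\<lambda>t. cutoff t * s t) has_real_derivative deriv cutoff t * s t + deriv s t * cutoff t) (at t)"
    by (rule DERIV_mult[OF smooth1_DERIV[OF sm(2)] smooth1_DERIV[OF sm(1)]])
  then have "deriv (\<lambda>t. cutoff t * s t) t = deriv cutoff t * s t + deriv s t * cutoff t" by (rule DERIV_imp_deriv)
  moreover have "deriv s t * cutoff t = deriv s t"
    using is_step_deriv_cc[OF s] \<kappa> cutoff(2)[of t] by (cases "\<bar>t\<bar> \<le> 3") (auto simp: smooth_cc_def)
  ultimately show "deriv s t = deriv (\<lambda>t. cutoff t * s t) t - deriv cutoff t * s t" by simp
qed

lemma smooth_cc_corr_integrable:
  assumes "smooth_cc R p" "smooth_cc R q" "loc_integrable h"
  shows "integrable lebesgue (\<lambda>Y. tensor p q (Y - x) * h Y)"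
proof -
  have "smooth_cc \<bar>R\<bar> p" "smooth_cc \<bar>R\<bar> q" using assms by (auto simp: smooth_cc_def)
  then obtain L where "lip_kern \<bar>R\<bar> L (tensor p q)" using lip_kern_tensor abs_ge_zero by blast
  from kern_integrable[OF lip_kernD(1)[OF this] assms(3)] show ?thesis .
qed

text \<open>
  The derivative of a step is \<open>(c s)' - c' s\<close> for a cut-off \<open>c\<close> that is constant where \<open>s\<close> moves. Moving
  the derivatives onto \<open>f\<close> leaves only bounded kernels, whatever the width of the step: this is the
  two-dimensional Sobolev inequality with first and mixed second derivatives.
\<close>

lemma corr_step_expand:
  assumes wd: "tensor_wd 1 f f1" "tensor_wd 2 f f2" "tensor_wd 2 f1 f12"
    and l: "loc_integrable f" "loc_integrable f1" "loc_integrable f2" "loc_integrable f12"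
    and s1: "is_step \<kappa> s1" and s2: "is_step \<kappa> s2" and \<kappa>: "\<kappa> \<le> 2"
  shows "corr (tensor (deriv s1) (deriv s2)) f x =
     corr (tensor (\<lambda>t. cutoff t * s1 t) (\<lambda>t. cutoff t * s2 t)) f12 x
     + corr (tensor (\<lambda>t. cutoff t * s1 t) (\<lambda>t. deriv cutoff t * s2 t)) f1 x
     + corr (tensor (\<lambda>t. deriv cutoff t * s1 t) (\<lambda>t. cutoff t * s2 t)) f2 x
     + corr (tensor (\<lambda>t. deriv cutoff t * s1 t) (\<lambda>t. deriv cutoff t * s2 t)) f x"
proof -
  let ?l1 = "\<lambda>t. cutoff t * s1 t" and ?l2 = "\<lambda>t. cutoff t * s2 t"
  let ?b1 = "\<lambda>t. deriv cutoff t * s1 t" and ?b2 = "\<lambda>t. deriv cutoff t * s2 t"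
  note c1 = localized_step(1,2)[OF s1 \<kappa>] and c2 = localized_step(1,2)[OF s2 \<kappa>]
  note d1 = smooth_cc_deriv[OF c1(1)] and d2 = smooth_cc_deriv[OF c2(1)]
  have split: "tensor (deriv s1) (deriv s2) z = tensor (deriv ?l1) (deriv ?l2) z - tensor (deriv ?l1) ?b2 z
      - tensor ?b1 (deriv ?l2) z + tensor ?b1 ?b2 z" for z
    unfolding tensor_def localized_step(3)[OF s1 \<kappa>] localized_step(3)[OF s2 \<kappa>] by (simp add: algebra_simps)
  have "corr (tensor (deriv s1) (deriv s2)) f x = corr (tensor (deriv ?l1) (deriv ?l2)) f x
     - corr (tensor (deriv ?l1) ?b2) f x - corr (tensor ?b1 (deriv ?l2)) f x + corr (tensor ?b1 ?b2) f x"
    unfolding corr_def split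
    using smooth_cc_corr_integrable[OF d1 d2 l(1), of x] smooth_cc_corr_integrable[OF d1 c2(2) l(1), of x]
      smooth_cc_corr_integrable[OF c1(2) d2 l(1), of x] smooth_cc_corr_integrable[OF c1(2) c2(2) l(1), of x]
    by (simp add: algebra_simps)
  also have "corr (tensor (deriv ?l1) (deriv ?l2)) f x = - corr (tensor ?l1 (deriv ?l2)) f1 x"
    using wd(1) c1(1) d2 unfolding tensor_wd_def tens_def by auto
  also have "corr (tensor ?l1 (deriv ?l2)) f1 x = - corr (tensor ?l1 ?l2) f12 x"
    using wd(3) c1(1) c2(1) unfolding tensor_wd_def tens_def by auto
  also have "corr (tensor (deriv ?l1) ?b2) f x = - corr (tensor ?l1 ?b2) f1 x"
    using wd(1) c1(1) c2(2) unfolding tensor_wd_def tens_def by auto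
  also have "corr (tensor ?b1 (deriv ?l2)) f x = - corr (tensor ?b1 ?l2) f2 x"
    using wd(2) c1(2) c2(1) unfolding tensor_wd_def tens_def by auto
  finally show ?thesis by simp
qed

text \<open>The part of the support of the localised kernels on which two steps in direction \<open>i\<close> may differ.\<close>

definition slab :: "2 \<Rightarrow> real^2 \<Rightarrow> real \<Rightarrow> (real^2) set" where
  "slab i x \<kappa> = {Y. Y \<in> sqbox x 5 \<and> \<bar>Y $ i - x $ i\<bar> \<le> \<kappa>}"

lemma slab_measure:
  assumes "0 \<le> \<kappa>" "\<kappa> \<le> 5"
  shows "slab i x \<kappa> \<in> lmeasurable" "measure lebesgue (slab i x \<kappa>) = 20 * \<kappa>"
proof -
  define v :: "real^2" where "v = (\<chi> j. if j = i then \<kappa> else 5)"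
  have "slab i x \<kappa> = cbox (x - v) (x + v)"
  proof (rule set_eqI)
    fix Y
    have *: "\<bar>Y $ j - x $ j\<bar> \<le> r \<longleftrightarrow> x $ j - r \<le> Y $ j \<and> Y $ j \<le> x $ j + r" for j r by linarith
    have "Y \<in> slab i x \<kappa> \<longleftrightarrow> (\<forall>j. \<bar>Y $ j - x $ j\<bar> \<le> v $ j)"
      unfolding slab_def sqbox_def v_def using assms by (auto split: if_splits intro: order_trans)
    then show "Y \<in> slab i x \<kappa> \<longleftrightarrow> Y \<in> cbox (x - v) (x + v)" by (simp add: mem_box_cart *)
  qed
  moreover have "measure lborel (cbox (x - v) (x + v)) = (\<Prod>j\<in>UNIV. (x + v) $ j - (x - v) $ j)"
    by (rule content_cbox_cart) (use assms in \<open>auto simp: interval_ne_empty_cart(1) v_def\<close>)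
  moreover have "\<dots> = 20 * \<kappa>" using exhaust_2[of i] by (auto simp: UNIV_2 v_def)
  ultimately show "slab i x \<kappa> \<in> lmeasurable" "measure lebesgue (slab i x \<kappa>) = 20 * \<kappa>" by simp_all
qed

text \<open>A difference of products is \<open>(u - u') v + u' (v - v')\<close>; each summand lives in one slab.\<close>

lemma corr_diff_slab_bound:
  assumes cc: "smooth_cc 5 u" "smooth_cc 5 v" "smooth_cc 5 u'" "smooth_cc 5 v'"
    and b: "\<And>t. \<bar>v t\<bar> \<le> C" "\<And>t. \<bar>u' t\<bar> \<le> C"
    and d: "\<And>t. \<bar>u t - u' t\<bar> \<le> C * indicator {-\<kappa>..\<kappa>} t" "\<And>t. \<bar>v t - v' t\<bar> \<le> C * indicator {-\<kappa>..\<kappa>} t"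
    and \<kappa>: "0 \<le> \<kappa>" "\<kappa> \<le> 5" and h: "L2_fun h"
  shows "\<bar>corr (tensor u v) h x - corr (tensor u' v') h x\<bar>
    \<le> C\<^sup>2 * ((LINT Y:slab 1 x \<kappa>|lebesgue. \<bar>h Y\<bar>) + (LINT Y:slab 2 x \<kappa>|lebesgue. \<bar>h Y\<bar>))"
proof -
  have C: "0 \<le> C" using b(1)[of 0] by linarith
  note hl = L2_fun_loc_integrable[OF h]
  have habs: "L2_fun (\<lambda>Y. \<bar>h Y\<bar>)" by (rule L2_fun_bound(1)[OF h]) (use L2_fun_measurable[OF h] in auto)
  have si: "integrable lebesgue (\<lambda>Y. indicat_real (slab i x \<kappa>) Y * \<bar>h Y\<bar>)" for i
    using L2_fun_set_integrable[OF habs slab_measure(1)[OF \<kappa>, of i x]] by (simp add: set_integrable_def)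
  note i1 = smooth_cc_corr_integrable[OF cc(1,2) hl, of x] and i2 = smooth_cc_corr_integrable[OF cc(3,4) hl, of x]
  have "corr (tensor u v) h x - corr (tensor u' v') h x = (LINT Y|lebesgue. tensor u v (Y - x) * h Y - tensor u' v' (Y - x) * h Y)"
    unfolding corr_def by (rule Bochner_Integration.integral_diff[symmetric, OF i1 i2])
  also have "\<bar>\<dots>\<bar> \<le> (LINT Y|lebesgue. C\<^sup>2 * (indicat_real (slab 1 x \<kappa>) Y * \<bar>h Y\<bar> + indicat_real (slab 2 x \<kappa>) Y * \<bar>h Y\<bar>))"
  proof (rule order_trans[OF integral_abs_bound integral_mono])
    show "integrable lebesgue (\<lambda>Y. \<bar>tensor u v (Y - x) * h Y - tensor u' v' (Y - x) * h Y\<bar>)" using i1 i2 by simp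
    show "integrable lebesgue (\<lambda>Y. C\<^sup>2 * (indicat_real (slab 1 x \<kappa>) Y * \<bar>h Y\<bar> + indicat_real (slab 2 x \<kappa>) Y * \<bar>h Y\<bar>))"
      using si by simp
    fix Y
    define z where "z = Y - x"
    have D: "\<bar>tensor u v z - tensor u' v' z\<bar> \<le> C\<^sup>2 * (indicat_real (slab 1 x \<kappa>) Y + indicat_real (slab 2 x \<kappa>) Y)"
    proof (cases "Y \<in> sqbox x 5")
      case True
      have ind: "indicat_real {-\<kappa>..\<kappa>} (z $ i) = indicat_real (slab i x \<kappa>) Y" for i
        using True by (auto simp: slab_def z_def indicator_def abs_le_iff)
      have "tensor u v z - tensor u' v' z = (u (z $ 1) - u' (z $ 1)) * v (z $ 2) + u' (z $ 1) * (v (z $ 2) - v' (z $ 2))"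
        by (simp add: tensor_def algebra_simps)
      also have "\<bar>\<dots>\<bar> \<le> \<bar>u (z $ 1) - u' (z $ 1)\<bar> * \<bar>v (z $ 2)\<bar> + \<bar>u' (z $ 1)\<bar> * \<bar>v (z $ 2) - v' (z $ 2)\<bar>"
        by (rule order_trans[OF abs_triangle_ineq]) (simp add: abs_mult)
      also have "\<dots> \<le> (C * indicator {-\<kappa>..\<kappa>} (z $ 1)) * C + C * (C * indicator {-\<kappa>..\<kappa>} (z $ 2))"
        by (intro add_mono mult_mono b d) (use C in auto)
      finally show ?thesis by (simp add: ind power2_eq_square algebra_simps)
    next
      case False
      then have "z \<notin> sqbox 0 5" using sqbox_shift[of Y x 5] by (simp add: z_def)
      then have "tensor u v z = 0" "tensor u' v' z = 0"
        using cc by (auto intro!: tensor_zero_outside[where R=5] simp: smooth_cc_def)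
      then show ?thesis by simp
    qed
    have "\<bar>tensor u v (Y - x) * h Y - tensor u' v' (Y - x) * h Y\<bar> = \<bar>tensor u v z - tensor u' v' z\<bar> * \<bar>h Y\<bar>"
      by (simp add: z_def left_diff_distrib[symmetric] abs_mult)
    also have "\<dots> \<le> C\<^sup>2 * (indicat_real (slab 1 x \<kappa>) Y + indicat_real (slab 2 x \<kappa>) Y) * \<bar>h Y\<bar>"
      by (rule mult_right_mono[OF D]) simp
    finally show "\<bar>tensor u v (Y - x) * h Y - tensor u' v' (Y - x) * h Y\<bar>
       \<le> C\<^sup>2 * (indicat_real (slab 1 x \<kappa>) Y * \<bar>h Y\<bar> + indicat_real (slab 2 x \<kappa>) Y * \<bar>h Y\<bar>)"
      by (simp add: distrib_right mult.assoc)
  qed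
  also have "\<dots> = C\<^sup>2 * ((LINT Y:slab 1 x \<kappa>|lebesgue. \<bar>h Y\<bar>) + (LINT Y:slab 2 x \<kappa>|lebesgue. \<bar>h Y\<bar>))"
    using si by (simp add: set_lebesgue_integral_def)
  finally show ?thesis .
qed

text \<open>
  After expansion the kernels of both sides are bounded and differ only in slabs of measure
  \<open>20 \<kappa>\<close>, so the inequality of Cauchy and Schwarz gains a factor \<open>\<kappa>\<close>.
\<close>

lemma step_compare:
  assumes wd: "tensor_wd 1 f f1" "tensor_wd 2 f f2" "tensor_wd 2 f1 f12"
    and l: "L2_fun f" "L2_fun f1" "L2_fun f2" "L2_fun f12"
    and s: "is_step \<kappa> s1" "is_step \<kappa> s2" "is_step \<kappa> t1" "is_step \<kappa> t2" and \<kappa>: "0 \<le> \<kappa>" "\<kappa> \<le> 2"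
  shows "(corr (tensor (deriv s1) (deriv s2)) f x - corr (tensor (deriv t1) (deriv t2)) f x)\<^sup>2
    \<le> (80 * C0 ^ 4 * \<kappa>) * (LINT Y:sqbox x 5|lebesgue. (\<bar>f Y\<bar> + \<bar>f1 Y\<bar> + \<bar>f2 Y\<bar> + \<bar>f12 Y\<bar>)\<^sup>2)"
proof -
  let ?F = "\<lambda>Y. \<bar>f Y\<bar> + \<bar>f1 Y\<bar> + \<bar>f2 Y\<bar> + \<bar>f12 Y\<bar>"
  have \<kappa>5: "\<kappa> \<le> 5" using \<kappa> by simp
  have abs: "L2_fun (\<lambda>Y. \<bar>h Y\<bar>)" if "L2_fun h" for h
    by (rule L2_fun_bound(1)[OF that]) (use L2_fun_measurable[OF that] in auto)
  have F: "L2_fun ?F" by (intro L2_fun_add(1) abs l)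
  define I where "I i h = (LINT Y:slab i x \<kappa>|lebesgue. \<bar>h Y\<bar>)" for i and h :: "real^2 \<Rightarrow> real"
  have Isum: "I i f + I i f1 + I i f2 + I i f12 = I i ?F" for i
  proof -
    have "set_integrable lebesgue (slab i x \<kappa>) (\<lambda>Y. \<bar>h Y\<bar>)" if "L2_fun h" for h
      by (rule L2_fun_set_integrable[OF abs[OF that] slab_measure(1)[OF \<kappa>(1) \<kappa>5]])
    then show ?thesis unfolding I_def using l by (simp add: set_integral_add)
  qed
  have bounds: "\<bar>cutoff t * s t\<bar> \<le> C0" "\<bar>deriv cutoff t * s t\<bar> \<le> C0" if "is_step \<kappa> s" for s t
  proof -
    have st: "0 \<le> s t" "s t \<le> 1" using that by (auto simp: is_step_def)
    have "\<bar>cutoff t\<bar> * s t \<le> C0 * 1" "\<bar>deriv cutoff t\<bar> * s t \<le> C0 * 1"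
      by (intro mult_mono C0; use st C0(1) in simp)+
    then show "\<bar>cutoff t * s t\<bar> \<le> C0" "\<bar>deriv cutoff t * s t\<bar> \<le> C0" using st by (simp_all add: abs_mult)
  qed
  have diffs: "\<bar>cutoff t * s t - cutoff t * r t\<bar> \<le> C0 * indicator {-\<kappa>..\<kappa>} t"
    "\<bar>deriv cutoff t * s t - deriv cutoff t * r t\<bar> \<le> C0 * indicator {-\<kappa>..\<kappa>} t"
    if "is_step \<kappa> s" "is_step \<kappa> r" for s r t
  proof -
    have d: "\<bar>s t - r t\<bar> \<le> indicator {-\<kappa>..\<kappa>} t"
    proof (cases "t \<in> {-\<kappa>..\<kappa>}")
      case True
      have "0 \<le> s t" "s t \<le> 1" "0 \<le> r t" "r t \<le> 1" using that by (auto simp: is_step_def)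
      then show ?thesis using True by simp
    next
      case False
      then have "t \<le> -\<kappa> \<or> t \<ge> \<kappa>" by auto
      then show ?thesis using that False by (auto simp: is_step_def)
    qed
    have "\<bar>cutoff t\<bar> * \<bar>s t - r t\<bar> \<le> C0 * indicator {-\<kappa>..\<kappa>} t"
      "\<bar>deriv cutoff t\<bar> * \<bar>s t - r t\<bar> \<le> C0 * indicator {-\<kappa>..\<kappa>} t"
      by (intro mult_mono C0 d; use C0(1) in simp)+
    then show "\<bar>cutoff t * s t - cutoff t * r t\<bar> \<le> C0 * indicator {-\<kappa>..\<kappa>} t"
      "\<bar>deriv cutoff t * s t - deriv cutoff t * r t\<bar> \<le> C0 * indicator {-\<kappa>..\<kappa>} t"
      by (simp_all add: right_diff_distrib[symmetric] abs_mult)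
  qed
  note loc = localized_step(1,2)[OF _ \<kappa>(2)]
  note li = L2_fun_loc_integrable
  have B: "\<bar>corr (tensor (deriv s1) (deriv s2)) f x - corr (tensor (deriv t1) (deriv t2)) f x\<bar>
      \<le> C0\<^sup>2 * (I 1 ?F + I 2 ?F)"
  proof -
    have "\<bar>corr (tensor (\<lambda>t. cutoff t * s1 t) (\<lambda>t. cutoff t * s2 t)) f12 x - corr (tensor (\<lambda>t. cutoff t * t1 t) (\<lambda>t. cutoff t * t2 t)) f12 x\<bar> \<le> C0\<^sup>2 * (I 1 f12 + I 2 f12)"
      unfolding I_def by (rule corr_diff_slab_bound) (intro loc s bounds diffs \<kappa> \<kappa>5 l)+
    moreover have "\<bar>corr (tensor (\<lambda>t. cutoff t * s1 t) (\<lambda>t. deriv cutoff t * s2 t)) f1 x - corr (tensor (\<lambda>t. cutoff t * t1 t) (\<lambda>t. deriv cutoff t * t2 t)) f1 x\<bar> \<le> C0\<^sup>2 * (I 1 f1 + I 2 f1)"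
      unfolding I_def by (rule corr_diff_slab_bound) (intro loc s bounds diffs \<kappa> \<kappa>5 l)+
    moreover have "\<bar>corr (tensor (\<lambda>t. deriv cutoff t * s1 t) (\<lambda>t. cutoff t * s2 t)) f2 x - corr (tensor (\<lambda>t. deriv cutoff t * t1 t) (\<lambda>t. cutoff t * t2 t)) f2 x\<bar> \<le> C0\<^sup>2 * (I 1 f2 + I 2 f2)"
      unfolding I_def by (rule corr_diff_slab_bound) (intro loc s bounds diffs \<kappa> \<kappa>5 l)+
    moreover have "\<bar>corr (tensor (\<lambda>t. deriv cutoff t * s1 t) (\<lambda>t. deriv cutoff t * s2 t)) f x - corr (tensor (\<lambda>t. deriv cutoff t * t1 t) (\<lambda>t. deriv cutoff t * t2 t)) f x\<bar> \<le> C0\<^sup>2 * (I 1 f + I 2 f)"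
      unfolding I_def by (rule corr_diff_slab_bound) (intro loc s bounds diffs \<kappa> \<kappa>5 l)+
    moreover have "C0\<^sup>2 * (I 1 f12 + I 2 f12) + C0\<^sup>2 * (I 1 f1 + I 2 f1) + C0\<^sup>2 * (I 1 f2 + I 2 f2) + C0\<^sup>2 * (I 1 f + I 2 f) = C0\<^sup>2 * (I 1 ?F + I 2 ?F)"
      unfolding Isum[symmetric] by (simp add: algebra_simps)
    ultimately show ?thesis
      unfolding corr_step_expand[OF wd li[OF l(1)] li[OF l(2)] li[OF l(3)] li[OF l(4)] s(1,2) \<kappa>(2)]
        corr_step_expand[OF wd li[OF l(1)] li[OF l(2)] li[OF l(3)] li[OF l(4)] s(3,4) \<kappa>(2)]
      by linarith
  qed
  have Isq: "(I i ?F)\<^sup>2 \<le> 20 * \<kappa> * (LINT Y:sqbox x 5|lebesgue. (?F Y)\<^sup>2)" for i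
  proof -
    have "(I i ?F)\<^sup>2 \<le> 20 * \<kappa> * (LINT Y:slab i x \<kappa>|lebesgue. (?F Y)\<^sup>2)"
      unfolding I_def using set_integral_abs_sq_le[OF F slab_measure(1)[OF \<kappa>(1) \<kappa>5, of i x]]
      by (simp only: slab_measure(2)[OF \<kappa>(1) \<kappa>5])
    also have "\<dots> \<le> 20 * \<kappa> * (LINT Y:sqbox x 5|lebesgue. (?F Y)\<^sup>2)"
      unfolding set_lebesgue_integral_def
    proof (intro mult_left_mono integral_mono)
      show "integrable lebesgue (\<lambda>Y. indicat_real (slab i x \<kappa>) Y *\<^sub>R (?F Y)\<^sup>2)"
        by (rule integrable_mult_indicator[OF fmeasurableD[OF slab_measure(1)[OF \<kappa>(1) \<kappa>5]] L2_fun_integrable_sq[OF F]])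
      show "integrable lebesgue (\<lambda>Y. indicat_real (sqbox x 5) Y *\<^sub>R (?F Y)\<^sup>2)"
        by (rule integrable_mult_indicator[OF sqbox_sets(1) L2_fun_integrable_sq[OF F]])
      show "indicat_real (slab i x \<kappa>) Y *\<^sub>R (?F Y)\<^sup>2 \<le> indicat_real (sqbox x 5) Y *\<^sub>R (?F Y)\<^sup>2" for Y
        by (auto simp: slab_def indicator_def)
    qed (use \<kappa> in auto)
    finally show ?thesis .
  qed
  have "(corr (tensor (deriv s1) (deriv s2)) f x - corr (tensor (deriv t1) (deriv t2)) f x)\<^sup>2 \<le> (C0\<^sup>2 * (I 1 ?F + I 2 ?F))\<^sup>2"
    using power_mono[OF B abs_ge_zero, of 2] by simp
  also have "\<dots> = C0 ^ 4 * (I 1 ?F + I 2 ?F)\<^sup>2" by (simp add: power_mult_distrib)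
  also have "\<dots> \<le> C0 ^ 4 * (2 * (I 1 ?F)\<^sup>2 + 2 * (I 2 ?F)\<^sup>2)"
  proof (rule mult_left_mono)
    have "0 \<le> (I 1 ?F - I 2 ?F)\<^sup>2" by simp
    then show "(I 1 ?F + I 2 ?F)\<^sup>2 \<le> 2 * (I 1 ?F)\<^sup>2 + 2 * (I 2 ?F)\<^sup>2" unfolding power2_diff power2_sum by linarith
  qed simp
  also have "\<dots> \<le> C0 ^ 4 * (2 * (20 * \<kappa> * (LINT Y:sqbox x 5|lebesgue. (?F Y)\<^sup>2)) + 2 * (20 * \<kappa> * (LINT Y:sqbox x 5|lebesgue. (?F Y)\<^sup>2)))"
    by (intro mult_left_mono add_mono Isq) auto
  finally show ?thesis by (simp add: mult_ac)
qed

lemma is_step_stp: "0 < \<delta> \<Longrightarrow> \<delta> \<le> \<kappa> \<Longrightarrow> is_step \<kappa> (stp \<delta>)"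
  using stp[of \<delta>] by (auto simp: is_step_def)

text \<open>The scale \<open>\<eta>\<close> is compared with a scale \<open>\<delta>\<close> that tends to \<open>0\<close>; continuity identifies the limit.\<close>

lemma mollification_error_pointwise:
  assumes wd: "tensor_wd 1 f f1" "tensor_wd 2 f f2" "tensor_wd 2 f1 f12"
    and l: "L2_fun f" "L2_fun f1" "L2_fun f2" "L2_fun f12"
    and c: "continuous_on UNIV f" and \<eta>: "0 < \<eta>" "\<eta> \<le> 1"
  shows "(f x - corr (rho \<eta>) f x)\<^sup>2
    \<le> (80 * C0 ^ 4 * \<eta>) * (LINT Y:sqbox x 5|lebesgue. (\<bar>f Y\<bar> + \<bar>f1 Y\<bar> + \<bar>f2 Y\<bar> + \<bar>f12 Y\<bar>)\<^sup>2)" (is "_ \<le> ?B")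
proof (rule tendsto_upperbound)
  show "((\<lambda>\<delta>. (corr (rho \<delta>) f x - corr (rho \<eta>) f x)\<^sup>2) \<longlongrightarrow> (f x - corr (rho \<eta>) f x)\<^sup>2) (at_right 0)"
    by (intro tendsto_intros corr_rho_tendsto_continuous c)
  show "\<forall>\<^sub>F \<delta> in at_right 0. (corr (rho \<delta>) f x - corr (rho \<eta>) f x)\<^sup>2 \<le> ?B"
    unfolding eventually_at_right[OF zero_less_one]
  proof (intro exI[of _ \<eta>] conjI allI impI)
    fix \<delta> assume "0 < \<delta>" "\<delta> < \<eta>"
    then show "(corr (rho \<delta>) f x - corr (rho \<eta>) f x)\<^sup>2 \<le> ?B"
      unfolding rho_def using \<eta> by (intro step_compare[OF wd l] is_step_stp) auto
  qed (use \<eta> in auto)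
qed simp

text \<open>The average of a step over \<open>[t - \<epsilon>, t]\<close> takes values of the step, by the mean value theorem.\<close>

lemma averaged_step:
  assumes \<delta>: "0 < \<delta>" and \<epsilon>: "0 < \<epsilon>"
  shows "\<exists>Q. is_step (\<delta> + \<epsilon>) Q \<and> deriv Q = (\<lambda>t. (stp \<delta> t - stp \<delta> (t - \<epsilon>)) / \<epsilon>)"
proof -
  note sm = stp(1)[OF \<delta>]
  have "isCont (stp \<delta>) t" for t by (rule DERIV_isCont[OF smooth1_DERIV[OF sm]])
  then obtain R where R: "\<And>t. (R has_real_derivative stp \<delta> t) (at t)"
    using einterval_antiderivative[of "-\<infinity>" "\<infinity>" "stp \<delta>"] by (auto simp: has_real_derivative_iff_has_vector_derivative)
  define Q where "Q t = (R t - R (t - \<epsilon>)) / \<epsilon>" for t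
  have R': "((\<lambda>t. R (t - \<epsilon>)) has_real_derivative stp \<delta> (t - \<epsilon>)) (at t)" for t
  proof -
    have "((\<lambda>t. t - \<epsilon>) has_real_derivative 1) (at t)" by (auto intro!: derivative_eq_intros)
    from DERIV_chain2[OF R this] show ?thesis by simp
  qed
  have Qd: "(Q has_real_derivative (stp \<delta> t - stp \<delta> (t - \<epsilon>)) / \<epsilon>) (at t)" for t
    unfolding Q_def by (rule DERIV_cdivide[OF DERIV_diff[OF R R']])
  have dQ: "deriv Q = (\<lambda>t. (stp \<delta> t - stp \<delta> (t - \<epsilon>)) / \<epsilon>)"
    using DERIV_imp_deriv[OF Qd] by auto
  have "smooth1 (\<lambda>t. (1 / \<epsilon>) * (stp \<delta> t - stp \<delta> (t - \<epsilon>)))"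
    by (intro smooth1_cmult smooth1_diff sm smooth1_shift)
  then have "smooth1 (\<lambda>t. (stp \<delta> t - stp \<delta> (t - \<epsilon>)) / \<epsilon>)" by simp
  then have Qs: "smooth1 Q" by (rule smooth1_antideriv[OF Qd])
  have mvt: "\<exists>s. t - \<epsilon> < s \<and> s < t \<and> Q t = stp \<delta> s" for t
  proof -
    have "\<exists>z>t - \<epsilon>. z < t \<and> R t - R (t - \<epsilon>) = (t - (t - \<epsilon>)) * stp \<delta> z"
      by (rule MVT2) (use \<epsilon> R in auto)
    then show ?thesis using \<epsilon> by (auto simp: Q_def)
  qed
  have "is_step (\<delta> + \<epsilon>) Q"
    unfolding is_step_def
  proof (intro conjI allI impI)
    fix t
    obtain s where s: "t - \<epsilon> < s" "s < t" "Q t = stp \<delta> s" using mvt by blast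
    show "0 \<le> Q t" "Q t \<le> 1" unfolding s(3) by (rule stp(4,5)[OF \<delta>])+
    show "Q t = 0" if "t \<le> - (\<delta> + \<epsilon>)" unfolding s(3) using that s \<epsilon> by (intro stp(2)[OF \<delta>]) simp
    show "Q t = 1" if "\<delta> + \<epsilon> \<le> t" unfolding s(3) using that s by (intro stp(3)[OF \<delta>]) simp
  qed (rule Qs)
  with dQ show ?thesis by blast
qed

lemma tens_shift_axis: "tens i p q (z - \<epsilon> *\<^sub>R axis i 1) = tens i (\<lambda>t. p (t - \<epsilon>)) q z"
  using exhaust_2[of i] by (auto simp: tens_def tensor_def axis_def)

text \<open>
  A difference quotient of a mollification is a mollification of the derivative, with the step
  replaced by its average over the increment.
\<close>

lemma difference_quotient_mollified:
  assumes wd: "tensor_wd i f f1" and l: "loc_integrable f" and \<delta>: "0 < \<delta>" and \<epsilon>: "0 < \<epsilon>"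
    and dQ: "deriv Q = (\<lambda>t. (stp \<delta> t - stp \<delta> (t - \<epsilon>)) / \<epsilon>)"
  shows "(corr (rho \<delta>) f (x + \<epsilon> *\<^sub>R axis i 1) - corr (rho \<delta>) f x) / \<epsilon> = corr (tens i (deriv Q) (deriv (stp \<delta>))) f1 x"
proof -
  let ?b = "deriv (stp \<delta>)"
  note sm = stp(1)[OF \<delta>]
  have rt: "rho \<delta> = tens i ?b ?b" by (simp add: rho_def tens_def)
  have bcc: "smooth_cc (\<delta> + \<epsilon>) ?b" using smooth_cc_deriv_stp[OF \<delta>] \<epsilon> by (auto simp: smooth_cc_def)
  have qcc: "smooth_cc (\<delta> + \<epsilon>) (deriv Q)"
    unfolding smooth_cc_def
  proof (intro conjI allI impI)
    have "smooth1 (\<lambda>t. (1 / \<epsilon>) * (stp \<delta> t - stp \<delta> (t - \<epsilon>)))"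
      by (intro smooth1_cmult smooth1_diff sm smooth1_shift)
    then show "smooth1 (deriv Q)" by (simp add: dQ)
    fix t assume "\<delta> + \<epsilon> < \<bar>t\<bar>"
    then consider "t \<le> - \<delta>" "t - \<epsilon> \<le> - \<delta>" | "t \<ge> \<delta>" "t - \<epsilon> \<ge> \<delta>" using \<delta> \<epsilon> by linarith
    then show "deriv Q t = 0" unfolding dQ by cases (simp_all add: stp(2,3)[OF \<delta>])
  qed
  have ddQ: "deriv (deriv Q) t = (?b t - ?b (t - \<epsilon>)) / \<epsilon>" for t
  proof -
    have "((\<lambda>t. stp \<delta> (t - \<epsilon>)) has_real_derivative ?b (t - \<epsilon>)) (at t)"
      using smooth1_DERIV[OF smooth1_shift[OF sm], of \<epsilon> t] by (simp add: deriv_shift[OF sm])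
    then have "((\<lambda>t. (stp \<delta> t - stp \<delta> (t - \<epsilon>)) / \<epsilon>) has_real_derivative (?b t - ?b (t - \<epsilon>)) / \<epsilon>) (at t)"
      by (intro DERIV_cdivide DERIV_diff smooth1_DERIV[OF sm])
    then show ?thesis unfolding dQ by (rule DERIV_imp_deriv)
  qed
  have k: "tens i (deriv (deriv Q)) ?b z = (1 / \<epsilon>) * (rho \<delta> z - rho \<delta> (z - \<epsilon> *\<^sub>R axis i 1))" for z
    unfolding rt tens_shift_axis using exhaust_2[of i]
    by (auto simp: tens_def tensor_def ddQ diff_divide_distrib left_diff_distrib right_diff_distrib)
  obtain L where L: "lip_kern \<delta> L (rho \<delta>)" using lip_kern_rho[OF \<delta>] by blast
  have i1: "integrable lebesgue (\<lambda>Y. rho \<delta> (Y - x) * f Y)" by (rule kern_integrable[OF lip_kernD(1)[OF L] l])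
  have i2: "integrable lebesgue (\<lambda>Y. rho \<delta> (Y - (x + \<epsilon> *\<^sub>R axis i 1)) * f Y)" by (rule kern_integrable[OF lip_kernD(1)[OF L] l])
  have "corr (tens i (deriv (deriv Q)) ?b) f x
      = (LINT Y|lebesgue. (1 / \<epsilon>) * (rho \<delta> (Y - x) * f Y - rho \<delta> (Y - (x + \<epsilon> *\<^sub>R axis i 1)) * f Y))"
    unfolding corr_def k by (simp add: left_diff_distrib diff_diff_eq mult.assoc diff_divide_distrib)
  also have "\<dots> = (corr (rho \<delta>) f x - corr (rho \<delta>) f (x + \<epsilon> *\<^sub>R axis i 1)) / \<epsilon>"
    using i1 i2 by (simp add: corr_def)
  finally have "corr (tens i (deriv (deriv Q)) ?b) f x = (corr (rho \<delta>) f x - corr (rho \<delta>) f (x + \<epsilon> *\<^sub>R axis i 1)) / \<epsilon>" .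
  moreover have "corr (tens i (deriv (deriv Q)) ?b) f x = - corr (tens i (deriv Q) ?b) f1 x"
    using wd qcc bcc unfolding tensor_wd_def by blast
  ultimately have "corr (tens i (deriv Q) ?b) f1 x = - ((corr (rho \<delta>) f x - corr (rho \<delta>) f (x + \<epsilon> *\<^sub>R axis i 1)) / \<epsilon>)"
    by simp
  also have "\<dots> = (corr (rho \<delta>) f (x + \<epsilon> *\<^sub>R axis i 1) - corr (rho \<delta>) f x) / \<epsilon>"
    by (simp add: diff_divide_distrib)
  finally show ?thesis by simp
qed

text \<open>
  Difference quotients at both scales are mollifications of the weak derivative \<open>f\<close> of \<open>\<phi>\<close>, with
  steps of width at most \<open>\<eta> + \<epsilon>\<close>; these are compared as above.
\<close>

lemma mollification_gradient_error_pointwise: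
  assumes wdi: "tensor_wd i \<phi> f"
    and wd: "tensor_wd 1 f f1" "tensor_wd 2 f f2" "tensor_wd 2 f1 f12"
    and l: "L2_fun f" "L2_fun f1" "L2_fun f2" "L2_fun f12"
    and c: "continuous_on UNIV \<phi>" and \<eta>: "0 < \<eta>" "\<eta> \<le> 1" and \<epsilon>: "0 < \<epsilon>" "\<epsilon> \<le> 1"
  defines "g \<equiv> \<lambda>x. \<phi> x - corr (rho \<eta>) \<phi> x"
  shows "((g (x + \<epsilon> *\<^sub>R axis i 1) - g x) / \<epsilon>)\<^sup>2
    \<le> (80 * C0 ^ 4 * (\<eta> + \<epsilon>)) * (LINT Y:sqbox x 5|lebesgue. (\<bar>f Y\<bar> + \<bar>f1 Y\<bar> + \<bar>f2 Y\<bar> + \<bar>f12 Y\<bar>)\<^sup>2)" (is "_ \<le> ?B")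
proof (rule tendsto_upperbound)
  let ?g = "\<lambda>\<delta> x. corr (rho \<delta>) \<phi> x - corr (rho \<eta>) \<phi> x"
  show "((\<lambda>\<delta>. ((?g \<delta> (x + \<epsilon> *\<^sub>R axis i 1) - ?g \<delta> x) / \<epsilon>)\<^sup>2) \<longlongrightarrow> ((g (x + \<epsilon> *\<^sub>R axis i 1) - g x) / \<epsilon>)\<^sup>2) (at_right 0)"
    unfolding g_def by (intro tendsto_intros corr_rho_tendsto_continuous c) (use \<epsilon> in auto)
  note cl = continuous_loc_integrable[OF c]
  obtain Q where Q: "is_step (\<eta> + \<epsilon>) Q" "deriv Q = (\<lambda>t. (stp \<eta> t - stp \<eta> (t - \<epsilon>)) / \<epsilon>)"
    using averaged_step[OF \<eta>(1) \<epsilon>(1)] by blast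
  show "\<forall>\<^sub>F \<delta> in at_right 0. ((?g \<delta> (x + \<epsilon> *\<^sub>R axis i 1) - ?g \<delta> x) / \<epsilon>)\<^sup>2 \<le> ?B"
    unfolding eventually_at_right[OF zero_less_one]
  proof (intro exI[of _ \<eta>] conjI allI impI)
    fix \<delta> assume \<delta>: "0 < \<delta>" "\<delta> < \<eta>"
    obtain P where P: "is_step (\<delta> + \<epsilon>) P" "deriv P = (\<lambda>t. (stp \<delta> t - stp \<delta> (t - \<epsilon>)) / \<epsilon>)"
      using averaged_step[OF \<delta>(1) \<epsilon>(1)] by blast
    have P': "is_step (\<eta> + \<epsilon>) P" using P(1) \<delta> by (auto simp: is_step_def)
    have st: "is_step (\<eta> + \<epsilon>) (stp \<delta>)" "is_step (\<eta> + \<epsilon>) (stp \<eta>)" using \<delta> \<epsilon> \<eta> by (auto intro!: is_step_stp)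
    let ?d = "corr (tens i (deriv P) (deriv (stp \<delta>))) f x - corr (tens i (deriv Q) (deriv (stp \<eta>))) f x"
    have "(?g \<delta> (x + \<epsilon> *\<^sub>R axis i 1) - ?g \<delta> x) / \<epsilon>
      = (corr (rho \<delta>) \<phi> (x + \<epsilon> *\<^sub>R axis i 1) - corr (rho \<delta>) \<phi> x) / \<epsilon>
        - (corr (rho \<eta>) \<phi> (x + \<epsilon> *\<^sub>R axis i 1) - corr (rho \<eta>) \<phi> x) / \<epsilon>"
      by (simp add: diff_divide_distrib)
    also have "\<dots> = ?d"
      by (simp only: difference_quotient_mollified[OF wdi cl \<delta>(1) \<epsilon>(1) P(2)] difference_quotient_mollified[OF wdi cl \<eta>(1) \<epsilon>(1) Q(2)])
    finally have eq: "(?g \<delta> (x + \<epsilon> *\<^sub>R axis i 1) - ?g \<delta> x) / \<epsilon> = ?d" .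
    have "?d\<^sup>2 \<le> ?B"
    proof -
      have k: "0 \<le> \<eta> + \<epsilon>" "\<eta> + \<epsilon> \<le> 2" using \<eta> \<epsilon> by auto
      show ?thesis
      proof (cases "i = 1")
        case True
        show ?thesis
          using step_compare[OF wd l P' st(1) Q(1) st(2) k, of x] by (simp only: tens_def True if_True simp_thms)
      next
        case False
        show ?thesis
          using step_compare[OF wd l st(1) P' st(2) Q(1) k, of x] by (simp only: tens_def False if_False simp_thms)
      qed
    qed
    then show "((?g \<delta> (x + \<epsilon> *\<^sub>R axis i 1) - ?g \<delta> x) / \<epsilon>)\<^sup>2 \<le> ?B" by (simp only: eq)
  qed (use \<eta> in auto)
qed simp

subsection \<open>Sums over the sample points\<close>

lemma poly_weight_ge_1: "0 < \<sigma> \<Longrightarrow> 1 \<le> poly_weight \<sigma> x"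
  by (simp add: poly_weight_def ge_one_powr_ge_zero)

lemma tensor_wd_cong_AE:
  assumes "tensor_wd i f g" "AE x in lebesgue. f x = f' x" "f \<in> borel_measurable lebesgue" "f' \<in> borel_measurable lebesgue"
  shows "tensor_wd i f' g"
  unfolding tensor_wd_def
proof (intro allI impI)
  fix R p q x assume pq: "smooth_cc R p" "smooth_cc R q"
  have pq': "smooth_cc \<bar>R\<bar> (deriv p)" "smooth_cc \<bar>R\<bar> q"
    using smooth_cc_deriv[OF pq(1)] pq(2) by (auto simp: smooth_cc_def)
  obtain L where "lip_kern \<bar>R\<bar> L (tensor (deriv p) q)" using lip_kern_tensor[OF pq'] by auto
  moreover obtain L' where "lip_kern \<bar>R\<bar> L' (tensor q (deriv p))" using lip_kern_tensor[OF pq'(2,1)] by auto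
  ultimately obtain L'' where k: "kern \<bar>R\<bar> L'' (tens i (deriv p) q)"
    unfolding tens_def using lip_kernD(1) by (cases "i = 1") auto
  have "corr (tens i (deriv p) q) f x = corr (tens i (deriv p) q) f' x"
    by (rule corr_cong_AE[OF assms(2-4) k])
  then show "corr (tens i (deriv p) q) f' x = - corr (tens i p q) g x"
    using assms(1) pq unfolding tensor_wd_def by metis
qed

text \<open>The weight is at least \<open>1\<close>, so the weighted norms dominate the unweighted ones.\<close>

lemma H5_structure:
  assumes f: "f \<in> H_weighted 5 \<sigma>" and \<sigma>: "0 < \<sigma>" and c: "continuous_on UNIV f"
  shows "L2_fun f"
    "\<And>\<alpha>. length \<alpha> \<le> 5 \<Longrightarrow> L2_fun (wderiv \<alpha> f)"
    "\<And>\<alpha> i. length \<alpha> < 5 \<Longrightarrow> tensor_wd i (wderiv \<alpha> f) (wderiv (\<alpha> @ [i]) f)"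
    "\<And>i. tensor_wd i f (wderiv [i] f)"
proof -
  have S: "Sobolev_fun (poly_weight \<sigma>) 5 f" using f by simp
  note w1 = poly_weight_ge_1[OF \<sigma>]
  show L: "L2_fun f" by (rule Sobolev_fun_L2(1)[OF S w1])
  show "\<And>\<alpha>. length \<alpha> \<le> 5 \<Longrightarrow> L2_fun (wderiv \<alpha> f)" by (rule Sobolev_fun_wderiv(2)[OF S _ w1])
  show *: "\<And>\<alpha> i. length \<alpha> < 5 \<Longrightarrow> tensor_wd i (wderiv \<alpha> f) (wderiv (\<alpha> @ [i]) f)"
    by (rule Sobolev_fun_tensor_wd[OF S _ w1])
  note l = L2_fun_loc_integrable[OF L]
  show "tensor_wd i f (wderiv [i] f)" for i
    by (rule tensor_wd_cong_AE[OF _ wderiv_Nil_AE(1)[OF l] loc_integrable_measurable[OF wderiv_Nil_AE(2)[OF l]] loc_integrable_measurable[OF l]])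
       (use *[of "[]" i] in simp)
qed

abbreviation moll_err :: "real \<Rightarrow> (real^2 \<Rightarrow> real) \<Rightarrow> real^2 \<Rightarrow> real" where
  "moll_err \<eta> f x \<equiv> f x - corr (rho \<eta>) f x"

text \<open>
  Summation of the pointwise errors over the sample points: each point of the plane lies in at most
  \<open>(11 / \<epsilon>)\<^sup>2\<close> of the boxes of half-width \<open>5\<close>.
\<close>

lemma data_sampling_value:
  assumes f: "f \<in> H_weighted 5 \<sigma>" and \<sigma>: "0 < \<sigma>" and c: "continuous_on UNIV f"
  shows "\<exists>C\<ge>0. \<forall>\<eta> \<epsilon> A. 0 < \<eta> \<longrightarrow> \<eta> \<le> 1 \<longrightarrow> 0 < \<epsilon> \<longrightarrow> \<epsilon> \<le> 1 \<longrightarrow> finite A \<longrightarrow>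
    \<epsilon>\<^sup>2 * (\<Sum>k\<in>A. (moll_err \<eta> f (\<epsilon> *\<^sub>R lattice_pt k))\<^sup>2) \<le> C * \<eta>"
proof -
  note H = H5_structure[OF f \<sigma> c]
  define F where "F Y = \<bar>f Y\<bar> + \<bar>wderiv [1] f Y\<bar> + \<bar>wderiv [2] f Y\<bar> + \<bar>wderiv [1,2] f Y\<bar>" for Y
  have abs: "L2_fun (\<lambda>Y. \<bar>h Y\<bar>)" if "L2_fun h" for h
    by (rule L2_fun_bound(1)[OF that]) (use L2_fun_measurable[OF that] in auto)
  have F: "L2_fun F" unfolding F_def by (intro L2_fun_add(1) abs H(1) H(2)) auto
  show ?thesis
  proof (intro exI[of _ "80 * C0 ^ 4 * 11\<^sup>2 * (L2n F)\<^sup>2"] conjI allI impI)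
    show "0 \<le> 80 * C0 ^ 4 * 11\<^sup>2 * (L2n F)\<^sup>2" by simp
    fix \<eta> \<epsilon> :: real and A :: "(int^2) set" assume \<eta>: "0 < \<eta>" "\<eta> \<le> 1" and \<epsilon>: "0 < \<epsilon>" "\<epsilon> \<le> 1" and A: "finite A"
    have "\<epsilon>\<^sup>2 * (\<Sum>k\<in>A. (moll_err \<eta> f (\<epsilon> *\<^sub>R lattice_pt k))\<^sup>2)
        \<le> (80 * C0 ^ 4 * \<eta>) * (2 * 5 + \<epsilon>)\<^sup>2 * (L2n F)\<^sup>2"
    proof (rule sampling_bound_sq[OF F \<epsilon>(1) _ _ A, of _ _ _ 0])
      fix k
      show "(moll_err \<eta> f (\<epsilon> *\<^sub>R lattice_pt k))\<^sup>2
        \<le> 80 * C0 ^ 4 * \<eta> * (LINT Y:sqbox (\<epsilon> *\<^sub>R (lattice_pt k + 0)) 5|lebesgue. (F Y)\<^sup>2)"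
        unfolding F_def add_0_right using H(2,3)
        by (intro mollification_error_pointwise[OF H(4) H(4) _ H(1) _ _ _ c \<eta>]) (use H(3)[of "[1]" 2] in auto)
    qed (use \<eta> in auto)
    also have "\<dots> \<le> (80 * C0 ^ 4 * \<eta>) * 11\<^sup>2 * (L2n F)\<^sup>2"
      using \<epsilon> \<eta> by (intro mult_right_mono mult_left_mono power_mono) auto
    finally show "\<epsilon>\<^sup>2 * (\<Sum>k\<in>A. (moll_err \<eta> f (\<epsilon> *\<^sub>R lattice_pt k))\<^sup>2)
        \<le> 80 * C0 ^ 4 * 11\<^sup>2 * (L2n F)\<^sup>2 * \<eta>" by (simp add: mult_ac)
  qed
qed

text \<open>The same summation for the difference quotients, with one more derivative of \<open>f\<close>.\<close>

lemma data_sampling_gradient: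
  assumes f: "f \<in> H_weighted 5 \<sigma>" and \<sigma>: "0 < \<sigma>" and c: "continuous_on UNIV f"
  shows "\<exists>C\<ge>0. \<forall>\<eta> \<epsilon> A. 0 < \<eta> \<longrightarrow> \<eta> \<le> 1 \<longrightarrow> 0 < \<epsilon> \<longrightarrow> \<epsilon> \<le> 1 \<longrightarrow> finite A \<longrightarrow>
    \<epsilon>\<^sup>2 * (\<Sum>k\<in>A. ((moll_err \<eta> f (\<epsilon> *\<^sub>R lattice_pt k + \<epsilon> *\<^sub>R axis i 1)
      - moll_err \<eta> f (\<epsilon> *\<^sub>R lattice_pt k)) / \<epsilon>)\<^sup>2) \<le> C * (\<eta> + \<epsilon>)"
proof -
  note H = H5_structure[OF f \<sigma> c]
  define F where "F Y = \<bar>wderiv [i] f Y\<bar> + \<bar>wderiv [i,1] f Y\<bar> + \<bar>wderiv [i,2] f Y\<bar> + \<bar>wderiv [i,1,2] f Y\<bar>" for Y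
  have abs: "L2_fun (\<lambda>Y. \<bar>h Y\<bar>)" if "L2_fun h" for h
    by (rule L2_fun_bound(1)[OF that]) (use L2_fun_measurable[OF that] in auto)
  have F: "L2_fun F" unfolding F_def by (intro L2_fun_add(1) abs H(1) H(2)) auto
  have wd: "tensor_wd 1 (wderiv [i] f) (wderiv [i,1] f)" "tensor_wd 2 (wderiv [i] f) (wderiv [i,2] f)"
    "tensor_wd 2 (wderiv [i,1] f) (wderiv [i,1,2] f)"
    using H(3)[of "[i]" 1] H(3)[of "[i]" 2] H(3)[of "[i,1]" 2] by auto
  have l: "L2_fun (wderiv [i] f)" "L2_fun (wderiv [i,1] f)" "L2_fun (wderiv [i,2] f)" "L2_fun (wderiv [i,1,2] f)"
    by (intro H(2); simp)+
  show ?thesis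
  proof (intro exI[of _ "80 * C0 ^ 4 * 11\<^sup>2 * (L2n F)\<^sup>2"] conjI allI impI)
    show "0 \<le> 80 * C0 ^ 4 * 11\<^sup>2 * (L2n F)\<^sup>2" by simp
    fix \<eta> \<epsilon> :: real and A :: "(int^2) set" assume \<eta>: "0 < \<eta>" "\<eta> \<le> 1" and \<epsilon>: "0 < \<epsilon>" "\<epsilon> \<le> 1" and A: "finite A"
    let ?g = "\<lambda>k. (moll_err \<eta> f (\<epsilon> *\<^sub>R lattice_pt k + \<epsilon> *\<^sub>R axis i 1)
      - moll_err \<eta> f (\<epsilon> *\<^sub>R lattice_pt k)) / \<epsilon>"
    have "\<epsilon>\<^sup>2 * (\<Sum>k\<in>A. (?g k)\<^sup>2) \<le> (80 * C0 ^ 4 * (\<eta> + \<epsilon>)) * (2 * 5 + \<epsilon>)\<^sup>2 * (L2n F)\<^sup>2"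
    proof (rule sampling_bound_sq[OF F \<epsilon>(1) _ _ A, of _ _ _ 0])
      fix k
      show "(?g k)\<^sup>2 \<le> 80 * C0 ^ 4 * (\<eta> + \<epsilon>) * (LINT Y:sqbox (\<epsilon> *\<^sub>R (lattice_pt k + 0)) 5|lebesgue. (F Y)\<^sup>2)"
        unfolding F_def add_0_right
        by (rule mollification_gradient_error_pointwise[OF H(4) wd l c \<eta> \<epsilon>])
    qed (use \<eta> \<epsilon> in auto)
    also have "\<dots> \<le> (80 * C0 ^ 4 * (\<eta> + \<epsilon>)) * 11\<^sup>2 * (L2n F)\<^sup>2"
      using \<epsilon> \<eta> by (intro mult_right_mono mult_left_mono power_mono) auto
    finally show "\<epsilon>\<^sup>2 * (\<Sum>k\<in>A. (?g k)\<^sup>2) \<le> 80 * C0 ^ 4 * 11\<^sup>2 * (L2n F)\<^sup>2 * (\<eta> + \<epsilon>)" by (simp add: mult_ac)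
  qed
qed

section \<open>Low-pass interpolation\<close>

subsection \<open>Exponentials on the torus\<close>

lemma torus_cell_mem: "y \<in> torus_cell \<longleftrightarrow> (\<forall>i. - pi \<le> y $ i \<and> y $ i \<le> pi)"
  by (simp add: torus_cell_def mem_box_cart)

lemma torus_cell_props [simp]: "compact torus_cell" "torus_cell \<in> sets lebesgue" "torus_cell \<in> sets borel" "torus_cell \<in> lmeasurable"
  by (simp_all add: torus_cell_def)

declare torus_cell_props(2,3) [measurable]

lemma cell_integrable:
  fixes h :: "real^2 \<Rightarrow> 'a::{banach, second_countable_topology}"
  assumes "continuous_on UNIV h" shows "set_integrable lebesgue torus_cell h"
proof -
  have "set_integrable lborel torus_cell h"
    by (rule borel_integrable_compact[OF torus_cell_props(1) continuous_on_subset[OF assms subset_UNIV], folded set_integrable_def])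
  moreover have "(\<lambda>x. indicat_real torus_cell x *\<^sub>R h x) \<in> borel_measurable borel"
  proof -
    have [measurable]: "torus_cell \<in> sets borel" "h \<in> borel_measurable borel"
      using borel_measurable_continuous_onI[OF assms] by auto
    show ?thesis by measurable
  qed
  ultimately show ?thesis by (simp add: set_integrable_def integrable_completion)
qed

text \<open>Integrals over the frequency cell; \<open>RI\<close> serves real integrands such as energy densities.\<close>

definition CI :: "(real^2 \<Rightarrow> complex) \<Rightarrow> complex" where "CI h = (LINT y:torus_cell|lebesgue. h y)"
definition RI :: "(real^2 \<Rightarrow> real) \<Rightarrow> real" where "RI h = (LINT y:torus_cell|lebesgue. h y)"

lemma CI_add: "continuous_on UNIV f \<Longrightarrow> continuous_on UNIV g \<Longrightarrow> CI (\<lambda>y. f y + g y) = CI f + CI g"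
  unfolding CI_def by (intro set_integral_add cell_integrable)
lemma CI_cmult: "CI (\<lambda>y. c * f y) = c * CI f"
  unfolding CI_def by (rule set_integral_mult_right)
lemma CI_sum: "(\<And>j. j \<in> A \<Longrightarrow> continuous_on UNIV (f j)) \<Longrightarrow> CI (\<lambda>y. \<Sum>j\<in>A. f j y) = (\<Sum>j\<in>A. CI (f j))"
proof (induction A rule: infinite_finite_induct)
  case (insert x F)
  have "CI (\<lambda>y. \<Sum>j\<in>insert x F. f j y) = CI (\<lambda>y. f x y + (\<Sum>j\<in>F. f j y))" using insert by simp
  also have "\<dots> = CI (f x) + CI (\<lambda>y. \<Sum>j\<in>F. f j y)"
    by (rule CI_add) (use insert in \<open>auto intro!: continuous_on_sum\<close>)
  finally show ?case using insert by simp
qed (simp_all add: CI_def set_lebesgue_integral_def)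
lemma RI_Re: "continuous_on UNIV f \<Longrightarrow> RI (\<lambda>y. Re (f y)) = Re (CI f)"
  unfolding RI_def CI_def set_lebesgue_integral_def
  using integral_bounded_linear[OF bounded_linear_Re, of lebesgue "\<lambda>y. indicat_real torus_cell y *\<^sub>R f y"] cell_integrable[of f]
  by (simp add: set_integrable_def)
lemma RI_mono: "continuous_on UNIV f \<Longrightarrow> continuous_on UNIV g \<Longrightarrow> (\<And>y. y \<in> torus_cell \<Longrightarrow> f y \<le> g y) \<Longrightarrow> RI f \<le> RI g"
  unfolding RI_def by (rule set_integral_mono) (auto intro: cell_integrable)
lemma RI_add: "continuous_on UNIV f \<Longrightarrow> continuous_on UNIV g \<Longrightarrow> RI (\<lambda>y. f y + g y) = RI f + RI g"
  unfolding RI_def by (intro set_integral_add cell_integrable)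
lemma RI_cmult: "RI (\<lambda>y. c * f y) = c * RI f"
  unfolding RI_def by (rule set_integral_mult_right)

lemma exp_integral_1:
  "has_bochner_integral lborel (\<lambda>t. indicator {-pi..pi} t *\<^sub>R cis (of_int n * t)) (if n = 0 then complex_of_real (2 * pi) else 0)"
proof (cases "n = 0")
  case True
  have "has_bochner_integral lborel (\<lambda>t. indicator {-pi..pi} t *\<^sub>R (1::complex)) (of_real pi - of_real (- pi))"
    by (rule has_bochner_integral_FTC_Icc)
       (auto intro!: derivative_eq_intros simp: has_vector_derivative_def fun_eq_iff scaleR_conv_of_real)
  then show ?thesis using True by (simp add: cis_zero)
next
  case False
  define F where "F t = cis (of_int n * t) / (\<i> * of_int n)" for t :: real
  have "(F has_vector_derivative cis (of_int n * t)) (at t within {-pi..pi})" for t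
  proof -
    have "((\<lambda>t. cis (of_int n * t)) has_vector_derivative of_int n *\<^sub>R (\<i> * cis (of_int n * t))) (at t within {-pi..pi})"
    proof -
      have "((\<lambda>t. complex_of_real t) has_vector_derivative 1) (at t within {-pi..pi})"
        by (auto intro!: derivative_eq_intros simp: has_vector_derivative_def fun_eq_iff scaleR_conv_of_real)
      then have "((\<lambda>t. (\<i> * of_int n) * complex_of_real t) has_vector_derivative (\<i> * of_int n) * 1) (at t within {-pi..pi})"
        by (rule has_vector_derivative_mult_right)
      from field_vector_diff_chain_within[OF this has_field_derivative_at_within[OF DERIV_exp]]
      show ?thesis by (simp add: o_def cis_conv_exp mult_ac scaleR_conv_of_real)
    qed
    then have "((\<lambda>t. cis (of_int n * t) * (1 / (\<i> * of_int n))) has_vector_derivative (of_int n *\<^sub>R (\<i> * cis (of_int n * t))) * (1 / (\<i> * of_int n))) (at t within {-pi..pi})"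
      by (rule has_vector_derivative_mult_left)
    then show ?thesis using False by (simp add: F_def[abs_def] scaleR_conv_of_real field_simps)
  qed
  then have "has_bochner_integral lborel (\<lambda>t. indicator {-pi..pi} t *\<^sub>R cis (of_int n * t)) (F pi - F (- pi))"
    by (intro has_bochner_integral_FTC_Icc) (auto intro!: continuous_intros simp: cis_conv_exp)
  moreover have "F pi = F (- pi)"
  proof -
    have "sin (of_int n * pi) = 0" unfolding sin_zero_iff_int2 by auto
    then have "cis (of_int n * pi) = cis (of_int n * - pi)" by (simp add: complex_eq_iff)
    then show ?thesis by (simp only: F_def)
  qed
  ultimately show ?thesis using False by simp
qed

lemma inner_R2: "(x::real^2) \<bullet> y = x $ 1 * y $ 1 + x $ 2 * y $ 2"
  by (simp add: inner_vec_def sum_2)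

lemma continuous_cis_inner [continuous_intros]: "continuous_on S (\<lambda>y. cis (f y))" if "continuous_on S f"
  unfolding cis_conv_exp using that by (intro continuous_intros)

lemma CI_exp: "CI (\<lambda>y. cis (lattice_pt k \<bullet> y)) = (if k = 0 then complex_of_real ((2 * pi)\<^sup>2) else 0)"
proof -
  let ?f = "\<lambda>n t. indicator {-pi..pi} t *\<^sub>R cis (of_int n * t)"
  have int: "integrable lborel (?f n)" "(LINT t|lborel. ?f n t) = (if n = 0 then complex_of_real (2 * pi) else 0)" for n
    using exp_integral_1[of n] by (auto simp: has_bochner_integral_iff)
  have "CI (\<lambda>y. cis (lattice_pt k \<bullet> y)) = (LINT (y::real^2)|lebesgue. ?f (k $ 1) (y $ 1) * ?f (k $ 2) (y $ 2))"
    unfolding CI_def set_lebesgue_integral_def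
    by (rule Bochner_Integration.integral_cong) (auto simp: torus_cell_mem forall_2 inner_R2 cis_mult indicator_def)
  also have "\<dots> = (LINT t|lborel. ?f (k $ 1) t) * (LINT t|lborel. ?f (k $ 2) t)"
    by (rule lebesgue_tensor(2)[OF int(1) int(1)])
  also have "\<dots> = (if k = 0 then complex_of_real ((2 * pi)\<^sup>2) else 0)"
    by (simp add: int(2) vec_eq_iff forall_2 power2_eq_square)
  finally show ?thesis .
qed

text \<open>The partial sums by which the lattice Fourier transform is defined.\<close>

definition trig :: "(int^2) set \<Rightarrow> (int^2 \<Rightarrow> complex) \<Rightarrow> real^2 \<Rightarrow> complex" where
  "trig A f y = (1 / (2 * pi)\<^sup>2) *\<^sub>R (\<Sum>j\<in>A. cis (- (lattice_pt j \<bullet> y)) * f j)"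

lemma continuous_trig [continuous_intros]: "continuous_on S (trig A f)"
  unfolding trig_def[abs_def] by (intro continuous_intros)

lemma lattice_pt_diff: "lattice_pt (j - k) = lattice_pt j - lattice_pt k"
  by (simp add: vec_eq_iff)
lemma lattice_pt_add: "lattice_pt (j + k) = lattice_pt j + lattice_pt k"
  by (simp add: vec_eq_iff)

lemma trig_mult:
  "z * trig A f y = (\<Sum>j\<in>A. (f j / of_real ((2 * pi)\<^sup>2)) * (z * cis (- (lattice_pt j \<bullet> y))))"
proof -
  have *: "z * (of_real (1 / c) * (e * v)) = v / of_real c * (z * e)" for c :: real and e v :: complex
    by (simp add: divide_inverse mult_ac)
  show ?thesis unfolding trig_def scaleR_conv_of_real sum_distrib_left * ..
qed

lemma cnj_trig_mult:
  "cnj (trig A f y) * z = (\<Sum>j\<in>A. (cnj (f j) / of_real ((2 * pi)\<^sup>2)) * (cis (lattice_pt j \<bullet> y) * z))"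
proof -
  have *: "(of_real (1 / c) * (e * v)) * z = v / of_real c * (e * z)" for c :: real and e v :: complex
    by (simp add: divide_inverse mult_ac)
  have "cnj (trig A f y) = (\<Sum>j\<in>A. of_real (1 / (2 * pi)\<^sup>2) * (cis (lattice_pt j \<bullet> y) * cnj (f j)))"
    unfolding trig_def scaleR_conv_of_real sum_distrib_left[symmetric] by (simp add: cis_cnj)
  then show ?thesis by (simp only: sum_distrib_right *)
qed

lemma CI_trig_coeff:
  assumes "finite A"
  shows "CI (\<lambda>y. cis (lattice_pt k \<bullet> y) * trig A f y) = (if k \<in> A then f k else 0)"
proof -
  have "(\<lambda>y. cis (lattice_pt k \<bullet> y) * trig A f y) = (\<lambda>y. \<Sum>j\<in>A. (f j / of_real ((2 * pi)\<^sup>2)) * cis (lattice_pt (k - j) \<bullet> y))"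
    unfolding trig_mult cis_mult lattice_pt_diff inner_diff_left by simp
  then have "CI (\<lambda>y. cis (lattice_pt k \<bullet> y) * trig A f y) = (\<Sum>j\<in>A. CI (\<lambda>y. (f j / of_real ((2 * pi)\<^sup>2)) * cis (lattice_pt (k - j) \<bullet> y)))"
    by (simp only:) (rule CI_sum, intro continuous_intros)
  also have "\<dots> = (\<Sum>j\<in>A. if k = j then f j else 0)"
    unfolding CI_cmult CI_exp by (intro sum.cong) auto
  also have "\<dots> = (if k \<in> A then f k else 0)" using assms by simp
  finally show ?thesis .
qed

lemma norm_sq_cnj: "(norm z)\<^sup>2 = Re (cnj z * z)" "Re (cnj z / of_real c * z) = (norm z)\<^sup>2 / c"
  unfolding cmod_power2 by (simp_all add: power2_eq_square add_divide_distrib)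

text \<open>Parseval's identity for finite sums, from the orthogonality of the exponentials.\<close>

lemma RI_trig_sq:
  assumes "finite A"
  shows "RI (\<lambda>y. (norm (trig A f y))\<^sup>2) = (\<Sum>j\<in>A. (norm (f j))\<^sup>2) / (2 * pi)\<^sup>2"
proof -
  have eq: "cnj (trig A f y) * trig A f y = (\<Sum>j\<in>A. (cnj (f j) / of_real ((2 * pi)\<^sup>2)) * (cis (lattice_pt j \<bullet> y) * trig A f y))" for y
    by (rule cnj_trig_mult)
  have "RI (\<lambda>y. (norm (trig A f y))\<^sup>2) = RI (\<lambda>y. Re (cnj (trig A f y) * trig A f y))"
    by (simp only: norm_sq_cnj(1))
  also have "\<dots> = Re (CI (\<lambda>y. cnj (trig A f y) * trig A f y))"
    by (rule RI_Re) (intro continuous_intros)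
  also have "CI (\<lambda>y. cnj (trig A f y) * trig A f y) = (\<Sum>j\<in>A. CI (\<lambda>y. (cnj (f j) / of_real ((2 * pi)\<^sup>2)) * (cis (lattice_pt j \<bullet> y) * trig A f y)))"
    unfolding eq by (rule CI_sum) (intro continuous_intros)
  also have "\<dots> = (\<Sum>j\<in>A. cnj (f j) / of_real ((2 * pi)\<^sup>2) * f j)"
    unfolding CI_cmult CI_trig_coeff[OF assms] by simp
  also have "Re \<dots> = (\<Sum>j\<in>A. (norm (f j))\<^sup>2) / (2 * pi)\<^sup>2"
    by (simp only: Re_sum norm_sq_cnj(2) sum_divide_distrib)
  finally show ?thesis .
qed

text \<open>The distance of \<open>h\<close> to its projection on the exponentials with frequencies in \<open>K\<close> is nonnegative.\<close>

lemma Bessel: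
  assumes h: "continuous_on UNIV h" and K: "finite K"
  shows "(\<Sum>k\<in>K. (norm (CI (\<lambda>y. cis (lattice_pt k \<bullet> y) * h y)))\<^sup>2) \<le> (2 * pi)\<^sup>2 * RI (\<lambda>y. (norm (h y))\<^sup>2)"
proof -
  define c where "c k = CI (\<lambda>y. cis (lattice_pt k \<bullet> y) * h y)" for k
  have eq: "cnj (trig K c y) * h y = (\<Sum>k\<in>K. (cnj (c k) / of_real ((2 * pi)\<^sup>2)) * (cis (lattice_pt k \<bullet> y) * h y))" for y
    by (rule cnj_trig_mult)
  have "CI (\<lambda>y. cnj (trig K c y) * h y) = (\<Sum>k\<in>K. CI (\<lambda>y. (cnj (c k) / of_real ((2 * pi)\<^sup>2)) * (cis (lattice_pt k \<bullet> y) * h y)))"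
    unfolding eq by (rule CI_sum) (intro continuous_intros h)
  also have "\<dots> = (\<Sum>k\<in>K. cnj (c k) / of_real ((2 * pi)\<^sup>2) * c k)"
    unfolding CI_cmult c_def by simp
  finally have "Re (CI (\<lambda>y. cnj (trig K c y) * h y)) = (\<Sum>k\<in>K. (norm (c k))\<^sup>2) / (2 * pi)\<^sup>2"
    by (simp only: Re_sum norm_sq_cnj(2) sum_divide_distrib)
  then have cross: "RI (\<lambda>y. Re (cnj (trig K c y) * h y)) = (\<Sum>k\<in>K. (norm (c k))\<^sup>2) / (2 * pi)\<^sup>2"
    by (subst RI_Re) (auto intro!: continuous_intros h)
  have "0 \<le> RI (\<lambda>y. (norm (h y - trig K c y))\<^sup>2)"
    unfolding RI_def set_lebesgue_integral_def by (rule Bochner_Integration.integral_nonneg) simp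
  also have expand: "(\<lambda>y. (norm (h y - trig K c y))\<^sup>2) = (\<lambda>y. ((norm (h y))\<^sup>2 + (-2) * Re (cnj (trig K c y) * h y)) + (norm (trig K c y))\<^sup>2)"
    unfolding cmod_power2 by (simp add: fun_eq_iff power2_eq_square algebra_simps)
  also have "RI \<dots> = RI (\<lambda>y. (norm (h y))\<^sup>2) + (-2) * RI (\<lambda>y. Re (cnj (trig K c y) * h y)) + RI (\<lambda>y. (norm (trig K c y))\<^sup>2)"
    by (subst RI_add, (intro continuous_intros h)+, subst RI_add, (intro continuous_intros h)+, simp only: RI_cmult)
  finally have "(\<Sum>k\<in>K. (norm (c k))\<^sup>2) / (2 * pi)\<^sup>2 \<le> RI (\<lambda>y. (norm (h y))\<^sup>2)"
    unfolding cross RI_trig_sq[OF K] by simp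
  then show ?thesis by (simp add: c_def divide_le_eq mult.commute)
qed

subsection \<open>The lattice Fourier transform exists\<close>

abbreviation cell_norm :: "(real^2 \<Rightarrow> complex) \<Rightarrow> ennreal" where
  "cell_norm h \<equiv> L2_norm (\<lambda>y. indicator torus_cell y *\<^sub>R h y)"

lemma nn_cell_trig:
  assumes "finite A"
  shows "(\<integral>\<^sup>+y. ennreal ((norm (indicator torus_cell y *\<^sub>R trig A f y))\<^sup>2) \<partial>lebesgue) = ennreal ((\<Sum>j\<in>A. (norm (f j))\<^sup>2) / (2 * pi)\<^sup>2)"
proof -
  have c: "continuous_on UNIV (\<lambda>y. (norm (trig A f y))\<^sup>2)" by (intro continuous_intros)
  have "(\<integral>\<^sup>+y. ennreal ((norm (indicator torus_cell y *\<^sub>R trig A f y))\<^sup>2) \<partial>lebesgue)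
      = (\<integral>\<^sup>+y. ennreal (indicator torus_cell y *\<^sub>R (norm (trig A f y))\<^sup>2) \<partial>lebesgue)"
    by (intro nn_integral_cong) (auto split: split_indicator)
  also have "\<dots> = ennreal (RI (\<lambda>y. (norm (trig A f y))\<^sup>2))"
    unfolding RI_def set_lebesgue_integral_def
    by (rule nn_integral_eq_integral) (use cell_integrable[OF c] in \<open>auto simp: set_integrable_def\<close>)
  finally show ?thesis by (simp add: RI_trig_sq[OF assms])
qed

lemma L2_norm_cell_trig:
  assumes "finite A"
  shows "cell_norm (trig A f) \<le> ennreal (sqrt (\<Sum>j\<in>A. (norm (f j))\<^sup>2))"
proof (subst L2_norm_le_iff)
  have pi1: "1 \<le> (2 * pi)\<^sup>2" using pi_gt3 by (intro one_le_power) linarith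
  have s: "0 \<le> (\<Sum>j\<in>A. (norm (f j))\<^sup>2)" by (intro sum_nonneg) simp
  then have "(\<Sum>j\<in>A. (norm (f j))\<^sup>2) / (2 * pi)\<^sup>2 \<le> (\<Sum>j\<in>A. (norm (f j))\<^sup>2)"
    using divide_left_mono[OF pi1 s] by simp
  then show "(\<integral>\<^sup>+y. ennreal ((norm (indicator torus_cell y *\<^sub>R trig A f y))\<^sup>2) \<partial>lebesgue) \<le> ennreal ((sqrt (\<Sum>j\<in>A. (norm (f j))\<^sup>2))\<^sup>2)"
    unfolding nn_cell_trig[OF assms] using s by (intro ennreal_leI) simp
qed (simp add: sum_nonneg)

lemma trig_diff_subset:
  assumes "finite B" "A \<subseteq> B" shows "trig B f y - trig A f y = trig (B - A) f y"
  unfolding trig_def scaleR_diff_right[symmetric] using assms by (simp add: sum_diff)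

lemma trig_measurable [measurable]: "trig A f \<in> borel_measurable lebesgue"
  using borel_measurable_continuous_onI[OF continuous_trig] by (simp add: measurable_completion)

text \<open>
  The theorem of Riesz and Fischer: partial sums along a rapidly exhausting sequence of finite sets
  converge almost everywhere, and Fatou's lemma identifies the limit in \<open>L\<^sup>2\<close>.
\<close>

lemma lattice_FT_exists:
  assumes f: "(\<lambda>j. (norm (f j))\<^sup>2) summable_on UNIV"
  shows "\<exists>g. g \<in> borel_measurable lebesgue \<and>
    ((\<lambda>A. cell_norm (\<lambda>y. g y - trig A f y)) \<longlongrightarrow> 0) (finite_subsets_at_top UNIV)"
proof -
  define s where "s = (\<Sum>\<^sub>\<infinity>j. (norm (f j))\<^sup>2)"
  have hs: "((\<lambda>j. (norm (f j))\<^sup>2) has_sum s) UNIV" using f by (simp add: s_def)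
  have "\<exists>A. finite A \<and> (\<forall>B. finite B \<longrightarrow> A \<subseteq> B \<longrightarrow> \<bar>(\<Sum>j\<in>B. (norm (f j))\<^sup>2) - s\<bar> < (1/4) ^ n / 2)" for n :: nat
  proof -
    have "\<forall>\<^sub>F B in finite_subsets_at_top UNIV. dist (\<Sum>j\<in>B. (norm (f j))\<^sup>2) s < (1/4) ^ n / 2"
      using hs unfolding has_sum_def by (rule tendstoD) simp
    then show ?thesis unfolding eventually_finite_subsets_at_top dist_real_def by auto
  qed
  then obtain A0 where A0: "\<And>n. finite (A0 n)" "\<And>n B. finite B \<Longrightarrow> A0 n \<subseteq> B \<Longrightarrow> \<bar>(\<Sum>j\<in>B. (norm (f j))\<^sup>2) - s\<bar> < (1/4) ^ n / 2"
    by metis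
  define A where "A n = (\<Union>m\<le>n. A0 m)" for n
  have Af: "finite (A n)" and AA0: "A0 n \<subseteq> A n" for n
    using A0(1) by (auto simp: A_def)
  have Amono: "A m \<subseteq> A n" if "m \<le> n" for m n
    unfolding A_def using that by (intro UN_mono) auto
  have tail: "(\<Sum>j\<in>B - A n. (norm (f j))\<^sup>2) \<le> (1/4) ^ n" if "finite B" "A n \<subseteq> B" for B n
  proof -
    have "(\<Sum>j\<in>B - A n. (norm (f j))\<^sup>2) = (\<Sum>j\<in>B. (norm (f j))\<^sup>2) - (\<Sum>j\<in>A n. (norm (f j))\<^sup>2)"
      using that by (intro sum_diff)
    moreover have "\<bar>(\<Sum>j\<in>B. (norm (f j))\<^sup>2) - s\<bar> < (1/4) ^ n / 2" using that AA0 by (intro A0(2)) auto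
    moreover have "\<bar>(\<Sum>j\<in>A n. (norm (f j))\<^sup>2) - s\<bar> < (1/4) ^ n / 2" using AA0 Af by (intro A0(2)) auto
    ultimately show ?thesis by linarith
  qed
  have sq: "sqrt ((1/4) ^ n) = (1/2::real) ^ n" for n
    unfolding real_sqrt_power by (simp add: real_sqrt_divide)
  have tailn: "cell_norm (\<lambda>y. trig B f y - trig (A n) f y) \<le> ennreal ((1/2) ^ n)"
    if "finite B" "A n \<subseteq> B" for B n
  proof -
    have "cell_norm (trig (B - A n) f) \<le> ennreal (sqrt (\<Sum>j\<in>B - A n. (norm (f j))\<^sup>2))"
      by (rule L2_norm_cell_trig) (use that in simp)
    also have "\<dots> \<le> ennreal ((1/2) ^ n)"
      unfolding sq[symmetric] by (intro ennreal_leI real_sqrt_le_mono tail that)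
    finally show ?thesis by (simp only: trig_diff_subset[OF that])
  qed
  define T where "T n = trig (A n) f" for n
  have Tm [measurable]: "T n \<in> borel_measurable lebesgue" for n by (simp add: T_def)
  define D where "D n y = indicat_real torus_cell y * norm (T (Suc n) y - T n y)" for n y
  have Dm [measurable]: "D n \<in> borel_measurable lebesgue" for n unfolding D_def by measurable
  have Dint: "(\<integral>\<^sup>+y. ennreal (D n y) \<partial>lebesgue) \<le> ennreal (2 * pi * (1/2) ^ n)" for n
  proof (rule ennreal_power2_le_imp_le)
    have "(\<integral>\<^sup>+y. ennreal (D n y) * indicator torus_cell y \<partial>lebesgue)\<^sup>2
        \<le> (\<integral>\<^sup>+y. (ennreal (D n y))\<^sup>2 \<partial>lebesgue) * (\<integral>\<^sup>+y. (indicator torus_cell y)\<^sup>2 \<partial>lebesgue)"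
    proof (rule Cauchy_Schwarz_nn_integral)
      show "(\<lambda>y. ennreal (D n y)) \<in> borel_measurable lebesgue" by measurable
      show "indicator torus_cell \<in> borel_measurable lebesgue" by (rule borel_measurable_indicator) simp
    qed
    also have "(\<integral>\<^sup>+y. ennreal (D n y) * indicator torus_cell y \<partial>lebesgue) = (\<integral>\<^sup>+y. ennreal (D n y) \<partial>lebesgue)"
      by (intro nn_integral_cong) (auto simp: D_def split: split_indicator)
    also have "(\<integral>\<^sup>+y. (indicator torus_cell y :: ennreal)\<^sup>2 \<partial>lebesgue) = (\<integral>\<^sup>+y. indicator torus_cell y \<partial>lebesgue)"
      by (intro nn_integral_cong) (auto split: split_indicator)
    also have "\<dots> = emeasure lebesgue torus_cell" by (rule nn_integral_indicator) simp
    also have "emeasure lebesgue torus_cell = ennreal ((2 * pi)\<^sup>2)"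
    proof -
      have t: "torus_cell = sqbox 0 pi" by (auto simp: torus_cell_mem sqbox_def abs_le_iff minus_le_iff)
      have "measure lebesgue torus_cell = (2 * pi)\<^sup>2"
        unfolding t by (rule measure_sqbox) simp
      then show ?thesis using emeasure_eq_ennreal_measure[OF fmeasurableD2[OF torus_cell_props(4)]] by metis
    qed
    also have "(\<integral>\<^sup>+y. (ennreal (D n y))\<^sup>2 \<partial>lebesgue) = (cell_norm (\<lambda>y. trig (A (Suc n)) f y - trig (A n) f y))\<^sup>2"
      unfolding L2_norm_power2 by (intro nn_integral_cong) (auto simp: D_def T_def ennreal_power split: split_indicator)
    also have "\<dots> * ennreal ((2 * pi)\<^sup>2) \<le> (ennreal ((1/2) ^ n))\<^sup>2 * ennreal ((2 * pi)\<^sup>2)"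
      by (intro mult_right_mono power_mono tailn Af Amono) auto
    also have "\<dots> = ennreal (((1/2) ^ n)\<^sup>2 * (2 * pi)\<^sup>2)"
      by (subst ennreal_mult) (simp_all add: ennreal_power)
    also have "((1/2) ^ n)\<^sup>2 * (2 * pi)\<^sup>2 = (2 * pi * (1/2) ^ n)\<^sup>2" by (simp only: power_mult_distrib mult_ac)
    also have "ennreal ((2 * pi * (1/2) ^ n)\<^sup>2) = (ennreal (2 * pi * (1/2) ^ n))\<^sup>2"
      by (rule ennreal_power[symmetric]) simp
    finally show "(\<integral>\<^sup>+y. ennreal (D n y) \<partial>lebesgue)\<^sup>2 \<le> (ennreal (2 * pi * (1/2) ^ n))\<^sup>2" .
  qed
  have "(\<integral>\<^sup>+y. (\<Sum>n. ennreal (D n y)) \<partial>lebesgue) = (\<Sum>n. \<integral>\<^sup>+y. ennreal (D n y) \<partial>lebesgue)"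
    by (rule nn_integral_suminf) measurable
  also have "\<dots> \<le> (\<Sum>n. ennreal (2 * pi * (1/2) ^ n))" by (intro suminf_le Dint) auto
  also have "\<dots> < \<infinity>"
  proof -
    have "summable (\<lambda>n. 2 * pi * (1/2::real) ^ n)" by (intro summable_mult summable_geometric) simp
    then have "(\<Sum>n. ennreal (2 * pi * (1/2) ^ n)) \<noteq> top" by (rule ennreal_suminf_neq_top) simp
    then show ?thesis by (metis infinity_ennreal_def top.not_eq_extremum)
  qed
  finally have fin: "(\<integral>\<^sup>+y. (\<Sum>n. ennreal (D n y)) \<partial>lebesgue) \<noteq> \<infinity>" by (rule less_imp_neq)
  have "AE y in lebesgue. (\<Sum>n. ennreal (D n y)) \<noteq> \<infinity>"
    by (rule nn_integral_PInf_AE[OF _ fin]) measurable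
  then have conv: "AE y in lebesgue. y \<in> torus_cell \<longrightarrow> convergent (\<lambda>n. T n y)"
  proof eventually_elim
    case (elim y)
    show ?case
    proof
      assume y: "y \<in> torus_cell"
      have "summable (\<lambda>n. D n y)" by (rule summable_suminf_not_top) (use elim in \<open>auto simp: D_def\<close>)
      then have "summable (\<lambda>n. norm (T (Suc n) y - T n y))" using y by (simp add: D_def)
      then have "summable (\<lambda>n. T (Suc n) y - T n y)" by (rule summable_norm_cancel)
      then have "convergent (\<lambda>n. \<Sum>i<n. T (Suc i) y - T i y)" by (simp add: summable_iff_convergent)
      then have "convergent (\<lambda>n. T n y - T 0 y)" by (simp only: sum_lessThan_telescope[of "\<lambda>i. T i y"])
      from convergent_add[OF this convergent_const[of "T 0 y"]] show "convergent (\<lambda>n. T n y)" by simp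
    qed
  qed
  define g where "g y = lim (\<lambda>n. T n y)" for y
  have gm [measurable]: "g \<in> borel_measurable lebesgue" unfolding g_def by measurable
  have glim: "AE y in lebesgue. y \<in> torus_cell \<longrightarrow> (\<lambda>n. T n y) \<longlonglongrightarrow> g y"
    using conv by eventually_elim (simp add: g_def convergent_LIMSEQ_iff)
  have gT: "cell_norm (\<lambda>y. g y - T n y) \<le> ennreal ((1/2) ^ n)" for n
  proof -
    have "(\<integral>\<^sup>+y. ennreal ((norm (indicator torus_cell y *\<^sub>R (g y - T n y)))\<^sup>2) \<partial>lebesgue)
       = (\<integral>\<^sup>+y. liminf (\<lambda>m. ennreal ((norm (indicator torus_cell y *\<^sub>R (T m y - T n y)))\<^sup>2)) \<partial>lebesgue)"
    proof (rule nn_integral_cong_AE)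
      show "AE y in lebesgue. ennreal ((norm (indicator torus_cell y *\<^sub>R (g y - T n y)))\<^sup>2) = liminf (\<lambda>m. ennreal ((norm (indicator torus_cell y *\<^sub>R (T m y - T n y)))\<^sup>2))"
        using glim
      proof eventually_elim
        case (elim y)
        have "(\<lambda>m. ennreal ((norm (indicator torus_cell y *\<^sub>R (T m y - T n y)))\<^sup>2)) \<longlonglongrightarrow> ennreal ((norm (indicator torus_cell y *\<^sub>R (g y - T n y)))\<^sup>2)"
          using elim by (cases "y \<in> torus_cell") (auto intro!: tendsto_intros)
        then show ?case by (rule lim_imp_Liminf[OF trivial_limit_sequentially, symmetric])
      qed
    qed
    also have "\<dots> \<le> liminf (\<lambda>m. \<integral>\<^sup>+y. ennreal ((norm (indicator torus_cell y *\<^sub>R (T m y - T n y)))\<^sup>2) \<partial>lebesgue)"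
      by (rule nn_integral_liminf) measurable
    also have "\<dots> \<le> ennreal (((1/2) ^ n)\<^sup>2)"
    proof (rule Liminf_le)
      show "\<forall>\<^sub>F m in sequentially. (\<integral>\<^sup>+y. ennreal ((norm (indicator torus_cell y *\<^sub>R (T m y - T n y)))\<^sup>2) \<partial>lebesgue) \<le> ennreal (((1/2) ^ n)\<^sup>2)"
      proof (rule eventually_sequentiallyI[of n])
        fix m assume "n \<le> m"
        then show "(\<integral>\<^sup>+y. ennreal ((norm (indicator torus_cell y *\<^sub>R (T m y - T n y)))\<^sup>2) \<partial>lebesgue) \<le> ennreal (((1/2) ^ n)\<^sup>2)"
          unfolding T_def by (subst L2_norm_le_iff[symmetric]) (auto intro!: tailn Af Amono)
      qed
    qed simp
    finally show ?thesis by (subst L2_norm_le_iff) auto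
  qed
  have main: "((\<lambda>B. cell_norm (\<lambda>y. g y - trig B f y)) \<longlongrightarrow> 0) (finite_subsets_at_top UNIV)"
  proof (rule order_tendstoI)
    fix a :: ennreal assume "0 < a"
    obtain n where n: "ennreal (2 * (1/2) ^ n) < a"
    proof -
      have "(\<lambda>n. ennreal (2 * (1/2) ^ n)) \<longlonglongrightarrow> ennreal (2 * 0)"
        by (intro tendsto_intros LIMSEQ_power_zero) simp
      then have "\<forall>\<^sub>F n in sequentially. ennreal (2 * (1/2) ^ n) < a" using \<open>0 < a\<close> by (intro order_tendstoD(2)) auto
      then show ?thesis using that by (meson eventually_sequentially order_refl)
    qed
    show "\<forall>\<^sub>F B in finite_subsets_at_top UNIV. cell_norm (\<lambda>y. g y - trig B f y) < a"
      unfolding eventually_finite_subsets_at_top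
    proof (intro exI[of _ "A n"] conjI allI impI)
      fix B assume B: "finite B \<and> A n \<subseteq> B \<and> B \<subseteq> UNIV"
      have "cell_norm (\<lambda>y. g y - trig B f y)
          = L2_norm (\<lambda>y. indicator torus_cell y *\<^sub>R (g y - T n y) + indicator torus_cell y *\<^sub>R (T n y - trig B f y))"
        by (simp add: algebra_simps)
      also have "\<dots> \<le> cell_norm (\<lambda>y. g y - T n y) + cell_norm (\<lambda>y. T n y - trig B f y)"
        by (rule L2_norm_triangle) measurable
      also have "cell_norm (\<lambda>y. T n y - trig B f y) = cell_norm (\<lambda>y. trig B f y - T n y)"
        by (simp add: L2_norm_def norm_minus_commute)
      also have "cell_norm (\<lambda>y. g y - T n y) + \<dots> \<le> ennreal ((1/2) ^ n) + ennreal ((1/2) ^ n)"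
        by (intro add_mono gT) (use tailn[of B n] B in \<open>simp add: T_def\<close>)
      also have "\<dots> = ennreal (2 * (1/2) ^ n)" by (simp flip: ennreal_plus)
      also have "\<dots> < a" by (rule n)
      finally show "cell_norm (\<lambda>y. g y - trig B f y) < a" .
    qed (use Af in auto)
  qed simp
  show ?thesis by (rule exI[of _ g]) (use gm main in auto)
qed

subsection \<open>Low-pass interpolation as an operator on \<open>\<ell>\<^sup>2\<close>\<close>

lemma cell_L1_le_L2:
  assumes hm [measurable]: "h \<in> borel_measurable lebesgue" and r: "0 \<le> r"
    and le: "cell_norm h \<le> ennreal r"
  shows "set_integrable lebesgue torus_cell h" "norm (CI h) \<le> 2 * pi * r"
proof -
  let ?h = "\<lambda>y. indicator torus_cell y *\<^sub>R h y"
  have hm' [measurable]: "?h \<in> borel_measurable lebesgue" by measurable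
  have em: "emeasure lebesgue torus_cell = ennreal ((2 * pi)\<^sup>2)"
  proof -
    have t: "torus_cell = sqbox 0 pi" by (auto simp: torus_cell_mem sqbox_def abs_le_iff minus_le_iff)
    have "measure lebesgue torus_cell = (2 * pi)\<^sup>2" unfolding t by (rule measure_sqbox) simp
    then show ?thesis using emeasure_eq_ennreal_measure[OF fmeasurableD2[OF torus_cell_props(4)]] by metis
  qed
  have nn: "(\<integral>\<^sup>+y. ennreal (norm (?h y)) \<partial>lebesgue) \<le> ennreal (2 * pi * r)"
  proof (rule ennreal_power2_le_imp_le)
    have "(\<integral>\<^sup>+y. ennreal (norm (?h y)) * indicator torus_cell y \<partial>lebesgue)\<^sup>2
        \<le> (\<integral>\<^sup>+y. (ennreal (norm (?h y)))\<^sup>2 \<partial>lebesgue) * (\<integral>\<^sup>+y. (indicator torus_cell y)\<^sup>2 \<partial>lebesgue)"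
    proof (rule Cauchy_Schwarz_nn_integral)
      show "(\<lambda>y. ennreal (norm (?h y))) \<in> borel_measurable lebesgue" by measurable
      show "indicator torus_cell \<in> borel_measurable lebesgue" by (rule borel_measurable_indicator) simp
    qed
    also have "(\<integral>\<^sup>+y. ennreal (norm (?h y)) * indicator torus_cell y \<partial>lebesgue) = (\<integral>\<^sup>+y. ennreal (norm (?h y)) \<partial>lebesgue)"
      by (intro nn_integral_cong) (auto split: split_indicator)
    also have "(\<integral>\<^sup>+y. (indicator torus_cell y :: ennreal)\<^sup>2 \<partial>lebesgue) = (\<integral>\<^sup>+y. indicator torus_cell y \<partial>lebesgue)"
      by (intro nn_integral_cong) (auto split: split_indicator)
    also have "\<dots> = emeasure lebesgue torus_cell" by (rule nn_integral_indicator) simp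
    also have "(\<integral>\<^sup>+y. (ennreal (norm (?h y)))\<^sup>2 \<partial>lebesgue) = (L2_norm ?h)\<^sup>2"
      unfolding L2_norm_power2 by (intro nn_integral_cong) (auto simp: ennreal_power)
    also have "(L2_norm ?h)\<^sup>2 * emeasure lebesgue torus_cell \<le> (ennreal r)\<^sup>2 * ennreal ((2 * pi)\<^sup>2)"
      unfolding em by (intro mult_right_mono power_mono le) auto
    also have "\<dots> = ennreal (r\<^sup>2 * (2 * pi)\<^sup>2)"
      by (subst ennreal_mult) (simp_all add: ennreal_power r)
    also have "r\<^sup>2 * (2 * pi)\<^sup>2 = (2 * pi * r)\<^sup>2" by (simp only: power_mult_distrib mult_ac)
    also have "ennreal ((2 * pi * r)\<^sup>2) = (ennreal (2 * pi * r))\<^sup>2"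
      by (rule ennreal_power[symmetric]) (use r in simp)
    finally show "(\<integral>\<^sup>+y. ennreal (norm (?h y)) \<partial>lebesgue)\<^sup>2 \<le> (ennreal (2 * pi * r))\<^sup>2" .
  qed
  then have int: "integrable lebesgue ?h"
    by (intro integrableI_bounded hm') (use le_less_trans[OF _ ennreal_less_top] in auto)
  then show "set_integrable lebesgue torus_cell h" by (simp add: set_integrable_def)
  have "norm (CI h) \<le> (LINT y|lebesgue. norm (?h y))"
    unfolding CI_def set_lebesgue_integral_def by (rule integral_norm_bound)
  also have "ennreal \<dots> = (\<integral>\<^sup>+y. ennreal (norm (?h y)) \<partial>lebesgue)"
    by (rule nn_integral_eq_integral[symmetric, OF integrable_norm[OF int]]) simp
  then have "(LINT y|lebesgue. norm (?h y)) \<le> 2 * pi * r"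
    using nn r by (metis ennreal_le_iff mult_nonneg_nonneg pi_ge_zero zero_le_numeral)
  finally show "norm (CI h) \<le> 2 * pi * r" .
qed

text \<open>
  Integration against a phase over the cell is continuous in \<open>L\<^sup>2\<close>, so every representative of the
  Fourier transform gives the limit of the partial sums.
\<close>

lemma low_pass_limit:
  assumes f: "(\<lambda>j. (norm (f j))\<^sup>2) summable_on UNIV"
  shows "((\<lambda>A. CI (\<lambda>y. cis (y \<bullet> x) * trig A f y)) \<longlongrightarrow> low_pass f x) (finite_subsets_at_top UNIV)"
proof -
  define G where "G = lattice_FT f"
  define N where "N A = cell_norm (\<lambda>y. G y - trig A f y)" for A
  have "G \<in> borel_measurable lebesgue \<and> (N \<longlongrightarrow> 0) (finite_subsets_at_top UNIV)"
    unfolding N_def G_def lattice_FT_def trig_def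
    by (rule someI_ex[OF lattice_FT_exists[OF f, unfolded trig_def]])
  then have Gm [measurable]: "G \<in> borel_measurable lebesgue" and N: "(N \<longlongrightarrow> 0) (finite_subsets_at_top UNIV)" by auto
  have cism [measurable]: "(\<lambda>y. cis (y \<bullet> x)) \<in> borel_measurable lebesgue"
  proof -
    have "(\<lambda>y. cis (y \<bullet> x)) \<in> borel_measurable borel"
      by (intro borel_measurable_continuous_onI continuous_intros)
    then show ?thesis by (simp add: measurable_completion)
  qed
  show ?thesis
  proof (rule tendstoI)
    fix e :: real assume e: "0 < e"
    define r where "r = e / (4 * pi)"
    have r: "0 < r" using e by (simp add: r_def)
    have "\<forall>\<^sub>F A in finite_subsets_at_top UNIV. N A < ennreal r"
      using N by (rule order_tendstoD) (use r in simp)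
    then show "\<forall>\<^sub>F A in finite_subsets_at_top UNIV. dist (CI (\<lambda>y. cis (y \<bullet> x) * trig A f y)) (low_pass f x) < e"
    proof eventually_elim
      case (elim A)
      let ?d = "\<lambda>y. cis (y \<bullet> x) * (G y - trig A f y)"
      have "cell_norm ?d = N A"
        unfolding N_def L2_norm_def by (simp add: norm_mult)
      then have le: "cell_norm ?d \<le> ennreal r" using elim by simp
      have dm: "?d \<in> borel_measurable lebesgue" by measurable
      note d = cell_L1_le_L2[OF dm less_imp_le[OF r] le]
      have t: "set_integrable lebesgue torus_cell (\<lambda>y. cis (y \<bullet> x) * trig A f y)"
        by (rule cell_integrable) (intro continuous_intros)
      have "low_pass f x = (LINT y:torus_cell|lebesgue. ?d y + cis (y \<bullet> x) * trig A f y)"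
        unfolding low_pass_def G_def by (simp add: algebra_simps)
      also have "\<dots> = CI ?d + CI (\<lambda>y. cis (y \<bullet> x) * trig A f y)"
        unfolding CI_def by (rule set_integral_add(2)[OF d(1) t])
      finally have "dist (CI (\<lambda>y. cis (y \<bullet> x) * trig A f y)) (low_pass f x) = norm (CI ?d)"
        by (simp add: dist_norm)
      also have "\<dots> \<le> 2 * pi * r" by (rule d(2))
      also have "\<dots> < e" using e by (simp add: r_def)
      finally show ?case .
    qed
  qed
qed

definition lp :: "(int^2) ell2 \<Rightarrow> real^2 \<Rightarrow> complex" where
  "lp u x = low_pass (\<lambda>j. complex_of_real (coord u j)) x"

definition ct :: "(int^2) set \<Rightarrow> (int^2) ell2 \<Rightarrow> real^2 \<Rightarrow> complex" where
  "ct A u = trig A (\<lambda>j. complex_of_real (coord u j))"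

lemma continuous_ct [continuous_intros]: "continuous_on S (ct A u)"
  unfolding ct_def by (rule continuous_trig)

lemma lp_limit: "((\<lambda>A. CI (\<lambda>y. cis (y \<bullet> x) * ct A u y)) \<longlongrightarrow> lp u x) (finite_subsets_at_top UNIV)"
  unfolding lp_def ct_def by (rule low_pass_limit) (simp add: coord_summable)

lemma ct_add: "ct A (u + v) y = ct A u y + ct A v y"
  by (simp add: ct_def trig_def ring_distribs sum.distrib scaleR_add_right)

lemma ct_scaleR: "ct A (r *\<^sub>R u) y = of_real r * ct A u y"
proof -
  have "(\<Sum>j\<in>A. cis (- (lattice_pt j \<bullet> y)) * (of_real r * of_real (coord u j))) = of_real r * (\<Sum>j\<in>A. cis (- (lattice_pt j \<bullet> y)) * of_real (coord u j))"
    unfolding sum_distrib_left by (intro sum.cong) (auto simp: mult_ac)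
  then show ?thesis by (simp add: ct_def trig_def)
qed

lemma lp_add: "lp (u + v) x = lp u x + lp v x"
proof (rule tendsto_unique[OF _ lp_limit])
  have "CI (\<lambda>y. cis (y \<bullet> x) * ct A (u + v) y) = CI (\<lambda>y. cis (y \<bullet> x) * ct A u y) + CI (\<lambda>y. cis (y \<bullet> x) * ct A v y)" for A
    by (subst CI_add[symmetric]) (auto intro!: continuous_intros simp: ct_add distrib_left)
  then show "((\<lambda>A. CI (\<lambda>y. cis (y \<bullet> x) * ct A (u + v) y)) \<longlongrightarrow> lp u x + lp v x) (finite_subsets_at_top UNIV)"
    by (simp only:) (intro tendsto_add lp_limit)
qed simp

lemma lp_scaleR: "lp (r *\<^sub>R u) x = r *\<^sub>R lp u x"
proof (rule tendsto_unique[OF _ lp_limit])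
  have "CI (\<lambda>y. cis (y \<bullet> x) * ct A (r *\<^sub>R u) y) = of_real r * CI (\<lambda>y. cis (y \<bullet> x) * ct A u y)" for A
    unfolding ct_scaleR by (subst CI_cmult[symmetric]) (simp only: mult.left_commute)
  then show "((\<lambda>A. CI (\<lambda>y. cis (y \<bullet> x) * ct A (r *\<^sub>R u) y)) \<longlongrightarrow> r *\<^sub>R lp u x) (finite_subsets_at_top UNIV)"
    unfolding scaleR_conv_of_real by (simp only:) (intro tendsto_mult tendsto_const lp_limit)
qed simp

subsection \<open>Finite sections\<close>

text \<open>Finite sections have continuous transforms, for which Bessel's inequality is available.\<close>

definition section_op :: "'i set \<Rightarrow> 'i ell2 \<Rightarrow> 'i ell2" where
  "section_op A = mult_op (indicator A)"

lemma coord_section [simp]: "coord (section_op A u) j = indicator A j * coord u j"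
  unfolding section_op_def by (rule coord_mult_op[where c=1]) (simp split: split_indicator)

lemma norm_section: "finite A \<Longrightarrow> (norm (section_op A u))\<^sup>2 = (\<Sum>j\<in>A. (coord u j)\<^sup>2)"
proof -
  assume A: "finite A"
  have "(norm (section_op A u))\<^sup>2 = (\<Sum>\<^sub>\<infinity>j\<in>A. (coord u j)\<^sup>2)"
    unfolding norm_ell2_sq by (rule infsum_cong_neutral) (auto split: split_indicator)
  then show ?thesis using A by simp
qed

lemma section_tendsto: "((\<lambda>A. section_op A u) \<longlongrightarrow> u) (finite_subsets_at_top UNIV)"
proof -
  have pyth: "(norm (section_op A u - u))\<^sup>2 = (norm u)\<^sup>2 - (norm (section_op A u))\<^sup>2" for A
  proof -
    have "inner (section_op A u) u = inner (section_op A u) (section_op A u)"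
      by (rule inner_cong) (auto split: split_indicator)
    then show ?thesis
      by (simp add: power2_norm_eq_inner inner_diff_left inner_diff_right inner_commute)
  qed
  have "((\<lambda>A. \<Sum>j\<in>A. (coord u j)\<^sup>2) \<longlongrightarrow> (norm u)\<^sup>2) (finite_subsets_at_top UNIV)"
    using has_sum_infsum[OF coord_summable[of u]] unfolding has_sum_def norm_ell2_sq .
  then have "((\<lambda>A. (norm u)\<^sup>2 - (\<Sum>j\<in>A. (coord u j)\<^sup>2)) \<longlongrightarrow> (norm u)\<^sup>2 - (norm u)\<^sup>2) (finite_subsets_at_top UNIV)"
    by (intro tendsto_intros)
  moreover have "\<forall>\<^sub>F A in finite_subsets_at_top UNIV. (norm u)\<^sup>2 - (\<Sum>j\<in>A. (coord u j)\<^sup>2) = (norm (section_op A u - u))\<^sup>2"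
    unfolding eventually_finite_subsets_at_top by (intro exI[of _ "{}"]) (auto simp: pyth norm_section)
  ultimately have "((\<lambda>A. (norm (section_op A u - u))\<^sup>2) \<longlongrightarrow> 0) (finite_subsets_at_top UNIV)"
    using Lim_transform_eventually by fastforce
  then have "((\<lambda>A. sqrt ((norm (section_op A u - u))\<^sup>2)) \<longlongrightarrow> sqrt 0) (finite_subsets_at_top UNIV)"
    by (rule tendsto_real_sqrt)
  then show ?thesis by (simp add: tendsto_norm_zero_iff LIM_zero_iff)
qed

lemma lp_section: "finite A \<Longrightarrow> lp (section_op A u) x = CI (\<lambda>y. cis (y \<bullet> x) * ct A u y)"
proof (rule tendsto_unique[OF _ lp_limit])
  assume A: "finite A"
  have "ct B (section_op A u) = ct A u" if "finite B" "A \<subseteq> B" for B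
  proof
    fix y
    have "(\<Sum>j\<in>B. cis (- (lattice_pt j \<bullet> y)) * complex_of_real (indicator A j * coord u j)) = (\<Sum>j\<in>A. cis (- (lattice_pt j \<bullet> y)) * complex_of_real (coord u j))"
      by (rule sum.mono_neutral_cong_right) (use that in auto)
    then show "ct B (section_op A u) y = ct A u y" by (simp add: ct_def trig_def)
  qed
  then have "\<forall>\<^sub>F B in finite_subsets_at_top UNIV. CI (\<lambda>y. cis (y \<bullet> x) * ct B (section_op A u) y) = CI (\<lambda>y. cis (y \<bullet> x) * ct A u y)"
    unfolding eventually_finite_subsets_at_top using A by (intro exI[of _ A]) auto
  then show "((\<lambda>B. CI (\<lambda>y. cis (y \<bullet> x) * ct B (section_op A u) y)) \<longlongrightarrow> CI (\<lambda>y. cis (y \<bullet> x) * ct A u y)) (finite_subsets_at_top UNIV)"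
    by (rule tendsto_eventually)
qed simp

lemma lp_section_tendsto: "((\<lambda>A. lp (section_op A u) x) \<longlongrightarrow> lp u x) (finite_subsets_at_top UNIV)"
proof (rule Lim_transform_eventually[OF lp_limit])
  show "\<forall>\<^sub>F A in finite_subsets_at_top UNIV. CI (\<lambda>y. cis (y \<bullet> x) * ct A u y) = lp (section_op A u) x"
    unfolding eventually_finite_subsets_at_top by (intro exI[of _ "{}"]) (auto simp: lp_section)
qed

lemma RI_ct_sq: "finite A \<Longrightarrow> RI (\<lambda>y. (norm (ct A u y))\<^sup>2) = (norm (section_op A u))\<^sup>2 / (2 * pi)\<^sup>2"
  unfolding ct_def by (simp add: RI_trig_sq norm_section)

text \<open>
  For a fixed position \<open>x\<close> within a cell, the values \<open>lp u (k + x)\<close> are the Fourier coefficients of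
  the transform of \<open>u\<close> multiplied by a phase: Bessel's inequality bounds them by the norm of \<open>u\<close>.
\<close>

lemma lp_bound:
  assumes K: "finite K"
  shows "(\<Sum>k\<in>K. (norm (lp u (lattice_pt k + x)))\<^sup>2) \<le> (norm u)\<^sup>2"
proof (rule tendsto_upperbound)
  show "((\<lambda>A. \<Sum>k\<in>K. (norm (lp (section_op A u) (lattice_pt k + x)))\<^sup>2) \<longlongrightarrow> (\<Sum>k\<in>K. (norm (lp u (lattice_pt k + x)))\<^sup>2)) (finite_subsets_at_top UNIV)"
    by (intro tendsto_intros lp_section_tendsto)
  show "\<forall>\<^sub>F A in finite_subsets_at_top UNIV. (\<Sum>k\<in>K. (norm (lp (section_op A u) (lattice_pt k + x)))\<^sup>2) \<le> (norm u)\<^sup>2"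
    unfolding eventually_finite_subsets_at_top
  proof (intro exI[of _ "{}"] conjI allI impI)
    fix A :: "(int^2) set" assume "finite A \<and> {} \<subseteq> A \<and> A \<subseteq> UNIV"
    then have A: "finite A" by simp
    let ?h = "\<lambda>y. cis (y \<bullet> x) * ct A u y"
    have "lp (section_op A u) (lattice_pt k + x) = CI (\<lambda>y. cis (lattice_pt k \<bullet> y) * ?h y)" for k
      unfolding lp_section[OF A] by (simp add: inner_add_right cis_mult[symmetric] inner_commute mult.assoc)
    then have "(\<Sum>k\<in>K. (norm (lp (section_op A u) (lattice_pt k + x)))\<^sup>2) \<le> (2 * pi)\<^sup>2 * RI (\<lambda>y. (norm (?h y))\<^sup>2)"
      by (simp only:) (rule Bessel[OF _ K], intro continuous_intros)
    also have "\<dots> = (2 * pi)\<^sup>2 * RI (\<lambda>y. (norm (ct A u y))\<^sup>2)" by (simp add: norm_mult)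
    also have "\<dots> = (norm (section_op A u))\<^sup>2" unfolding RI_ct_sq[OF A] by simp
    also have "\<dots> \<le> (norm u)\<^sup>2" by (intro power_mono norm_ell2_mono) (auto split: split_indicator)
    finally show "(\<Sum>k\<in>K. (norm (lp (section_op A u) (lattice_pt k + x)))\<^sup>2) \<le> (norm u)\<^sup>2" .
  qed auto
qed simp

lemma norm_lp_le: "norm (lp u x) \<le> norm u"
proof -
  have "lattice_pt 0 = 0" by (simp add: vec_eq_iff)
  then have "(norm (lp u x))\<^sup>2 \<le> (norm u)\<^sup>2" using lp_bound[of "{0}" u x] by simp
  then show ?thesis by (rule power2_le_imp_le) simp
qed

lemma bounded_linear_lp: "bounded_linear (\<lambda>u. lp u x)"
  by (rule bounded_linear_intro[where K=1]) (auto simp: lp_add lp_scaleR norm_lp_le)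

lemma lp_diff: "lp (u - v) x = lp u x - lp v x"
  by (rule linear_diff[OF bounded_linear.linear[OF bounded_linear_lp]])

lemma lp_measurable: "lp u \<in> borel_measurable borel"
proof -
  have *: "(\<lambda>x. lp (section_op A u) x) \<in> borel_measurable borel" if A: "finite A" for A
  proof -
    have "(\<lambda>x. LINT y|lborel. indicator torus_cell y *\<^sub>R (cis (y \<bullet> x) * ct A u y)) \<in> borel_measurable borel"
    proof (rule lborel.borel_measurable_lebesgue_integral)
      have [measurable]: "(\<lambda>p::(real^2) \<times> (real^2). cis (snd p \<bullet> fst p)) \<in> borel_measurable (borel \<Otimes>\<^sub>M borel)"
        unfolding borel_prod by (intro borel_measurable_continuous_onI continuous_intros)
      have [measurable]: "ct A u \<in> borel_measurable borel" by (intro borel_measurable_continuous_onI continuous_intros)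
      show "(\<lambda>(x, y). indicat_real torus_cell y *\<^sub>R (cis (y \<bullet> x) * ct A u y)) \<in> borel_measurable (borel \<Otimes>\<^sub>M lborel)"
        unfolding split_beta' by measurable
    qed
    moreover have "CI (\<lambda>y. cis (y \<bullet> x) * ct A u y) = (LINT y|lborel. indicator torus_cell y *\<^sub>R (cis (y \<bullet> x) * ct A u y))" for x
    proof -
      have [measurable]: "(\<lambda>y. cis (y \<bullet> x) * ct A u y) \<in> borel_measurable borel"
        by (intro borel_measurable_continuous_onI continuous_intros)
      show ?thesis unfolding CI_def set_lebesgue_integral_def by (rule integral_completion) measurable
    qed
    ultimately show ?thesis unfolding lp_section[OF A] by simp
  qed
  have "\<exists>A. finite A \<and> dist (section_op A u) u < inverse (real (Suc n))" for n
  proof -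
    have "\<forall>\<^sub>F A in finite_subsets_at_top UNIV. dist (section_op A u) u < inverse (real (Suc n))"
      by (rule tendstoD[OF section_tendsto]) simp
    then show ?thesis unfolding eventually_finite_subsets_at_top by blast
  qed
  then obtain A where A: "\<And>n. finite (A n)" "\<And>n. dist (section_op (A n) u) u < inverse (real (Suc n))" by metis
  have "(\<lambda>n. dist (section_op (A n) u) u) \<longlonglongrightarrow> 0"
    by (rule tendsto_sandwich[OF _ _ tendsto_const LIMSEQ_inverse_real_of_nat]) (use A(2) in \<open>auto intro!: always_eventually less_imp_le simp del: of_nat_Suc\<close>)
  then have "(\<lambda>n. section_op (A n) u) \<longlonglongrightarrow> u" by (rule tendsto_dist_iff[THEN iffD2])
  then have "(\<lambda>n. lp (section_op (A n) u) x) \<longlonglongrightarrow> lp u x" for x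
    by (rule bounded_linear.tendsto[OF bounded_linear_lp])
  then show ?thesis by (intro borel_measurable_LIMSEQ_metric[OF *[OF A(1)]]) auto
qed

subsection \<open>Interpolation of slowly varying lattice functions\<close>

definition fd :: "2 \<Rightarrow> (int^2) ell2 \<Rightarrow> (int^2) ell2" where
  "fd i u = shift_op (axis i 1) u - u"

lemma bounded_linear_fd: "bounded_linear (fd i)"
  unfolding fd_def[abs_def] by (intro bounded_linear_sub bounded_linear_shift_op bounded_linear_ident)

lemma coord_fd [simp]: "coord (fd i u) j = coord u (j + axis i 1) - coord u j"
  by (simp add: fd_def)

lemma phase_bound:
  assumes "y \<in> torus_cell" "x \<in> unit_cell"
  shows "(norm (cis (y \<bullet> x) - 1))\<^sup>2 \<le> 2 * (norm (cis (y $ 1) - 1))\<^sup>2 + 2 * (norm (cis (y $ 2) - 1))\<^sup>2"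
proof -
  have sq: "(norm (cis t - 1))\<^sup>2 = 2 - 2 * cos t" for t
    unfolding cmod_power2 using sin_cos_squared_add[of t] by (simp add: power2_eq_square algebra_simps)
  have le: "norm (cis (y $ i * x $ i) - 1) \<le> norm (cis (y $ i) - 1)" for i
  proof (rule power2_le_imp_le)
    have y: "\<bar>y $ i\<bar> \<le> pi" using assms(1) by (auto simp: torus_cell_mem abs_le_iff minus_le_iff)
    have x: "0 \<le> x $ i" "x $ i \<le> 1" using assms(2) by (auto simp: unit_cell_def less_imp_le)
    have "\<bar>y $ i * x $ i\<bar> \<le> \<bar>y $ i\<bar>" using x by (simp add: abs_mult mult_left_le)
    then have "cos \<bar>y $ i\<bar> \<le> cos \<bar>y $ i * x $ i\<bar>" using y by (intro cos_monotone_0_pi_le) auto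
    then show "(norm (cis (y $ i * x $ i) - 1))\<^sup>2 \<le> (norm (cis (y $ i) - 1))\<^sup>2"
      unfolding sq cos_abs_real by linarith
  qed simp
  have "cis (y \<bullet> x) - 1 = cis (y $ 1 * x $ 1) * (cis (y $ 2 * x $ 2) - 1) + (cis (y $ 1 * x $ 1) - 1)"
    by (simp add: inner_R2 cis_mult[symmetric] algebra_simps)
  also have "norm \<dots> \<le> norm (cis (y $ 2 * x $ 2) - 1) + norm (cis (y $ 1 * x $ 1) - 1)"
    by (rule order_trans[OF norm_triangle_ineq]) (simp add: norm_mult)
  also have "\<dots> \<le> norm (cis (y $ 2) - 1) + norm (cis (y $ 1) - 1)" by (intro add_mono le)
  finally have "(norm (cis (y \<bullet> x) - 1))\<^sup>2 \<le> (norm (cis (y $ 2) - 1) + norm (cis (y $ 1) - 1))\<^sup>2"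
    by (rule power_mono) simp
  also have "\<dots> \<le> 2 * (norm (cis (y $ 1) - 1))\<^sup>2 + 2 * (norm (cis (y $ 2) - 1))\<^sup>2"
    using zero_le_power2[of "norm (cis (y $ 2) - 1) - norm (cis (y $ 1) - 1)"] unfolding power2_diff power2_sum by linarith
  finally show ?thesis .
qed

lemma RI_phase_ct:
  assumes A: "finite A"
  shows "RI (\<lambda>y. (norm ((cis (y $ i) - 1) * ct A u y))\<^sup>2) \<le> (norm (fd i (section_op A u)))\<^sup>2 / (2 * pi)\<^sup>2"
proof -
  let ?e = "axis i 1 :: int^2"
  let ?v = "section_op A u"
  define B where "B = A \<union> (\<lambda>j. j - ?e) ` A"
  have B: "finite B" using A by (simp add: B_def)
  have le: "lattice_pt ?e \<bullet> y = y $ i" for y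
    using exhaust_2[of i] by (auto simp: inner_R2 axis_def)
  have s1: "(\<Sum>j\<in>B. cis (- (lattice_pt j \<bullet> y)) * complex_of_real (coord ?v j)) = (\<Sum>j\<in>A. cis (- (lattice_pt j \<bullet> y)) * complex_of_real (coord u j))" for y
    by (rule sum.mono_neutral_cong_right) (use A in \<open>auto simp: B_def\<close>)
  have s2: "(\<Sum>j\<in>B. cis (- (lattice_pt j \<bullet> y)) * complex_of_real (coord ?v (j + ?e))) = cis (y $ i) * (\<Sum>j\<in>A. cis (- (lattice_pt j \<bullet> y)) * complex_of_real (coord u j))" for y
  proof -
    have "(\<Sum>j\<in>B. cis (- (lattice_pt j \<bullet> y)) * complex_of_real (coord ?v (j + ?e)))
        = (\<Sum>j\<in>(\<lambda>j. j - ?e) ` A. cis (- (lattice_pt j \<bullet> y)) * complex_of_real (coord u (j + ?e)))"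
    proof (rule sum.mono_neutral_cong_right)
      have "j \<in> (\<lambda>j. j - ?e) ` A" if "j + ?e \<in> A" for j
        using that by (intro image_eqI[of _ _ "j + ?e"]) auto
      then show "\<forall>j\<in>B - (\<lambda>j. j - ?e) ` A. cis (- (lattice_pt j \<bullet> y)) * complex_of_real (coord ?v (j + ?e)) = 0"
        by (auto simp: indicator_def)
    qed (use A in \<open>auto simp: B_def\<close>)
    also have "\<dots> = (\<Sum>j\<in>A. cis (- (lattice_pt (j - ?e) \<bullet> y)) * complex_of_real (coord u j))"
      by (subst sum.reindex) (auto simp: inj_on_def)
    also have "\<dots> = cis (y $ i) * (\<Sum>j\<in>A. cis (- (lattice_pt j \<bullet> y)) * complex_of_real (coord u j))"
      unfolding sum_distrib_left
      by (intro sum.cong refl) (simp add: lattice_pt_diff inner_diff_left le cis_mult mult.assoc[symmetric])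
    finally show ?thesis .
  qed
  have eq: "(cis (y $ i) - 1) * ct A u y = ct B (fd i ?v) y" for y
  proof -
    have "ct B (fd i ?v) y = (1 / (2 * pi)\<^sup>2) *\<^sub>R ((\<Sum>j\<in>B. cis (- (lattice_pt j \<bullet> y)) * complex_of_real (coord ?v (j + ?e)))
        - (\<Sum>j\<in>B. cis (- (lattice_pt j \<bullet> y)) * complex_of_real (coord ?v j)))"
      unfolding ct_def trig_def coord_fd of_real_diff right_diff_distrib sum_subtractf ..
    also have "\<dots> = (cis (y $ i) - 1) * ct A u y"
      unfolding s1 s2 ct_def trig_def by (simp add: algebra_simps)
    finally show ?thesis by simp
  qed
  have "RI (\<lambda>y. (norm ((cis (y $ i) - 1) * ct A u y))\<^sup>2) = (norm (section_op B (fd i ?v)))\<^sup>2 / (2 * pi)\<^sup>2"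
    unfolding eq by (rule RI_ct_sq[OF B])
  also have "\<dots> \<le> (norm (fd i ?v))\<^sup>2 / (2 * pi)\<^sup>2"
    by (intro divide_right_mono power_mono norm_ell2_mono) (auto simp del: coord_fd split: split_indicator)
  finally show ?thesis .
qed

text \<open>
  For \<open>x\<close> in the cell the distance of the phase \<open>cis (y \<bullet> x)\<close> from \<open>1\<close> is controlled by that of the
  symbols \<open>cis (y $ i)\<close> of the unit shifts. So the lattice gradient controls the difference between
  interpolation and piecewise constant extension.
\<close>

lemma lp_minus_sample_bound:
  assumes K: "finite K" and x: "x \<in> unit_cell"
  shows "(\<Sum>k\<in>K. (norm (lp u (lattice_pt k + x) - of_real (coord u k)))\<^sup>2) \<le> 2 * (norm (fd 1 u))\<^sup>2 + 2 * (norm (fd 2 u))\<^sup>2"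
proof (rule tendsto_le)
  let ?F = "finite_subsets_at_top (UNIV :: (int^2) set)"
  show "((\<lambda>A. \<Sum>k\<in>K. (norm (lp (section_op A u) (lattice_pt k + x) - of_real (coord (section_op A u) k)))\<^sup>2)
     \<longlongrightarrow> (\<Sum>k\<in>K. (norm (lp u (lattice_pt k + x) - of_real (coord u k)))\<^sup>2)) ?F"
  proof (intro tendsto_intros lp_section_tendsto)
    fix k
    have "\<forall>\<^sub>F A in ?F. coord (section_op A u) k = coord u k"
      unfolding eventually_finite_subsets_at_top by (intro exI[of _ "{k}"]) auto
    then show "((\<lambda>A. coord (section_op A u) k) \<longlongrightarrow> coord u k) ?F" by (rule tendsto_eventually)
  qed
  show "((\<lambda>A. 2 * (norm (fd 1 (section_op A u)))\<^sup>2 + 2 * (norm (fd 2 (section_op A u)))\<^sup>2) \<longlongrightarrow> 2 * (norm (fd 1 u))\<^sup>2 + 2 * (norm (fd 2 u))\<^sup>2) ?F"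
    by (intro tendsto_intros bounded_linear.tendsto[OF bounded_linear_fd] section_tendsto)
  show "\<forall>\<^sub>F A in ?F. (\<Sum>k\<in>K. (norm (lp (section_op A u) (lattice_pt k + x) - of_real (coord (section_op A u) k)))\<^sup>2)
     \<le> 2 * (norm (fd 1 (section_op A u)))\<^sup>2 + 2 * (norm (fd 2 (section_op A u)))\<^sup>2"
    unfolding eventually_finite_subsets_at_top
  proof (intro exI[of _ "{}"] conjI allI impI)
    fix A :: "(int^2) set" assume "finite A \<and> {} \<subseteq> A \<and> A \<subseteq> UNIV"
    then have A: "finite A" by simp
    let ?h = "\<lambda>y. (cis (y \<bullet> x) - 1) * ct A u y"
    have co: "of_real (coord (section_op A u) k) = CI (\<lambda>y. cis (lattice_pt k \<bullet> y) * ct A u y)" for k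
      unfolding ct_def CI_trig_coeff[OF A] by (simp split: split_indicator)
    have "lp (section_op A u) (lattice_pt k + x) - of_real (coord (section_op A u) k) = CI (\<lambda>y. cis (lattice_pt k \<bullet> y) * ?h y)" for k
    proof -
      have "lp (section_op A u) (lattice_pt k + x) = CI (\<lambda>y. cis (lattice_pt k \<bullet> y) * ?h y + cis (lattice_pt k \<bullet> y) * ct A u y)"
        unfolding lp_section[OF A] by (simp add: inner_add_right cis_mult[symmetric] inner_commute algebra_simps)
      also have "\<dots> = CI (\<lambda>y. cis (lattice_pt k \<bullet> y) * ?h y) + CI (\<lambda>y. cis (lattice_pt k \<bullet> y) * ct A u y)"
        by (rule CI_add) (intro continuous_intros)+
      finally show ?thesis unfolding co by simp
    qed
    then have "(\<Sum>k\<in>K. (norm (lp (section_op A u) (lattice_pt k + x) - of_real (coord (section_op A u) k)))\<^sup>2) \<le> (2 * pi)\<^sup>2 * RI (\<lambda>y. (norm (?h y))\<^sup>2)"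
      by (simp only:) (rule Bessel[OF _ K], intro continuous_intros)
    also have "RI (\<lambda>y. (norm (?h y))\<^sup>2) \<le> RI (\<lambda>y. 2 * (norm ((cis (y $ 1) - 1) * ct A u y))\<^sup>2 + 2 * (norm ((cis (y $ 2) - 1) * ct A u y))\<^sup>2)"
    proof (rule RI_mono)
      fix y assume y: "y \<in> torus_cell"
      have "(norm (?h y))\<^sup>2 = (norm (cis (y \<bullet> x) - 1))\<^sup>2 * (norm (ct A u y))\<^sup>2" by (simp add: norm_mult power_mult_distrib)
      also have "\<dots> \<le> (2 * (norm (cis (y $ 1) - 1))\<^sup>2 + 2 * (norm (cis (y $ 2) - 1))\<^sup>2) * (norm (ct A u y))\<^sup>2"
        by (intro mult_right_mono phase_bound y x) simp
      finally show "(norm (?h y))\<^sup>2 \<le> 2 * (norm ((cis (y $ 1) - 1) * ct A u y))\<^sup>2 + 2 * (norm ((cis (y $ 2) - 1) * ct A u y))\<^sup>2"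
        by (simp only: norm_mult power_mult_distrib distrib_right mult.assoc)
    qed (intro continuous_intros)+
    also have "\<dots> = 2 * RI (\<lambda>y. (norm ((cis (y $ 1) - 1) * ct A u y))\<^sup>2) + 2 * RI (\<lambda>y. (norm ((cis (y $ 2) - 1) * ct A u y))\<^sup>2)"
      by (subst RI_add, (intro continuous_intros)+, simp only: RI_cmult)
    also have "\<dots> \<le> 2 * ((norm (fd 1 (section_op A u)))\<^sup>2 / (2 * pi)\<^sup>2) + 2 * ((norm (fd 2 (section_op A u)))\<^sup>2 / (2 * pi)\<^sup>2)"
      by (intro add_mono mult_left_mono RI_phase_ct A) auto
    finally show "(\<Sum>k\<in>K. (norm (lp (section_op A u) (lattice_pt k + x) - of_real (coord (section_op A u) k)))\<^sup>2)
        \<le> 2 * (norm (fd 1 (section_op A u)))\<^sup>2 + 2 * (norm (fd 2 (section_op A u)))\<^sup>2"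
      by (simp add: mult_left_mono distrib_left)
  qed auto
qed simp

text \<open>
  An intermediate lattice function \<open>w\<close> with small gradient separates the two mechanisms: interpolation
  is a contraction on \<open>u - w\<close> and nearly the identity on \<open>w\<close>.
\<close>

lemma interpolation_error:
  assumes K: "finite K" and x: "x \<in> unit_cell"
  shows "sqrt (\<Sum>k\<in>K. (norm (lp u (lattice_pt k + x) - of_real (coord z k)))\<^sup>2)
    \<le> norm (u - w) + (2 * norm (fd 1 w) + 2 * norm (fd 2 w)) + norm (w - z)"
proof -
  let ?a = "\<lambda>k. norm (lp (u - w) (lattice_pt k + x))"
  let ?b = "\<lambda>k. norm (lp w (lattice_pt k + x) - of_real (coord w k))"
  let ?c = "\<lambda>k. \<bar>coord (w - z) k\<bar>"
  have "sqrt (\<Sum>k\<in>K. (norm (lp u (lattice_pt k + x) - of_real (coord z k)))\<^sup>2) \<le> L2_set (\<lambda>k. (?a k + ?b k) + ?c k) K"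
    unfolding L2_set_def
  proof (intro real_sqrt_le_mono sum_mono power_mono)
    fix k
    have "lp u (lattice_pt k + x) - of_real (coord z k)
      = (lp (u - w) (lattice_pt k + x) + (lp w (lattice_pt k + x) - of_real (coord w k))) + of_real (coord (w - z) k)"
      by (simp add: lp_diff)
    also have "norm \<dots> \<le> (?a k + ?b k) + ?c k"
      by (rule order_trans[OF norm_triangle_ineq add_mono[OF norm_triangle_ineq]]) simp
    finally show "norm (lp u (lattice_pt k + x) - of_real (coord z k)) \<le> (?a k + ?b k) + ?c k" .
  qed simp
  also have "\<dots> \<le> L2_set ?a K + L2_set ?b K + L2_set ?c K"
    by (rule order_trans[OF L2_set_triangle_ineq add_right_mono[OF L2_set_triangle_ineq]])
  also have "L2_set ?a K \<le> norm (u - w)" unfolding L2_set_def by (rule real_le_lsqrt[OF _ lp_bound[OF K]]) simp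
  also have "L2_set ?c K \<le> norm (w - z)" unfolding L2_set_def power2_abs by (rule real_le_lsqrt[OF _ sum_coord_sq_le[OF K]]) simp
  also have "L2_set ?b K \<le> 2 * norm (fd 1 w) + 2 * norm (fd 2 w)"
    unfolding L2_set_def
  proof (rule real_le_lsqrt)
    have "(\<Sum>k\<in>K. (?b k)\<^sup>2) \<le> 2 * (norm (fd 1 w))\<^sup>2 + 2 * (norm (fd 2 w))\<^sup>2" by (rule lp_minus_sample_bound[OF K x])
    also have "\<dots> \<le> (2 * norm (fd 1 w) + 2 * norm (fd 2 w))\<^sup>2"
      by (simp add: power2_sum power_mult_distrib)
    finally show "(\<Sum>k\<in>K. (?b k)\<^sup>2) \<le> (2 * norm (fd 1 w) + 2 * norm (fd 2 w))\<^sup>2" .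
  qed simp
  finally show ?thesis by simp
qed

section \<open>Averaging of the masses\<close>

subsection \<open>A uniform law of large numbers over blocks\<close>

definition blk :: "nat \<Rightarrow> (int^2) set" where
  "blk N = {k. \<forall>i. k $ i \<in> {0..<int N}}"

abbreviation small_block_averages :: "(int^2 \<Rightarrow> real) \<Rightarrow> bool" where
  "small_block_averages \<mu> \<equiv> \<forall>\<delta>>0. \<exists>N0. \<forall>N\<ge>N0. \<forall>j. (\<forall>i. \<bar>j $ i\<bar> \<le> int N ^ 3) \<longrightarrow>
    \<bar>\<Sum>k\<in>blk N. \<mu> (j + k)\<bar> \<le> \<delta> * (real N)\<^sup>2"

lemma card_vec2:
  assumes "finite (S :: int set)"
  shows "finite {k::int^2. \<forall>i. k $ i \<in> S}" "card {k::int^2. \<forall>i. k $ i \<in> S} = (card S)\<^sup>2"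
proof -
  let ?f = "\<lambda>k::int^2. (k $ 1, k $ 2)"
  have "bij_betw ?f {k. \<forall>i. k $ i \<in> S} (S \<times> S)"
  proof (rule bij_betwI)
    show "?f \<in> {k. \<forall>i. k $ i \<in> S} \<rightarrow> S \<times> S" by auto
    show "(\<lambda>(p, q). \<chi> i. if i = 1 then p else q) \<in> S \<times> S \<rightarrow> {k::int^2. \<forall>i. k $ i \<in> S}" by auto
    show "(\<lambda>(p, q). \<chi> i. if i = 1 then p else q) (?f k) = k" for k by (auto simp: vec_eq_iff forall_2)
    show "?f ((\<lambda>(p, q). \<chi> i. if i = 1 then p else q) y) = y" for y by (auto split: prod.split)
  qed
  then show "finite {k::int^2. \<forall>i. k $ i \<in> S}" "card {k::int^2. \<forall>i. k $ i \<in> S} = (card S)\<^sup>2"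
    using assms by (auto simp: bij_betw_finite bij_betw_same_card card_cartesian_product power2_eq_square)
qed

lemma blk: "finite (blk N)" "card (blk N) = N\<^sup>2"
  unfolding blk_def using card_vec2[of "{0..<int N}"] by simp_all

text \<open>The number of blocks is polynomial in \<open>N\<close>, the bound for a single block Gaussian.\<close>

lemma summable_poly_gauss:
  fixes c :: real assumes c: "0 < c"
  shows "summable (\<lambda>N. (2 * real N ^ 3 + 1)\<^sup>2 * (2 * exp (- (c * (real N)\<^sup>2))))"
proof (rule summable_comparison_test_ev)
  show "summable (\<lambda>N. (18 / c ^ 8) * inverse (real N ^ 2))"
    by (intro summable_mult inverse_power_summable) simp
  have "((\<lambda>x. x ^ 8 / exp x) \<longlongrightarrow> (0::real)) at_top" by (rule tendsto_power_div_exp_0)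
  then have "\<forall>\<^sub>F x in at_top. x ^ 8 / exp x < (1::real)" by (rule order_tendstoD) simp
  moreover have "filterlim (\<lambda>N. c * real N) at_top sequentially"
    by (rule filterlim_tendsto_pos_mult_at_top[OF tendsto_const c filterlim_real_sequentially])
  ultimately have ev: "\<forall>\<^sub>F N in sequentially. (c * real N) ^ 8 / exp (c * real N) < 1"
    by (rule eventually_compose_filterlim)
  show "\<forall>\<^sub>F N in sequentially. norm ((2 * real N ^ 3 + 1)\<^sup>2 * (2 * exp (- (c * (real N)\<^sup>2)))) \<le> (18 / c ^ 8) * inverse (real N ^ 2)"
    using ev eventually_ge_at_top[of 1]
  proof eventually_elim
    case (elim N)
    define x where "x = real N"
    have x: "1 \<le> x" using elim(2) by (simp add: x_def)
    have e1: "exp (- (c * x\<^sup>2)) \<le> exp (- (c * x))"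
      using c x by (simp add: power2_eq_square mult_left_mono)
    have "(c * x) ^ 8 < exp (c * x)" using elim(1) by (simp add: x_def divide_less_eq)
    then have "exp (- (c * x)) \<le> 1 / (c * x) ^ 8"
      using c x by (simp add: exp_minus inverse_eq_divide frac_le)
    with e1 have e2: "exp (- (c * x\<^sup>2)) \<le> 1 / (c * x) ^ 8" by linarith
    have "2 * x ^ 3 + 1 \<le> 3 * x ^ 3" using one_le_power[OF x, of 3] by linarith
    then have "(2 * x ^ 3 + 1)\<^sup>2 \<le> (3 * x ^ 3)\<^sup>2" using x by (intro power_mono) auto
    then have "(2 * x ^ 3 + 1)\<^sup>2 * (2 * exp (- (c * x\<^sup>2))) \<le> (3 * x ^ 3)\<^sup>2 * (2 * (1 / (c * x) ^ 8))"
      using e2 by (intro mult_mono) auto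
    also have "\<dots> = (18 / c ^ 8) * inverse (x ^ 2)"
      using x c by (simp add: power_mult_distrib field_simps flip: power_mult power_add)
    finally show ?case by (simp add: x_def)
  qed
qed

text \<open>
  By Hoeffding's inequality a given block of \<open>N\<^sup>2\<close> masses is bad with probability at most
  \<open>2 exp (- c N\<^sup>2)\<close>. There are \<open>O(N\<^sup>6)\<close> blocks to consider, so these probabilities are summable and the
  Borel-Cantelli lemma applies.
\<close>

lemma block_average_AE:
  fixes m :: "int^2 \<Rightarrow> 'w \<Rightarrow> real"
  assumes M: "prob_space M"
    and ind: "prob_space.indep_vars M (\<lambda>_. borel) m UNIV"
    and bnd: "\<And>j. AE \<omega> in M. m j \<omega> \<in> {a..b}"
    and mean: "\<And>j. mbar = prob_space.expectation M (m j)"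
  shows "AE \<omega> in M. (\<forall>j. m j \<omega> \<in> {a..b}) \<and>
    small_block_averages (\<lambda>j. m j \<omega> - mbar)"
proof -
  interpret prob_space M by (rule M)
  have rv [measurable]: "m j \<in> borel_measurable M" for j using ind unfolding indep_vars_def by blast
  have ab: "a \<le> b"
  proof -
    have "\<exists>\<omega>. m 0 \<omega> \<in> {a..b}"
      using bnd[of 0] eventually_happens[OF bnd[of 0]] by (simp add: ae_filter_eq_bot_iff emeasure_space_1)
    then show ?thesis by auto
  qed
  define bad where "bad \<delta> N j = {\<omega>\<in>space M. \<bar>\<Sum>k\<in>blk N. m (j + k) \<omega> - mbar\<bar> \<ge> \<delta> * (real N)\<^sup>2}" for \<delta> N j
  define J where "J N = {j::int^2. \<forall>i. j $ i \<in> {- (int N ^ 3)..int N ^ 3}}" for N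
  have bads [measurable]: "bad \<delta> N j \<in> sets M" for \<delta> N j unfolding bad_def by measurable
  have J: "finite (J N)" "real (card (J N)) = (2 * real N ^ 3 + 1)\<^sup>2" for N
    unfolding J_def using card_vec2[of "{- (int N ^ 3)..int N ^ 3}"]
    by (simp_all add: nat_add_distrib nat_power_eq nat_mult_distrib flip: mult_2)
  have pbad: "prob (bad \<delta> N j) \<le> 2 * exp (- (2 * \<delta>\<^sup>2 / (b + 1 - a)\<^sup>2 * (real N)\<^sup>2))" if \<delta>: "0 < \<delta>" and N: "1 \<le> N" for \<delta> N j
  proof -
    define I where "I = (\<lambda>k. j + k) ` blk N"
    have inj: "inj_on (\<lambda>k. j + k) (blk N)" by (simp add: inj_on_def)
    have cI: "finite I" "card I = N\<^sup>2" using blk by (simp_all add: I_def card_image[OF inj])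
    \<comment> \<open>The upper bound is enlarged to \<open>b + 1\<close> because the exponent divides by the length of the interval.\<close>
    interpret H: Hoeffding_ineq M I m "\<lambda>_. a" "\<lambda>_. b + 1" "\<Sum>i\<in>I. expectation (m i)"
    proof unfold_locales
      show "indep_vars (\<lambda>_. borel) m I" by (rule indep_vars_subset[OF ind]) simp
      show "AE x in M. m i x \<in> {a..b + 1}" for i using bnd[of i] by eventually_elim auto
    qed (use cI in auto)
    have sumI: "(\<Sum>i\<in>I. m i \<omega>) - (\<Sum>i\<in>I. expectation (m i)) = (\<Sum>k\<in>blk N. m (j + k) \<omega> - mbar)" for \<omega>
      unfolding I_def sum_subtractf[symmetric] using mean by (subst sum.reindex[OF inj]) (simp add: o_def)
    have s: "(\<Sum>i\<in>I. (b + 1 - a)\<^sup>2) = (real N)\<^sup>2 * (b + 1 - a)\<^sup>2" by (simp add: cI)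
    have N0: "real N \<noteq> 0" and d0: "b + 1 - a > 0" using N ab by auto
    have "prob {x\<in>space M. \<bar>(\<Sum>i\<in>I. m i x) - (\<Sum>i\<in>I. expectation (m i))\<bar> \<ge> \<delta> * (real N)\<^sup>2}
        \<le> 2 * exp (- 2 * (\<delta> * (real N)\<^sup>2)\<^sup>2 / (\<Sum>i\<in>I. (b + 1 - a)\<^sup>2))"
      by (rule H.Hoeffding_ineq_abs_ge) (use \<delta> N0 d0 s in auto)
    also have "- 2 * (\<delta> * (real N)\<^sup>2)\<^sup>2 / (\<Sum>i\<in>I. (b + 1 - a)\<^sup>2) = - (2 * \<delta>\<^sup>2 / (b + 1 - a)\<^sup>2 * (real N)\<^sup>2)"
    proof -
      have "- 2 * (\<delta> * n)\<^sup>2 / (n * D) = - (2 * \<delta>\<^sup>2 / D * n)" if "n \<noteq> 0" for n D :: real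
        using that by (simp add: power2_eq_square)
      from this[of "(real N)\<^sup>2" "(b + 1 - a)\<^sup>2"] show ?thesis unfolding s using N0 by simp
    qed
    finally show ?thesis by (simp add: sumI bad_def)
  qed
  have main: "AE \<omega> in M. \<forall>\<^sub>F N in sequentially. \<forall>j\<in>J N. \<omega> \<notin> bad \<delta> N j" if \<delta>: "0 < \<delta>" for \<delta>
  proof -
    define A where "A N = (if N = 0 then {} else (\<Union>j\<in>J N. bad \<delta> N j))" for N
    define c where "c = 2 * \<delta>\<^sup>2 / (b + 1 - a)\<^sup>2"
    have c: "0 < c" using \<delta> ab by (simp add: c_def)
    have As: "A N \<in> sets M" for N unfolding A_def using J(1) by auto
    have Ale: "prob (A N) \<le> (2 * real N ^ 3 + 1)\<^sup>2 * (2 * exp (- (c * (real N)\<^sup>2)))" for N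
    proof (cases "N = 0")
      case False
      have "prob (A N) \<le> (\<Sum>j\<in>J N. prob (bad \<delta> N j))"
        unfolding A_def using False J(1) by (simp add: finite_measure_subadditive_finite image_subset_iff)
      also have "\<dots> \<le> (\<Sum>j\<in>J N. 2 * exp (- (c * (real N)\<^sup>2)))"
        unfolding c_def using False by (intro sum_mono pbad \<delta>) auto
      finally show ?thesis by (simp add: J(2))
    qed (simp add: A_def)
    have "AE \<omega> in M. \<forall>\<^sub>F N in sequentially. \<omega> \<in> space M - A N"
    proof (rule borel_cantelli_AE1)
      show "summable (\<lambda>N. prob (A N))"
        by (rule summable_comparison_test'[OF summable_poly_gauss[OF c], of 0]) (use Ale in auto)
    qed (use As in \<open>auto simp: emeasure_eq_measure\<close>)
    then show ?thesis
    proof eventually_elim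
      case (elim \<omega>)
      then show ?case using eventually_ge_at_top[of 1]
        by eventually_elim (auto simp: A_def)
    qed
  qed
  have "AE \<omega> in M. \<forall>p::nat. \<forall>\<^sub>F N in sequentially. \<forall>j\<in>J N. \<omega> \<notin> bad (inverse (real (Suc p))) N j"
    unfolding AE_all_countable using main by simp
  moreover have "AE \<omega> in M. \<forall>j. m j \<omega> \<in> {a..b}" unfolding AE_all_countable using bnd by blast
  ultimately show ?thesis
    using AE_space
  proof eventually_elim
    case (elim \<omega>)
    show ?case
    proof (intro conjI allI impI)
      show "m j \<omega> \<in> {a..b}" for j using elim(2) by blast
      fix \<delta> :: real assume "0 < \<delta>"
      then obtain p where p: "inverse (real (Suc p)) < \<delta>" using reals_Archimedean by blast
      obtain N0 where N0: "\<And>N j. N0 \<le> N \<Longrightarrow> j \<in> J N \<Longrightarrow> \<omega> \<notin> bad (inverse (real (Suc p))) N j"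
        using elim(1)[rule_format, of p] unfolding eventually_sequentially by blast
      show "\<exists>N0. \<forall>N\<ge>N0. \<forall>j. (\<forall>i. \<bar>j $ i\<bar> \<le> int N ^ 3) \<longrightarrow> \<bar>\<Sum>k\<in>blk N. m (j + k) \<omega> - mbar\<bar> \<le> \<delta> * (real N)\<^sup>2"
      proof (intro exI[of _ N0] allI impI)
        fix N and j :: "int^2" assume N: "N0 \<le> N" and j: "\<forall>i. \<bar>j $ i\<bar> \<le> int N ^ 3"
        have "j \<in> J N" using j by (auto simp: J_def abs_le_iff minus_le_iff)
        then have "\<bar>\<Sum>k\<in>blk N. m (j + k) \<omega> - mbar\<bar> < inverse (real (Suc p)) * (real N)\<^sup>2"
          using N0[OF N] elim(3) by (simp add: bad_def not_le)
        also have "\<dots> \<le> \<delta> * (real N)\<^sup>2" using p by (intro mult_right_mono) auto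
        finally show "\<bar>\<Sum>k\<in>blk N. m (j + k) \<omega> - mbar\<bar> \<le> \<delta> * (real N)\<^sup>2" by simp
      qed
    qed
  qed
qed

subsection \<open>Averaging an oscillating coefficient\<close>

lemma norm_shift_power_diff:
  "norm (shift_op (of_nat n *s axis i 1) u - u) \<le> real n * norm (fd i u)"
proof (induction n)
  case 0
  have "shift_op (of_nat 0 *s axis i 1) u = u" by (rule ell2_eqI) simp
  then show ?case by simp
next
  case (Suc n)
  have "of_nat (Suc n) *s axis i 1 = of_nat n *s axis i 1 + (axis i 1 :: int^2)"
    by (simp add: vec_eq_iff axis_def)
  then have "shift_op (of_nat (Suc n) *s axis i 1) u = shift_op (of_nat n *s axis i 1) (shift_op (axis i 1) u)"
    by (simp only: shift_op_shift_op)
  then have eq: "shift_op (of_nat (Suc n) *s axis i 1) u - u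
      = shift_op (of_nat n *s axis i 1) (fd i u) + (shift_op (of_nat n *s axis i 1) u - u)"
    by (simp add: fd_def shift_op_linear)
  have "norm (shift_op (of_nat (Suc n) *s axis i 1) u - u) \<le> norm (fd i u) + norm (shift_op (of_nat n *s axis i 1) u - u)"
    unfolding eq by (rule order_trans[OF norm_triangle_ineq]) (simp only: norm_shift_op order_refl)
  then show ?case using Suc by (simp add: algebra_simps)
qed

abbreviation grad_norm :: "(int^2) ell2 \<Rightarrow> real" where
  "grad_norm u \<equiv> norm (fd 1 u) + norm (fd 2 u)"

text \<open>A path of at most \<open>2 N\<close> unit steps leads from the corner of the block to \<open>k\<close>.\<close>

lemma norm_shift_diff:
  assumes "k \<in> blk N"
  shows "norm (shift_op k u - u) \<le> real N * grad_norm u"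
proof -
  define n1 n2 where "n1 = nat (k $ 1)" and "n2 = nat (k $ 2)"
  have k: "0 \<le> k $ 1" "k $ 1 < int N" "0 \<le> k $ 2" "k $ 2 < int N" using assms by (auto simp: blk_def)
  have n: "n1 \<le> N" "n2 \<le> N" using k by (auto simp: n1_def n2_def)
  have keq: "k = of_nat n1 *s axis 1 1 + of_nat n2 *s axis 2 1"
    using k by (simp add: vec_eq_iff forall_2 n1_def n2_def axis_def)
  let ?S1 = "shift_op (of_nat n1 *s axis 1 1)" and ?S2 = "shift_op (of_nat n2 *s axis 2 1)"
  have eq: "shift_op k u - u = ?S1 (?S2 u - u) + (?S1 u - u)"
    unfolding keq shift_op_shift_op[symmetric] by (simp add: shift_op_linear)
  have "norm (shift_op k u - u) \<le> norm (?S2 u - u) + norm (?S1 u - u)"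
    unfolding eq by (rule order_trans[OF norm_triangle_ineq]) (simp only: norm_shift_op order_refl)
  also have "\<dots> \<le> real n2 * norm (fd 2 u) + real n1 * norm (fd 1 u)"
    by (intro add_mono norm_shift_power_diff)
  also have "\<dots> \<le> real N * norm (fd 2 u) + real N * norm (fd 1 u)"
    using n by (intro add_mono mult_right_mono) auto
  finally show ?thesis by (simp add: algebra_simps)
qed

text \<open>
  Pairing with an oscillating coefficient of small block averages gains: translating both factors
  over a block costs their gradients, and what remains only sees the block sums of the coefficient.
\<close>

lemma oscillating_pairing_bound:
  fixes e A :: "(int^2) ell2"
  assumes \<mu>: "\<And>j. \<bar>\<mu> j\<bar> \<le> c0" and N: "1 \<le> N" and \<delta>: "0 \<le> \<delta>"
    and blk_small: "\<And>j. j \<in> Q \<Longrightarrow> \<bar>\<Sum>k\<in>blk N. \<mu> (j + k)\<bar> \<le> \<delta> * (real N)\<^sup>2"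
  shows "\<bar>inner e (mult_op \<mu> A)\<bar> \<le> real N * grad_norm e * (c0 * norm A)
    + norm e * (c0 * (real N * grad_norm A))
    + norm e * (\<delta> * norm A + c0 * norm (mult_op (indicator (- Q)) A))"
proof -
  have c0: "0 \<le> c0" using \<mu>[of 0] by linarith
  have \<mu>k: "\<bar>\<mu> (j + k)\<bar> \<le> c0" for j k by (rule \<mu>)
  define \<sigma> where "\<sigma> j = (\<Sum>k\<in>blk N. \<mu> (j + k))" for j
  define n2 where "n2 = (real N)\<^sup>2"
  have n2: "0 < n2" using N by (simp add: n2_def)
  have cardn: "real (card (blk N)) = n2" by (simp add: blk n2_def)
  have \<sigma>b: "\<bar>\<sigma> j\<bar> \<le> n2 * c0" for j
  proof -
    have "\<bar>\<sigma> j\<bar> \<le> (\<Sum>k\<in>blk N. c0)" unfolding \<sigma>_def by (rule order_trans[OF sum_abs sum_mono]) (rule \<mu>)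
    then show ?thesis by (simp add: cardn)
  qed
  \<comment> \<open>Both factors are translated by \<open>k\<close>. In the last term the coefficient is translated and the
    factors are not, so that summation over the block produces the block sums.\<close>
  have split: "inner e (mult_op \<mu> A) = inner (shift_op k e - e) (shift_op k (mult_op \<mu> A))
     + inner e (mult_op (\<lambda>j. \<mu> (j + k)) (shift_op k A - A)) + inner e (mult_op (\<lambda>j. \<mu> (j + k)) A)" for k
  proof -
    have "shift_op k (mult_op \<mu> A) = mult_op (\<lambda>j. \<mu> (j + k)) (shift_op k A - A) + mult_op (\<lambda>j. \<mu> (j + k)) A"
      by (rule ell2_eqI) (simp add: coord_mult_op[of \<mu>, OF \<mu>] coord_mult_op[of "\<lambda>j. \<mu> (j + k)", OF \<mu>k] algebra_simps)
    then have "inner e (mult_op (\<lambda>j. \<mu> (j + k)) (shift_op k A - A)) + inner e (mult_op (\<lambda>j. \<mu> (j + k)) A) = inner e (shift_op k (mult_op \<mu> A))"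
      by (simp add: inner_add_right)
    then show ?thesis using inner_shift_op[of k e "mult_op \<mu> A"] by (simp add: inner_diff_left)
  qed
  have sum3: "(\<Sum>k\<in>blk N. inner e (mult_op (\<lambda>j. \<mu> (j + k)) A)) = inner e (mult_op \<sigma> A)"
  proof -
    have "mult_op \<sigma> A = (\<Sum>k\<in>blk N. mult_op (\<lambda>j. \<mu> (j + k)) A)"
    proof (rule ell2_eqI)
      fix j
      have cs: "coord (\<Sum>k\<in>S. f k) j = (\<Sum>k\<in>S. coord (f k) j)" if "finite S" for S and f :: "int^2 \<Rightarrow> (int^2) ell2"
        using that by induction auto
      show "coord (mult_op \<sigma> A) j = coord (\<Sum>k\<in>blk N. mult_op (\<lambda>j. \<mu> (j + k)) A) j"
        unfolding cs[OF blk(1)] coord_mult_op[of \<sigma>, OF \<sigma>b] coord_mult_op[of "\<lambda>j. \<mu> (j + _)", OF \<mu>k]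
        by (simp add: \<sigma>_def sum_distrib_right)
    qed
    then show ?thesis by (simp add: inner_sum_right)
  qed
  have b1: "\<bar>inner (shift_op k e - e) (shift_op k (mult_op \<mu> A))\<bar> \<le> real N * grad_norm e * (c0 * norm A)" (is "_ \<le> ?B1") if "k \<in> blk N" for k
  proof -
    have "\<bar>inner (shift_op k e - e) (shift_op k (mult_op \<mu> A))\<bar> \<le> norm (shift_op k e - e) * norm (mult_op \<mu> A)"
      using Cauchy_Schwarz_ineq2[of "shift_op k e - e" "shift_op k (mult_op \<mu> A)"] by simp
    also have "\<dots> \<le> ?B1" by (intro mult_mono norm_shift_diff that norm_mult_op_le \<mu>) auto
    finally show ?thesis .
  qed
  have b2: "\<bar>inner e (mult_op (\<lambda>j. \<mu> (j + k)) (shift_op k A - A))\<bar> \<le> norm e * (c0 * (real N * grad_norm A))" (is "_ \<le> ?B2") if "k \<in> blk N" for k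
  proof -
    have "\<bar>inner e (mult_op (\<lambda>j. \<mu> (j + k)) (shift_op k A - A))\<bar> \<le> norm e * norm (mult_op (\<lambda>j. \<mu> (j + k)) (shift_op k A - A))"
      by (rule Cauchy_Schwarz_ineq2)
    also have "\<dots> \<le> norm e * (c0 * norm (shift_op k A - A))"
      by (intro mult_left_mono norm_mult_op_le \<mu>) auto
    also have "\<dots> \<le> ?B2" by (intro mult_left_mono norm_shift_diff that c0) auto
    finally show ?thesis .
  qed
  have b3: "\<bar>inner e (mult_op \<sigma> A)\<bar> \<le> n2 * (norm e * (\<delta> * norm A + c0 * norm (mult_op (indicator (- Q)) A)))"
  proof -
    let ?t = "mult_op (indicator (- Q)) A"
    have ind1: "\<bar>indicat_real (- Q) j\<bar> \<le> 1" for j by (simp split: split_indicator)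
    let ?s = "\<lambda>j. n2 * \<delta> + n2 * c0 * indicat_real (- Q) j"
    have sb: "\<bar>?s j\<bar> \<le> n2 * \<delta> + n2 * c0" for j using n2 \<delta> c0 by (simp split: split_indicator)
    have "norm (mult_op \<sigma> A) \<le> norm (mult_op ?s A)"
    proof (rule norm_ell2_mono)
      fix j
      have "\<bar>\<sigma> j\<bar> \<le> \<bar>?s j\<bar>"
      proof (cases "j \<in> Q")
        case True
        then show ?thesis using blk_small[OF True] n2 \<delta> by (simp add: \<sigma>_def n2_def mult.commute)
      next
        case False
        then show ?thesis using \<sigma>b[of j] n2 \<delta> c0 by (simp add: abs_of_nonneg) (smt (verit) mult_nonneg_nonneg)
      qed
      then show "\<bar>coord (mult_op \<sigma> A) j\<bar> \<le> \<bar>coord (mult_op ?s A) j\<bar>"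
        unfolding coord_mult_op[of \<sigma>, OF \<sigma>b] coord_mult_op[of ?s, OF sb] abs_mult by (rule mult_right_mono) simp
    qed
    also have "mult_op ?s A = (n2 * \<delta>) *\<^sub>R A + (n2 * c0) *\<^sub>R ?t"
      by (rule ell2_eqI, unfold coord_mult_op[of ?s, OF sb] coord_simps coord_mult_op[of "indicat_real (- Q)", OF ind1])
         (simp only: distrib_right mult.assoc)
    also have "norm \<dots> \<le> n2 * \<delta> * norm A + n2 * c0 * norm ?t"
      by (rule order_trans[OF norm_triangle_ineq]) (use n2 \<delta> c0 in \<open>simp add: abs_mult\<close>)
    finally have le: "norm (mult_op \<sigma> A) \<le> n2 * (\<delta> * norm A + c0 * norm ?t)" by (simp add: algebra_simps)
    have "\<bar>inner e (mult_op \<sigma> A)\<bar> \<le> norm e * norm (mult_op \<sigma> A)" by (rule Cauchy_Schwarz_ineq2)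
    also have "\<dots> \<le> norm e * (n2 * (\<delta> * norm A + c0 * norm ?t))" by (intro mult_left_mono le) simp
    finally show ?thesis by (simp add: mult_ac)
  qed
  have "n2 * inner e (mult_op \<mu> A) = (\<Sum>k\<in>blk N. inner e (mult_op \<mu> A))" by (simp add: cardn)
  also have "\<dots> = (\<Sum>k\<in>blk N. inner (shift_op k e - e) (shift_op k (mult_op \<mu> A))
     + inner e (mult_op (\<lambda>j. \<mu> (j + k)) (shift_op k A - A)) + inner e (mult_op (\<lambda>j. \<mu> (j + k)) A))"
    by (rule sum.cong[OF refl split])
  also have "\<dots> = (\<Sum>k\<in>blk N. inner (shift_op k e - e) (shift_op k (mult_op \<mu> A)))
     + (\<Sum>k\<in>blk N. inner e (mult_op (\<lambda>j. \<mu> (j + k)) (shift_op k A - A))) + inner e (mult_op \<sigma> A)"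
    by (simp only: sum.distrib sum3)
  finally have eq: "n2 * inner e (mult_op \<mu> A) = \<dots>" .
  have s1: "\<bar>\<Sum>k\<in>blk N. inner (shift_op k e - e) (shift_op k (mult_op \<mu> A))\<bar> \<le> n2 * ?B1"
  proof -
    have "n2 * ?B1 = (\<Sum>k\<in>blk N. ?B1)" by (simp add: cardn)
    then show ?thesis by (simp only:) (rule order_trans[OF sum_abs], rule sum_mono, rule b1)
  qed
  have s2: "\<bar>\<Sum>k\<in>blk N. inner e (mult_op (\<lambda>j. \<mu> (j + k)) (shift_op k A - A))\<bar> \<le> n2 * ?B2"
  proof -
    have "n2 * ?B2 = (\<Sum>k\<in>blk N. ?B2)" by (simp add: cardn)
    then show ?thesis by (simp only:) (rule order_trans[OF sum_abs], rule sum_mono, rule b2)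
  qed
  have "n2 * \<bar>inner e (mult_op \<mu> A)\<bar> = \<bar>n2 * inner e (mult_op \<mu> A)\<bar>" using n2 by (simp add: abs_mult)
  also have "\<dots> \<le> n2 * ?B1 + n2 * ?B2 + n2 * (norm e * (\<delta> * norm A + c0 * norm (mult_op (indicator (- Q)) A)))"
    unfolding eq using s1 s2 b3 by linarith
  also have "\<dots> = n2 * (?B1 + ?B2 + norm e * (\<delta> * norm A + c0 * norm (mult_op (indicator (- Q)) A)))"
    by (simp only: distrib_left)
  finally show ?thesis using n2 by (rule mult_left_le_imp_le)
qed

section \<open>The energy estimate\<close>

definition lap :: "(int^2) ell2 \<Rightarrow> (int^2) ell2" where
  "lap u = (\<Sum>i\<in>UNIV. shift_op (axis i 1) u + shift_op (- axis i 1) u - 2 *\<^sub>R u)"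

lemma coord_lap: "coord (lap u) j = lattice_laplacian (coord u) j"
  by (simp add: lap_def lattice_laplacian_def UNIV_2)

text \<open>Summation by parts.\<close>

lemma inner_lap: "inner (lap u) v = - (\<Sum>i\<in>UNIV. inner (fd i u) (fd i v))"
proof -
  have "inner (shift_op (axis i 1) u + shift_op (- axis i 1) u - 2 *\<^sub>R u) v = - inner (fd i u) (fd i v)" for i
  proof -
    have "inner u (shift_op (axis i 1) v) = inner (shift_op (- axis i 1) u) v"
      using inner_shift_op_left[of "- axis i 1" u v] by simp
    then show ?thesis
      by (simp add: fd_def inner_diff_left inner_diff_right inner_add_left inner_shift_op)
  qed
  then show ?thesis unfolding lap_def by (simp add: inner_sum_left sum_negf)
qed

lemma quadratic_bound:
  fixes s X Y :: real assumes "s\<^sup>2 \<le> X + Y * s" shows "s\<^sup>2 \<le> 2 * X + Y\<^sup>2"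
proof -
  have "0 \<le> (s - Y)\<^sup>2" by simp
  then have "2 * (Y * s) \<le> s\<^sup>2 + Y\<^sup>2" by (simp add: power2_diff algebra_simps)
  then show ?thesis using assms by linarith
qed

text \<open>
  The forcing \<open>(m - mbar) A\<close> is not small in norm, so its pairing with \<open>d\<close> is not estimated directly.
  Adding the pairing with \<open>e\<close> to the energy replaces it by pairings of \<open>e\<close> with the forcing and its
  time derivative, which are small relative to \<open>e\<close> and its gradient. As \<open>e\<close> itself is the time
  integral of \<open>d\<close>, the maximum of the energy norm over the time interval satisfies a quadratic
  inequality. Throughout, \<open>\<epsilon> * norm\<close> corresponds to the norm of \<open>L\<^sup>2\<close> and \<open>fd i\<close> to \<open>\<epsilon> \<partial>\<^sub>i\<close>.
\<close>

lemma energy_estimate: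
  fixes e d d' A B r :: "real \<Rightarrow> (int^2) ell2" and m :: "int^2 \<Rightarrow> real"
  assumes a: "0 < a" and m: "\<And>j. m j \<in> {a..b}" and mbar: "mbar \<in> {a..b}"
    and \<epsilon>: "0 < \<epsilon>" and T: "0 < T"
    and de: "\<And>\<tau>. (e has_vector_derivative d \<tau>) (at \<tau>)"
    and dd: "\<And>\<tau>. (d has_vector_derivative d' \<tau>) (at \<tau>)"
    and dA: "\<And>\<tau>. (A has_vector_derivative B \<tau>) (at \<tau>)"
    and eqn: "\<And>\<tau>. mult_op m (d' \<tau>) = (1 / \<epsilon>\<^sup>2) *\<^sub>R lap (e \<tau>) - mult_op (\<lambda>j. m j - mbar) (A \<tau>) - r \<tau>"
    and pair: "\<And>\<tau>. \<bar>\<tau>\<bar> \<le> T \<Longrightarrow> \<epsilon>\<^sup>2 * \<bar>inner (e \<tau>) (mult_op (\<lambda>j. m j - mbar) (A \<tau>))\<bar> \<le> \<kappa> * (grad_norm (e \<tau>) + \<epsilon> * norm (e \<tau>))"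
      "\<And>\<tau>. \<bar>\<tau>\<bar> \<le> T \<Longrightarrow> \<epsilon>\<^sup>2 * \<bar>inner (e \<tau>) (mult_op (\<lambda>j. m j - mbar) (B \<tau>))\<bar> \<le> \<kappa> * (grad_norm (e \<tau>) + \<epsilon> * norm (e \<tau>))"
    and r: "\<And>\<tau>. \<bar>\<tau>\<bar> \<le> T \<Longrightarrow> \<epsilon> * norm (r \<tau>) \<le> \<kappa>"
    and \<kappa>: "0 \<le> \<kappa>"
  defines "P \<equiv> \<lambda>\<tau>. \<epsilon> * norm (d \<tau>)" and "G \<equiv> \<lambda>\<tau>. grad_norm (e \<tau>)"
  defines "C1 \<equiv> 4 / a + 8"
  defines "S \<equiv> 2 * C1 * (b * (P 0)\<^sup>2 + (G 0)\<^sup>2 + \<kappa> * (2 + T) * (\<epsilon> * norm (e 0))) + (C1 * \<kappa> * (2 + T) * (1 + T))\<^sup>2"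
  shows "\<bar>\<tau>\<bar> \<le> T \<Longrightarrow> P \<tau> + G \<tau> \<le> sqrt S" "\<bar>\<tau>\<bar> \<le> T \<Longrightarrow> \<epsilon> * norm (e \<tau>) \<le> \<epsilon> * norm (e 0) + T * sqrt S"
proof -
  define \<mu> where "\<mu> = (\<lambda>j. m j - mbar)"
  have ab: "a \<le> b" using mbar by auto
  have mb: "\<bar>m j\<bar> \<le> b" for j using m[of j] a by auto
  have \<mu>b: "\<bar>\<mu> j\<bar> \<le> b - a" for j unfolding \<mu>_def using m[of j] mbar by (auto simp: abs_le_iff)
  note blm = bounded_linear_mult_op[of m b, OF mb] and bl\<mu> = bounded_linear_mult_op[of \<mu> "b - a", OF \<mu>b]
  \<comment> \<open>\<open>En\<close> is the energy of the error. In the derivative of \<open>\<Phi>\<close> the pairing of the forcing with \<open>d\<close>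
    cancels.\<close>
  define En where "En \<tau> = inner (mult_op m (d \<tau>)) (d \<tau>) / 2 + (1 / \<epsilon>\<^sup>2) * ((\<Sum>i\<in>UNIV. inner (fd i (e \<tau>)) (fd i (e \<tau>))) / 2)" for \<tau>
  define \<Phi> where "\<Phi> \<tau> = En \<tau> + inner (e \<tau>) (mult_op \<mu> (A \<tau>))" for \<tau>
  define E where "E \<tau> = \<epsilon> * norm (e \<tau>)" for \<tau>
  have ivd: "((\<lambda>t. inner (f t) (g t)) has_real_derivative inner (f \<tau>) g' + inner f' (g \<tau>)) (at \<tau>)"
    if "(f has_vector_derivative f') (at \<tau>)" "(g has_vector_derivative g') (at \<tau>)" for f g :: "real \<Rightarrow> (int^2) ell2" and f' g' \<tau>
    using bounded_bilinear.has_vector_derivative[OF bounded_bilinear_inner that] by (simp add: has_real_derivative_iff_has_vector_derivative)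
  have \<Phi>': "(\<Phi> has_real_derivative (inner (e \<tau>) (mult_op \<mu> (B \<tau>)) - inner (r \<tau>) (d \<tau>))) (at \<tau>)" for \<tau>
  proof -
    have 1: "((\<lambda>t. inner (mult_op m (d t)) (d t)) has_real_derivative inner (mult_op m (d \<tau>)) (d' \<tau>) + inner (mult_op m (d' \<tau>)) (d \<tau>)) (at \<tau>)"
      by (rule ivd[OF bounded_linear.has_vector_derivative[OF blm dd] dd])
    have 2: "((\<lambda>t. inner (fd i (e t)) (fd i (e t))) has_real_derivative inner (fd i (e \<tau>)) (fd i (d \<tau>)) + inner (fd i (d \<tau>)) (fd i (e \<tau>))) (at \<tau>)" for i
      by (rule ivd[OF bounded_linear.has_vector_derivative[OF bounded_linear_fd de] bounded_linear.has_vector_derivative[OF bounded_linear_fd de]])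
    have 3: "((\<lambda>t. inner (e t) (mult_op \<mu> (A t))) has_real_derivative inner (e \<tau>) (mult_op \<mu> (B \<tau>)) + inner (d \<tau>) (mult_op \<mu> (A \<tau>))) (at \<tau>)"
      by (rule ivd[OF de bounded_linear.has_vector_derivative[OF bl\<mu> dA]])
    have "(\<Phi> has_real_derivative (inner (mult_op m (d \<tau>)) (d' \<tau>) + inner (mult_op m (d' \<tau>)) (d \<tau>)) / 2
       + (1 / \<epsilon>\<^sup>2) * ((\<Sum>i\<in>UNIV. inner (fd i (e \<tau>)) (fd i (d \<tau>)) + inner (fd i (d \<tau>)) (fd i (e \<tau>))) / 2)
       + (inner (e \<tau>) (mult_op \<mu> (B \<tau>)) + inner (d \<tau>) (mult_op \<mu> (A \<tau>)))) (at \<tau>)"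
      unfolding \<Phi>_def[abs_def] En_def by (intro DERIV_add DERIV_cdivide DERIV_cmult DERIV_sum 1 2 3)
    also have "(inner (mult_op m (d \<tau>)) (d' \<tau>) + inner (mult_op m (d' \<tau>)) (d \<tau>)) / 2 = inner (mult_op m (d' \<tau>)) (d \<tau>)"
      using inner_mult_op[of m b "d \<tau>" "d' \<tau>", OF mb] by (simp add: inner_commute)
    also have "(\<Sum>i\<in>UNIV. inner (fd i (e \<tau>)) (fd i (d \<tau>)) + inner (fd i (d \<tau>)) (fd i (e \<tau>))) / 2 = - inner (lap (e \<tau>)) (d \<tau>)"
      unfolding inner_lap by (simp add: UNIV_2 inner_commute)
    also have "inner (mult_op m (d' \<tau>)) (d \<tau>) + (1 / \<epsilon>\<^sup>2) * (- inner (lap (e \<tau>)) (d \<tau>)) + (inner (e \<tau>) (mult_op \<mu> (B \<tau>)) + inner (d \<tau>) (mult_op \<mu> (A \<tau>)))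
        = inner (e \<tau>) (mult_op \<mu> (B \<tau>)) - inner (r \<tau>) (d \<tau>)"
      unfolding eqn \<mu>_def inner_diff_left inner_scaleR_left by (simp add: inner_commute)
    finally show ?thesis .
  qed
  have Pc: "continuous_on {-T..T} (\<lambda>\<tau>. P \<tau> + G \<tau>)"
  proof -
    have "continuous_on {-T..T} d" "continuous_on {-T..T} e"
      by (intro continuous_at_imp_continuous_on ballI has_vector_derivative_continuous[OF dd] has_vector_derivative_continuous[OF de])+
    then show ?thesis unfolding P_def G_def
      by (intro continuous_intros bounded_linear.continuous_on[OF bounded_linear_fd])
  qed
  have "{-T..T} \<noteq> {}" using T by simp
  \<comment> \<open>The supremum over the interval is attained, which replaces a Gronwall argument.\<close>
  then obtain \<tau>m where \<tau>m: "\<tau>m \<in> {-T..T}" "\<And>\<tau>. \<tau> \<in> {-T..T} \<Longrightarrow> P \<tau> + G \<tau> \<le> P \<tau>m + G \<tau>m"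
    using continuous_attains_sup[OF compact_Icc _ Pc] by blast
  define s where "s = P \<tau>m + G \<tau>m"
  have le_s: "P \<tau> + G \<tau> \<le> s" if "\<bar>\<tau>\<bar> \<le> T" for \<tau>
    unfolding s_def using that by (intro \<tau>m(2)) auto
  have P0: "0 \<le> P \<tau>" and G0: "0 \<le> G \<tau>" and E0: "0 \<le> E \<tau>" for \<tau> using \<epsilon> by (auto simp: P_def G_def E_def)
  have s0: "0 \<le> s" unfolding s_def using P0 G0 by (intro add_nonneg_nonneg)
  have Ele: "E \<tau> \<le> E 0 + T * s" if \<tau>: "\<bar>\<tau>\<bar> \<le> T" for \<tau>
  proof -
    have "norm (e \<tau> - e 0) \<le> (s / \<epsilon>) * norm (\<tau> - 0)"
    proof (rule differentiable_bound)
      show "convex {-T..T}" by simp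
      show "(e has_derivative (\<lambda>x. x *\<^sub>R d t)) (at t within {-T..T})" for t
        using de[of t] by (auto simp: has_vector_derivative_def intro: has_derivative_at_withinI)
      fix t assume "t \<in> {-T..T}"
      then have "\<bar>t\<bar> \<le> T" by auto
      then have "\<epsilon> * norm (d t) \<le> s" using le_s[of t] G0[of t] by (simp add: P_def)
      then have "norm (d t) \<le> s / \<epsilon>" using \<epsilon> by (simp add: le_divide_eq mult.commute)
      then show "onorm (\<lambda>x. x *\<^sub>R d t) \<le> s / \<epsilon>"
        by (intro onorm_le) (simp only: norm_scaleR real_norm_def mult.commute[of "\<bar>_\<bar>"] mult_right_mono abs_ge_zero)
    qed (use \<tau> T in auto)
    then have "\<epsilon> * norm (e \<tau> - e 0) \<le> s * \<bar>\<tau>\<bar>" using \<epsilon> by (simp add: field_simps)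
    also have "\<dots> \<le> s * T" using \<tau> s0 by (intro mult_left_mono)
    finally have 1: "\<epsilon> * norm (e \<tau> - e 0) \<le> s * T" .
    have "norm (e \<tau>) \<le> norm (e 0) + norm (e \<tau> - e 0)" using norm_triangle_ineq[of "e 0" "e \<tau> - e 0"] by simp
    then have "E \<tau> \<le> E 0 + \<epsilon> * norm (e \<tau> - e 0)" unfolding E_def using \<epsilon> by (simp flip: distrib_left)
    then show ?thesis using 1 by (simp add: mult.commute)
  qed
  have d\<Phi>: "\<epsilon>\<^sup>2 * \<bar>inner (e \<tau>) (mult_op \<mu> (B \<tau>)) - inner (r \<tau>) (d \<tau>)\<bar> \<le> \<kappa> * (s + E 0 + T * s)" if \<tau>: "\<bar>\<tau>\<bar> \<le> T" for \<tau>
  proof -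
    have "\<epsilon>\<^sup>2 * \<bar>inner (r \<tau>) (d \<tau>)\<bar> \<le> \<epsilon>\<^sup>2 * (norm (r \<tau>) * norm (d \<tau>))" by (intro mult_left_mono Cauchy_Schwarz_ineq2) simp
    also have "\<dots> = (\<epsilon> * norm (r \<tau>)) * P \<tau>" by (simp add: P_def power2_eq_square)
    also have "\<dots> \<le> \<kappa> * P \<tau>" by (rule mult_right_mono[OF r[OF \<tau>] P0])
    finally have 1: "\<epsilon>\<^sup>2 * \<bar>inner (r \<tau>) (d \<tau>)\<bar> \<le> \<kappa> * P \<tau>" .
    have 2: "\<epsilon>\<^sup>2 * \<bar>inner (e \<tau>) (mult_op \<mu> (B \<tau>))\<bar> \<le> \<kappa> * (G \<tau> + E \<tau>)"
      using pair(2)[OF \<tau>] by (simp add: G_def E_def \<mu>_def)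
    have "\<epsilon>\<^sup>2 * \<bar>inner (e \<tau>) (mult_op \<mu> (B \<tau>)) - inner (r \<tau>) (d \<tau>)\<bar> \<le> \<epsilon>\<^sup>2 * (\<bar>inner (e \<tau>) (mult_op \<mu> (B \<tau>))\<bar> + \<bar>inner (r \<tau>) (d \<tau>)\<bar>)"
      by (intro mult_left_mono abs_triangle_ineq4) simp
    also have "\<dots> \<le> \<kappa> * (G \<tau> + E \<tau>) + \<kappa> * P \<tau>" using 1 2 by (simp add: distrib_left)
    also have "\<dots> = \<kappa> * ((P \<tau> + G \<tau>) + E \<tau>)" by (simp add: algebra_simps)
    also have "\<dots> \<le> \<kappa> * (s + (E 0 + T * s))" by (intro mult_left_mono add_mono le_s Ele \<tau> \<kappa>)
    finally show ?thesis by (simp add: add.assoc)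
  qed
  have \<Phi>diff: "\<epsilon>\<^sup>2 * \<bar>\<Phi> \<tau> - \<Phi> 0\<bar> \<le> T * (\<kappa> * (s + E 0 + T * s))" if \<tau>: "\<bar>\<tau>\<bar> \<le> T" for \<tau>
  proof -
    have "norm (\<Phi> \<tau> - \<Phi> 0) \<le> (\<kappa> * (s + E 0 + T * s) / \<epsilon>\<^sup>2) * norm (\<tau> - 0)"
    proof (rule field_differentiable_bound)
      show "convex {-T..T}" by simp
      show "(\<Phi> has_real_derivative (inner (e t) (mult_op \<mu> (B t)) - inner (r t) (d t))) (at t within {-T..T})" for t
        by (rule has_field_derivative_at_within[OF \<Phi>'])
      fix t assume "t \<in> {-T..T}"
      then have "\<bar>t\<bar> \<le> T" by auto
      from d\<Phi>[OF this] show "norm (inner (e t) (mult_op \<mu> (B t)) - inner (r t) (d t)) \<le> \<kappa> * (s + E 0 + T * s) / \<epsilon>\<^sup>2"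
        using \<epsilon> by (simp add: le_divide_eq mult.commute)
    qed (use \<tau> T in auto)
    then have "\<epsilon>\<^sup>2 * \<bar>\<Phi> \<tau> - \<Phi> 0\<bar> \<le> (\<kappa> * (s + E 0 + T * s)) * \<bar>\<tau>\<bar>" using \<epsilon> by (simp add: field_simps)
    also have "\<dots> \<le> (\<kappa> * (s + E 0 + T * s)) * T"
      using \<tau> s0 \<kappa> E0[of 0] T by (intro mult_left_mono) auto
    finally show ?thesis by (simp add: mult.commute)
  qed
  have Enlow: "a * (P \<tau>)\<^sup>2 / 2 + (G \<tau>)\<^sup>2 / 4 \<le> \<epsilon>\<^sup>2 * En \<tau>" for \<tau>
  proof -
    have "a * (norm (d \<tau>))\<^sup>2 = inner (a *\<^sub>R d \<tau>) (d \<tau>)" by (simp add: power2_norm_eq_inner)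
    also have "\<dots> \<le> inner (mult_op m (d \<tau>)) (d \<tau>)"
      unfolding inner_ell2_def
    proof (rule infsum_mono)
      show "coord (a *\<^sub>R d \<tau>) j * coord (d \<tau>) j \<le> coord (mult_op m (d \<tau>)) j * coord (d \<tau>) j" for j
        using mult_right_mono[of a "m j" "coord (d \<tau>) j * coord (d \<tau>) j"] m[of j] by (simp add: coord_mult_op[of m b, OF mb] mult.assoc)
    qed (rule coord_summable_mult)+
    finally have 1: "a * (norm (d \<tau>))\<^sup>2 \<le> inner (mult_op m (d \<tau>)) (d \<tau>)" .
    have "a * (P \<tau>)\<^sup>2 = \<epsilon>\<^sup>2 * (a * (norm (d \<tau>))\<^sup>2)" by (simp add: P_def power_mult_distrib)
    also have "\<dots> \<le> \<epsilon>\<^sup>2 * inner (mult_op m (d \<tau>)) (d \<tau>)" by (intro mult_left_mono 1) simp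
    finally have 2: "a * (P \<tau>)\<^sup>2 \<le> \<epsilon>\<^sup>2 * inner (mult_op m (d \<tau>)) (d \<tau>)" .
    have "0 \<le> (norm (fd 1 (e \<tau>)) - norm (fd 2 (e \<tau>)))\<^sup>2" by simp
    then have 3: "(G \<tau>)\<^sup>2 \<le> 2 * (\<Sum>i\<in>UNIV. inner (fd i (e \<tau>)) (fd i (e \<tau>)))"
      by (simp add: G_def UNIV_2 power2_sum power2_diff power2_norm_eq_inner)
    have "\<epsilon>\<^sup>2 * En \<tau> = \<epsilon>\<^sup>2 * inner (mult_op m (d \<tau>)) (d \<tau>) / 2 + (\<Sum>i\<in>UNIV. inner (fd i (e \<tau>)) (fd i (e \<tau>))) / 2"
      unfolding En_def using \<epsilon> by (simp add: distrib_left)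
    with 2 3 show ?thesis by linarith
  qed
  have Enup: "\<epsilon>\<^sup>2 * En 0 \<le> b * (P 0)\<^sup>2 + (G 0)\<^sup>2"
  proof -
    have "inner (mult_op m (d 0)) (d 0) \<le> norm (mult_op m (d 0)) * norm (d 0)" by (rule norm_cauchy_schwarz)
    also have "\<dots> \<le> (b * norm (d 0)) * norm (d 0)" by (intro mult_right_mono norm_mult_op_le mb) simp
    finally have 1: "inner (mult_op m (d 0)) (d 0) \<le> b * (norm (d 0))\<^sup>2" by (simp add: power2_eq_square mult.assoc)
    have "\<epsilon>\<^sup>2 * inner (mult_op m (d 0)) (d 0) \<le> \<epsilon>\<^sup>2 * (b * (norm (d 0))\<^sup>2)" by (intro mult_left_mono 1) simp
    also have "\<dots> = b * (P 0)\<^sup>2" by (simp add: P_def power_mult_distrib)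
    finally have 2: "\<epsilon>\<^sup>2 * inner (mult_op m (d 0)) (d 0) \<le> b * (P 0)\<^sup>2" .
    have "0 \<le> norm (fd 1 (e 0)) * norm (fd 2 (e 0))" by simp
    then have 3: "(\<Sum>i\<in>UNIV. inner (fd i (e 0)) (fd i (e 0))) \<le> (G 0)\<^sup>2"
      by (simp add: G_def UNIV_2 power2_sum power2_norm_eq_inner[symmetric])
    have "\<epsilon>\<^sup>2 * En 0 = \<epsilon>\<^sup>2 * inner (mult_op m (d 0)) (d 0) / 2 + (\<Sum>i\<in>UNIV. inner (fd i (e 0)) (fd i (e 0))) / 2"
      unfolding En_def using \<epsilon> by (simp add: distrib_left)
    moreover have "0 \<le> b * (P 0)\<^sup>2" using a ab by simp
    moreover have "0 \<le> (G 0)\<^sup>2" by simp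
    ultimately show ?thesis using 2 3 by linarith
  qed
  have C1: "0 < C1" "4 / a \<le> C1" "8 \<le> C1" using a by (auto simp: C1_def intro: add_pos_pos)
  have key: "(P \<tau> + G \<tau>)\<^sup>2 \<le> C1 * (b * (P 0)\<^sup>2 + (G 0)\<^sup>2 + \<kappa> * (2 + T) * (s + E 0 + T * s))" if \<tau>: "\<bar>\<tau>\<bar> \<le> T" for \<tau>
  proof -
    have p: "\<epsilon>\<^sup>2 * \<bar>inner (e t) (mult_op \<mu> (A t))\<bar> \<le> \<kappa> * (s + E 0 + T * s)" if t: "\<bar>t\<bar> \<le> T" for t
    proof -
      have "\<epsilon>\<^sup>2 * \<bar>inner (e t) (mult_op \<mu> (A t))\<bar> \<le> \<kappa> * (G t + E t)" using pair(1)[OF t] by (simp add: G_def E_def \<mu>_def)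
      also have "\<dots> \<le> \<kappa> * (s + (E 0 + T * s))"
        using le_s[OF t] P0[of t] by (intro mult_left_mono add_mono Ele t \<kappa>) auto
      finally show ?thesis by (simp add: add.assoc)
    qed
    have T0: "\<bar>0\<bar> \<le> T" using T by simp
    have le: "\<epsilon>\<^sup>2 * En \<tau> \<le> \<epsilon>\<^sup>2 * En 0 + \<epsilon>\<^sup>2 * \<bar>\<Phi> \<tau> - \<Phi> 0\<bar> + \<epsilon>\<^sup>2 * \<bar>inner (e \<tau>) (mult_op \<mu> (A \<tau>))\<bar> + \<epsilon>\<^sup>2 * \<bar>inner (e 0) (mult_op \<mu> (A 0))\<bar>"
    proof -
      have "En \<tau> \<le> En 0 + \<bar>\<Phi> \<tau> - \<Phi> 0\<bar> + \<bar>inner (e \<tau>) (mult_op \<mu> (A \<tau>))\<bar> + \<bar>inner (e 0) (mult_op \<mu> (A 0))\<bar>"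
        unfolding \<Phi>_def by linarith
      then have "\<epsilon>\<^sup>2 * En \<tau> \<le> \<epsilon>\<^sup>2 * (En 0 + \<bar>\<Phi> \<tau> - \<Phi> 0\<bar> + \<bar>inner (e \<tau>) (mult_op \<mu> (A \<tau>))\<bar> + \<bar>inner (e 0) (mult_op \<mu> (A 0))\<bar>)"
        by (rule mult_left_mono) simp
      then show ?thesis by (simp only: distrib_left)
    qed
    define Z where "Z = \<kappa> * (s + E 0 + T * s)"
    have "a * (P \<tau>)\<^sup>2 / 2 + (G \<tau>)\<^sup>2 / 4 \<le> (b * (P 0)\<^sup>2 + (G 0)\<^sup>2) + T * Z + Z + Z"
      using Enlow[of \<tau>] le Enup \<Phi>diff[OF \<tau>] p[OF \<tau>] p[OF T0] unfolding Z_def by linarith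
    then have low: "a * (P \<tau>)\<^sup>2 / 2 + (G \<tau>)\<^sup>2 / 4 \<le> b * (P 0)\<^sup>2 + (G 0)\<^sup>2 + (2 + T) * Z" by (simp add: algebra_simps)
    have "0 \<le> (P \<tau> - G \<tau>)\<^sup>2" by simp
    then have "(P \<tau> + G \<tau>)\<^sup>2 \<le> 2 * (P \<tau>)\<^sup>2 + 2 * (G \<tau>)\<^sup>2" by (simp add: power2_diff power2_sum)
    also have "\<dots> = (4 / a) * (a * (P \<tau>)\<^sup>2 / 2) + 8 * ((G \<tau>)\<^sup>2 / 4)" using a by simp
    also have "\<dots> \<le> C1 * (a * (P \<tau>)\<^sup>2 / 2) + C1 * ((G \<tau>)\<^sup>2 / 4)" using a C1 by (intro add_mono mult_right_mono) auto
    also have "\<dots> = C1 * (a * (P \<tau>)\<^sup>2 / 2 + (G \<tau>)\<^sup>2 / 4)" by (simp only: distrib_left)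
    also have "\<dots> \<le> C1 * (b * (P 0)\<^sup>2 + (G 0)\<^sup>2 + (2 + T) * Z)" using C1 by (intro mult_left_mono low) simp
    finally show ?thesis by (simp only: Z_def mult_ac)
  qed
  have "\<bar>\<tau>m\<bar> \<le> T" using \<tau>m(1) by auto
  from key[OF this] have "s\<^sup>2 \<le> C1 * (b * (P 0)\<^sup>2 + (G 0)\<^sup>2 + \<kappa> * (2 + T) * (s + E 0 + T * s))" by (simp only: s_def)
  also have "\<dots> = C1 * (b * (P 0)\<^sup>2 + (G 0)\<^sup>2 + \<kappa> * (2 + T) * E 0) + (C1 * \<kappa> * (2 + T) * (1 + T)) * s"
    by (simp add: algebra_simps)
  finally have "s\<^sup>2 \<le> 2 * (C1 * (b * (P 0)\<^sup>2 + (G 0)\<^sup>2 + \<kappa> * (2 + T) * E 0)) + (C1 * \<kappa> * (2 + T) * (1 + T))\<^sup>2"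
    by (rule quadratic_bound)
  then have "s\<^sup>2 \<le> S" by (simp add: S_def E_def mult.assoc)
  then have sS: "s \<le> sqrt S" by (rule real_le_rsqrt)
  show "P \<tau> + G \<tau> \<le> sqrt S" if "\<bar>\<tau>\<bar> \<le> T" using le_s[OF that] sS by linarith
  show "\<epsilon> * norm (e \<tau>) \<le> \<epsilon> * norm (e 0) + T * sqrt S" if "\<bar>\<tau>\<bar> \<le> T"
    using Ele[OF that] mult_left_mono[OF sS, of T] T unfolding E_def by linarith
qed

section \<open>Both equations as curves of square-summable sequences\<close>

lemma l2_norm_coord: "l2_norm (coord z) = norm z"
  by (simp add: l2_norm_def norm_ell2_sq[symmetric])

lemma bounded_linear_lap: "bounded_linear lap"
  unfolding lap_def[abs_def]
  by (intro bounded_linear_sum bounded_linear_sub bounded_linear_add bounded_linear_shift_op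
      bounded_linear_scaleR_right)

text \<open>
  The equation gives second derivatives only site by site; they depend continuously on time in
  \<open>\<ell>\<^sup>2\<close> and are therefore derivatives in the norm.
\<close>

lemma lattice_solution_curve:
  assumes s: "lattice_solution \<mu> f g u v" and a: "0 < a" and \<mu>: "\<And>j. \<mu> j \<in> {a..b}"
  shows "coord (Abs_ell2 (u t)) = u t" "coord (Abs_ell2 (v t)) = v t"
    "((\<lambda>t. Abs_ell2 (u t)) has_vector_derivative Abs_ell2 (v t)) (at t)"
    "((\<lambda>t. Abs_ell2 (v t)) has_vector_derivative mult_op (\<lambda>j. 1 / \<mu> j) (lap (Abs_ell2 (u t)))) (at t)"
proof -
  show cu: "coord (Abs_ell2 (u t)) = u t" and cv: "coord (Abs_ell2 (v t)) = v t" for t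
    using s unfolding lattice_solution_def l2_seq_def by (auto intro!: coord_Abs_ell2)
  have vl: "((\<lambda>s. norm (Abs_ell2 (v s) - Abs_ell2 (v t))) \<longlongrightarrow> 0) (at t)" for t
  proof -
    have "l2_norm (\<lambda>j. v s j - v t j) = norm (Abs_ell2 (v s) - Abs_ell2 (v t))" for s
      unfolding l2_norm_coord[symmetric] by (rule arg_cong[of _ _ l2_norm]) (simp add: cv fun_eq_iff)
    moreover have "((\<lambda>s. l2_norm (\<lambda>j. v s j - v t j)) \<longlongrightarrow> 0) (at t)"
      using s unfolding lattice_solution_def by blast
    ultimately show ?thesis by simp
  qed
  have vcont: "isCont (\<lambda>t. Abs_ell2 (v t)) t" for t
    unfolding isCont_def using vl[of t] by (metis Lim_null tendsto_norm_zero_cancel)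
  have du: "((\<lambda>s. u s j) has_real_derivative v t j) (at t)" for t j
  proof -
    have eq: "l2_norm (\<lambda>j. (u s j - u t j) / (s - t) - v t j)
        = norm ((1 / (s - t)) *\<^sub>R (Abs_ell2 (u s) - Abs_ell2 (u t)) - Abs_ell2 (v t))" (is "_ = norm (?z s)") for s
      unfolding l2_norm_coord[symmetric] by (rule arg_cong[of _ _ l2_norm]) (simp add: cu cv fun_eq_iff)
    have "((\<lambda>s. l2_norm (\<lambda>j. (u s j - u t j) / (s - t) - v t j)) \<longlongrightarrow> 0) (at t)"
      using s unfolding lattice_solution_def by blast
    then have l: "((\<lambda>s. norm (?z s)) \<longlongrightarrow> 0) (at t)" by (simp only: eq)
    have "((\<lambda>s. (u s j - u t j) / (s - t) - v t j) \<longlongrightarrow> 0) (at t)"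
    proof (rule Lim_null_comparison[OF _ l], rule always_eventually, rule allI)
      fix s
      show "norm ((u s j - u t j) / (s - t) - v t j) \<le> norm (?z s)"
        using abs_coord_le_norm[of "?z s" j] by (simp add: cu cv)
    qed
    then show ?thesis by (simp add: has_field_derivative_iff Lim_null[symmetric])
  qed
  show *: "((\<lambda>t. Abs_ell2 (u t)) has_vector_derivative Abs_ell2 (v t)) (at t)" for t
    by (rule ell2_has_vector_derivativeI) (simp_all add: cu cv du vcont)
  have \<mu>b: "\<bar>1 / \<mu> j\<bar> \<le> 1 / a" for j using \<mu>[of j] a by (simp add: frac_le)
  show "((\<lambda>t. Abs_ell2 (v t)) has_vector_derivative mult_op (\<lambda>j. 1 / \<mu> j) (lap (Abs_ell2 (u t)))) (at t)"
  proof (rule ell2_has_vector_derivativeI)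
    fix t j
    obtain a' where a': "((\<lambda>s. v s j) has_real_derivative a') (at t)" "\<mu> j * a' = lattice_laplacian (u t) j"
      using s unfolding lattice_solution_def by blast
    have "a' = (1 / \<mu> j) * lattice_laplacian (u t) j" using a'(2)[symmetric] \<mu>[of j] a by simp
    then show "((\<lambda>s. coord (Abs_ell2 (v s)) j) has_real_derivative
        coord (mult_op (\<lambda>j. 1 / \<mu> j) (lap (Abs_ell2 (u t)))) j) (at t)"
      using a'(1) by (simp add: cv coord_mult_op[of "\<lambda>j. 1 / \<mu> j", OF \<mu>b] coord_lap cu)
  next
    have "isCont (\<lambda>t. Abs_ell2 (u t)) t" using * by (rule has_vector_derivative_continuous)
    then show "isCont (\<lambda>t. mult_op (\<lambda>j. 1 / \<mu> j) (lap (Abs_ell2 (u t)))) t"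
      by (intro bounded_linear.isCont[OF bounded_linear_mult_op[of "\<lambda>j. 1 / \<mu> j", OF \<mu>b]]
          bounded_linear.isCont[OF bounded_linear_lap])
  qed
qed

lemma has_vector_derivative_rescale:
  assumes "\<And>t. (f has_vector_derivative f' t) (at t)" and "\<epsilon> \<noteq> 0"
  shows "((\<lambda>s. \<epsilon> *\<^sub>R f (s / \<epsilon>)) has_vector_derivative f' (\<tau> / \<epsilon>)) (at \<tau>)"
proof -
  have "((\<lambda>s. s / \<epsilon>) has_vector_derivative 1 / \<epsilon>) (at \<tau>)"
    using assms(2) by (auto intro!: derivative_eq_intros simp: has_real_derivative_iff_has_vector_derivative[symmetric])
  from vector_diff_chain_at[OF this assms(1)]
  have "((\<lambda>s. f (s / \<epsilon>)) has_vector_derivative (1 / \<epsilon>) *\<^sub>R f' (\<tau> / \<epsilon>)) (at \<tau>)" by (simp add: o_def)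
  from bounded_linear.has_vector_derivative[OF bounded_linear_scaleR_right this, of \<epsilon>]
  show ?thesis using assms(2) by simp
qed

lemma rescaled_interp_eq:
  assumes "coord (Abs_ell2 (u (\<tau> / \<epsilon>))) = u (\<tau> / \<epsilon>)"
  shows "rescaled_interp \<epsilon> u \<tau> X = lp (Abs_ell2 (u (\<tau> / \<epsilon>))) ((1 / \<epsilon>) *\<^sub>R X)"
  by (simp add: rescaled_interp_def lp_def assms)

text \<open>The value of the interpolation at a fixed point is a bounded linear functional of the lattice function.\<close>

lemma rescaled_interp_has_derivative:
  assumes s: "lattice_solution \<mu> f g u v" and a: "0 < a" and \<mu>: "\<And>j. \<mu> j \<in> {a..b}" and \<epsilon>: "0 < \<epsilon>"
  shows "((\<lambda>s. of_real \<epsilon> * rescaled_interp \<epsilon> u s X) has_vector_derivative rescaled_interp \<epsilon> v \<tau> X) (at \<tau>)"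
proof -
  note c = lattice_solution_curve[OF s a \<mu>]
  have "((\<lambda>s. \<epsilon> *\<^sub>R Abs_ell2 (u (s / \<epsilon>))) has_vector_derivative Abs_ell2 (v (\<tau> / \<epsilon>))) (at \<tau>)"
    using has_vector_derivative_rescale[OF c(3), of \<epsilon>] \<epsilon> by simp
  from bounded_linear.has_vector_derivative[OF bounded_linear_lp this, of "(1 / \<epsilon>) *\<^sub>R X"]
  show ?thesis by (simp add: rescaled_interp_eq c(1,2) lp_scaleR scaleR_conv_of_real)
qed

lemma samp_difference_bound:
  assumes k: "kern R c K" and h: "L2_fun h" "L2_fun h'" and \<epsilon>: "0 < \<epsilon>" "\<epsilon> \<le> 1" and R: "0 \<le> R"
  shows "norm (samp \<epsilon> x K h - samp \<epsilon> x K h') \<le> (c * (2 * R) * (2 * R + 1) / \<epsilon>) * L2n (\<lambda>X. h X - h' X)"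
proof -
  have "\<epsilon> * norm (samp \<epsilon> x K (\<lambda>X. h X - h' X)) \<le> c * (2 * R) * (2 * R + 1) * L2n (\<lambda>X. h X - h' X)"
    by (rule samp_props(2)[OF k L2_fun_diff(1)[OF h] \<epsilon> R])
  then show ?thesis using \<epsilon> by (simp add: samp_diff[OF k h \<epsilon> R] field_simps)
qed

lemma samp_continuous:
  assumes W: "\<And>\<tau>. L2_fun (W \<tau>)" and c: "((\<lambda>s. L2n (\<lambda>X. W s X - W \<tau> X)) \<longlongrightarrow> 0) (at \<tau>)"
    and k: "kern R c K" and \<epsilon>: "0 < \<epsilon>" "\<epsilon> \<le> 1" and R: "0 \<le> R"
  shows "isCont (\<lambda>s. samp \<epsilon> x K (W s)) \<tau>"
proof -
  have "((\<lambda>s. samp \<epsilon> x K (W s) - samp \<epsilon> x K (W \<tau>)) \<longlongrightarrow> 0) (at \<tau>)"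
    by (rule Lim_null_comparison[OF always_eventually tendsto_mult_right_zero[OF c]])
       (rule allI, rule samp_difference_bound[OF k W W \<epsilon> R])
  then show ?thesis by (simp add: isCont_def Lim_null[symmetric])
qed

text \<open>Sampling is a bounded linear map from \<open>L\<^sup>2\<close> for each fixed \<open>\<epsilon>\<close>.\<close>

lemma samp_has_derivative:
  assumes W: "\<And>\<tau>. L2_fun (W \<tau>)" "\<And>\<tau>. L2_fun (W' \<tau>)"
    and d: "\<And>\<tau>. ((\<lambda>s. L2n (\<lambda>X. (W s X - W \<tau> X) / (s - \<tau>) - W' \<tau> X)) \<longlongrightarrow> 0) (at \<tau>)"
    and c: "\<And>\<tau>. ((\<lambda>s. L2n (\<lambda>X. W' s X - W' \<tau> X)) \<longlongrightarrow> 0) (at \<tau>)"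
    and k: "kern R c K" and \<epsilon>: "0 < \<epsilon>" "\<epsilon> \<le> 1" and R: "0 \<le> R"
  shows "((\<lambda>s. samp \<epsilon> x K (W s)) has_vector_derivative samp \<epsilon> x K (W' \<tau>)) (at \<tau>)"
proof (rule ell2_has_vector_derivativeI)
  show "isCont (\<lambda>\<tau>. samp \<epsilon> x K (W' \<tau>)) \<tau>" by (rule samp_continuous[OF W(2) c k \<epsilon> R])
  fix t j
  define z where "z s = (1 / (s - t)) *\<^sub>R (samp \<epsilon> x K (W s) - samp \<epsilon> x K (W t)) - samp \<epsilon> x K (W' t)" for s
  let ?C = "c * (2 * R) * (2 * R + 1) / \<epsilon>"
  have zb: "norm (z s) \<le> ?C * L2n (\<lambda>X. (W s X - W t X) / (s - t) - W' t X)" for s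
  proof -
    have q: "L2_fun (\<lambda>X. (1 / (s - t)) * (W s X - W t X))" by (intro L2_fun_cmult L2_fun_diff W)
    have "z s = samp \<epsilon> x K (\<lambda>X. (1 / (s - t)) * (W s X - W t X)) - samp \<epsilon> x K (W' t)"
      unfolding z_def by (simp only: samp_cmult[OF k L2_fun_diff(1)[OF W(1) W(1)] \<epsilon> R] samp_diff[OF k W(1) W(1) \<epsilon> R])
    then show ?thesis using samp_difference_bound[OF k q W(2) \<epsilon> R, where x=x] by simp
  qed
  have "((\<lambda>s. (coord (samp \<epsilon> x K (W s)) j - coord (samp \<epsilon> x K (W t)) j) / (s - t) - coord (samp \<epsilon> x K (W' t)) j) \<longlongrightarrow> 0) (at t)"
  proof (rule Lim_null_comparison[OF always_eventually tendsto_mult_right_zero[OF d, of ?C]], rule allI)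
    fix s
    show "norm ((coord (samp \<epsilon> x K (W s)) j - coord (samp \<epsilon> x K (W t)) j) / (s - t) - coord (samp \<epsilon> x K (W' t)) j)
        \<le> ?C * L2n (\<lambda>X. (W s X - W t X) / (s - t) - W' t X)"
      using order_trans[OF abs_coord_le_norm[of "z s" j] zb[of s]] by (simp add: z_def)
  qed
  then show "((\<lambda>s. coord (samp \<epsilon> x K (W s)) j) has_real_derivative coord (samp \<epsilon> x K (W' t)) j) (at t)"
    by (simp add: has_field_derivative_iff Lim_null[symmetric])
qed

text \<open>The Laplacian of the mollifier \<^const>\<open>rho\<close>.\<close>

definition lapk :: "real \<Rightarrow> real^2 \<Rightarrow> real" where
  "lapk \<eta> z = (let p = deriv (stp \<eta>) in tensor (deriv (deriv p)) p z + tensor p (deriv (deriv p)) z)"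

lemma lip_kern_lapk: assumes "0 < \<eta>" shows "\<exists>L. lip_kern \<eta> L (lapk \<eta>)"
proof -
  let ?p = "deriv (stp \<eta>)"
  have p: "smooth_cc \<eta> ?p" by (rule smooth_cc_deriv_stp[OF assms])
  have p'': "smooth_cc \<eta> (deriv (deriv ?p))" by (intro smooth_cc_deriv p)
  obtain L where L: "lip_kern \<eta> L (tensor (deriv (deriv ?p)) ?p)"
    using lip_kern_tensor[OF p'' p] assms by auto
  obtain L' where L': "lip_kern \<eta> L' (tensor ?p (deriv (deriv ?p)))"
    using lip_kern_tensor[OF p p''] assms by auto
  show ?thesis using lip_kern_add[OF L L'] unfolding lapk_def[abs_def] Let_def by blast
qed

text \<open>
  Each sample of the mollified velocity is a pairing with a test function, whose derivative the weak
  wave equation provides.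
\<close>

lemma samp_velocity_has_derivative:
  assumes w: "wave_solution c \<phi> \<psi> U V" and c: "0 < c" and \<eta>: "0 < \<eta>" and \<epsilon>: "0 < \<epsilon>" "\<epsilon> \<le> 1"
  shows "((\<lambda>s. samp \<epsilon> x (rho \<eta>) (V s)) has_vector_derivative (1 / c) *\<^sub>R samp \<epsilon> x (lapk \<eta>) (U \<tau>)) (at \<tau>)"
proof (rule ell2_has_vector_derivativeI)
  obtain L where L: "lip_kern \<eta> L (lapk \<eta>)" using lip_kern_lapk[OF \<eta>] by blast
  have \<eta>0: "0 \<le> \<eta>" using \<eta> by simp
  note wl = wave_solution_L2[OF w]
  show "isCont (\<lambda>\<tau>. (1 / c) *\<^sub>R samp \<epsilon> x (lapk \<eta>) (U \<tau>)) \<tau>"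
    by (intro isCont_scaleR continuous_const samp_continuous[OF wl(1) wl(3) lip_kernD(1)[OF L] \<epsilon> \<eta>0])
  fix t j
  let ?p = "deriv (stp \<eta>)" and ?X = "\<epsilon> *\<^sub>R (lattice_pt j + x)"
  have "((\<lambda>s. c * corr (rho \<eta>) (V s) ?X) has_real_derivative corr (lapk \<eta>) (U t) ?X) (at t)"
    using wave_solution_corr[OF w smooth_cc_deriv_stp[OF \<eta>] smooth_cc_deriv_stp[OF \<eta>]]
    unfolding rho_def lapk_def[abs_def] Let_def .
  from DERIV_cmult[OF this, of "1 / c"]
  have "((\<lambda>s. corr (rho \<eta>) (V s) ?X) has_real_derivative (1 / c) * corr (lapk \<eta>) (U t) ?X) (at t)"
    using c by simp
  then show "((\<lambda>s. coord (samp \<epsilon> x (rho \<eta>) (V s)) j) has_real_derivative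
      coord ((1 / c) *\<^sub>R samp \<epsilon> x (lapk \<eta>) (U t)) j) (at t)"
    by (simp add: samp_props(1)[OF kern_rho[OF \<eta>] wl(2) \<epsilon> \<eta>0] samp_props(1)[OF lip_kernD(1)[OF L] wl(1) \<epsilon> \<eta>0])
qed

section \<open>Differences of samples and consistency of the discrete Laplacian\<close>

lemma scaled_axis_sqbox: "\<bar>s\<bar> \<le> r \<Longrightarrow> s *\<^sub>R axis i 1 \<in> sqbox 0 r"
  by (auto simp: sqbox_def axis_def)

text \<open>Increments of samples over a distance of order \<open>\<epsilon>\<close> carry an additional factor \<open>\<epsilon>\<close>.\<close>

lemma samp_increment_bound:
  assumes K: "lip_kern R L K" and h: "L2_fun h" and \<epsilon>: "0 < \<epsilon>" "\<epsilon> \<le> 1" and w: "w \<in> sqbox 0 1"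
    and z: "\<And>k. coord z k = corr K h (\<epsilon> *\<^sub>R (lattice_pt k + x) + \<epsilon> *\<^sub>R w) - corr K h (\<epsilon> *\<^sub>R (lattice_pt k + x))"
  shows "\<epsilon> * norm z \<le> \<epsilon> * (L * (2 * (R + 1)) * (2 * (R + 1) + 1) * L2n h)"
proof -
  have R: "0 \<le> R" and L: "0 \<le> L" using lip_kernD[OF K] by auto
  let ?C = "(L * \<epsilon>) * (2 * (R + 1)) * (2 * (R + 1) + \<epsilon>) * L2n h"
  have ew: "\<epsilon> *\<^sub>R w \<in> sqbox 0 \<epsilon>"
    using w \<epsilon> by (auto simp: sqbox_def abs_mult intro: mult_left_le)
  have bd: "\<epsilon>\<^sup>2 * (\<Sum>k\<in>A. (coord z k)\<^sup>2) \<le> ?C\<^sup>2" if A: "finite A" for A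
  proof (rule sampling_bound[OF h \<epsilon>(1) _ _ A])
    show "0 \<le> R + 1" "0 \<le> L * \<epsilon>" using R L \<epsilon> by auto
    fix k
    show "\<bar>coord z k\<bar> \<le> L * \<epsilon> * (LINT Y:sqbox (\<epsilon> *\<^sub>R (lattice_pt k + x)) (R + 1)|lebesgue. \<bar>h Y\<bar>)"
      unfolding z by (rule corr_increment[OF K L2_fun_loc_integrable[OF h] _ \<epsilon>(2) ew]) (use \<epsilon> in simp)
  qed
  then have bd': "(\<Sum>k\<in>A. (coord z k)\<^sup>2) \<le> (?C / \<epsilon>)\<^sup>2" if "finite A" for A
    unfolding power_divide using bd[OF that, unfolded mult.commute[of "\<epsilon>\<^sup>2"]] \<epsilon>(1)
    by (subst pos_le_divide_eq) auto
  have "norm z \<le> ?C / \<epsilon>"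
    by (rule norm_ell2_le) (use L R \<epsilon> bd' in \<open>simp_all\<close>)
  then have "\<epsilon> * norm z \<le> ?C" using \<epsilon>(1) by (simp add: le_divide_eq mult.commute)
  also have "\<dots> \<le> (L * \<epsilon>) * (2 * (R + 1)) * (2 * (R + 1) + 1) * L2n h"
    using L R \<epsilon> by (intro mult_right_mono mult_left_mono) auto
  finally show ?thesis by (simp add: ac_simps)
qed

lemma lattice_pt_axis: "lattice_pt (axis i 1) = axis i 1"
  by (simp add: vec_eq_iff axis_def)

lemma samp_fd_bound:
  assumes K: "lip_kern R L K" and h: "L2_fun h" and \<epsilon>: "0 < \<epsilon>" "\<epsilon> \<le> 1"
  shows "\<epsilon> * norm (fd i (samp \<epsilon> x K h)) \<le> \<epsilon> * (L * (2 * (R + 1)) * (2 * (R + 1) + 1) * L2n h)"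
proof (rule samp_increment_bound[OF K h \<epsilon>, where w="axis i 1" and x=x])
  show "axis i 1 \<in> sqbox 0 1" using scaled_axis_sqbox[of 1 1 i] by simp
  show "coord (fd i (samp \<epsilon> x K h)) k =
      corr K h (\<epsilon> *\<^sub>R (lattice_pt k + x) + \<epsilon> *\<^sub>R axis i 1) - corr K h (\<epsilon> *\<^sub>R (lattice_pt k + x))" for k
    by (simp add: samp_props(1)[OF lip_kernD(1)[OF K] h \<epsilon> lip_kernD(2)[OF K]] lattice_pt_add lattice_pt_axis
        scaleR_add_right[symmetric] add.assoc add.commute add.left_commute)
qed

lemma samp_offset_bound:
  assumes K: "lip_kern R L K" and h: "L2_fun h" and \<epsilon>: "0 < \<epsilon>" "\<epsilon> \<le> 1" and x: "x \<in> unit_cell"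
  shows "\<epsilon> * norm (samp \<epsilon> 0 K h - samp \<epsilon> x K h) \<le> \<epsilon> * (L * (2 * (R + 1)) * (2 * (R + 1) + 1) * L2n h)"
proof -
  have "\<epsilon> * norm (samp \<epsilon> x K h - samp \<epsilon> 0 K h) \<le> \<epsilon> * (L * (2 * (R + 1)) * (2 * (R + 1) + 1) * L2n h)"
  proof (rule samp_increment_bound[OF K h \<epsilon>, where w=x and x=0])
    show "x \<in> sqbox 0 1" using x by (auto simp: sqbox_def unit_cell_def abs_le_iff intro: less_imp_le order_trans[of _ 0])
    show "coord (samp \<epsilon> x K h - samp \<epsilon> 0 K h) k =
        corr K h (\<epsilon> *\<^sub>R (lattice_pt k + 0) + \<epsilon> *\<^sub>R x) - corr K h (\<epsilon> *\<^sub>R (lattice_pt k + 0))" for k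
      by (simp add: samp_props(1)[OF lip_kernD(1)[OF K] h \<epsilon> lip_kernD(2)[OF K]] scaleR_add_right)
  qed
  then show ?thesis by (simp add: norm_minus_commute)
qed

text \<open>
  The remainder \<open>g\<close>, as a function of \<open>s\<close>, vanishes together with its first derivative at \<open>0\<close>, and its
  second derivative is at most \<open>2 P s\<close>; the mean value theorem is applied twice.
\<close>

lemma second_difference_bound:
  assumes p: "smooth_cc R p"
  shows "\<exists>P\<ge>0. \<forall>t s. 0 \<le> s \<longrightarrow> \<bar>p (t + s) + p (t - s) - 2 * p t - s\<^sup>2 * deriv (deriv p) t\<bar> \<le> P * s ^ 3"
proof -
  have D: "(p has_real_derivative deriv p t) (at t)" "(deriv p has_real_derivative deriv (deriv p) t) (at t)" for t
    using p smooth1_DERIV smooth1_deriv_smooth by (auto simp: smooth_cc_def)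
  obtain P where P: "0 \<le> P" "\<And>s t. \<bar>deriv (deriv p) s - deriv (deriv p) t\<bar> \<le> P * \<bar>s - t\<bar>"
    using smooth_cc_Lipschitz[OF smooth_cc_deriv[OF smooth_cc_deriv[OF p]]] by blast
  have "\<bar>p (t + s) + p (t - s) - 2 * p t - s\<^sup>2 * deriv (deriv p) t\<bar> \<le> (2 * P) * s ^ 3" if s: "0 \<le> s" for t s
  proof (cases "s = 0")
    case True then show ?thesis by simp
  next
    case False
    then have s0: "0 < s" using s by simp
    define g where "g r = p (t + r) + p (t - r) - 2 * p t - r\<^sup>2 * deriv (deriv p) t" for r
    define g' where "g' r = deriv p (t + r) - deriv p (t - r) - 2 * r * deriv (deriv p) t" for r
    define g'' where "g'' r = deriv (deriv p) (t + r) + deriv (deriv p) (t - r) - 2 * deriv (deriv p) t" for r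
    have c1: "((\<lambda>r. p (t + r)) has_real_derivative deriv p (t + r)) (at r)"
      "((\<lambda>r. p (t - r)) has_real_derivative - deriv p (t - r)) (at r)"
      "((\<lambda>r. deriv p (t + r)) has_real_derivative deriv (deriv p) (t + r)) (at r)"
      "((\<lambda>r. deriv p (t - r)) has_real_derivative - deriv (deriv p) (t - r)) (at r)" for r
    proof -
      have cs: "((\<lambda>r. t + r) has_real_derivative 1) (at r)" "((\<lambda>r. t - r) has_real_derivative -1) (at r)"
        by (auto intro!: derivative_eq_intros)
      show "((\<lambda>r. p (t + r)) has_real_derivative deriv p (t + r)) (at r)"
        "((\<lambda>r. p (t - r)) has_real_derivative - deriv p (t - r)) (at r)"
        "((\<lambda>r. deriv p (t + r)) has_real_derivative deriv (deriv p) (t + r)) (at r)"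
        "((\<lambda>r. deriv p (t - r)) has_real_derivative - deriv (deriv p) (t - r)) (at r)"
        using DERIV_chain2[OF D(1) cs(1)] DERIV_chain2[OF D(1) cs(2)]
          DERIV_chain2[OF D(2) cs(1)] DERIV_chain2[OF D(2) cs(2)] by simp_all
    qed
    have dg: "(g has_real_derivative g' r) (at r)" for r
      unfolding g_def[abs_def] g'_def by (auto intro!: derivative_eq_intros c1)
    have dg': "(g' has_real_derivative g'' r) (at r)" for r
      unfolding g'_def[abs_def] g''_def by (auto intro!: derivative_eq_intros c1)
    obtain r where r: "0 < r" "r < s" "g s - g 0 = (s - 0) * g' r"
      using MVT2[of 0 s g g'] s0 dg by blast
    obtain q where q: "0 < q" "q < r" "g' r - g' 0 = (r - 0) * g'' q"
      using MVT2[of 0 r g' g''] r(1) dg' by blast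
    have g0: "g 0 = 0" "g' 0 = 0" by (simp_all add: g_def g'_def)
    have "\<bar>g'' q\<bar> \<le> P * q + P * q"
      using P(2)[of "t + q" t] P(2)[of "t - q" t] q(1) unfolding g''_def by auto
    also have "\<dots> \<le> (2 * P) * s"
    proof -
      have "P * q \<le> P * s" using q r P(1) by (intro mult_left_mono) auto
      then show ?thesis by simp
    qed
    finally have "\<bar>g s\<bar> \<le> s * (r * ((2 * P) * s))"
      using r q g0 s0 by (simp add: abs_mult mult_left_mono)
    also have "\<dots> \<le> s * (s * ((2 * P) * s))"
      using r s0 P(1) by (intro mult_left_mono mult_right_mono) auto
    finally show ?thesis by (simp add: g_def power3_eq_cube power2_eq_square ac_simps)
  qed
  then show ?thesis using P(1) by (intro exI[of _ "2 * P"]) auto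
qed

lemma kern_shift: assumes "kern R c K" "v \<in> sqbox 0 1" "0 \<le> R" shows "kern (R + 1) c (\<lambda>z. K (z - v))"
proof -
  have [measurable]: "K \<in> borel_measurable borel" using assms(1) by (simp add: kern_def)
  have c: "0 \<le> c" by (rule kern_nonneg[OF assms(1,3)])
  have "\<bar>K (z - v)\<bar> \<le> c * indicator (sqbox 0 (R + 1)) z" for z
  proof (cases "z \<in> sqbox 0 (R + 1)")
    case True
    have "\<bar>K (z - v)\<bar> \<le> c * indicator (sqbox 0 R) (z - v)" using assms(1) by (simp add: kern_def)
    also have "\<dots> \<le> c" using c by (simp add: indicator_def)
    finally show ?thesis using True by simp
  next
    case False
    then obtain i where "\<bar>z $ i\<bar> > R + 1" by (auto simp: sqbox_def not_le)
    moreover have "\<bar>v $ i\<bar> \<le> 1" using assms(2) by (auto simp: sqbox_def)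
    ultimately have "\<bar>(z - v) $ i\<bar> > R" by auto
    then have "z - v \<notin> sqbox 0 R" by (auto simp: sqbox_def not_le)
    moreover have "\<bar>K (z - v)\<bar> \<le> c * indicator (sqbox 0 R) (z - v)" using assms(1) by (simp add: kern_def)
    ultimately show ?thesis using c by simp
  qed
  then show ?thesis by (simp add: kern_def)
qed

text \<open>
  The second differences fall on the kernel, which is smooth at the fixed scale \<open>\<eta>\<close>, so that
  \<open>h\<close> may be any square-integrable function. The constant depends on \<open>\<eta>\<close>.
\<close>

lemma consistency:
  assumes \<eta>: "0 < \<eta>"
  shows "\<exists>C\<ge>0. \<forall>\<epsilon> h. 0 < \<epsilon> \<longrightarrow> \<epsilon> \<le> 1 \<longrightarrow> L2_fun h \<longrightarrow>
    \<epsilon> * norm ((1 / \<epsilon>\<^sup>2) *\<^sub>R lap (samp \<epsilon> 0 (rho \<eta>) h) - samp \<epsilon> 0 (lapk \<eta>) h) \<le> C * \<epsilon> * L2n h"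
proof -
  let ?p = "deriv (stp \<eta>)"
  have p: "smooth_cc \<eta> ?p" by (rule smooth_cc_deriv_stp[OF \<eta>])
  obtain P where P: "0 \<le> P" "\<And>t s. 0 \<le> s \<Longrightarrow> \<bar>?p (t + s) + ?p (t - s) - 2 * ?p t - s\<^sup>2 * deriv (deriv ?p) t\<bar> \<le> P * s ^ 3"
    using second_difference_bound[OF p] by blast
  obtain M where M: "0 \<le> M" "\<And>t. \<bar>?p t\<bar> \<le> M" using smooth_cc_bounded[OF p] by blast
  obtain L where L: "lip_kern \<eta> L (lapk \<eta>)" using lip_kern_lapk[OF \<eta>] by blast
  have \<eta>0: "0 \<le> \<eta>" "0 \<le> \<eta> + 1" using \<eta> by auto
  let ?C = "2 * M * P * (2 * (\<eta> + 1)) * (2 * (\<eta> + 1) + 1)"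
  have "\<epsilon> * norm ((1 / \<epsilon>\<^sup>2) *\<^sub>R lap (samp \<epsilon> 0 (rho \<eta>) h) - samp \<epsilon> 0 (lapk \<eta>) h) \<le> ?C * \<epsilon> * L2n h"
    if \<epsilon>: "0 < \<epsilon>" "\<epsilon> \<le> 1" and h: "L2_fun h" for \<epsilon> h
  proof -
    define D where "D z = (1 / \<epsilon>\<^sup>2) * (rho \<eta> (z - \<epsilon> *\<^sub>R axis 1 1) + rho \<eta> (z - (- \<epsilon>) *\<^sub>R axis 1 1)
      + (rho \<eta> (z - \<epsilon> *\<^sub>R axis 2 1) + rho \<eta> (z - (- \<epsilon>) *\<^sub>R axis 2 1)) - 4 * rho \<eta> z) - lapk \<eta> z" for z
    have vb: "s *\<^sub>R axis i 1 \<in> sqbox 0 1" if "\<bar>s\<bar> \<le> \<epsilon>" for s i using scaled_axis_sqbox[of s 1 i] that \<epsilon> by simp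
    note kr = kern_rho[OF \<eta>] and kl = lip_kernD(1)[OF L]
    have ksh: "kern (\<eta> + 1) (M0 / \<eta> * (M0 / \<eta>)) (\<lambda>z. rho \<eta> (z - s *\<^sub>R axis i 1))" if "\<bar>s\<bar> \<le> \<epsilon>" for s i
      by (rule kern_shift[OF kr vb[OF that] \<eta>0(1)])
    have kr1: "kern (\<eta> + 1) (M0 / \<eta> * (M0 / \<eta>)) (rho \<eta>)" by (rule kern_mono[OF kr \<eta>0(1)]) auto
    have kl1: "kern (\<eta> + 1) L (lapk \<eta>)" by (rule kern_mono[OF kl \<eta>0(1)]) auto
    have kD: "kern (\<eta> + 1) (2 * M * P * \<epsilon>) D"
      unfolding kern_def
    proof (intro conjI allI)
      have [measurable]: "rho \<eta> \<in> borel_measurable borel" "lapk \<eta> \<in> borel_measurable borel"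
        using kr kl by (auto simp: kern_def)
      show "D \<in> borel_measurable borel" unfolding D_def[abs_def] by measurable
      fix z :: "real^2"
      show "\<bar>D z\<bar> \<le> 2 * M * P * \<epsilon> * indicator (sqbox 0 (\<eta> + 1)) z"
      proof (cases "z \<in> sqbox 0 (\<eta> + 1)")
        case True
        define E where "E t = ?p (t + \<epsilon>) + ?p (t - \<epsilon>) - 2 * ?p t - \<epsilon>\<^sup>2 * deriv (deriv ?p) t" for t
        have E: "\<bar>E t\<bar> \<le> P * \<epsilon> ^ 3" for t unfolding E_def by (rule P(2)) (use \<epsilon> in simp)
        have "D z = (1 / \<epsilon>\<^sup>2) * (E (z $ 1) * ?p (z $ 2) + ?p (z $ 1) * E (z $ 2))"
          using \<epsilon> by (simp add: D_def rho_def lapk_def Let_def tensor_def E_def axis_def field_simps)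
        also have "\<bar>\<dots>\<bar> = (1 / \<epsilon>\<^sup>2) * \<bar>E (z $ 1) * ?p (z $ 2) + ?p (z $ 1) * E (z $ 2)\<bar>" by (simp add: abs_mult)
        also have "\<dots> \<le> (1 / \<epsilon>\<^sup>2) * ((P * \<epsilon> ^ 3) * M + M * (P * \<epsilon> ^ 3))"
        proof (intro mult_left_mono order_trans[OF abs_triangle_ineq] add_mono)
          show "\<bar>E (z $ 1) * ?p (z $ 2)\<bar> \<le> (P * \<epsilon> ^ 3) * M" "\<bar>?p (z $ 1) * E (z $ 2)\<bar> \<le> M * (P * \<epsilon> ^ 3)"
            unfolding abs_mult using E M P(1) \<epsilon> by (auto intro!: mult_mono)
        qed simp
        also have "\<dots> = 2 * M * P * \<epsilon>" using \<epsilon> by (simp add: power3_eq_cube power2_eq_square field_simps)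
        finally show ?thesis using True by simp
      next
        case False
        have e0: "\<bar>\<epsilon>\<bar> \<le> \<epsilon>" "\<bar>- \<epsilon>\<bar> \<le> \<epsilon>" using \<epsilon> by auto
        have z: "K z = 0" if "kern (\<eta> + 1) c K" for c K
          using that False unfolding kern_def by (metis abs_ge_zero abs_le_zero_iff indicator_simps(2) mult_zero_right)
        show ?thesis unfolding D_def
          by (simp only: z[OF ksh[OF e0(1)]] z[OF ksh[OF e0(2)]] z[OF kr1] z[OF kl1]) (use False in simp)
      qed
    qed
    note hl = L2_fun_loc_integrable[OF h]
    have co: "coord ((1 / \<epsilon>\<^sup>2) *\<^sub>R lap (samp \<epsilon> 0 (rho \<eta>) h) - samp \<epsilon> 0 (lapk \<eta>) h) k = coord (samp \<epsilon> 0 D h) k" for k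
    proof -
      let ?X = "\<epsilon> *\<^sub>R (lattice_pt k + 0)"
      have e0: "\<bar>\<epsilon>\<bar> \<le> \<epsilon>" "\<bar>- \<epsilon>\<bar> \<le> \<epsilon>" using \<epsilon> by auto
      have "corr D h ?X = (1 / \<epsilon>\<^sup>2) * (corr (\<lambda>z. rho \<eta> (z - \<epsilon> *\<^sub>R axis 1 1)) h ?X + corr (\<lambda>z. rho \<eta> (z - (- \<epsilon>) *\<^sub>R axis 1 1)) h ?X
        + (corr (\<lambda>z. rho \<eta> (z - \<epsilon> *\<^sub>R axis 2 1)) h ?X + corr (\<lambda>z. rho \<eta> (z - (- \<epsilon>) *\<^sub>R axis 2 1)) h ?X) - 4 * corr (rho \<eta>) h ?X)
        - corr (lapk \<eta>) h ?X"
      proof -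
        note i = kern_integrable[OF ksh[OF e0(1), of 1] hl, of ?X] kern_integrable[OF ksh[OF e0(2), of 1] hl, of ?X]
          kern_integrable[OF ksh[OF e0(1), of 2] hl, of ?X] kern_integrable[OF ksh[OF e0(2), of 2] hl, of ?X]
          kern_integrable[OF kr1 hl, of ?X] kern_integrable[OF kl1 hl, of ?X]
        have "D (Y - ?X) * h Y = (1 / \<epsilon>\<^sup>2) * (rho \<eta> (Y - ?X - \<epsilon> *\<^sub>R axis 1 1) * h Y + rho \<eta> (Y - ?X - (- \<epsilon>) *\<^sub>R axis 1 1) * h Y
      + (rho \<eta> (Y - ?X - \<epsilon> *\<^sub>R axis 2 1) * h Y + rho \<eta> (Y - ?X - (- \<epsilon>) *\<^sub>R axis 2 1) * h Y) - 4 * (rho \<eta> (Y - ?X) * h Y)) - lapk \<eta> (Y - ?X) * h Y" for Y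
          unfolding D_def left_diff_distrib mult.assoc distrib_right by (rule refl)
        then show ?thesis
          unfolding corr_def
          by (simp only: Bochner_Integration.integral_diff Bochner_Integration.integral_add integral_mult_right_zero
            integrable_mult_right integrable_mult_right_iff Bochner_Integration.integrable_add Bochner_Integration.integrable_diff i simp_thms if_False)
      qed
      then have "corr D h ?X = (1 / \<epsilon>\<^sup>2) * (corr (rho \<eta>) h (?X + \<epsilon> *\<^sub>R axis 1 1) + corr (rho \<eta>) h (?X + (- \<epsilon>) *\<^sub>R axis 1 1)
        + (corr (rho \<eta>) h (?X + \<epsilon> *\<^sub>R axis 2 1) + corr (rho \<eta>) h (?X + (- \<epsilon>) *\<^sub>R axis 2 1)) - 4 * corr (rho \<eta>) h ?X)
        - corr (lapk \<eta>) h ?X" by (simp only: corr_shift[symmetric])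
      then show ?thesis
        by (simp add: samp_props(1)[OF kr h \<epsilon> \<eta>0(1)] samp_props(1)[OF kl h \<epsilon> \<eta>0(1)] samp_props(1)[OF kD h \<epsilon> \<eta>0(2)]
          coord_lap lattice_laplacian_def UNIV_2 lattice_pt_add lattice_pt_diff lattice_pt_axis scaleR_add_right scaleR_diff_right)
    qed
    have "(1 / \<epsilon>\<^sup>2) *\<^sub>R lap (samp \<epsilon> 0 (rho \<eta>) h) - samp \<epsilon> 0 (lapk \<eta>) h = samp \<epsilon> 0 D h"
      by (rule ell2_eqI[OF co])
    then show ?thesis using samp_props(2)[OF kD h \<epsilon> \<eta>0(2), of 0] by (simp add: ac_simps)
  qed
  moreover have "0 \<le> ?C" using M(1) P(1) \<eta> by simp
  ultimately show ?thesis by blast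
qed

section \<open>Smallness of the fluctuating forcing\<close>

lemma norm_mult_indicator_le: "norm (mult_op (indicator S) z) \<le> norm z"
proof -
  have "\<bar>indicator S j :: real\<bar> \<le> 1" for j by (simp add: indicator_def)
  from norm_mult_op_le[of "indicator S" 1 z, OF this] show ?thesis by simp
qed

lemma coord_mult_indicator: "coord (mult_op (indicator S) z) j = indicator S j * coord z j"
  by (rule coord_mult_op[of "indicator S" 1]) (simp add: indicator_def)

lemma mult_indicator_diff: "mult_op (indicator S) z - mult_op (indicator S) z' = mult_op (indicator S) (z - z')"
  by (rule ell2_eqI) (simp add: coord_mult_indicator algebra_simps)

lemma eventually_small_pos: "0 < r \<Longrightarrow> \<forall>\<^sub>F \<epsilon>::real in at_right 0. 0 < \<epsilon> \<and> \<epsilon> \<le> r"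
  unfolding eventually_at_right_field by (intro exI[of _ r]) auto

text \<open>At a point far out the kernel only sees the part of \<open>h\<close> that is far out.\<close>

lemma corr_restrict_tail:
  assumes k: "kern R c K" and X: "R0 + R < \<bar>X $ i\<bar>"
  shows "corr K h X = corr K (\<lambda>Y. indicator (- sqbox 0 R0) Y * h Y) X"
proof -
  have "K (Y - X) * h Y = K (Y - X) * (indicator (- sqbox 0 R0) Y * h Y)" for Y
  proof (cases "Y \<in> sqbox X R")
    case True
    then have "\<bar>Y $ i - X $ i\<bar> \<le> R" by (simp add: sqbox_def)
    then have "R0 < \<bar>Y $ i\<bar>" using X by linarith
    then have "Y \<notin> sqbox 0 R0" by (auto simp: sqbox_def not_le)
    then show ?thesis by simp
  next
    case False
    then show ?thesis using kern_le[OF k, of Y X] by simp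
  qed
  then show ?thesis unfolding corr_def by (metis (no_types, lifting))
qed

text \<open>
  Sites outside the region lie at distance more than \<open>\<epsilon> N\<^sup>3 \<ge> 1 / sqrt \<epsilon>\<close> from the origin after
  rescaling, where \<open>h\<close> has little mass; the compactness of the time interval gives uniformity.
\<close>

lemma samp_tail_small:
  assumes k: "kern R c K" and R: "0 \<le> R" and W: "\<And>\<tau>. L2_fun (W \<tau>)"
    and W': "\<And>\<tau>. ((\<lambda>s. L2n (\<lambda>X. W s X - W \<tau> X)) \<longlongrightarrow> 0) (at \<tau>)"
    and N: "\<And>\<epsilon>. 0 < \<epsilon> \<Longrightarrow> 1 / sqrt \<epsilon> \<le> real (N \<epsilon>)" and e: "0 < e"
  shows "\<forall>\<^sub>F \<epsilon> in at_right 0. \<forall>\<tau>\<in>{-T..T::real}.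
    \<epsilon> * norm (mult_op (indicator (- {j. \<forall>i. \<bar>j $ i\<bar> \<le> int (N \<epsilon>) ^ 3})) (samp \<epsilon> 0 K (W \<tau>))) < e"
proof -
  define Q where "Q \<epsilon> = - {j::int^2. \<forall>i. \<bar>j $ i\<bar> \<le> int (N \<epsilon>) ^ 3}" for \<epsilon>
  define \<Phi> where "\<Phi> \<epsilon> h = \<epsilon> * norm (mult_op (indicator (Q \<epsilon>)) (samp \<epsilon> 0 K h))" for \<epsilon> h
  let ?C = "c * (2 * R) * (2 * R + 1)"
  have C: "0 \<le> ?C" using kern_nonneg[OF k R] R by simp
  have \<Phi>_nonneg: "0 \<le> \<Phi> \<epsilon> h" if "0 < \<epsilon>" for \<epsilon> h using that by (simp add: \<Phi>_def)
  have lip: "\<forall>\<^sub>F \<epsilon> in at_right 0. \<forall>h h'. L2_fun h \<longrightarrow> L2_fun h' \<longrightarrow> \<bar>\<Phi> \<epsilon> h - \<Phi> \<epsilon> h'\<bar> \<le> ?C * L2n (\<lambda>X. h X - h' X)"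
  proof (rule eventually_mono[OF eventually_small_pos[of 1]], simp, intro allI impI)
    fix \<epsilon> :: real and h h' assume \<epsilon>: "0 < \<epsilon> \<and> \<epsilon> \<le> 1" and h: "L2_fun h" "L2_fun h'"
    let ?z = "samp \<epsilon> 0 K h" and ?z' = "samp \<epsilon> 0 K h'" and ?M = "mult_op (indicator (Q \<epsilon>))"
    have "\<bar>norm (?M ?z) - norm (?M ?z')\<bar> \<le> norm (?M ?z - ?M ?z')" by (rule norm_triangle_ineq3)
    also have "\<dots> \<le> norm (?z - ?z')" unfolding mult_indicator_diff by (rule norm_mult_indicator_le)
    also have "\<dots> \<le> ?C / \<epsilon> * L2n (\<lambda>X. h X - h' X)" by (rule samp_difference_bound[OF k h _ _ R]) (use \<epsilon> in auto)
    finally have "\<epsilon> * \<bar>norm (?M ?z) - norm (?M ?z')\<bar> \<le> \<epsilon> * (?C / \<epsilon> * L2n (\<lambda>X. h X - h' X))"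
      using \<epsilon> by (intro mult_left_mono) auto
    moreover have "\<bar>\<Phi> \<epsilon> h - \<Phi> \<epsilon> h'\<bar> = \<epsilon> * \<bar>norm (?M ?z) - norm (?M ?z')\<bar>"
      using \<epsilon> by (simp add: \<Phi>_def right_diff_distrib[symmetric] abs_mult)
    ultimately show "\<bar>\<Phi> \<epsilon> h - \<Phi> \<epsilon> h'\<bar> \<le> ?C * L2n (\<lambda>X. h X - h' X)" using \<epsilon> by simp
  qed
  have lim: "((\<lambda>\<epsilon>. \<Phi> \<epsilon> h) \<longlongrightarrow> 0) (at_right 0)" if h: "L2_fun h" for h
  proof (rule tendstoI)
    fix e :: real assume e: "0 < e"
    obtain R0 where R0: "0 < R0" "L2n (\<lambda>x. indicator (- sqbox 0 R0) x * h x) < e / (?C + 1)"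
      using L2_tail_small[OF h, of "e / (?C + 1)"] e C by auto
    define h1 where "h1 = (\<lambda>x. indicator (- sqbox 0 R0) x * h x)"
    have h1: "L2_fun h1"
      by (rule L2_fun_bound(1)[OF h])
         (use L2_fun_measurable[OF h] in \<open>auto simp: h1_def indicator_def intro!: borel_measurable_times borel_measurable_indicator\<close>)
    let ?r = "1 / (R0 + R + 1)\<^sup>2"
    show "\<forall>\<^sub>F \<epsilon> in at_right 0. dist (\<Phi> \<epsilon> h) 0 < e"
    proof (rule eventually_mono[OF eventually_small_pos[of "min 1 ?r"]])
      show "0 < min 1 ?r" using R0(1) R by simp
      fix \<epsilon> assume "0 < \<epsilon> \<and> \<epsilon> \<le> min 1 ?r"
      then have \<epsilon>: "0 < \<epsilon>" "\<epsilon> \<le> 1" "\<epsilon> \<le> ?r" by auto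
      have s: "0 < sqrt \<epsilon>" "sqrt \<epsilon> * sqrt \<epsilon> = \<epsilon>" using \<epsilon> by auto
      have "sqrt \<epsilon> \<le> 1 / (R0 + R + 1)"
        using real_sqrt_le_mono[OF \<epsilon>(3)] R0(1) R by (simp add: real_sqrt_divide)
      then have "R0 + R + 1 \<le> 1 / sqrt \<epsilon>" using s(1) R0(1) R by (simp add: field_simps)
      then have big: "R0 + R < 1 / sqrt \<epsilon>" by linarith
      have "\<bar>coord (mult_op (indicator (Q \<epsilon>)) (samp \<epsilon> 0 K h)) j\<bar> \<le> \<bar>coord (samp \<epsilon> 0 K h1) j\<bar>" for j
      proof (cases "j \<in> Q \<epsilon>")
        case True
        then obtain i where i: "int (N \<epsilon>) ^ 3 < \<bar>j $ i\<bar>" by (auto simp: Q_def not_le)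
        have "(1 / sqrt \<epsilon>) ^ 3 \<le> real (N \<epsilon>) ^ 3" by (rule power_mono[OF N[OF \<epsilon>(1)]]) (use s in simp)
        also have "\<dots> = of_int (int (N \<epsilon>) ^ 3)" by simp
        also have "\<dots> < of_int \<bar>j $ i\<bar>" using i by (simp only: of_int_less_iff)
        finally have "\<epsilon> * (1 / sqrt \<epsilon>) ^ 3 < \<epsilon> * \<bar>of_int (j $ i)\<bar>" using \<epsilon>(1) by simp
        moreover have "\<epsilon> * (1 / sqrt \<epsilon>) ^ 3 = 1 / sqrt \<epsilon>"
          using s by (simp add: power3_eq_cube field_simps)
        ultimately have "R0 + R < \<bar>(\<epsilon> *\<^sub>R (lattice_pt j + 0)) $ i\<bar>" using big \<epsilon>(1) by (simp add: abs_mult)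
        from corr_restrict_tail[OF k this, of h, folded h1_def] show ?thesis
          by (simp add: coord_mult_indicator True samp_props(1)[OF k h \<epsilon>(1,2) R] samp_props(1)[OF k h1 \<epsilon>(1,2) R])
      qed (simp add: coord_mult_indicator)
      then have "norm (mult_op (indicator (Q \<epsilon>)) (samp \<epsilon> 0 K h)) \<le> norm (samp \<epsilon> 0 K h1)" by (rule norm_ell2_mono)
      then have "\<Phi> \<epsilon> h \<le> \<epsilon> * norm (samp \<epsilon> 0 K h1)" unfolding \<Phi>_def using \<epsilon>(1) by (intro mult_left_mono) auto
      also have "\<dots> \<le> ?C * L2n h1" by (rule samp_props(2)[OF k h1 \<epsilon>(1,2) R])
      also have "\<dots> \<le> ?C * (e / (?C + 1))" using R0(2) C by (intro mult_left_mono) (auto simp: h1_def)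
      also have "\<dots> < e" using e C by (simp add: field_simps)
      finally show "dist (\<Phi> \<epsilon> h) 0 < e" using \<Phi>_nonneg[OF \<epsilon>(1)] by simp
    qed
  qed
  show ?thesis
    using L2_uniform_on_compact[OF W W' lip lim e, of T] unfolding \<Phi>_def Q_def
    by (auto elim!: eventually_mono dest: bspec)
qed

text \<open>
  The three terms of \<open>oscillating_pairing_bound\<close> for sampled correlations: the first two are of
  order \<open>N \<epsilon>\<close>, the third combines small block averages with small tails. The right-hand side is
  relative to \<open>e\<close>, as the energy estimate requires.
\<close>

lemma pairing_small:
  fixes W :: "real \<Rightarrow> real^2 \<Rightarrow> real" and \<mu> :: "int^2 \<Rightarrow> real"
  assumes K: "lip_kern R L K" and W: "\<And>\<tau>. L2_fun (W \<tau>)"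
    and W': "\<And>\<tau>. ((\<lambda>s. L2n (\<lambda>X. W s X - W \<tau> X)) \<longlongrightarrow> 0) (at \<tau>)"
    and \<mu>: "\<And>j. \<bar>\<mu> j\<bar> \<le> c0" and c0: "0 \<le> c0"
    and blk: "small_block_averages \<mu>"
    and \<kappa>: "0 < \<kappa>"
  shows "\<forall>\<^sub>F \<epsilon> in at_right 0. \<forall>\<tau>\<in>{-T..T::real}. \<forall>e.
    \<epsilon>\<^sup>2 * \<bar>inner e (mult_op \<mu> (samp \<epsilon> 0 K (W \<tau>)))\<bar> \<le> \<kappa> * (grad_norm e + \<epsilon> * norm e)"
proof -
  note R = lip_kernD(2)[OF K] and k = lip_kernD(1)[OF K] and L = lip_kernD(3)[OF K]
  obtain H where H: "0 \<le> H" "\<And>\<tau>. \<tau> \<in> {-T..T} \<Longrightarrow> L2n (W \<tau>) \<le> H"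
    using L2n_bounded_on_compact[OF W W', of T] by blast
  define D1 where "D1 = L * (2 * R) * (2 * R + 1) * H"
  define D2 where "D2 = L * (2 * (R + 1)) * (2 * (R + 1) + 1) * H"
  have D: "0 \<le> D1" "0 \<le> D2" using L R H(1) by (auto simp: D1_def D2_def)
  define \<delta> where "\<delta> = \<kappa> / (3 * (D1 + 1))"
  have \<delta>: "0 < \<delta>" using \<kappa> D by (simp add: \<delta>_def)
  obtain N0 where N0: "\<And>N j. N0 \<le> N \<Longrightarrow> (\<forall>i. \<bar>j $ i\<bar> \<le> int N ^ 3) \<Longrightarrow> \<bar>\<Sum>k\<in>blk N. \<mu> (j + k)\<bar> \<le> \<delta> * (real N)\<^sup>2"
    using blk \<delta> by blast
  \<comment> \<open>This block size satisfies \<open>N \<epsilon> \<rightarrow> 0\<close>, whereas \<open>\<epsilon> N\<^sup>3 \<rightarrow> \<infinity>\<close>: the blocks are microscopic for the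
    wave, and the region where the block averages are controlled fills the plane.\<close>
  define N where "N \<epsilon> = nat \<lceil>1 / sqrt \<epsilon>\<rceil>" for \<epsilon> :: real
  have Nge: "1 / sqrt \<epsilon> \<le> real (N \<epsilon>)" for \<epsilon> unfolding N_def by (rule real_nat_ceiling_ge)
  define q where "q = \<kappa> / (12 * c0 * (D1 + D2) + 1)"
  have q: "0 < q" using \<kappa> c0 D unfolding q_def by (intro divide_pos_pos add_nonneg_pos mult_nonneg_nonneg) auto
  have t: "0 < \<kappa> / (3 * (c0 + 1))" using \<kappa> c0 by simp
  have ev1: "\<forall>\<^sub>F \<epsilon> in at_right 0. 0 < \<epsilon> \<and> \<epsilon> \<le> min 1 (min (q\<^sup>2) (1 / (real N0 + 1)\<^sup>2))"
    by (rule eventually_small_pos) (use q in simp)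
  show ?thesis
    using ev1 samp_tail_small[OF k R W W' Nge t, of T]
  proof eventually_elim
    case (elim \<epsilon>)
    then have \<epsilon>: "0 < \<epsilon>" "\<epsilon> \<le> 1" "\<epsilon> \<le> q\<^sup>2" "\<epsilon> \<le> 1 / (real N0 + 1)\<^sup>2" by auto
    define s where "s = sqrt \<epsilon>"
    have s: "0 < s" "s * s = \<epsilon>" "s \<le> 1" using \<epsilon> by (auto simp: s_def)
    have sq: "s \<le> q" using real_sqrt_le_mono[OF \<epsilon>(3)] q by (simp add: s_def)
    have "s \<le> 1 / (real N0 + 1)" using real_sqrt_le_mono[OF \<epsilon>(4)] by (simp add: s_def real_sqrt_divide)
    then have "real N0 + 1 \<le> 1 / s" using s(1) by (simp add: field_simps)
    then have NN0: "N0 \<le> N \<epsilon>" using Nge[of \<epsilon>] by (simp add: s_def)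
    have "1 \<le> 1 / s" using s by (simp add: field_simps)
    then have "1 \<le> real (N \<epsilon>)" using Nge[of \<epsilon>] unfolding s_def by linarith
    then have N1: "1 \<le> N \<epsilon>" by simp
    have "real (N \<epsilon>) \<le> 1 / s + 1" unfolding N_def s_def using \<epsilon>(1) by (simp add: of_nat_nat ceiling_correct)
    also have "\<dots> \<le> 2 / s" using \<open>1 \<le> 1 / s\<close> by simp
    finally have "real (N \<epsilon>) * \<epsilon> \<le> 2 / s * \<epsilon>" using \<epsilon> by (intro mult_right_mono) auto
    then have Ns: "real (N \<epsilon>) * \<epsilon> \<le> 2 * s" using s(1) by (simp add: s(2)[symmetric])
    have "s * (12 * c0 * (D1 + D2) + 1) \<le> \<kappa>"
    proof -
      have "0 < 12 * c0 * (D1 + D2) + 1" using c0 D by (intro add_nonneg_pos mult_nonneg_nonneg) auto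
      then show ?thesis using sq unfolding q_def by (simp only: pos_le_divide_eq)
    qed
    then have sk: "12 * (s * c0 * D1) + 12 * (s * c0 * D2) \<le> \<kappa>" using s(1) by (simp add: algebra_simps)
    have n1: "0 \<le> s * c0 * D1" "0 \<le> s * c0 * D2" using s c0 D by auto
    show ?case
    proof (intro ballI allI)
      fix \<tau> e assume \<tau>: "\<tau> \<in> {-T..T}"
      define A where "A = samp \<epsilon> 0 K (W \<tau>)"
      define G where "G = grad_norm e"
      have G: "0 \<le> G" by (simp add: G_def)
      define Z where "Z = norm (mult_op (indicator (- {j. \<forall>i. \<bar>j $ i\<bar> \<le> int (N \<epsilon>) ^ 3})) A)"
      have Z: "\<epsilon> * Z \<le> \<kappa> / (3 * (c0 + 1))" using elim(2) \<tau> unfolding Z_def A_def by (meson less_imp_le)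
      have "\<epsilon> * norm A \<le> L * (2 * R) * (2 * R + 1) * L2n (W \<tau>)" unfolding A_def by (rule samp_props(2)[OF k W \<epsilon>(1,2) R])
      also have "\<dots> \<le> D1" unfolding D1_def using L R by (intro mult_left_mono H(2)[OF \<tau>]) auto
      finally have A1: "\<epsilon> * norm A \<le> D1" .
      have A2: "\<epsilon> * norm (fd i A) \<le> \<epsilon> * D2" for i
      proof -
        have "\<epsilon> * norm (fd i A) \<le> \<epsilon> * (L * (2 * (R + 1)) * (2 * (R + 1) + 1) * L2n (W \<tau>))"
          unfolding A_def by (rule samp_fd_bound[OF K W \<epsilon>(1,2)])
        also have "\<dots> \<le> \<epsilon> * D2" unfolding D2_def using L R \<epsilon> by (intro mult_left_mono H(2)[OF \<tau>]) auto
        finally show ?thesis .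
      qed
      have "\<bar>inner e (mult_op \<mu> A)\<bar> \<le> real (N \<epsilon>) * G * (c0 * norm A)
        + norm e * (c0 * (real (N \<epsilon>) * grad_norm A)) + norm e * (\<delta> * norm A + c0 * Z)"
        unfolding G_def Z_def
        by (rule oscillating_pairing_bound[OF \<mu> N1 less_imp_le[OF \<delta>]]) (use N0[OF NN0] in blast)
      then have "\<epsilon>\<^sup>2 * \<bar>inner e (mult_op \<mu> A)\<bar> \<le> \<epsilon>\<^sup>2 * (real (N \<epsilon>) * G * (c0 * norm A)
        + norm e * (c0 * (real (N \<epsilon>) * grad_norm A)) + norm e * (\<delta> * norm A + c0 * Z))"
        by (intro mult_left_mono) auto
      also have "\<dots> = G * (c0 * ((real (N \<epsilon>) * \<epsilon>) * (\<epsilon> * norm A)))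
        + (\<epsilon> * norm e) * (c0 * (real (N \<epsilon>) * (\<epsilon> * norm (fd 1 A) + \<epsilon> * norm (fd 2 A))) + \<delta> * (\<epsilon> * norm A) + c0 * (\<epsilon> * Z))"
        by (simp add: power2_eq_square algebra_simps)
      also have "\<dots> \<le> G * (c0 * ((2 * s) * D1))
        + (\<epsilon> * norm e) * (c0 * (real (N \<epsilon>) * (\<epsilon> * D2 + \<epsilon> * D2)) + \<delta> * D1 + c0 * (\<kappa> / (3 * (c0 + 1))))"
      proof -
        have i: "(real (N \<epsilon>) * \<epsilon>) * (\<epsilon> * norm A) \<le> (2 * s) * D1"
          by (rule mult_mono[OF Ns A1]) (use s(1) \<epsilon>(1) in auto)
        have ii: "real (N \<epsilon>) * (\<epsilon> * norm (fd 1 A) + \<epsilon> * norm (fd 2 A)) \<le> real (N \<epsilon>) * (\<epsilon> * D2 + \<epsilon> * D2)"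
          by (rule mult_left_mono[OF add_mono[OF A2 A2]]) simp
        have en: "0 \<le> \<epsilon> * norm e" using \<epsilon>(1) by simp
        show ?thesis
          by (rule add_mono[OF mult_left_mono[OF mult_left_mono[OF i c0] G]
              mult_left_mono[OF add_mono[OF add_mono[OF mult_left_mono[OF ii c0]
                mult_left_mono[OF A1 less_imp_le[OF \<delta>]]] mult_left_mono[OF Z c0]] en]])
      qed
      also have "\<dots> \<le> G * \<kappa> + (\<epsilon> * norm e) * \<kappa>"
      proof (intro add_mono mult_left_mono)
        show "c0 * ((2 * s) * D1) \<le> \<kappa>" using sk n1 by (simp add: algebra_simps)
        have "c0 * (real (N \<epsilon>) * (\<epsilon> * D2 + \<epsilon> * D2)) = 2 * c0 * D2 * (real (N \<epsilon>) * \<epsilon>)" by (simp add: algebra_simps)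
        also have "\<dots> \<le> 2 * c0 * D2 * (2 * s)" using c0 D by (intro mult_left_mono Ns) auto
        also have "\<dots> \<le> \<kappa> / 3" using sk n1 by (simp add: algebra_simps)
        finally have a: "c0 * (real (N \<epsilon>) * (\<epsilon> * D2 + \<epsilon> * D2)) \<le> \<kappa> / 3" .
        have b: "\<delta> * D1 \<le> \<kappa> / 3" using \<kappa> D by (simp add: \<delta>_def field_simps)
        have c: "c0 * (\<kappa> / (3 * (c0 + 1))) \<le> \<kappa> / 3" using \<kappa> c0 by (simp add: field_simps)
        show "c0 * (real (N \<epsilon>) * (\<epsilon> * D2 + \<epsilon> * D2)) + \<delta> * D1 + c0 * (\<kappa> / (3 * (c0 + 1))) \<le> \<kappa>"
          using a b c by linarith
      qed (use G \<epsilon> in auto)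
      finally show "\<epsilon>\<^sup>2 * \<bar>inner e (mult_op \<mu> (samp \<epsilon> 0 K (W \<tau>)))\<bar> \<le> \<kappa> * (grad_norm e + \<epsilon> * norm e)"
        by (simp add: A_def G_def algebra_simps)
    qed
  qed
qed

section \<open>The error on the lattice\<close>

lemma scaled_norm_le:
  assumes "\<And>A. finite A \<Longrightarrow> \<epsilon>\<^sup>2 * (\<Sum>k\<in>A. (coord z k)\<^sup>2) \<le> c" "0 < \<epsilon>" "0 \<le> c"
  shows "\<epsilon> * norm z \<le> sqrt c"
proof -
  have "norm z \<le> sqrt c / \<epsilon>"
  proof (rule norm_ell2_le)
    fix A :: "'a set" assume "finite A"
    then show "(\<Sum>k\<in>A. (coord z k)\<^sup>2) \<le> (sqrt c / \<epsilon>)\<^sup>2"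
      using assms(1)[of A] assms(2,3) by (simp add: power_divide pos_le_divide_eq mult.commute)
  qed (use assms in simp)
  then show ?thesis using assms(2) by (simp add: pos_le_divide_eq mult.commute)
qed

lemma initial_value_error:
  assumes z: "\<And>k. coord z k = moll_err \<eta> f (\<epsilon> *\<^sub>R lattice_pt k)"
    and C: "\<And>A. finite A \<Longrightarrow> \<epsilon>\<^sup>2 * (\<Sum>k\<in>A. (moll_err \<eta> f (\<epsilon> *\<^sub>R lattice_pt k))\<^sup>2) \<le> c"
    and \<epsilon>: "0 < \<epsilon>" "0 \<le> c"
  shows "\<epsilon> * norm z \<le> sqrt c"
  by (rule scaled_norm_le[OF _ \<epsilon>]) (simp add: z C)

lemma initial_gradient_error:
  assumes z: "\<And>k. coord z k = moll_err \<eta> f (\<epsilon> *\<^sub>R lattice_pt k)"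
    and C: "\<And>A. finite A \<Longrightarrow> \<epsilon>\<^sup>2 * (\<Sum>k\<in>A. ((moll_err \<eta> f (\<epsilon> *\<^sub>R lattice_pt k + \<epsilon> *\<^sub>R axis i 1)
      - moll_err \<eta> f (\<epsilon> *\<^sub>R lattice_pt k)) / \<epsilon>)\<^sup>2) \<le> c"
    and \<epsilon>: "0 < \<epsilon>" "0 \<le> c"
  shows "norm (fd i z) \<le> sqrt c"
proof -
  have "coord (fd i z) k = moll_err \<eta> f (\<epsilon> *\<^sub>R lattice_pt k + \<epsilon> *\<^sub>R axis i 1)
      - moll_err \<eta> f (\<epsilon> *\<^sub>R lattice_pt k)" for k
    by (simp add: z lattice_pt_add lattice_pt_axis scaleR_add_right)
  then have "\<epsilon> * norm ((1 / \<epsilon>) *\<^sub>R fd i z) \<le> sqrt c"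
    by (intro scaled_norm_le[OF _ \<epsilon>]) (use C in simp)
  then show ?thesis using \<epsilon>(1) by simp
qed

lemma error_equation:
  assumes m: "\<And>j. m j \<in> {a..b}" and a: "0 < a" and \<epsilon>: "0 < \<epsilon>" and mbar: "mbar \<noteq> 0"
  shows "mult_op m ((1 / \<epsilon>) *\<^sub>R mult_op (\<lambda>j. 1 / m j) (lap u) - (1 / mbar) *\<^sub>R l)
    = (1 / \<epsilon>\<^sup>2) *\<^sub>R lap (\<epsilon> *\<^sub>R u - w) - mult_op (\<lambda>j. m j - mbar) ((1 / mbar) *\<^sub>R l) - (l - (1 / \<epsilon>\<^sup>2) *\<^sub>R lap w)"
proof (rule ell2_eqI)
  fix j
  have b1: "\<bar>m j\<bar> \<le> b" "\<bar>1 / m j\<bar> \<le> 1 / a" "\<bar>m j - mbar\<bar> \<le> b + \<bar>mbar\<bar>" for j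
    using m[of j] a by (auto simp: frac_le)
  have lin: "lap (\<epsilon> *\<^sub>R u - w) = \<epsilon> *\<^sub>R lap u - lap w"
    using bounded_linear.linear[OF bounded_linear_lap] by (simp add: linear_diff linear_scale)
  have "m j \<noteq> 0" using m[of j] a by auto
  then show "coord (mult_op m ((1 / \<epsilon>) *\<^sub>R mult_op (\<lambda>j. 1 / m j) (lap u) - (1 / mbar) *\<^sub>R l)) j
    = coord ((1 / \<epsilon>\<^sup>2) *\<^sub>R lap (\<epsilon> *\<^sub>R u - w) - mult_op (\<lambda>j. m j - mbar) ((1 / mbar) *\<^sub>R l) - (l - (1 / \<epsilon>\<^sup>2) *\<^sub>R lap w)) j"
    unfolding lin using \<epsilon> mbar
    by (simp add: coord_mult_op[of m, OF b1(1)] coord_mult_op[of "\<lambda>j. 1 / m j", OF b1(2)]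
        coord_mult_op[of "\<lambda>j. m j - mbar", OF b1(3)] field_simps power2_eq_square)
qed

lemma pairing_scaled:
  assumes "\<epsilon>\<^sup>2 * \<bar>inner e (mult_op \<mu> z)\<bar> \<le> c * \<kappa> * X" "0 < c" and \<mu>: "\<And>j. \<bar>\<mu> j\<bar> \<le> c0"
  shows "\<epsilon>\<^sup>2 * \<bar>inner e (mult_op \<mu> ((1 / c) *\<^sub>R z))\<bar> \<le> \<kappa> * X"
proof -
  have "mult_op \<mu> ((1 / c) *\<^sub>R z) = (1 / c) *\<^sub>R mult_op \<mu> z"
    using bounded_linear.linear[OF bounded_linear_mult_op[of \<mu>, OF \<mu>]] by (simp add: linear_scale)
  then have "\<epsilon>\<^sup>2 * \<bar>inner e (mult_op \<mu> ((1 / c) *\<^sub>R z))\<bar> = (1 / c) * (\<epsilon>\<^sup>2 * \<bar>inner e (mult_op \<mu> z)\<bar>)"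
    using assms(2) by (simp add: abs_mult)
  also have "\<dots> \<le> (1 / c) * (c * \<kappa> * X)" using assms(1,2) by (intro mult_left_mono) auto
  finally show ?thesis using assms(2) by simp
qed

text \<open>The equation in the microscopic variables, with the initial data of the macroscopic problem.\<close>

abbreviation scaled_solution :: "(int^2 \<Rightarrow> real) \<Rightarrow> (real^2 \<Rightarrow> real) \<Rightarrow> (real^2 \<Rightarrow> real) \<Rightarrow> real \<Rightarrow>
    (real \<Rightarrow> int^2 \<Rightarrow> real) \<Rightarrow> (real \<Rightarrow> int^2 \<Rightarrow> real) \<Rightarrow> bool" where
  "scaled_solution m \<phi> \<psi> \<epsilon> \<equiv>
    lattice_solution m (\<lambda>j. (1 / \<epsilon>) * \<phi> (\<epsilon> *\<^sub>R lattice_pt j)) (\<lambda>j. \<psi> (\<epsilon> *\<^sub>R lattice_pt j))"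

text \<open>
  For fixed \<open>\<eta>\<close> the pairings with the forcing and the consistency error vanish with \<open>\<epsilon>\<close>, so their
  bounds are eventually below \<open>\<eta>\<close>, and the initial errors are at most of order \<open>sqrt \<eta>\<close> by the sampling bounds for the data. The
  energy estimate with \<open>\<kappa> = \<eta>\<close> then gives a bound that depends on \<open>\<eta>\<close> alone.
\<close>

lemma lattice_error:
  fixes m :: "int^2 \<Rightarrow> real"
  assumes w: "wave_solution mbar \<phi> \<psi> U V"
    and \<phi>: "\<phi> \<in> H_weighted 5 \<sigma>" "continuous_on UNIV \<phi>" and \<psi>: "\<psi> \<in> H_weighted 5 \<sigma>" "continuous_on UNIV \<psi>"
    and \<sigma>: "0 < \<sigma>" and T: "0 < T" and a: "0 < a" and m: "\<And>j. m j \<in> {a..b}" and mbar: "mbar \<in> {a..b}"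
    and blk: "small_block_averages (\<lambda>j. m j - mbar)"
  shows "\<exists>\<Theta>. (\<Theta> \<longlongrightarrow> 0) (at_right 0) \<and> (\<forall>\<eta>. 0 < \<eta> \<longrightarrow> \<eta> \<le> 1 \<longrightarrow> (\<forall>\<^sub>F \<epsilon> in at_right 0. \<forall>u v.
    scaled_solution m \<phi> \<psi> \<epsilon> u v \<longrightarrow>
    (\<forall>\<tau>\<in>{-T..T}. \<epsilon> * norm (\<epsilon> *\<^sub>R Abs_ell2 (u (\<tau> / \<epsilon>)) - samp \<epsilon> 0 (rho \<eta>) (U \<tau>)) \<le> \<Theta> \<eta> \<and>
      \<epsilon> * norm (Abs_ell2 (v (\<tau> / \<epsilon>)) - samp \<epsilon> 0 (rho \<eta>) (V \<tau>)) \<le> \<Theta> \<eta>)))"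
proof -
  note wl = wave_solution_L2[OF w]
  have c: "0 < mbar" using a mbar by auto
  obtain C0 where C0: "0 \<le> C0" "\<And>\<eta> \<epsilon> A. 0 < \<eta> \<Longrightarrow> \<eta> \<le> 1 \<Longrightarrow> 0 < \<epsilon> \<Longrightarrow> \<epsilon> \<le> 1 \<Longrightarrow> finite A \<Longrightarrow>
    \<epsilon>\<^sup>2 * (\<Sum>k\<in>A. (moll_err \<eta> \<phi> (\<epsilon> *\<^sub>R lattice_pt k))\<^sup>2) \<le> C0 * \<eta>"
    using data_sampling_value[OF \<phi>(1) \<sigma> \<phi>(2)] by blast
  obtain C1 where C1: "0 \<le> C1" "\<And>\<eta> \<epsilon> A. 0 < \<eta> \<Longrightarrow> \<eta> \<le> 1 \<Longrightarrow> 0 < \<epsilon> \<Longrightarrow> \<epsilon> \<le> 1 \<Longrightarrow> finite A \<Longrightarrow>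
    \<epsilon>\<^sup>2 * (\<Sum>k\<in>A. (moll_err \<eta> \<psi> (\<epsilon> *\<^sub>R lattice_pt k))\<^sup>2) \<le> C1 * \<eta>"
    using data_sampling_value[OF \<psi>(1) \<sigma> \<psi>(2)] by blast
  have "\<forall>i. \<exists>C\<ge>0. \<forall>\<eta> \<epsilon> A. 0 < \<eta> \<longrightarrow> \<eta> \<le> 1 \<longrightarrow> 0 < \<epsilon> \<longrightarrow> \<epsilon> \<le> 1 \<longrightarrow> finite A \<longrightarrow>
    \<epsilon>\<^sup>2 * (\<Sum>k\<in>A. ((moll_err \<eta> \<phi> (\<epsilon> *\<^sub>R lattice_pt k + \<epsilon> *\<^sub>R axis i 1)
      - moll_err \<eta> \<phi> (\<epsilon> *\<^sub>R lattice_pt k)) / \<epsilon>)\<^sup>2) \<le> C * (\<eta> + \<epsilon>)"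
    using data_sampling_gradient[OF \<phi>(1) \<sigma> \<phi>(2)] by blast
  from choice[OF this] obtain C2 where C2: "\<And>i. 0 \<le> C2 i" "\<And>i \<eta> \<epsilon> A. 0 < \<eta> \<Longrightarrow> \<eta> \<le> 1 \<Longrightarrow> 0 < \<epsilon> \<Longrightarrow> \<epsilon> \<le> 1 \<Longrightarrow> finite A \<Longrightarrow>
    \<epsilon>\<^sup>2 * (\<Sum>k\<in>A. ((moll_err \<eta> \<phi> (\<epsilon> *\<^sub>R lattice_pt k + \<epsilon> *\<^sub>R axis i 1)
      - moll_err \<eta> \<phi> (\<epsilon> *\<^sub>R lattice_pt k)) / \<epsilon>)\<^sup>2) \<le> C2 i * (\<eta> + \<epsilon>)" by blast
  define D where "D = C0 + C1 + 2 * C2 1 + 2 * C2 2"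
  have D: "0 \<le> D" "C0 \<le> D" "C1 \<le> D" "2 * C2 1 \<le> D" "2 * C2 2 \<le> D"
    using C0(1) C1(1) C2(1)[of 1] C2(1)[of 2] by (auto simp: D_def)
  let ?c = "4 / a + 8"
  define S where "S \<eta> = 2 * ?c * (b * (D * \<eta>) + 4 * (D * \<eta>) + \<eta> * (2 + T) * sqrt (D * \<eta>)) + (?c * \<eta> * (2 + T) * (1 + T))\<^sup>2" for \<eta>
  define \<Theta> where "\<Theta> \<eta> = sqrt (D * \<eta>) + (1 + T) * sqrt (S \<eta>)" for \<eta>
  have "(\<Theta> \<longlongrightarrow> sqrt (D * 0) + (1 + T) * sqrt (2 * ?c * (b * (D * 0) + 4 * (D * 0) + 0 * (2 + T) * sqrt (D * 0)) + (?c * 0 * (2 + T) * (1 + T))\<^sup>2)) (at_right 0)"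
    unfolding \<Theta>_def[abs_def] S_def by (intro tendsto_intros)
  then have \<Theta>0: "(\<Theta> \<longlongrightarrow> 0) (at_right 0)" by simp
  have b0: "0 < b" using a mbar by auto
  have \<mu>b: "\<bar>m j - mbar\<bar> \<le> b" for j using m[of j] mbar a by auto
  moreover have "\<forall>\<^sub>F \<epsilon> in at_right 0. \<forall>u v.
    scaled_solution m \<phi> \<psi> \<epsilon> u v \<longrightarrow>
    (\<forall>\<tau>\<in>{-T..T}. \<epsilon> * norm (\<epsilon> *\<^sub>R Abs_ell2 (u (\<tau> / \<epsilon>)) - samp \<epsilon> 0 (rho \<eta>) (U \<tau>)) \<le> \<Theta> \<eta> \<and>
      \<epsilon> * norm (Abs_ell2 (v (\<tau> / \<epsilon>)) - samp \<epsilon> 0 (rho \<eta>) (V \<tau>)) \<le> \<Theta> \<eta>)" if \<eta>: "0 < \<eta>" "\<eta> \<le> 1" for \<eta>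
  proof -
    have \<eta>0: "0 \<le> \<eta>" using \<eta> by simp
    obtain L where L: "lip_kern \<eta> L (lapk \<eta>)" using lip_kern_lapk[OF \<eta>(1)] by blast
    obtain Cc where Cc: "0 \<le> Cc" "\<And>\<epsilon> h. 0 < \<epsilon> \<Longrightarrow> \<epsilon> \<le> 1 \<Longrightarrow> L2_fun h \<Longrightarrow>
        \<epsilon> * norm ((1 / \<epsilon>\<^sup>2) *\<^sub>R lap (samp \<epsilon> 0 (rho \<eta>) h) - samp \<epsilon> 0 (lapk \<eta>) h) \<le> Cc * \<epsilon> * L2n h"
      using consistency[OF \<eta>(1)] by blast
    obtain H where H: "0 \<le> H" "\<And>\<tau>. \<tau> \<in> {-T..T} \<Longrightarrow> L2n (U \<tau>) \<le> H"
      using L2n_bounded_on_compact[OF wl(1,3), of T] by blast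
    have mk: "0 < mbar * \<eta>" using c \<eta> by simp
    have evU: "\<forall>\<^sub>F \<epsilon> in at_right 0. \<forall>\<tau>\<in>{-T..T}. \<forall>e. \<epsilon>\<^sup>2 * \<bar>inner e (mult_op (\<lambda>j. m j - mbar) (samp \<epsilon> 0 (lapk \<eta>) (U \<tau>)))\<bar>
        \<le> mbar * \<eta> * (grad_norm e + \<epsilon> * norm e)"
      by (rule pairing_small[OF L wl(1) wl(3), where \<mu>="\<lambda>j. m j - mbar", OF \<mu>b less_imp_le[OF b0] blk mk])
    have evV: "\<forall>\<^sub>F \<epsilon> in at_right 0. \<forall>\<tau>\<in>{-T..T}. \<forall>e. \<epsilon>\<^sup>2 * \<bar>inner e (mult_op (\<lambda>j. m j - mbar) (samp \<epsilon> 0 (lapk \<eta>) (V \<tau>)))\<bar>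
        \<le> mbar * \<eta> * (grad_norm e + \<epsilon> * norm e)"
      by (rule pairing_small[OF L wl(2) wl(4), where \<mu>="\<lambda>j. m j - mbar", OF \<mu>b less_imp_le[OF b0] blk mk])
    have ev0: "\<forall>\<^sub>F \<epsilon>::real in at_right 0. 0 < \<epsilon> \<and> \<epsilon> \<le> min \<eta> (\<eta> / (Cc * H + 1))"
      by (rule eventually_small_pos) (use \<eta> Cc(1) H(1) in \<open>simp add: add_nonneg_pos\<close>)
    show ?thesis
      using ev0 evU evV
    proof eventually_elim
      case (elim \<epsilon>)
      then have \<epsilon>: "0 < \<epsilon>" "\<epsilon> \<le> \<eta>" "\<epsilon> \<le> 1" "\<epsilon> \<le> \<eta> / (Cc * H + 1)" using \<eta> by auto
      have CH: "Cc * \<epsilon> * H \<le> \<eta>"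
      proof -
        have "\<epsilon> * (Cc * H + 1) \<le> \<eta>" using \<epsilon>(4) Cc(1) H(1) by (simp add: pos_le_divide_eq add_nonneg_pos)
        then show ?thesis using \<epsilon>(1) by (simp add: algebra_simps)
      qed
      show ?case
      proof (intro allI impI)
        fix u v assume sol: "scaled_solution m \<phi> \<psi> \<epsilon> u v"
        note lc = lattice_solution_curve[OF sol a m]
        define e where "e \<tau> = \<epsilon> *\<^sub>R Abs_ell2 (u (\<tau> / \<epsilon>)) - samp \<epsilon> 0 (rho \<eta>) (U \<tau>)" for \<tau>
        define d where "d \<tau> = Abs_ell2 (v (\<tau> / \<epsilon>)) - samp \<epsilon> 0 (rho \<eta>) (V \<tau>)" for \<tau>
        define A where "A \<tau> = (1 / mbar) *\<^sub>R samp \<epsilon> 0 (lapk \<eta>) (U \<tau>)" for \<tau>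
        define B where "B \<tau> = (1 / mbar) *\<^sub>R samp \<epsilon> 0 (lapk \<eta>) (V \<tau>)" for \<tau>
        define d' where "d' \<tau> = (1 / \<epsilon>) *\<^sub>R mult_op (\<lambda>j. 1 / m j) (lap (Abs_ell2 (u (\<tau> / \<epsilon>)))) - A \<tau>" for \<tau>
        define r where "r \<tau> = samp \<epsilon> 0 (lapk \<eta>) (U \<tau>) - (1 / \<epsilon>\<^sup>2) *\<^sub>R lap (samp \<epsilon> 0 (rho \<eta>) (U \<tau>))" for \<tau>
        note kr = kern_rho[OF \<eta>(1)] and kl = lip_kernD(1)[OF L]
        have \<epsilon>n: "\<epsilon> \<noteq> 0" using \<epsilon> by simp
        have de: "(e has_vector_derivative d \<tau>) (at \<tau>)" for \<tau>
          unfolding e_def[abs_def] d_def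
          by (intro has_vector_derivative_diff has_vector_derivative_rescale[OF lc(3) \<epsilon>n]
              samp_has_derivative[OF wl(1,2,5,4) kr \<epsilon>(1,3) \<eta>0])
        have dv: "((\<lambda>s. Abs_ell2 (v (s / \<epsilon>))) has_vector_derivative (1 / \<epsilon>) *\<^sub>R mult_op (\<lambda>j. 1 / m j) (lap (Abs_ell2 (u (\<tau> / \<epsilon>))))) (at \<tau>)" for \<tau>
          using bounded_linear.has_vector_derivative[OF bounded_linear_scaleR_right has_vector_derivative_rescale[OF lc(4) \<epsilon>n], of "1 / \<epsilon>"] \<epsilon>n
          by simp
        have dd: "(d has_vector_derivative d' \<tau>) (at \<tau>)" for \<tau>
          unfolding d_def[abs_def] d'_def A_def
          by (intro has_vector_derivative_diff dv samp_velocity_has_derivative[OF w c \<eta>(1) \<epsilon>(1,3)])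
        have dA: "(A has_vector_derivative B \<tau>) (at \<tau>)" for \<tau>
          unfolding A_def[abs_def] B_def
          by (intro bounded_linear.has_vector_derivative[OF bounded_linear_scaleR_right]
              samp_has_derivative[OF wl(1,2,5,4) kl \<epsilon>(1,3) \<eta>0])
        have eqn: "mult_op m (d' \<tau>) = (1 / \<epsilon>\<^sup>2) *\<^sub>R lap (e \<tau>) - mult_op (\<lambda>j. m j - mbar) (A \<tau>) - r \<tau>" for \<tau>
          unfolding d'_def e_def A_def r_def by (rule error_equation[OF m a \<epsilon>(1)]) (use c in simp)
        have tT: "\<tau> \<in> {-T..T}" if "\<bar>\<tau>\<bar> \<le> T" for \<tau> using that by auto
        have pA: "\<epsilon>\<^sup>2 * \<bar>inner (e \<tau>) (mult_op (\<lambda>j. m j - mbar) (A \<tau>))\<bar> \<le> \<eta> * (grad_norm (e \<tau>) + \<epsilon> * norm (e \<tau>))"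
          if "\<bar>\<tau>\<bar> \<le> T" for \<tau> unfolding A_def
          by (rule pairing_scaled[OF _ c, where \<mu>="\<lambda>j. m j - mbar", OF _ \<mu>b]) (use elim(2) tT[OF that] in blast)
        have pB: "\<epsilon>\<^sup>2 * \<bar>inner (e \<tau>) (mult_op (\<lambda>j. m j - mbar) (B \<tau>))\<bar> \<le> \<eta> * (grad_norm (e \<tau>) + \<epsilon> * norm (e \<tau>))"
          if "\<bar>\<tau>\<bar> \<le> T" for \<tau> unfolding B_def
          by (rule pairing_scaled[OF _ c, where \<mu>="\<lambda>j. m j - mbar", OF _ \<mu>b]) (use elim(3) tT[OF that] in blast)
        have rb: "\<epsilon> * norm (r \<tau>) \<le> \<eta>" if "\<bar>\<tau>\<bar> \<le> T" for \<tau>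
        proof -
          have "\<epsilon> * norm (r \<tau>) \<le> Cc * \<epsilon> * L2n (U \<tau>)"
            using Cc(2)[OF \<epsilon>(1,3) wl(1)[of \<tau>]] by (simp add: r_def norm_minus_commute)
          also have "\<dots> \<le> Cc * \<epsilon> * H" using Cc(1) \<epsilon> by (intro mult_left_mono H(2)[OF tT[OF that]]) auto
          finally show ?thesis using CH by linarith
        qed
        have U0: "corr (rho \<eta>) (U 0) X = corr (rho \<eta>) \<phi> X" and V0: "corr (rho \<eta>) (V 0) X = corr (rho \<eta>) \<psi> X" for X
          using w unfolding wave_solution_def
          by (auto intro!: corr_cong_AE[OF _ _ _ kr] L2_fun_measurable[OF wl(1)] L2_fun_measurable[OF wl(2)]
              L2_fun_measurable[OF H5_structure(1)[OF \<phi>(1) \<sigma> \<phi>(2)]] L2_fun_measurable[OF H5_structure(1)[OF \<psi>(1) \<sigma> \<psi>(2)]])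
        have uv0: "u 0 = (\<lambda>j. (1 / \<epsilon>) * \<phi> (\<epsilon> *\<^sub>R lattice_pt j))" "v 0 = (\<lambda>j. \<psi> (\<epsilon> *\<^sub>R lattice_pt j))"
          using sol unfolding lattice_solution_def by blast+
        have ce: "coord (e 0) k = moll_err \<eta> \<phi> (\<epsilon> *\<^sub>R lattice_pt k)" for k
          using \<epsilon>n lc(1)[of 0, unfolded uv0] by (simp add: e_def uv0 samp_props(1)[OF kr wl(1) \<epsilon>(1,3) \<eta>0] U0)
        have cd: "coord (d 0) k = moll_err \<eta> \<psi> (\<epsilon> *\<^sub>R lattice_pt k)" for k
          using \<epsilon>n lc(2)[of 0, unfolded uv0] by (simp add: d_def uv0 samp_props(1)[OF kr wl(2) \<epsilon>(1,3) \<eta>0] V0)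
        have D\<eta>: "0 \<le> D * \<eta>" using D(1) \<eta>0 by simp
        have e0: "\<epsilon> * norm (e 0) \<le> sqrt (D * \<eta>)"
          by (rule initial_value_error[OF ce _ \<epsilon>(1) D\<eta>])
             (rule order_trans[OF C0(2)[OF \<eta> \<epsilon>(1,3)] mult_right_mono[OF D(2) \<eta>0]])
        have d0: "\<epsilon> * norm (d 0) \<le> sqrt (D * \<eta>)"
          by (rule initial_value_error[OF cd _ \<epsilon>(1) D\<eta>])
             (rule order_trans[OF C1(2)[OF \<eta> \<epsilon>(1,3)] mult_right_mono[OF D(3) \<eta>0]])
        have D2: "C2 i * (\<eta> + \<epsilon>) \<le> D * \<eta>" for i
        proof -
          have "i = 1 \<or> i = 2" by (rule exhaust_2)
          then have "2 * C2 i \<le> D" using D by auto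
          then have "(2 * C2 i) * \<eta> \<le> D * \<eta>" by (intro mult_right_mono \<eta>0)
          moreover have "C2 i * (\<eta> + \<epsilon>) \<le> C2 i * (2 * \<eta>)" using C2(1) \<epsilon>(2) by (intro mult_left_mono) auto
          ultimately show ?thesis by simp
        qed
        have g0: "norm (fd i (e 0)) \<le> sqrt (D * \<eta>)" for i
          by (rule initial_gradient_error[OF ce _ \<epsilon>(1) D\<eta>])
             (rule order_trans[OF C2(2)[OF \<eta> \<epsilon>(1,3)] D2])
        note en = energy_estimate[OF a m mbar \<epsilon>(1) T de dd dA eqn pA pB rb \<eta>0]
        define S0 where "S0 = 2 * ?c * (b * (\<epsilon> * norm (d 0))\<^sup>2 + (grad_norm (e 0))\<^sup>2
            + \<eta> * (2 + T) * (\<epsilon> * norm (e 0))) + (?c * \<eta> * (2 + T) * (1 + T))\<^sup>2"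
        have "S0 \<le> S \<eta>"
          unfolding S0_def S_def
        proof (intro add_mono mult_left_mono order_refl)
          show "(\<epsilon> * norm (d 0))\<^sup>2 \<le> D * \<eta>" using power_mono[OF d0, of 2] \<epsilon> D\<eta> by simp
          have "(grad_norm (e 0))\<^sup>2 \<le> (sqrt (D * \<eta>) + sqrt (D * \<eta>))\<^sup>2"
            by (intro power_mono add_mono g0) simp
          also have "\<dots> = 4 * (D * \<eta>)" using D\<eta> by (simp add: power2_eq_square algebra_simps)
          finally show "(grad_norm (e 0))\<^sup>2 \<le> 4 * (D * \<eta>)" .
        qed (use a b0 e0 \<eta>0 T in auto)
        then have S0: "sqrt S0 \<le> sqrt (S \<eta>)" by simp
        have "0 \<le> sqrt (S \<eta>)" "0 \<le> sqrt (D * \<eta>)"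
        proof -
          show "0 \<le> sqrt (D * \<eta>)" using D\<eta> by simp
          show "0 \<le> sqrt (S \<eta>)" unfolding S_def using a b0 D\<eta> \<eta>0 T by simp
        qed
        have "\<epsilon> * norm (e \<tau>) \<le> \<Theta> \<eta> \<and> \<epsilon> * norm (d \<tau>) \<le> \<Theta> \<eta>" if "\<tau> \<in> {-T..T}" for \<tau>
        proof -
          have \<tau>: "\<bar>\<tau>\<bar> \<le> T" using that by auto
          have 1: "\<epsilon> * norm (d \<tau>) + grad_norm (e \<tau>) \<le> sqrt S0"
            unfolding S0_def by (rule en(1)) (use \<tau> in simp_all)
          have 2: "\<epsilon> * norm (e \<tau>) \<le> \<epsilon> * norm (e 0) + T * sqrt S0"
            unfolding S0_def by (rule en(2)) (use \<tau> in simp_all)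
          have "T * sqrt S0 \<le> T * sqrt (S \<eta>)" using T S0 by (intro mult_left_mono) auto
          moreover have "\<epsilon> * norm (d \<tau>) \<le> sqrt S0" using 1 norm_ge_zero[of "fd 1 (e \<tau>)"] norm_ge_zero[of "fd 2 (e \<tau>)"] by linarith
          moreover have "0 \<le> T * sqrt (S \<eta>)" using T \<open>0 \<le> sqrt (S \<eta>)\<close> by simp
          ultimately show ?thesis unfolding \<Theta>_def distrib_right
            using 2 e0 S0 \<open>0 \<le> sqrt (S \<eta>)\<close> \<open>0 \<le> sqrt (D * \<eta>)\<close> by linarith
        qed
        then show "\<forall>\<tau>\<in>{-T..T}. \<epsilon> * norm (\<epsilon> *\<^sub>R Abs_ell2 (u (\<tau> / \<epsilon>)) - samp \<epsilon> 0 (rho \<eta>) (U \<tau>)) \<le> \<Theta> \<eta> \<and>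
          \<epsilon> * norm (Abs_ell2 (v (\<tau> / \<epsilon>)) - samp \<epsilon> 0 (rho \<eta>) (V \<tau>)) \<le> \<Theta> \<eta>"
          by (simp add: e_def d_def)
      qed
    qed
  qed
  then show ?thesis using \<Theta>0 by blast
qed

section \<open>From the lattice to the plane\<close>

text \<open>
  On every shifted lattice the error splits into the lattice error, the gradient of the samples and
  their dependence on the offset; the last two are of order \<open>\<epsilon>\<close>.
\<close>

lemma interpolation_L2_error:
  fixes h :: "real^2 \<Rightarrow> real"
  assumes K: "lip_kern R L K" and h: "L2_fun h" and \<epsilon>: "0 < \<epsilon>" "\<epsilon> \<le> 1" and H: "L2n h \<le> H"
    and e: "\<epsilon> * norm (z - samp \<epsilon> 0 K h) \<le> \<theta>"
  shows "L2_norm (\<lambda>X. lp z ((1 / \<epsilon>) *\<^sub>R X) - of_real (corr K h X))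
    \<le> ennreal (\<theta> + \<epsilon> * (5 * (L * (2 * (R + 1)) * (2 * (R + 1) + 1) * H)))"
proof (rule L2_norm_tile_le[OF _ \<epsilon>(1)])
  let ?D = "L * (2 * (R + 1)) * (2 * (R + 1) + 1) * H"
  note R = lip_kernD(2)[OF K] and k = lip_kernD(1)[OF K] and L = lip_kernD(3)[OF K]
  have H0: "0 \<le> H" using H L2n_nonneg[of h] by linarith
  have \<theta>: "0 \<le> \<theta>" using e \<epsilon> by (smt (verit) mult_nonneg_nonneg norm_ge_zero)
  have D: "0 \<le> ?D" using L R H0 by simp
  then show c0: "0 \<le> \<theta> + \<epsilon> * (5 * ?D)" using \<theta> \<epsilon> by simp
  have 1: "(\<lambda>X. lp z ((1 / \<epsilon>) *\<^sub>R X)) \<in> borel_measurable lebesgue"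
    by (rule measurable_completion, rule measurable_compose[OF _ lp_measurable]) simp
  have [measurable]: "corr K h \<in> borel_measurable lebesgue"
    by (rule corr_measurable[OF K L2_fun_loc_integrable[OF h]])
  show "(\<lambda>X. norm (lp z ((1 / \<epsilon>) *\<^sub>R X) - complex_of_real (corr K h X))) \<in> borel_measurable lebesgue"
    using 1 by measurable
  fix x :: "real^2" and A :: "(int^2) set" assume x: "x \<in> unit_cell" and A: "finite A"
  let ?w = "samp \<epsilon> 0 K h" and ?z = "samp \<epsilon> x K h"
  have mono: "\<epsilon> * (L * (2 * (R + 1)) * (2 * (R + 1) + 1) * L2n h) \<le> \<epsilon> * ?D"
    using L R \<epsilon> H by (intro mult_left_mono) auto
  have f: "\<epsilon> * norm (fd i ?w) \<le> \<epsilon> * ?D" for i by (rule order_trans[OF samp_fd_bound[OF K h \<epsilon>] mono])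
  have o: "\<epsilon> * norm (?w - ?z) \<le> \<epsilon> * ?D" by (rule order_trans[OF samp_offset_bound[OF K h \<epsilon> x] mono])
  define Q where "Q = (\<Sum>k\<in>A. (norm (lp z (lattice_pt k + x) - of_real (coord ?z k)))\<^sup>2)"
  have Q0: "0 \<le> Q" by (simp add: Q_def sum_nonneg)
  have "sqrt Q \<le> norm (z - ?w) + (2 * norm (fd 1 ?w) + 2 * norm (fd 2 ?w)) + norm (?w - ?z)"
    unfolding Q_def by (rule interpolation_error[OF A x])
  then have "\<epsilon> * sqrt Q \<le> \<epsilon> * (norm (z - ?w) + (2 * norm (fd 1 ?w) + 2 * norm (fd 2 ?w)) + norm (?w - ?z))"
    using \<epsilon> by (intro mult_left_mono) auto
  also have "\<dots> = \<epsilon> * norm (z - ?w) + (2 * (\<epsilon> * norm (fd 1 ?w)) + 2 * (\<epsilon> * norm (fd 2 ?w))) + \<epsilon> * norm (?w - ?z)"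
    by (simp add: algebra_simps)
  also have "\<dots> \<le> \<theta> + (2 * (\<epsilon> * ?D) + 2 * (\<epsilon> * ?D)) + \<epsilon> * ?D"
    by (intro add_mono mult_left_mono e f o) auto
  finally have "\<epsilon> * sqrt Q \<le> \<theta> + \<epsilon> * (5 * ?D)" by (simp add: algebra_simps)
  from power_mono[OF this, of 2] have "\<epsilon>\<^sup>2 * Q \<le> (\<theta> + \<epsilon> * (5 * ?D))\<^sup>2"
    using \<epsilon> Q0 by (simp add: power_mult_distrib)
  then show "\<epsilon>\<^sup>2 * (\<Sum>k\<in>A. (norm (lp z ((1 / \<epsilon>) *\<^sub>R \<epsilon> *\<^sub>R (lattice_pt k + x)) - complex_of_real (corr K h (\<epsilon> *\<^sub>R (lattice_pt k + x)))))\<^sup>2)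
      \<le> (\<theta> + \<epsilon> * (5 * ?D))\<^sup>2"
    using \<epsilon> by (simp add: Q_def samp_props(1)[OF k h \<epsilon> R])
qed

lemma L2_norm_of_real: "L2_norm (\<lambda>x. complex_of_real (f x)) = L2_norm f"
  by (simp add: L2_norm_def)

lemma rescaled_interp_error:
  fixes h :: "real^2 \<Rightarrow> real"
  assumes K: "lip_kern R L K" and h: "L2_fun h" and \<epsilon>: "0 < \<epsilon>" "\<epsilon> \<le> 1" and H: "L2n h \<le> H"
    and e: "\<epsilon> * norm (z - samp \<epsilon> 0 K h) \<le> \<theta>"
    and mol: "L2_fun (corr K h)" "L2n (\<lambda>X. corr K h X - h X) \<le> q"
  shows "L2_norm (\<lambda>X. lp z ((1 / \<epsilon>) *\<^sub>R X) - of_real (h X))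
    \<le> ennreal (\<theta> + \<epsilon> * (5 * (L * (2 * (R + 1)) * (2 * (R + 1) + 1) * H)) + q)"
proof -
  let ?D = "5 * (L * (2 * (R + 1)) * (2 * (R + 1) + 1) * H)"
  have H0: "0 \<le> H" using H L2n_nonneg[of h] by linarith
  have \<theta>: "0 \<le> \<theta>" using e \<epsilon> by (smt (verit) mult_nonneg_nonneg norm_ge_zero)
  have D: "0 \<le> \<theta> + \<epsilon> * ?D" using lip_kernD[OF K] H0 \<theta> \<epsilon> by simp
  have q: "0 \<le> q" using mol(2) L2n_nonneg[of "\<lambda>X. corr K h X - h X"] by linarith
  have d: "L2_fun (\<lambda>X. corr K h X - h X)" by (rule L2_fun_diff(1)[OF mol(1) h])
  have 1: "(\<lambda>X. lp z ((1 / \<epsilon>) *\<^sub>R X)) \<in> borel_measurable lebesgue"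
    by (rule measurable_completion, rule measurable_compose[OF _ lp_measurable]) simp
  have [measurable]: "corr K h \<in> borel_measurable lebesgue" "h \<in> borel_measurable lebesgue"
    using mol(1) h by (auto dest: L2_fun_measurable)
  have "L2_norm (\<lambda>X. (lp z ((1 / \<epsilon>) *\<^sub>R X) - of_real (corr K h X)) + of_real (corr K h X - h X))
      \<le> L2_norm (\<lambda>X. lp z ((1 / \<epsilon>) *\<^sub>R X) - of_real (corr K h X)) + L2_norm (\<lambda>X. complex_of_real (corr K h X - h X))"
    by (rule L2_norm_triangle) (use 1 in measurable)
  also have "\<dots> \<le> ennreal (\<theta> + \<epsilon> * ?D) + ennreal q"
  proof (rule add_mono)
    show "L2_norm (\<lambda>X. lp z ((1 / \<epsilon>) *\<^sub>R X) - of_real (corr K h X)) \<le> ennreal (\<theta> + \<epsilon> * ?D)"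
      by (rule interpolation_L2_error[OF K h \<epsilon> H e])
    show "L2_norm (\<lambda>X. complex_of_real (corr K h X - h X)) \<le> ennreal q"
      unfolding L2_norm_of_real L2_norm_eq[OF d] using mol(2) by (rule ennreal_leI)
  qed
  also have "\<dots> = ennreal (\<theta> + \<epsilon> * ?D + q)" using D q by (rule ennreal_plus[symmetric])
  finally show ?thesis by simp
qed

text \<open>Mollifications are bounded on \<open>L\<^sup>2\<close> uniformly in \<open>\<eta>\<close>, so convergence is uniform on compact orbits.\<close>

lemma mollification_uniform:
  assumes W: "\<And>\<tau>. L2_fun (W \<tau>)" and c: "\<And>\<tau>. ((\<lambda>s. L2n (\<lambda>X. W s X - W \<tau> X)) \<longlongrightarrow> 0) (at \<tau>)" and e: "0 < e"
  shows "\<forall>\<^sub>F \<eta> in at_right 0. \<forall>\<tau>\<in>{-T..T::real}. L2n (\<lambda>X. corr (rho \<eta>) (W \<tau>) X - W \<tau> X) < e"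
proof -
  define \<Phi> where "\<Phi> \<eta> h = L2n (\<lambda>X. corr (rho \<eta>) h X - h X)" for \<eta> h
  have lip: "\<forall>\<^sub>F \<eta> in at_right 0. \<forall>h h'. L2_fun h \<longrightarrow> L2_fun h' \<longrightarrow> \<bar>\<Phi> \<eta> h - \<Phi> \<eta> h'\<bar> \<le> (6 * M0\<^sup>2 + 1) * L2n (\<lambda>X. h X - h' X)"
  proof (rule eventually_mono[OF eventually_small_pos[of 1]], simp, intro allI impI)
    fix \<eta> :: real and h h' assume "0 < \<eta> \<and> \<eta> \<le> 1" and h: "L2_fun h" "L2_fun h'"
    then have \<eta>: "0 < \<eta>" by simp
    let ?g = "\<lambda>X. h X - h' X"
    have g: "L2_fun ?g" by (rule L2_fun_diff(1)[OF h])
    have fs: "L2_fun (\<lambda>X. corr (rho \<eta>) f X - f X)" if "L2_fun f" for f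
      by (rule L2_fun_diff(1)[OF corr_rho_L2(1)[OF \<eta> that] that])
    have eq: "(\<lambda>X. (corr (rho \<eta>) h X - h X) - (corr (rho \<eta>) h' X - h' X)) = (\<lambda>X. corr (rho \<eta>) ?g X - ?g X)"
      by (rule ext) (simp add: corr_diff_fun[OF kern_rho[OF \<eta>] L2_fun_loc_integrable[OF h(1)] L2_fun_loc_integrable[OF h(2)]])
    have "\<bar>\<Phi> \<eta> h - \<Phi> \<eta> h'\<bar> \<le> L2n (\<lambda>X. (corr (rho \<eta>) h X - h X) - (corr (rho \<eta>) h' X - h' X))"
      unfolding \<Phi>_def by (rule L2n_triangle_diff[OF fs[OF h(1)] fs[OF h(2)]])
    then have "\<bar>\<Phi> \<eta> h - \<Phi> \<eta> h'\<bar> \<le> L2n (\<lambda>X. corr (rho \<eta>) ?g X - ?g X)" unfolding eq .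
    moreover have "L2n (\<lambda>X. corr (rho \<eta>) ?g X - ?g X) \<le> L2n (corr (rho \<eta>) ?g) + L2n ?g"
      by (rule L2_fun_diff(2)[OF corr_rho_L2(1)[OF \<eta> g] g])
    moreover have "L2n (corr (rho \<eta>) ?g) \<le> 6 * M0\<^sup>2 * L2n ?g" by (rule corr_rho_L2(2)[OF \<eta> g])
    ultimately show "\<bar>\<Phi> \<eta> h - \<Phi> \<eta> h'\<bar> \<le> (6 * M0\<^sup>2 + 1) * L2n ?g" unfolding distrib_right by linarith
  qed
  have "\<forall>\<^sub>F \<eta> in at_right 0. \<forall>\<tau>\<in>{-T..T}. \<bar>\<Phi> \<eta> (W \<tau>)\<bar> < e"
    by (rule L2_uniform_on_compact[OF W c lip _ e]) (simp add: \<Phi>_def corr_rho_tendsto_L2)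
  then show ?thesis by (simp add: \<Phi>_def)
qed

abbreviation interp_error :: "real \<Rightarrow> (real \<Rightarrow> int^2 \<Rightarrow> real) \<Rightarrow> (real \<Rightarrow> int^2 \<Rightarrow> real) \<Rightarrow>
    (real \<Rightarrow> real^2 \<Rightarrow> real) \<Rightarrow> (real \<Rightarrow> real^2 \<Rightarrow> real) \<Rightarrow> real \<Rightarrow> ennreal" where
  "interp_error \<epsilon> u v U V \<tau> \<equiv>
    L2_norm (\<lambda>X. of_real \<epsilon> * rescaled_interp \<epsilon> u \<tau> X - complex_of_real (U \<tau> X))
    + L2_norm (\<lambda>X. rescaled_interp \<epsilon> v \<tau> X - complex_of_real (V \<tau> X))"

text \<open>
  The deterministic part of the result, for one realisation of masses with small block averages. Given
  a tolerance \<open>r\<close>, first \<open>\<eta>\<close> is chosen to make the lattice error and the mollification error small,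
  then \<open>\<epsilon>\<close> to absorb the remaining terms.
\<close>

lemma homogenization_limit:
  fixes m :: "int^2 \<Rightarrow> real" and u v :: "real \<Rightarrow> real \<Rightarrow> int^2 \<Rightarrow> real"
  assumes w: "wave_solution mbar \<phi> \<psi> U V"
    and \<phi>: "\<phi> \<in> H_weighted 5 \<sigma>" "continuous_on UNIV \<phi>" and \<psi>: "\<psi> \<in> H_weighted 5 \<sigma>" "continuous_on UNIV \<psi>"
    and \<sigma>: "0 < \<sigma>" and T: "0 < T" and a: "0 < a" and m: "\<And>j. m j \<in> {a..b}" and mbar: "mbar \<in> {a..b}"
    and blk: "small_block_averages (\<lambda>j. m j - mbar)"
    and sol: "\<And>\<epsilon>. 0 < \<epsilon> \<Longrightarrow> scaled_solution m \<phi> \<psi> \<epsilon> (u \<epsilon>) (v \<epsilon>)"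
  shows "((\<lambda>\<epsilon>. SUP \<tau>\<in>{- T..T}. interp_error \<epsilon> (u \<epsilon>) (v \<epsilon>) U V \<tau>) \<longlongrightarrow> 0) (at_right 0)"
proof (rule order_tendstoI)
  note wl = wave_solution_L2[OF w]
  fix r0 :: ennreal assume "0 < r0"
  then obtain r1 where r1: "0 < r1" "r1 < r0" using dense by blast
  then have "r1 < \<top>" using top.not_eq_extremum by fastforce
  then obtain r where r: "r1 = ennreal r" "0 < r" using r1(1) by (cases r1) auto
  obtain \<Theta> where \<Theta>: "(\<Theta> \<longlongrightarrow> 0) (at_right 0)" and err: "\<And>\<eta>. 0 < \<eta> \<Longrightarrow> \<eta> \<le> 1 \<Longrightarrow> \<forall>\<^sub>F \<epsilon> in at_right 0. \<forall>u v.
    scaled_solution m \<phi> \<psi> \<epsilon> u v \<longrightarrow>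
    (\<forall>\<tau>\<in>{-T..T}. \<epsilon> * norm (\<epsilon> *\<^sub>R Abs_ell2 (u (\<tau> / \<epsilon>)) - samp \<epsilon> 0 (rho \<eta>) (U \<tau>)) \<le> \<Theta> \<eta> \<and>
      \<epsilon> * norm (Abs_ell2 (v (\<tau> / \<epsilon>)) - samp \<epsilon> 0 (rho \<eta>) (V \<tau>)) \<le> \<Theta> \<eta>)"
    using lattice_error[OF w \<phi> \<psi> \<sigma> T a m mbar blk] by blast
  have r6: "0 < r / 6" using r by simp
  have "\<forall>\<^sub>F \<eta> in at_right 0. (0 < \<eta> \<and> \<eta> \<le> 1) \<and> \<Theta> \<eta> < r / 6 \<and>
      (\<forall>\<tau>\<in>{-T..T}. L2n (\<lambda>X. corr (rho \<eta>) (U \<tau>) X - U \<tau> X) < r / 6) \<and>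
      (\<forall>\<tau>\<in>{-T..T}. L2n (\<lambda>X. corr (rho \<eta>) (V \<tau>) X - V \<tau> X) < r / 6)"
    by (intro eventually_conj eventually_small_pos order_tendstoD(2)[OF \<Theta> r6]
        mollification_uniform[OF wl(1,3) r6] mollification_uniform[OF wl(2,4) r6]) simp
  from eventually_happens[OF this] obtain \<eta> where \<eta>: "0 < \<eta>" "\<eta> \<le> 1" "\<Theta> \<eta> < r / 6"
      and molU: "\<And>\<tau>. \<tau> \<in> {-T..T} \<Longrightarrow> L2n (\<lambda>X. corr (rho \<eta>) (U \<tau>) X - U \<tau> X) \<le> r / 6"
      and molV: "\<And>\<tau>. \<tau> \<in> {-T..T} \<Longrightarrow> L2n (\<lambda>X. corr (rho \<eta>) (V \<tau>) X - V \<tau> X) \<le> r / 6"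
    by (auto simp: less_imp_le)
  obtain L where L: "lip_kern \<eta> L (rho \<eta>)" using lip_kern_rho[OF \<eta>(1)] by blast
  obtain HU where HU: "0 \<le> HU" "\<And>\<tau>. \<tau> \<in> {-T..T} \<Longrightarrow> L2n (U \<tau>) \<le> HU"
    using L2n_bounded_on_compact[OF wl(1,3), of T] by blast
  obtain HV where HV: "0 \<le> HV" "\<And>\<tau>. \<tau> \<in> {-T..T} \<Longrightarrow> L2n (V \<tau>) \<le> HV"
    using L2n_bounded_on_compact[OF wl(2,4), of T] by blast
  define H where "H = HU + HV"
  have H: "L2n (U \<tau>) \<le> H" "L2n (V \<tau>) \<le> H" if "\<tau> \<in> {-T..T}" for \<tau>
    using HU(1) HU(2)[OF that] HV(1) HV(2)[OF that] by (auto simp: H_def)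
  define D where "D = 5 * (L * (2 * (\<eta> + 1)) * (2 * (\<eta> + 1) + 1) * H)"
  have D: "0 \<le> D" using lip_kernD(3)[OF L] \<eta> HU(1) HV(1) by (simp add: D_def H_def)
  have ev: "\<forall>\<^sub>F \<epsilon>::real in at_right 0. 0 < \<epsilon> \<and> \<epsilon> \<le> min 1 (r / (6 * (D + 1)))"
    by (rule eventually_small_pos) (use r D in simp)
  show "\<forall>\<^sub>F \<epsilon> in at_right 0. (SUP \<tau>\<in>{- T..T}. interp_error \<epsilon> (u \<epsilon>) (v \<epsilon>) U V \<tau>) < r0"
    using ev err[OF \<eta>(1,2)]
  proof eventually_elim
    case (elim \<epsilon>)
    then have \<epsilon>: "0 < \<epsilon>" "\<epsilon> \<le> 1" "\<epsilon> \<le> r / (6 * (D + 1))" by auto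
    note s = sol[OF \<epsilon>(1)]
    note lc = lattice_solution_curve[OF s a m]
    have "\<epsilon> * (6 * (D + 1)) \<le> r" using \<epsilon>(3) D by (subst pos_le_divide_eq[symmetric]) auto
    then have \<epsilon>D: "\<epsilon> * D \<le> r / 6" using \<epsilon>(1) by (simp add: algebra_simps)
    have "(SUP \<tau>\<in>{- T..T}. interp_error \<epsilon> (u \<epsilon>) (v \<epsilon>) U V \<tau>) \<le> ennreal r"
    proof (rule SUP_least)
      fix \<tau> assume \<tau>: "\<tau> \<in> {-T..T}"
      have e: "\<epsilon> * norm (\<epsilon> *\<^sub>R Abs_ell2 (u \<epsilon> (\<tau> / \<epsilon>)) - samp \<epsilon> 0 (rho \<eta>) (U \<tau>)) \<le> \<Theta> \<eta>"
        "\<epsilon> * norm (Abs_ell2 (v \<epsilon> (\<tau> / \<epsilon>)) - samp \<epsilon> 0 (rho \<eta>) (V \<tau>)) \<le> \<Theta> \<eta>"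
        using elim(2) s \<tau> by blast+
      have "of_real \<epsilon> * rescaled_interp \<epsilon> (u \<epsilon>) \<tau> X = lp (\<epsilon> *\<^sub>R Abs_ell2 (u \<epsilon> (\<tau> / \<epsilon>))) ((1 / \<epsilon>) *\<^sub>R X)" for X
        by (simp add: rescaled_interp_eq lc(1) lp_scaleR scaleR_conv_of_real)
      then have 1: "L2_norm (\<lambda>X. of_real \<epsilon> * rescaled_interp \<epsilon> (u \<epsilon>) \<tau> X - complex_of_real (U \<tau> X)) \<le> ennreal (\<Theta> \<eta> + \<epsilon> * D + r / 6)"
        using rescaled_interp_error[OF L wl(1) \<epsilon>(1,2) H(1)[OF \<tau>] e(1) corr_rho_L2(1)[OF \<eta>(1) wl(1)] molU[OF \<tau>]]
        by (simp add: D_def)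
      have "rescaled_interp \<epsilon> (v \<epsilon>) \<tau> X = lp (Abs_ell2 (v \<epsilon> (\<tau> / \<epsilon>))) ((1 / \<epsilon>) *\<^sub>R X)" for X
        by (simp add: rescaled_interp_eq lc(2))
      then have 2: "L2_norm (\<lambda>X. rescaled_interp \<epsilon> (v \<epsilon>) \<tau> X - complex_of_real (V \<tau> X)) \<le> ennreal (\<Theta> \<eta> + \<epsilon> * D + r / 6)"
        using rescaled_interp_error[OF L wl(2) \<epsilon>(1,2) H(2)[OF \<tau>] e(2) corr_rho_L2(1)[OF \<eta>(1) wl(2)] molV[OF \<tau>]]
        by (simp add: D_def)
      have half: "ennreal (\<Theta> \<eta> + \<epsilon> * D + r / 6) \<le> ennreal (r / 2)" using \<eta>(3) \<epsilon>D by (intro ennreal_leI) linarith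
      have "interp_error \<epsilon> (u \<epsilon>) (v \<epsilon>) U V \<tau> \<le> ennreal (r / 2) + ennreal (r / 2)"
        by (rule add_mono[OF order_trans[OF 1 half] order_trans[OF 2 half]])
      also have "\<dots> = ennreal r" using r by (subst ennreal_plus[symmetric]) auto
      finally show "interp_error \<epsilon> (u \<epsilon>) (v \<epsilon>) U V \<tau> \<le> ennreal r" .
    qed
    then show ?case using r1 r by simp
  qed
qed simp

theorem theorem8p1:
  fixes M :: "'w measure" and m :: "int^2 \<Rightarrow> 'w \<Rightarrow> real" and a b mbar T \<sigma> :: real
    and \<phi> \<psi> :: "real^2 \<Rightarrow> real" and U V :: "real \<Rightarrow> real^2 \<Rightarrow> real"
  assumes "prob_space M"
    and "prob_space.indep_vars M (\<lambda>_. borel) m UNIV"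
    and "\<And>j. distr M borel (m j) = distr M borel (m 0)"
    and "0 < a"
    and "\<And>j. AE \<omega> in M. m j \<omega> \<in> {a..b}"
    and "\<And>j. mbar = prob_space.expectation M (m j)"
    and "0 < T" and "0 < \<sigma>" and "\<sigma> < 1"
    and "\<phi> \<in> H_weighted 5 \<sigma>" and "continuous_on UNIV \<phi>"
    and "\<psi> \<in> H_weighted 5 \<sigma>" and "continuous_on UNIV \<psi>"
    and "wave_solution mbar \<phi> \<psi> U V"
  shows "AE \<omega> in M. \<forall>u v :: real \<Rightarrow> real \<Rightarrow> int^2 \<Rightarrow> real.
    (\<forall>\<epsilon>>0. lattice_solution (\<lambda>j. m j \<omega>)
       (\<lambda>j. (1 / \<epsilon>) * \<phi> (\<epsilon> *\<^sub>R lattice_pt j)) (\<lambda>j. \<psi> (\<epsilon> *\<^sub>R lattice_pt j)) (u \<epsilon>) (v \<epsilon>)) \<longrightarrow>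
    (\<forall>\<epsilon>>0. \<forall>\<tau> X. ((\<lambda>s. of_real \<epsilon> * rescaled_interp \<epsilon> (u \<epsilon>) s X)
       has_vector_derivative rescaled_interp \<epsilon> (v \<epsilon>) \<tau> X) (at \<tau>)) \<and>
    ((\<lambda>\<epsilon>. SUP \<tau>\<in>{- T..T}.
        L2_norm (\<lambda>X. of_real \<epsilon> * rescaled_interp \<epsilon> (u \<epsilon>) \<tau> X - complex_of_real (U \<tau> X))
        + L2_norm (\<lambda>X. rescaled_interp \<epsilon> (v \<epsilon>) \<tau> X - complex_of_real (V \<tau> X)))
      \<longlongrightarrow> 0) (at_right 0)"
proof -
  interpret prob_space M by fact
  have m0: "m 0 \<in> borel_measurable M"
    using indep_vars_def2[of "\<lambda>_. borel" m UNIV] assms(2) by auto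
  have int: "integrable M (m 0)"
  proof (rule integrable_const_bound[OF _ m0])
    show "AE \<omega> in M. norm (m 0 \<omega>) \<le> \<bar>a\<bar> + \<bar>b\<bar>"
      using assms(5)[of 0] by (rule eventually_mono) auto
  qed
  have mbar: "mbar \<in> {a..b}"
  proof -
    have "AE \<omega> in M. a \<le> m 0 \<omega>" "AE \<omega> in M. m 0 \<omega> \<le> b" using assms(5)[of 0] by (auto elim!: eventually_mono)
    then show ?thesis
      unfolding assms(6)[of 0] using integral_ge_const[OF int, of a] integral_le_const[OF int, of b] by auto
  qed
  show ?thesis
    using block_average_AE[OF assms(1,2,5,6)]
  proof eventually_elim
    case (elim \<omega>)
    then have m: "\<And>j. m j \<omega> \<in> {a..b}"
      and blk: "small_block_averages (\<lambda>j. m j \<omega> - mbar)" by blast+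
    show ?case
    proof (intro allI impI conjI)
      fix u v :: "real \<Rightarrow> real \<Rightarrow> int^2 \<Rightarrow> real"
      assume sol: "\<forall>\<epsilon>>0. lattice_solution (\<lambda>j. m j \<omega>)
       (\<lambda>j. (1 / \<epsilon>) * \<phi> (\<epsilon> *\<^sub>R lattice_pt j)) (\<lambda>j. \<psi> (\<epsilon> *\<^sub>R lattice_pt j)) (u \<epsilon>) (v \<epsilon>)"
      show "((\<lambda>s. of_real \<epsilon> * rescaled_interp \<epsilon> (u \<epsilon>) s X)
         has_vector_derivative rescaled_interp \<epsilon> (v \<epsilon>) \<tau> X) (at \<tau>)" if "0 < \<epsilon>" for \<epsilon> \<tau> X
        by (rule rescaled_interp_has_derivative[OF sol[rule_format, OF that] assms(4) m that])
      show "((\<lambda>\<epsilon>. SUP \<tau>\<in>{- T..T}. interp_error \<epsilon> (u \<epsilon>) (v \<epsilon>) U V \<tau>) \<longlongrightarrow> 0) (at_right 0)"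
        by (rule homogenization_limit[OF assms(14,10,11,12,13,8,7,4) m mbar blk])
           (use sol in auto)
    qed
  qed
qed

end
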